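(* Let $\Omega$ be a bounded domain in $\mathbb{R}^N$ ($N=2$ or $3$) with $C^3$ boundary $\Gamma$, let $\nu>0$, and assume $\vec f\in L^2(0,T;L^2(\Omega,\mathbb{R}^N))$ for some given $T>0$ and $\vec u^0\in H^1_0(\Omega,\mathbb{R}^N)\cap H^2(\Omega,\mathbb{R}^N)$. For a time step $\Delta t>0$, consider the time-discrete scheme which, given $\vec u^n\in H^2\cap H^1_0(\Omega,\mathbb{R}^N)$, determines $\vec u^{n+1}\in H^2\cap H_0^1(\Omega,\mathbb{R}^N)$ by $$\frac{\vec u^{n+1}-\vec u^n}{\Delta t}-\nu\Delta\vec u^{n+1}=\vec f^n-\vec u^n\cdot\nabla\vec u^n-\nabla p_E^n-\nu\nabla p_S^n\quad\text{in }\Omega,\qquad \vec u^{n+1}|_\Gamma=0,$$ where $$\nabla p_E^n=(I-\mathcal{P})(\vec f^n-\vec u^n\cdot\nabla\vec u^n),\qquad \nabla p_S^n=(I-\mathcal{P})\Delta\vec u^n-\nabla(\nabla\cdot\vec u^n),\qquad \vec f^n=\frac1{\Delta t}\int_{n\Delta t}^{(n+1)\Delta t}\vec f(t)\,dt .$$ Then there exist positive constants $T^*$ and $C_3$ such that whenever $n\Delta t\le T^*$ (and $n\Delta t\le T$), we have $$\sup_{0\le k\le n}\|\nabla\vec u^k\|^2+\sum_{k=0}^n\|\Delta\vec u^k\|^2\,\Delta t\le C_3 .$$ The constants $T^*$ and $C_3$ depend only upon $\Omega$, $\nu$ and $$M_0:=\|\nabla\vec u^0\|^2+\nu\Delta t\|\Delta\vec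 u^0\|^2+\int_0^T\|\vec f(t)\|^2\,dt .$$
   Context: $\|\cdot\|$ denotes the $L^2(\Omega)$ norm. $\mathcal{P}$ denotes the Helmholtz projection on $L^2(\Omega,\mathbb{R}^N)$: the $L^2$-orthogonal projection onto the orthogonal complement of $\{\nabla\phi:\phi\in H^1(\Omega)\}$ (equivalently, onto the divergence-free fields $\vec a\in L^2$ with $\vec n\cdot\vec a=0$ on $\partial\Omega$). The initial datum $\vec u^0$ is not required to be divergence free. *)

theory Defs
  imports "HOL-Analysis.Analysis"
begin

text \<open>
  Elements of \<open>L\<^sup>2(\<Omega>)\<close> and of Sobolev spaces are represented by functions on the whole space whose
  values outside \<open>\<Omega>\<close> are irrelevant; functions agreeing almost everywhere on \<open>\<Omega>\<close> represent the
  same element.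
\<close>

section \<open>Smooth functions and domains\<close>

fun k_times_cont_diff :: "nat \<Rightarrow> ('a::euclidean_space \<Rightarrow> 'b::real_normed_vector) \<Rightarrow> bool" where
  "k_times_cont_diff 0 f \<longleftrightarrow> continuous_on UNIV f"
| "k_times_cont_diff (Suc k) f \<longleftrightarrow>
     (\<forall>x. f differentiable (at x)) \<and>
     (\<forall>b\<in>Basis. k_times_cont_diff k (\<lambda>x. frechet_derivative f (at x) b))"

definition partial :: "'n \<Rightarrow> (real^'n \<Rightarrow> real) \<Rightarrow> real^'n \<Rightarrow> real" where
  "partial i f x = frechet_derivative f (at x) (axis i 1)"

definition test_function :: "(real^'n) set \<Rightarrow> (real^'n \<Rightarrow> real) \<Rightarrow> bool" where
  "test_function \<Omega> \<phi> \<longleftrightarrow>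
     (\<forall>k. k_times_cont_diff k \<phi>) \<and> compact (closure {x. \<phi> x \<noteq> 0}) \<and> closure {x. \<phi> x \<noteq> 0} \<subseteq> \<Omega>"

text \<open>
  Near each boundary point, \<open>\<Omega>\<close> is the region on one side of the graph of a \<open>C\<^sup>k\<close> function
  over some coordinate hyperplane. The graph function \<open>\<gamma>\<close> of the remaining \<open>N - 1\<close> coordinates is
  written as a function on the whole space that does not depend on the coordinate \<open>i\<close>; the sign
  \<open>\<sigma>\<close> tells on which side \<open>\<Omega>\<close> lies.
\<close>

definition has_Ck_boundary :: "nat \<Rightarrow> (real^'n) set \<Rightarrow> bool" where
  "has_Ck_boundary k \<Omega> \<longleftrightarrow>
     (\<forall>x0\<in>frontier \<Omega>. \<exists>r>0. \<exists>i. \<exists>\<sigma>\<in>{-1, 1::real}. \<exists>\<gamma>::real^'n \<Rightarrow> real.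
        k_times_cont_diff k \<gamma> \<and>
        (\<forall>x y. (\<forall>j. j \<noteq> i \<longrightarrow> x $ j = y $ j) \<longrightarrow> \<gamma> x = \<gamma> y) \<and>
        \<Omega> \<inter> ball x0 r = {x \<in> ball x0 r. \<sigma> * x $ i > \<gamma> x})"

definition bounded_domain :: "(real^'n) set \<Rightarrow> bool" where
  "bounded_domain \<Omega> \<longleftrightarrow> \<Omega> \<noteq> {} \<and> open \<Omega> \<and> connected \<Omega> \<and> bounded \<Omega>"

section \<open>Lebesgue and Sobolev spaces\<close>

definition L2 :: "'a::euclidean_space set \<Rightarrow> ('a \<Rightarrow> 'b::euclidean_space) set" where
  "L2 \<Omega> = {f. f \<in> borel_measurable (lebesgue_on \<Omega>) \<and>
              integrable (lebesgue_on \<Omega>) (\<lambda>x. (norm (f x))\<^sup>2)}"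

text \<open>For matrix-valued functions, the pointwise norm used here is the Frobenius norm.\<close>

definition L2norm :: "'a::euclidean_space set \<Rightarrow> ('a \<Rightarrow> 'b::euclidean_space) \<Rightarrow> real" where
  "L2norm \<Omega> f = sqrt (LINT x|lebesgue_on \<Omega>. (norm (f x))\<^sup>2)"

definition L2inner ::
    "'a::euclidean_space set \<Rightarrow> ('a \<Rightarrow> 'b::euclidean_space) \<Rightarrow> ('a \<Rightarrow> 'b) \<Rightarrow> real" where
  "L2inner \<Omega> f g = (LINT x|lebesgue_on \<Omega>. f x \<bullet> g x)"

definition locally_integrable_on :: "(real^'n) set \<Rightarrow> (real^'n \<Rightarrow> real) \<Rightarrow> bool" where
  "locally_integrable_on \<Omega> f \<longleftrightarrow>
     (\<forall>K. compact K \<and> K \<subseteq> \<Omega> \<longrightarrow> integrable (lebesgue_on K) f)"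

definition has_weak_partial ::
    "(real^'n) set \<Rightarrow> 'n \<Rightarrow> (real^'n \<Rightarrow> real) \<Rightarrow> (real^'n \<Rightarrow> real) \<Rightarrow> bool" where
  "has_weak_partial \<Omega> i f g \<longleftrightarrow>
     locally_integrable_on \<Omega> f \<and> locally_integrable_on \<Omega> g \<and>
     (\<forall>\<phi>. test_function \<Omega> \<phi> \<longrightarrow>
        (LINT x|lebesgue_on \<Omega>. f x * partial i \<phi> x) = - (LINT x|lebesgue_on \<Omega>. g x * \<phi> x))"

text \<open>A weak derivative is unique almost everywhere on \<open>\<Omega>\<close>; the following picks a representative.\<close>

definition wpartial :: "(real^'n) set \<Rightarrow> 'n \<Rightarrow> (real^'n \<Rightarrow> real) \<Rightarrow> real^'n \<Rightarrow> real" where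
  "wpartial \<Omega> i f = (SOME g. has_weak_partial \<Omega> i f g)"

definition H1 :: "(real^'n) set \<Rightarrow> (real^'n \<Rightarrow> real) set" where
  "H1 \<Omega> = {f \<in> L2 \<Omega>. \<forall>i. \<exists>g\<in>L2 \<Omega>. has_weak_partial \<Omega> i f g}"

definition H2 :: "(real^'n) set \<Rightarrow> (real^'n \<Rightarrow> real) set" where
  "H2 \<Omega> = {f \<in> H1 \<Omega>. \<forall>i. wpartial \<Omega> i f \<in> H1 \<Omega>}"

text \<open>The closure of the test functions in \<open>H\<^sup>1\<close>.\<close>

definition H10 :: "(real^'n) set \<Rightarrow> (real^'n \<Rightarrow> real) set" where
  "H10 \<Omega> = {f \<in> H1 \<Omega>. \<exists>\<Phi>::nat \<Rightarrow> real^'n \<Rightarrow> real.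
     (\<forall>k. test_function \<Omega> (\<Phi> k)) \<and>
     (\<lambda>k. L2norm \<Omega> (\<lambda>x. \<Phi> k x - f x)) \<longlonglongrightarrow> 0 \<and>
     (\<forall>i. (\<lambda>k. L2norm \<Omega> (\<lambda>x. partial i (\<Phi> k) x - wpartial \<Omega> i f x)) \<longlonglongrightarrow> 0)}"

definition vec_H2_H10 :: "(real^'n) set \<Rightarrow> (real^'n \<Rightarrow> real^'n) set" where
  "vec_H2_H10 \<Omega> = {u. \<forall>i. (\<lambda>x. u x $ i) \<in> H2 \<Omega> \<inter> H10 \<Omega>}"

section \<open>Vector calculus and the Helmholtz projection\<close>

definition grad :: "(real^'n) set \<Rightarrow> (real^'n \<Rightarrow> real) \<Rightarrow> real^'n \<Rightarrow> real^'n" where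
  "grad \<Omega> \<phi> x = (\<chi> i. wpartial \<Omega> i \<phi> x)"

definition vgrad :: "(real^'n) set \<Rightarrow> (real^'n \<Rightarrow> real^'n) \<Rightarrow> real^'n \<Rightarrow> real^'n^'n" where
  "vgrad \<Omega> u x = (\<chi> i j. wpartial \<Omega> j (\<lambda>y. u y $ i) x)"

definition vdiv :: "(real^'n) set \<Rightarrow> (real^'n \<Rightarrow> real^'n) \<Rightarrow> real^'n \<Rightarrow> real" where
  "vdiv \<Omega> u x = (\<Sum>i\<in>UNIV. wpartial \<Omega> i (\<lambda>y. u y $ i) x)"

definition vlaplace :: "(real^'n) set \<Rightarrow> (real^'n \<Rightarrow> real^'n) \<Rightarrow> real^'n \<Rightarrow> real^'n" where
  "vlaplace \<Omega> u x = (\<chi> i. \<Sum>j\<in>UNIV. wpartial \<Omega> j (wpartial \<Omega> j (\<lambda>y. u y $ i)) x)"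

text \<open>\<open>advect \<Omega> u v\<close> is \<open>u \<cdot> \<nabla>v\<close>, with components \<open>\<Sum>\<^sub>j u\<^sub>j \<partial>\<^sub>j v\<^sub>i\<close>.\<close>

definition advect ::
    "(real^'n) set \<Rightarrow> (real^'n \<Rightarrow> real^'n) \<Rightarrow> (real^'n \<Rightarrow> real^'n) \<Rightarrow> real^'n \<Rightarrow> real^'n" where
  "advect \<Omega> u v x = (\<chi> i. \<Sum>j\<in>UNIV. u x $ j * wpartial \<Omega> j (\<lambda>y. v y $ i) x)"

definition gradients_perp :: "(real^'n) set \<Rightarrow> (real^'n \<Rightarrow> real^'n) set" where
  "gradients_perp \<Omega> = {a \<in> L2 \<Omega>. \<forall>\<phi>\<in>H1 \<Omega>. L2inner \<Omega> a (grad \<Omega> \<phi>) = 0}"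

text \<open>
  The orthogonal projection onto the closed subspace \<^const>\<open>gradients_perp\<close>; it is determined up to
  equality almost everywhere on \<open>\<Omega>\<close>, and only meaningful for arguments in \<open>L\<^sup>2\<close>.
\<close>

definition helmholtz :: "(real^'n) set \<Rightarrow> (real^'n \<Rightarrow> real^'n) \<Rightarrow> real^'n \<Rightarrow> real^'n" where
  "helmholtz \<Omega> v = (SOME w. w \<in> gradients_perp \<Omega> \<and>
     (\<forall>z\<in>gradients_perp \<Omega>. L2inner \<Omega> (\<lambda>x. v x - w x) z = 0))"

section \<open>The time-discrete scheme\<close>

text \<open>\<open>L\<^sup>2(0,T;L\<^sup>2(\<Omega>,\<real>\<^sup>N))\<close>, identified with \<open>L\<^sup>2((0,T) \<times> \<Omega>,\<real>\<^sup>N)\<close>.\<close>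

definition L2_time :: "real \<Rightarrow> (real^'n) set \<Rightarrow> (real \<Rightarrow> real^'n \<Rightarrow> real^'n) set" where
  "L2_time T \<Omega> = {f. (\<lambda>(t, x). f t x) \<in> L2 ({0<..<T} \<times> \<Omega>)}"

definition time_average ::
    "(real \<Rightarrow> real^'n \<Rightarrow> real^'n) \<Rightarrow> real \<Rightarrow> nat \<Rightarrow> real^'n \<Rightarrow> real^'n" where
  "time_average f \<Delta>t n x =
     (1 / \<Delta>t) *\<^sub>R (LINT t|lebesgue_on {real n * \<Delta>t .. (real n + 1) * \<Delta>t}. f t x)"

definition grad_pE ::
    "(real^'n) set \<Rightarrow> (real^'n \<Rightarrow> real^'n) \<Rightarrow> (real^'n \<Rightarrow> real^'n) \<Rightarrow> real^'n \<Rightarrow> real^'n" where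
  "grad_pE \<Omega> g u x = (g x - advect \<Omega> u u x) - helmholtz \<Omega> (\<lambda>y. g y - advect \<Omega> u u y) x"

definition grad_pS :: "(real^'n) set \<Rightarrow> (real^'n \<Rightarrow> real^'n) \<Rightarrow> real^'n \<Rightarrow> real^'n" where
  "grad_pS \<Omega> u x =
     (vlaplace \<Omega> u x - helmholtz \<Omega> (vlaplace \<Omega> u) x) - grad \<Omega> (vdiv \<Omega> u) x"

text \<open>
  One step from \<open>u\<close> to \<open>u'\<close> with averaged force \<open>g\<close>. The boundary condition is contained in the
  membership of \<open>u'\<close> in \<open>H\<^sup>1\<^sub>0\<close>.
\<close>

definition scheme_step ::
    "(real^'n) set \<Rightarrow> real \<Rightarrow> real \<Rightarrow> (real^'n \<Rightarrow> real^'n) \<Rightarrow> (real^'n \<Rightarrow> real^'n)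
      \<Rightarrow> (real^'n \<Rightarrow> real^'n) \<Rightarrow> bool" where
  "scheme_step \<Omega> \<nu> \<Delta>t g u u' \<longleftrightarrow>
     u' \<in> vec_H2_H10 \<Omega> \<and>
     (AE x in lebesgue_on \<Omega>.
        (1 / \<Delta>t) *\<^sub>R (u' x - u x) - \<nu> *\<^sub>R vlaplace \<Omega> u' x
        = g x - advect \<Omega> u u x - grad_pE \<Omega> g u x - \<nu> *\<^sub>R grad_pS \<Omega> u x)"

end

theory Submission
 imports Defs
begin

text \<open>
 Testing a step with \<open>-\<Delta>u'\<close> for the new velocity \<open>u'\<close> reduces the theorem to bounding the Stokes pressure
 \<open>G = \<nabla>p\<^sub>S\<close> by \<open>\<beta>\<parallel>\<Delta>u\<parallel>\<close> with \<open>\<beta> < 1\<close>, up to lower order terms, so that viscosity absorbs it. The field \<open>G\<close> is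
 divergence and curl free and \<open>\<parallel>G\<parallel>\<^sup>2 = \<langle>G, \<Delta>u - \<nabla>div u\<rangle>\<close>. Take charts in which \<open>\<Omega>\<close> is \<open>{\<rho> > 0}\<close> and a partition of
 unity \<open>\<theta>\<close>, and split \<open>u = \<Sum> Bu + Pu\<close> with \<open>P = \<theta> cos\<^sup>2(\<rho>/s) (I - \<nabla>\<rho>\<otimes>\<nabla>\<rho>/|\<nabla>\<rho>|\<^sup>2)\<close>. On the boundary \<open>Bu\<close> is normal to first
 order and pairs to zero with \<open>G\<close>, while \<open>div Pu\<close> vanishes there, so that \<open>\<parallel>G\<parallel>\<^sup>2 = \<langle>\<Sum> PG, \<Delta>u\<rangle>\<close> up to lower order. By a
 Rellich identity the tangential and normal parts of \<open>G\<close> have almost equal size in a thin boundary layer, and the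
 cosine cuts the rest off in the same proportion, whence \<open>\<parallel>\<Sum> PG\<parallel>\<^sup>2 \<le> (3/4) \<parallel>G\<parallel>\<^sup>2\<close>.

 For the convection term, integration by parts and the Sobolev embedding into \<open>L\<^sup>6\<close> give
 \<open>\<integral>|u|\<^sup>2|\<nabla>u|\<^sup>2 \<le> -\<integral>|u|\<^sup>2 u\<cdot>\<Delta>u \<le> C \<parallel>\<nabla>u\<parallel>\<^sup>3 \<parallel>\<Delta>u\<parallel>\<close>. By Young's inequality \<open>\<parallel>\<nabla>u\<parallel>\<^sup>2 + \<nu> \<Delta>t \<parallel>\<Delta>u\<parallel>\<^sup>2\<close> then satisfies a discrete
 differential inequality of cubic growth, which bounds it on a short time interval.
\<close>

section \<open>Calculus of continuously differentiable functions\<close>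

text \<open>The Stokes pressure is explicit and of the same order as the viscous term, so a bound by
  a large multiple of the Laplacian could not be absorbed for any step size. The gap \<gamma> =
  \<nu> (1 - \<beta>) pays for force, convection and lower order terms. Since the pressure sits at
  the old step, part of the dissipation of the old step has to be carried along; this is the origin
  of the term with \<nu> \<Delta>t in M0. The factor 3/4 is (1 + 1/2) / 2: equipartition alone would
  give 1/2, and s is chosen so that its error is at most half of the squared norm of G before the
  division by 2. Neither G nor the gradient of u is given boundary values. Vanishing on the boundary
  means integration by parts against all C^1 functions, and boundary integrals are replaced by
  cut-offs at distance 1/n, whose gradients of size n are compensated by factors O(\<rho>).
  Regularity is counted as follows: \<rho> is C^3, the field \<nabla>\<rho>/|\<nabla>\<rho>|^2 is
  C^2, and two derivatives fall on P, so the Leibniz remainder has bounded coefficients.\<close>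

abbreviation "kcd \<equiv> k_times_cont_diff"

abbreviation "leb \<equiv> lebesgue_on"

abbreviation "meas X \<equiv> borel_measurable (leb X)"

abbreviation NN_lborel :: "('a::euclidean_space => ennreal) => ennreal" (binder "NN " 10)
 where "NN_lborel f \<equiv> nn_integral lborel f"

abbreviation sum_UNIV :: "('a \<Rightarrow> 'b::comm_monoid_add) \<Rightarrow> 'b" (binder "SUM " 10)
 where "sum_UNIV f \<equiv> sum f UNIV"

abbreviation converges (infix "---->" 60) where "f ----> l \<equiv> f \<longlonglongrightarrow> l"

abbreviation "pd X u i k \<equiv> wpartial X i (\<lambda>y. u y $ k)"

abbreviation "pdd X u i j k \<equiv> wpartial X i (pd X u j k)"

lemmas lint_add = Bochner_Integration.integral_add and lint_diff = Bochner_Integration.integral_diff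
 and lint_sum = Bochner_Integration.integral_sum and lint_cong = Bochner_Integration.integral_cong
 and lint_nonneg = Bochner_Integration.integral_nonneg
 and lint_norm_bound_integral = Bochner_Integration.integral_norm_bound_integral
 and lintegrable_add = Bochner_Integration.integrable_add and lintegrable_diff = Bochner_Integration.integrable_diff
 and lintegrable_sum = Bochner_Integration.integrable_sum and lintegrable_bound = Bochner_Integration.integrable_bound

lemma kcd_SucD: "kcd (Suc k) f ==> kcd k f"
proof (induction k arbitrary: f)
 case 0
 then show ?case
  by (auto intro!: continuous_at_imp_continuous_on differentiable_imp_continuous_within)
next
 case (Suc k)
 then show ?case by auto
qed

lemma kcd_mono: "kcd l f ==> k <= l ==> kcd k f"
 by (induction l) (use kcd_SucD le_Suc_eq in \<open>auto\<close>)

lemma kcd_continuous: "kcd k f ==> continuous_on A f"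
 using kcd_mono[of k f 0] continuous_on_subset by auto

lemma kcd_has_derivative:
 "kcd k f ==> k >= 1 ==> (f has_derivative frechet_derivative f (at x)) (at x)"
 using kcd_mono[of k f 1] frechet_derivative_works[of f "at x"] by auto

lemma kcd_SucI:
 assumes "!!x. (f has_derivative D x) (at x)" "!!b. b \<in> Basis ==> kcd k (%x. D x b)"
 shows "kcd (Suc k) f"
proof -
 have "frechet_derivative f (at x) = D x" for x
  using assms(1) frechet_derivative_at by metis
 with assms show ?thesis by (auto simp: differentiable_def)
qed

lemma kcd_const: "kcd k (%x. c)"
proof (induction k arbitrary: c)
 case 0
 then show ?case by simp
next
 case (Suc k)
 then show ?case by (simp add: frechet_derivative_const)
qed

lemma kcd_add: "kcd k f ==> kcd k g ==> kcd k (%x. f x + g x)"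
proof (induction k arbitrary: f g)
 case 0
 then show ?case by (auto intro: continuous_intros)
next
 case (Suc k)
 have "frechet_derivative (%x. f x + g x) (at x) =
   (%h. frechet_derivative f (at x) h + frechet_derivative g (at x) h)" for x
  using Suc.prems
  by (intro frechet_derivative_at[symmetric] has_derivative_add) (auto simp: frechet_derivative_works[symmetric])
 with Suc show ?case by auto
qed

lemma kcd_mult:
 fixes f g :: "'a::euclidean_space => real"
 shows "kcd k f ==> kcd k g ==> kcd k (%x. f x * g x)"
proof (induction k arbitrary: f g)
 case 0
 then show ?case by (auto intro: continuous_intros)
next
 case (Suc k)
 have *: "frechet_derivative (%x. f x * g x) (at x) =
   (%h. f x * frechet_derivative g (at x) h + frechet_derivative f (at x) h * g x)" for x
  using Suc.prems
  by (intro frechet_derivative_at[symmetric] has_derivative_mult) (auto simp: frechet_derivative_works[symmetric])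
 have "kcd k f" "kcd k g"
  using Suc.prems by (auto intro: kcd_SucD)
 with Suc * show ?case by (auto intro!: kcd_add)
qed

lemma kcd_uminus:
 fixes f :: "'a::euclidean_space => real"
 shows "kcd k f ==> kcd k (%x. - f x)"
 using kcd_mult[OF kcd_const[of k "-1::real"], of f] by simp

lemma kcd_diff:
 fixes f g :: "'a::euclidean_space => real"
 shows "kcd k f ==> kcd k g ==> kcd k (%x. f x - g x)"
 using kcd_add[OF _ kcd_uminus, of k f g] by simp

lemma kcd_sum: "(!!i. i \<in> I ==> kcd k (f i)) ==> kcd k (%x. \<Sum>i\<in>I. f i x)"
 by (induction I rule: infinite_finite_induct) (auto intro: kcd_const kcd_add)

lemma kcd_prod:
 fixes f :: "'i => 'a::euclidean_space => real"
 shows "(!!i. i \<in> I ==> kcd k (f i)) ==> kcd k (%x. \<Prod>i\<in>I. f i x)"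
 by (induction I rule: infinite_finite_induct) (auto intro: kcd_const kcd_mult)

lemma kcd_power:
 fixes f :: "'a::euclidean_space => real"
 shows "kcd k f ==> kcd k (%x. f x ^ n)"
 by (induction n) (auto intro: kcd_const kcd_mult)

lemma kcd_inverse:
 fixes f :: "'a::euclidean_space => real"
 assumes "!!x. f x ~= 0"
 shows "kcd k f ==> kcd k (%x. inverse (f x))"
proof (induction k)
 case 0
 then show ?case using assms by (auto intro: continuous_intros)
next
 case (Suc k)
 have *: "((%x. inverse (f x)) has_derivative
   (%h. - (inverse (f x) * frechet_derivative f (at x) h * inverse (f x)))) (at x)" for x
  using Suc.prems assms
  by (intro Deriv.has_derivative_inverse) (auto simp: frechet_derivative_works[symmetric])
 have "kcd k (%x. inverse (f x))"
  using Suc kcd_SucD by blast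
 with Suc.prems * show ?case
  by (intro kcd_SucI[OF *] kcd_mult kcd_uminus) auto
qed

lemma kcd_divide:
 fixes f g :: "'a::euclidean_space => real"
 assumes "!!x. g x ~= 0"
 shows "kcd k f ==> kcd k g ==> kcd k (%x. f x / g x)"
 using kcd_mult[OF _ kcd_inverse[OF assms]] by (simp add: divide_inverse)

text \<open>Induction with \<open>g\<close> arbitrary and \<open>f\<close> fixed: the derivative is
  the product of \<open>g'\<close> composed with \<open>f\<close> and the derivative of
  \<open>f\<close>, so the induction hypothesis is applied to \<open>g'\<close>, while
  \<open>f\<close> merely loses one order.\<close>

lemma kcd_compose_real:
 fixes f :: "'a::euclidean_space => real" and g :: "real => real"
 shows "kcd k g ==> kcd k f ==> kcd k (%x. g (f x))"
proof (induction k arbitrary: g)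
 case 0
 then show ?case by (auto intro: continuous_on_compose2)
next
 case (Suc k)
 have d: "g differentiable at y" "f differentiable at x" for x y
  using Suc.prems by simp_all
 have *: "((%x. g (f x)) has_derivative
   (%h. frechet_derivative g (at (f x)) (frechet_derivative f (at x) h))) (at x)" for x
  by (rule has_derivative_compose[where g=g]) (use d frechet_derivative_works in blast)+
 have lin: "frechet_derivative g (at y) h = frechet_derivative g (at y) 1 * h" for y h
  using linear_scale[OF linear_frechet_derivative[OF d(1)], of y h 1] by simp
 have "kcd k f" "kcd k (%y. frechet_derivative g (at y) 1)"
  using kcd_SucD[OF Suc.prems(2)] Suc.prems(1) by simp_all
 then have g': "kcd k (%x. frechet_derivative g (at (f x)) 1)"
  using Suc.IH by blast
 have "kcd k (%x. frechet_derivative g (at (f x)) (frechet_derivative f (at x) b))" if "b \<in> Basis" for b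
  unfolding lin[of _ "frechet_derivative f _ b"] by (rule kcd_mult[OF g']) (use Suc.prems that in simp)
 with * show ?case
  by (rule kcd_SucI)
qed

lemma kcd_linear:
 assumes "bounded_linear f"
 shows "kcd k f"
proof (cases k)
 case 0
 then show ?thesis using assms by (auto intro: linear_continuous_on)
next
 case (Suc l)
 have "(f has_derivative f) (at x)" for x
  using assms by (rule bounded_linear_imp_has_derivative)
 then show ?thesis
  unfolding Suc by (rule kcd_SucI) (rule kcd_const)
qed

lemma kcd_nth: "kcd k (%x::real^'n. x $ i)"
 by (intro kcd_linear bounded_linear_vec_nth)

lemma kcd_real_derivative:
 fixes f :: "real => real"
 assumes "!!x. (f has_real_derivative f' x) (at x)" "kcd k f'"
 shows "kcd (Suc k) f"
proof -
 have "(f has_derivative (%h. f' x * h)) (at x)" for x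
  using assms(1) by (simp add: has_field_derivative_def)
 then show ?thesis
  by (rule kcd_SucI) (use assms(2) in auto)
qed

lemma kcd_sin: "kcd k (sin :: real => real)" and kcd_cos: "kcd k (cos :: real => real)"
proof (induction k)
 case 0
 { case 1 then show ?case by (auto intro: continuous_intros) }
 { case 2 then show ?case by (auto intro: continuous_intros) }
next
 case (Suc k)
 { case 1 show ?case
   by (rule kcd_real_derivative[where f'=cos]) (use Suc in \<open>auto intro: derivative_eq_intros\<close>) }
 { case 2 show ?case
   by (rule kcd_real_derivative[where f'="%x. - sin x"])
    (use Suc in \<open>auto intro!: derivative_eq_intros kcd_uminus\<close>) }
qed

lemma kcd_translation:
 fixes f :: "'a::euclidean_space => real"
 shows "kcd k f ==> kcd k (%x. f (x + c))"
proof (induction k arbitrary: f)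
 case 0
 then show ?case by (auto intro!: continuous_on_compose2[of UNIV f] continuous_intros)
next
 case (Suc k)
 have *: "((%x. f (x + c)) has_derivative frechet_derivative f (at (x + c))) (at x)" for x
  using Suc.prems
  by (intro has_derivative_compose[of "%x. x + c" "%h. h" x UNIV f "frechet_derivative f (at (x + c))"])
   (auto intro!: derivative_eq_intros simp: frechet_derivative_works[symmetric])
 with Suc show ?case
  by (intro kcd_SucI[OF *]) auto
qed

lemma kcd_reflect:
 fixes f :: "'a::euclidean_space => real"
 shows "kcd k f ==> kcd k (%x. f (- x))"
proof (induction k arbitrary: f)
 case 0
 then show ?case by (auto intro!: continuous_on_compose2[of UNIV f] continuous_intros)
next
 case (Suc k)
 have *: "((%x. f (- x)) has_derivative (%h. frechet_derivative f (at (- x)) (- h))) (at x)" for x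
  using Suc.prems
  by (intro has_derivative_compose[of "%x. - x" "%h. - h" x UNIV f "frechet_derivative f (at (- x))"])
   (auto intro!: derivative_eq_intros simp: frechet_derivative_works[symmetric])
 have lin: "frechet_derivative f (at y) (- h) = - frechet_derivative f (at y) h" for y h
  using linear_frechet_derivative[of f "at y"] Suc.prems
   linear_neg[of "frechet_derivative f (at y)" h] by auto
 with Suc show ?case
  by (intro kcd_SucI[OF *]) (auto simp: lin intro!: kcd_uminus)
qed

lemma kcd_shift_reflect:
 fixes f :: "'a::euclidean_space => real"
 shows "kcd k f ==> kcd k (%y. f (x - y))"
 using kcd_reflect[OF kcd_translation[of k f x]] by simp

declare k_times_cont_diff.simps(2) [simp del]

subsection \<open>Partial derivatives\<close>

lemma kcd_Suc_iff_partial: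
 "kcd (Suc k) (f :: real^'n => real) \<longleftrightarrow>
   (\<forall>x. f differentiable (at x)) & (\<forall>i. kcd k (partial i f))"
 by (simp add: k_times_cont_diff.simps(2) Basis_vec_def partial_def[abs_def])

lemma kcd_partial: "kcd (Suc k) (f :: real^'n => real) ==> kcd k (partial i f)"
 unfolding kcd_Suc_iff_partial by blast

lemma kcd_partial': "kcd k (f :: real^'n => real) ==> Suc j <= k ==> kcd j (partial i f)"
 using kcd_partial[OF kcd_mono[of k f "Suc j"]] by simp

lemma smooth_partial: "(!!k. kcd k (f :: real^'n => real)) ==> kcd k (partial i f)"
 by (rule kcd_partial)

lemma partial_eqI: "(f has_derivative D) (at x) ==> partial i f x = D (axis i 1)"
 unfolding partial_def by (drule frechet_derivative_at) metis

lemma kcd_derivative_partial: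
 fixes f :: "real^'n => real"
 assumes "kcd 1 f"
 shows "(f has_derivative (%h. SUM i. h $ i * partial i f x)) (at x)"
proof -
 have f: "(f has_derivative frechet_derivative f (at x)) (at x)"
  using assms kcd_has_derivative by blast
 then have "linear (frechet_derivative f (at x))"
  using has_derivative_linear by blast
 then have "frechet_derivative f (at x) h = (SUM i. h $ i * partial i f x)" for h
  by (subst basis_expansion[symmetric]) (simp add: linear_sum linear_scale partial_def scalar_mult_eq_scaleR)
 then have "frechet_derivative f (at x) = (%h. SUM i. h $ i * partial i f x)" by blast
 with f show ?thesis by metis
qed

lemma partial_const [simp]: "partial i (%x. c) x = 0"
 by (rule partial_eqI[THEN trans]) (auto intro: derivative_eq_intros)

lemma partial_add: "kcd 1 f ==> kcd 1 g ==> partial i (%x. f x + g x) x = partial i f x + partial i g x"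
 by (rule partial_eqI[THEN trans], rule has_derivative_add, rule kcd_has_derivative, assumption, simp,
   rule kcd_has_derivative, assumption, simp) (simp add: partial_def)

lemma partial_diff: "kcd 1 f ==> kcd 1 g ==> partial i (%x. f x - g x) x = partial i f x - partial i g x"
 by (rule partial_eqI[THEN trans], rule has_derivative_diff, rule kcd_has_derivative, assumption, simp,
   rule kcd_has_derivative, assumption, simp) (simp add: partial_def)

lemma partial_mult:
 "kcd 1 f ==> kcd 1 g ==> partial i (%x. f x * g x) x = partial i f x * g x + f x * partial i g x"
 by (rule partial_eqI[THEN trans], rule has_derivative_mult, rule kcd_has_derivative, assumption, simp,
   rule kcd_has_derivative, assumption, simp) (simp add: partial_def)

lemma partial_cmult: "kcd 1 f ==> partial i (%x. c * f x) x = c * partial i f x"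
 using partial_mult[OF kcd_const[of 1 c]] by simp

lemma partial_sum:
 "(!!j. j \<in> J ==> kcd 1 (f j)) ==> partial i (%x. \<Sum>j\<in>J. f j x) x = (\<Sum>j\<in>J. partial i (f j) x)"
 by (rule partial_eqI[THEN trans], rule has_derivative_sum, rule kcd_has_derivative, assumption, simp)
  (simp add: partial_def)

lemma partial_compose_real:
 assumes "!!y. (g has_real_derivative g' y) (at y)" "kcd 1 f"
 shows "partial i (%x. g (f x)) x = g' (f x) * partial i f x"
proof -
 have "(g has_derivative (%h. g' (f x) * h)) (at (f x))"
  using assms(1) by (simp add: has_field_derivative_def)
 from has_derivative_compose[OF kcd_has_derivative[OF assms(2)] this]
 show ?thesis by (subst partial_eqI) (auto simp: partial_def)
qed

lemma partial_shift_reflect: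
 fixes f :: "real^'n => real"
 assumes "kcd 1 f"
 shows "partial i (%y. f (x - y)) y = - partial i f (x - y)"
proof -
 have "((%y. x - y) has_derivative (%h. - h)) (at y)"
  by (auto intro!: derivative_eq_intros)
 from has_derivative_compose[OF this kcd_has_derivative[OF assms]]
 have "partial i (%y. f (x - y)) y = frechet_derivative f (at (x - y)) (- axis i 1)"
  by (subst partial_eqI) auto
 also have "... = - frechet_derivative f (at (x - y)) (axis i 1)"
  using has_derivative_linear[OF kcd_has_derivative[OF assms]] linear_neg by blast
 finally show ?thesis by (simp add: partial_def)
qed

lemma has_derivative_along_line:
 fixes f :: "real^'n => real"
 assumes "kcd 1 f"
 shows "((%t. f (x + t *\<^sub>R v)) has_real_derivative (SUM i. v $ i * partial i f (x + t *\<^sub>R v))) (at t)"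
proof -
 have "((%t. x + t *\<^sub>R v) has_derivative (%h. h *\<^sub>R v)) (at t)"
  by (auto intro!: derivative_eq_intros)
 from has_derivative_compose[OF this kcd_derivative_partial[OF assms]]
 have "((%t. f (x + t *\<^sub>R v)) has_derivative (%h. SUM i. (h *\<^sub>R v) $ i * partial i f (x + t *\<^sub>R v))) (at t)"
  by simp
 then show ?thesis
  unfolding has_field_derivative_def
  by (rule has_derivative_eq_rhs) (simp add: fun_eq_iff sum_distrib_left mult_ac)
qed

lemma sum_axis_mult: "(SUM j. axis i (1::real) $ j * f j) = f (i::'n::finite)"
 by (subst sum.mono_neutral_right[of UNIV "{i}"]) (auto simp: axis_def)

lemma has_derivative_along_axis:
 fixes f :: "real^'n => real"
 assumes "kcd 1 f"
 shows "((%t. f (x + t *\<^sub>R axis i 1)) has_real_derivative partial i f (x + t *\<^sub>R axis i 1)) (at t)"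
 using has_derivative_along_line[OF assms, of x "axis i 1" t] by (simp add: sum_axis_mult)

text \<open>Both mixed derivatives are the limit of the same second difference quotient.\<close>

lemma partial_commute:
 fixes f :: "real^'n => real"
 assumes "kcd 2 f"
 shows "partial i (partial j f) x = partial j (partial i f) x"
proof -
 define Q where "Q t = f (x + t *\<^sub>R axis i 1 + t *\<^sub>R axis j 1) - f (x + t *\<^sub>R axis i 1)
   - f (x + t *\<^sub>R axis j 1) + f x" for t
 \<comment> \<open>The mean value theorem is used twice: in direction \<open>a\<close> for the
   difference of \<open>g\<close> between the lines shifted by \<open>t\<close> along
   \<open>b\<close>, then in direction \<open>b\<close> for \<open>partial a g\<close>. The
   intermediate point tends to \<open>x\<close> with \<open>t\<close>, and the left-hand side is
   symmetric in \<open>a\<close> and \<open>b\<close>.\<close>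
 have key: "\<exists>y. dist y x <= 2 * t & g (x + t *\<^sub>R axis a 1 + t *\<^sub>R axis b 1) - g (x + t *\<^sub>R axis a 1)
   - g (x + t *\<^sub>R axis b 1) + g x = t^2 * partial b (partial a g) y"
  if "t > 0" "kcd 2 g" for t a b and g :: "real^'n => real"
 proof -
  have g1: "kcd 1 g" "kcd 1 (partial a g)" for a
   using that by (auto intro: kcd_mono[of 2] kcd_partial'[of 2])
  define h where "h r = g ((x + t *\<^sub>R axis b 1) + r *\<^sub>R axis a 1) - g (x + r *\<^sub>R axis a 1)" for r
  have "(h has_real_derivative partial a g ((x + t *\<^sub>R axis b 1) + r *\<^sub>R axis a 1)
     - partial a g (x + r *\<^sub>R axis a 1)) (at r)" for r
   unfolding h_def by (intro DERIV_diff has_derivative_along_axis g1)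
  from MVT2[of 0 t h, OF \<open>t > 0\<close> this]
  obtain r where r: "0 < r" "r < t" "h t - h 0 = (t - 0) * (partial a g ((x + t *\<^sub>R axis b 1) + r *\<^sub>R axis a 1)
     - partial a g (x + r *\<^sub>R axis a 1))" by blast
  from MVT2[of 0 t "%s. partial a g ((x + r *\<^sub>R axis a 1) + s *\<^sub>R axis b 1)",
    OF \<open>t > 0\<close> has_derivative_along_axis[OF g1(2)]]
  obtain s where s: "0 < s" "s < t" "partial a g ((x + r *\<^sub>R axis a 1) + t *\<^sub>R axis b 1)
     - partial a g ((x + r *\<^sub>R axis a 1) + 0 *\<^sub>R axis b 1)
     = (t - 0) * partial b (partial a g) ((x + r *\<^sub>R axis a 1) + s *\<^sub>R axis b 1)"
   by blast
  have sw: "(x + t *\<^sub>R axis b 1) + r *\<^sub>R axis a 1 = (x + r *\<^sub>R axis a 1) + t *\<^sub>R axis b 1"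
   by (simp add: add_ac)
  have "dist ((x + r *\<^sub>R axis a 1) + s *\<^sub>R axis b 1) x = norm (r *\<^sub>R axis a (1::real) + s *\<^sub>R axis b (1::real))"
   by (simp add: dist_norm)
  also have "... <= norm (r *\<^sub>R axis a (1::real)) + norm (s *\<^sub>R axis b (1::real))"
   by (rule norm_triangle_ineq)
  finally have "dist ((x + r *\<^sub>R axis a 1) + s *\<^sub>R axis b 1) x <= norm (r *\<^sub>R axis a (1::real)) + norm (s *\<^sub>R axis b (1::real))" .
  then have "dist ((x + r *\<^sub>R axis a 1) + s *\<^sub>R axis b 1) x <= 2 * t"
   using r s by simp
  moreover have "h t - h 0 = g (x + t *\<^sub>R axis a 1 + t *\<^sub>R axis b 1) - g (x + t *\<^sub>R axis a 1)
   - g (x + t *\<^sub>R axis b 1) + g x" by (simp add: h_def add_ac)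
  moreover have "h t - h 0 = t^2 * partial b (partial a g) ((x + r *\<^sub>R axis a 1) + s *\<^sub>R axis b 1)"
   using r(3) s(3) by (simp add: sw power2_eq_square)
  ultimately show ?thesis by metis
 qed
 define t where "t n = inverse (real (Suc n))" for n
 have t: "t n > 0" for n by (simp add: t_def)
 have t0: "(%n. 2 * t n) ----> 0"
  unfolding t_def using tendsto_mult_right_zero[OF LIMSEQ_inverse_real_of_nat, of 2] by simp
 have lim: "(%n. Q (t n) / (t n)^2) ----> partial b (partial a f) x" if "(a = i & b = j) \<or> (a = j & b = i)" for a b
 proof -
  have "\<forall>n. \<exists>y. dist y x <= 2 * t n & Q (t n) = (t n)^2 * partial b (partial a f) y"
  proof
   fix n
   show "\<exists>y. dist y x <= 2 * t n & Q (t n) = (t n)^2 * partial b (partial a f) y"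
    using key[OF t[of n] assms, of a b] that by (auto simp: Q_def add_ac)
  qed
  from choice[OF this] obtain y
   where "\<forall>n. dist (y n) x <= 2 * t n & Q (t n) = (t n)^2 * partial b (partial a f) (y n)" ..
  then have y: "!!n. dist (y n) x <= 2 * t n" "!!n. Q (t n) = (t n)^2 * partial b (partial a f) (y n)"
   by blast+
  have "y ----> x"
   by (rule tendsto_dist_iff[THEN iffD2], rule tendsto_sandwich[OF always_eventually always_eventually tendsto_const t0])
    (use y(1) in \<open>simp_all\<close>)
  moreover have c: "continuous_on UNIV (partial b (partial a f))"
   using assms by (intro kcd_continuous[of 0] kcd_partial'[of 1] kcd_partial'[of 2]) auto
  ultimately have "(%n. partial b (partial a f) (y n)) ----> partial b (partial a f) x"
   using continuous_on_tendsto_compose[OF c, of y x] by simp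
  moreover have "(%n. Q (t n) / (t n)^2) = (%n. partial b (partial a f) (y n))"
   unfolding y(2) using t[THEN less_imp_neq, symmetric] by simp
  ultimately show ?thesis by simp
 qed
 show ?thesis
  using LIMSEQ_unique[OF lim[of j i] lim[of i j]] by simp
qed

subsection \<open>Smooth cut-off functions\<close>

text \<open>The powers of 1/t in front of exp(-1/t) are included because the derivative of a member
  is a combination of two other members of the family; smoothness of all of them is then one
  induction.\<close>

definition flat_exp :: "nat => real => real" where
 "flat_exp m t = (if t > 0 then (1 / t) ^ m * exp (- (1 / t)) else 0)"

lemma flat_exp_nonneg: "flat_exp m t >= 0"
 by (auto simp: flat_exp_def)

text \<open>A single term of the exponential series of 1/t is bounded by the whole series. The case
  \<open>k = 2\<close> makes the difference quotient at the origin O(|h|), which is how the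
  derivative there is found.\<close>

lemma flat_exp_bound: "flat_exp m t <= fact (m + k) * \<bar>t\<bar> ^ k"
proof (cases "t > 0")
 case True
 have "(1 / t) ^ (m + k) / fact (m + k) <= exp (1 / t)"
 proof -
  have "(%n. (1 / t) ^ n /\<^sub>R fact n) sums exp (1 / t)"
   by (rule exp_converges)
  then have sm: "summable (%n. (1 / t) ^ n /\<^sub>R fact n)" "suminf (%n. (1 / t) ^ n /\<^sub>R fact n) = exp (1 / t)"
   by (simp_all only: sums_iff)
  have "sum (%n. (1 / t) ^ n /\<^sub>R fact n) {m + k} <= suminf (%n. (1 / t) ^ n /\<^sub>R fact n)"
   by (rule sum_le_suminf[OF sm(1)]) (use True in auto)
  with sm(2) have "sum (%n. (1 / t) ^ n /\<^sub>R fact n) {m + k} <= exp (1 / t)" by simp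
  then show ?thesis by (simp add: divide_inverse mult.commute)
 qed
 then have "(1 / t) ^ (m + k) * exp (- (1 / t)) <= fact (m + k)"
 proof -
  assume "(1 / t) ^ (m + k) / fact (m + k) <= exp (1 / t)"
  then have "(1 / t) ^ (m + k) <= fact (m + k) * exp (1 / t)"
   by (simp only: pos_divide_le_eq[OF fact_gt_zero] mult.commute)
  then have "(1 / t) ^ (m + k) * exp (- (1 / t)) <= fact (m + k) * exp (1 / t) * exp (- (1 / t))"
   by (intro mult_right_mono) auto
  then show ?thesis by (simp only: mult.assoc exp_minus_inverse mult_1_right)
 qed
 then have "(1 / t) ^ (m + k) * exp (- (1 / t)) * t ^ k <= fact (m + k) * t ^ k"
  using True by (intro mult_right_mono) auto
 moreover have "(1 / t) ^ (m + k) * exp (- (1 / t)) * t ^ k = flat_exp m t"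
  using True by (simp add: flat_exp_def power_add field_simps)
 ultimately show ?thesis using True by simp
qed (simp add: flat_exp_def)

lemma flat_exp_deriv:
 "(flat_exp m has_real_derivative (- real m * flat_exp (Suc m) t + flat_exp (Suc (Suc m)) t)) (at t)"
proof -
 consider "t > 0" | "t < 0" | "t = 0" by linarith
 then show ?thesis
 proof cases
  case 1
  have "((%t. (1 / t) ^ m * exp (- (1 / t))) has_real_derivative
    (- real m * flat_exp (Suc m) t + flat_exp (Suc (Suc m)) t)) (at t)"
  proof (cases m)
   case 0
   then show ?thesis
    using 1 by (auto intro!: derivative_eq_intros simp: flat_exp_def field_simps power2_eq_square)
  next
   case (Suc l)
   have d: "((%t. 1 / t) has_real_derivative - (1 / t^2)) (at t)"
    using 1 by (auto intro!: derivative_eq_intros simp: power2_eq_square)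
   have "((%t. exp (- (1 / t))) has_real_derivative exp (- (1 / t)) * (1 / t^2)) (at t)"
    using DERIV_chain2[OF DERIV_exp DERIV_minus[OF d]] by simp
   from DERIV_mult[OF DERIV_power[OF d, of m] this]
   show ?thesis
    by (rule DERIV_cong) (use 1 in \<open>simp add: Suc flat_exp_def field_simps power2_eq_square\<close>)
  qed
  then show ?thesis
   by (rule has_field_derivative_transform_within_open[where S="{0<..}"])
    (use 1 in \<open>auto simp: flat_exp_def\<close>)
 next
  case 2
  have "((%t. 0) has_real_derivative
    (- real m * flat_exp (Suc m) t + flat_exp (Suc (Suc m)) t)) (at t)"
   using 2 by (simp add: flat_exp_def)
  then show ?thesis
   by (rule has_field_derivative_transform_within_open[where S="{..<0}"])
    (use 2 in \<open>auto simp: flat_exp_def\<close>)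
 next
  case 3
  have "((%h. (flat_exp m (0 + h) - flat_exp m 0) / h) \<longlongrightarrow> 0) (at 0)"
  proof (rule tendsto_rabs_zero_cancel)
   show "((%h. \<bar>(flat_exp m (0 + h) - flat_exp m 0) / h\<bar>) \<longlongrightarrow> 0) (at 0)"
   proof (rule tendsto_sandwich[of "%_. 0"])
    show "\<forall>\<^sub>F h in at 0. \<bar>(flat_exp m (0 + h) - flat_exp m 0) / h\<bar> <= fact (m + 2) * \<bar>h\<bar>"
    proof (rule eventually_at_topological[THEN iffD2], intro exI[of _ UNIV] conjI ballI impI)
     fix h :: real assume "h ~= 0"
     then have "\<bar>flat_exp m h\<bar> / \<bar>h\<bar> <= (fact (m + 2) * \<bar>h\<bar> ^ 2) / \<bar>h\<bar>"
      using flat_exp_bound[of m h 2] flat_exp_nonneg[of m h] by (intro divide_right_mono) auto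
     moreover have "(c * a ^ 2) / a = c * a" for a c :: real
      by (cases "a = 0") (auto simp: power2_eq_square)
     moreover have "\<bar>(flat_exp m (0 + h) - flat_exp m 0) / h\<bar> = \<bar>flat_exp m h\<bar> / \<bar>h\<bar>"
      by (simp add: flat_exp_def[of m 0] abs_divide)
     ultimately show "\<bar>(flat_exp m (0 + h) - flat_exp m 0) / h\<bar> <= fact (m + 2) * \<bar>h\<bar>"
      by metis
    qed auto
    show "((%h. fact (m + 2) * \<bar>h\<bar>) \<longlongrightarrow> (0::real)) (at 0)"
     by (auto intro!: tendsto_eq_intros)
   qed auto
  qed
  then have "(flat_exp m has_real_derivative 0) (at 0)"
   unfolding DERIV_def .
  then show ?thesis using 3 by (simp add: flat_exp_def)
 qed
qed

lemma kcd_flat_exp: "kcd k (flat_exp m)"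
proof (induction k arbitrary: m)
 case 0
 show ?case
  using flat_exp_deriv by (auto intro!: continuous_at_imp_continuous_on DERIV_isCont)
next
 case (Suc k)
 show ?case
  by (rule kcd_real_derivative[OF flat_exp_deriv]) (intro kcd_add kcd_mult kcd_const Suc)
qed

definition smooth_step :: "real => real" where
 "smooth_step t = flat_exp 0 t / (flat_exp 0 t + flat_exp 0 (1 - t))"

lemma smooth_step_denom: "flat_exp 0 t + flat_exp 0 (1 - t) > 0"
 by (cases "t > 0") (auto simp: flat_exp_def add_pos_nonneg)

lemma kcd_smooth_step: "kcd k smooth_step"
proof -
 have "kcd k (%t. flat_exp 0 t / (flat_exp 0 t + flat_exp 0 (1 - t)))"
  using smooth_step_denom
  by (intro kcd_divide kcd_add kcd_flat_exp kcd_shift_reflect less_imp_neq[THEN not_sym])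
 then show ?thesis by (simp add: smooth_step_def[abs_def])
qed

lemma smooth_step_bounds: "0 <= smooth_step t" "smooth_step t <= 1"
 using smooth_step_denom[of t] flat_exp_nonneg[of 0 t] flat_exp_nonneg[of 0 "1 - t"]
 by (auto simp: smooth_step_def)

lemma smooth_step_0: "t <= 0 ==> smooth_step t = 0"
 by (simp add: smooth_step_def flat_exp_def)

lemma smooth_step_1: "t >= 1 ==> smooth_step t = 1"
 using smooth_step_denom[of t] by (simp add: smooth_step_def flat_exp_def)

text \<open>The squared distance is a polynomial and hence smooth at the centre too. The argument of
  the step is 1 at distance \<open>r\<close> and 0 at distance \<open>R\<close>.\<close>

definition bump :: "real^'n => real => real => real^'n => real" where
 "bump c r R x = smooth_step ((R^2 - (dist x c)^2) / (R^2 - r^2))"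

lemma kcd_dist2: "kcd k (%x::real^'n. (dist x c)^2)"
proof -
 have "kcd k (%x::real^'n. SUM i. (x $ i - c $ i) * (x $ i - c $ i))"
  by (intro kcd_sum kcd_mult kcd_diff kcd_nth kcd_const)
 then show ?thesis
  by (simp add: dist_norm power2_norm_eq_inner inner_vec_def)
qed

lemma kcd_bump: "kcd k (bump c r R)"
proof -
 have "kcd k (%x. smooth_step ((R^2 - (dist x c)^2) * (1 / (R^2 - r^2))))"
  by (intro kcd_compose_real[OF kcd_smooth_step] kcd_mult kcd_diff kcd_const kcd_dist2)
 then show ?thesis by (simp add: bump_def[abs_def])
qed

lemma bump_bounds: "0 <= bump c r R x" "bump c r R x <= 1"
 by (auto simp: bump_def smooth_step_bounds)

lemma bump_1: "0 <= r ==> r < R ==> dist x c <= r ==> bump c r R x = 1"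
 unfolding bump_def
 by (rule smooth_step_1) (auto simp: field_simps power_strict_mono power_mono)

lemma bump_0: "0 <= r ==> r < R ==> dist x c >= R ==> bump c r R x = 0"
 unfolding bump_def
 by (rule smooth_step_0, rule divide_nonpos_pos) (auto simp: power_strict_mono power_mono)

subsection \<open>Compactly supported functions\<close>

text \<open>The order is a parameter because weak derivatives are tested with C^1 functions as well.
  An arbitrary compact witness instead of the closed support makes products and derivatives
  immediate.\<close>

definition Cc :: "nat => (real^'n) set => (real^'n => real) => bool" where
 "Cc k U \<phi> \<longleftrightarrow> kcd k \<phi> & (\<exists>K. compact K & K \<subseteq> U & (\<forall>x. x \<notin> K --> \<phi> x = 0))"

lemma CcI: "kcd k \<phi> ==> compact K ==> K \<subseteq> U ==> (!!x. x \<notin> K ==> \<phi> x = 0) ==> Cc k U \<phi>"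
 by (auto simp: Cc_def)

lemma Cc_kcd: "Cc k U \<phi> ==> kcd k \<phi>"
 by (auto simp: Cc_def)

lemma compact_support_iff:
 fixes \<phi> :: "real^'n => real"
 shows "compact (closure {x. \<phi> x ~= 0}) & closure {x. \<phi> x ~= 0} \<subseteq> U \<longleftrightarrow>
  (\<exists>K. compact K & K \<subseteq> U & (\<forall>x. x \<notin> K --> \<phi> x = 0))" (is "?l \<longleftrightarrow> ?r")
proof
 assume ?l
 then show ?r
  using closure_subset[of "{x. \<phi> x ~= 0}"] by (intro exI[of _ "closure {x. \<phi> x ~= 0}"]) auto
next
 assume ?r
 then obtain K where K: "compact K" "K \<subseteq> U" "!!x. x \<notin> K ==> \<phi> x = 0" by blast
 then have "closure {x. \<phi> x ~= 0} \<subseteq> K"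
  by (intro closure_minimal compact_imp_closed) auto
 with K show ?l
  using compact_Int_closed[of K "closure {x. \<phi> x ~= 0}"] by (auto simp: inf_absorb2)
qed

lemma test_function_iff: "test_function U \<phi> \<longleftrightarrow> (\<forall>k. Cc k U \<phi>)"
 unfolding test_function_def Cc_def using compact_support_iff[of \<phi> U] by auto

lemma test_function_Cc: "test_function U \<phi> ==> Cc k U \<phi>"
 by (simp add: test_function_iff)

lemma test_function_kcd: "test_function U \<phi> ==> kcd k \<phi>"
 by (simp add: test_function_def)

lemma Cc_mono: "Cc l U \<phi> ==> k <= l ==> U \<subseteq> V ==> Cc k V \<phi>"
 unfolding Cc_def using kcd_mono by blast

lemma Cc_mult: "Cc k U \<phi> ==> kcd k a ==> Cc k U (%x. a x * \<phi> x)"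
 unfolding Cc_def using kcd_mult[of k a \<phi>] by auto

lemma Cc_cmult: "Cc k U \<phi> ==> Cc k U (%x. c * \<phi> x)"
 by (rule Cc_mult) (simp_all add: kcd_const)

lemma partial_outside_support:
 fixes \<phi> :: "real^'n => real"
 assumes "compact K" "!!x. x \<notin> K ==> \<phi> x = 0" "x \<notin> K"
 shows "partial i \<phi> x = 0"
proof -
 have "((%x. 0) has_derivative (%_. 0)) (at x)" by simp
 then have "(\<phi> has_derivative (%_. 0)) (at x)"
  by (rule has_derivative_transform_within_open[where s="- K"])
   (use assms compact_imp_closed in auto)
 then show ?thesis by (rule partial_eqI)
qed

lemma Cc_partial:
 assumes "Cc (Suc k) U \<phi>"
 shows "Cc k U (partial i \<phi>)"
proof -
 obtain K where K: "compact K" "K \<subseteq> U" "!!x. x \<notin> K ==> \<phi> x = 0"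
  using assms unfolding Cc_def by blast
 show ?thesis
  by (rule CcI[OF _ K(1,2)]) (use K assms Cc_kcd kcd_partial partial_outside_support in blast)+
qed

lemma test_function_partial: "test_function U \<phi> ==> test_function U (partial i \<phi>)"
 by (simp add: test_function_iff Cc_partial)

lemma test_function_bump:
 "0 <= r ==> r < R ==> cball c R \<subseteq> U ==> test_function U (bump c r R)"
 unfolding test_function_iff
 by (intro allI CcI[where K="cball c R"] kcd_bump bump_0) (auto simp: dist_commute)

lemma Cc_bounded:
 assumes "Cc k U \<phi>"
 obtains B where "B > 0" "!!x. \<bar>\<phi> x\<bar> <= B"
proof -
 obtain K where K: "compact K" "K \<subseteq> U" "!!x. x \<notin> K ==> \<phi> x = 0"
  using assms unfolding Cc_def by blast
 have "bounded (\<phi> ` K)"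
  using K assms by (intro compact_imp_bounded compact_continuous_image) (auto intro: kcd_continuous Cc_kcd)
 then obtain B where B: "B > 0" "!!x. x \<in> K ==> \<bar>\<phi> x\<bar> <= B"
  unfolding bounded_pos by auto
 show ?thesis
  by (rule that[OF B(1)]) (use B K in fastforce)
qed

lemma kcd_bounded_on:
 fixes a :: "real^'n => real"
 assumes "kcd k a" "bounded S"
 obtains B where "B > 0" "!!x. x \<in> S ==> \<bar>a x\<bar> <= B"
proof -
 have "bounded (a ` closure S)"
  using assms by (intro compact_imp_bounded compact_continuous_image) (auto intro: kcd_continuous)
 then obtain B where B: "B > 0" "!!x. x \<in> closure S ==> \<bar>a x\<bar> <= B"
  unfolding bounded_pos by auto
 show ?thesis
  by (rule that[OF B(1)]) (use B closure_subset in blast)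
qed

section \<open>The Hilbert space of square integrable functions\<close>

lemma L2D: "f \<in> L2 X ==> f \<in> meas X"
 "f \<in> L2 X ==> integrable (leb X) (%x. (norm (f x))^2)"
 by (auto simp: L2_def)

lemma L2_dominated:
 assumes "f \<in> meas X" "integrable (leb X) g"
  "AE x in leb X. (norm (f x))^2 <= g x"
 shows "f \<in> L2 X"
proof -
 have "integrable (leb X) (%x. (norm (f x))^2)"
  by (rule lintegrable_bound[OF assms(2)])
   (use assms in \<open>auto intro: measurable_compose elim!: eventually_mono\<close>)
 with assms show ?thesis by (simp add: L2_def)
qed

lemma L2_add:
 assumes "f \<in> L2 X" "g \<in> L2 X"
 shows "(%x. f x + g x) \<in> L2 X"
proof (rule L2_dominated)
 show "(%x. f x + g x) \<in> meas X"
  by (intro borel_measurable_add L2D assms)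
 show "integrable (leb X) (%x. 2 * (norm (f x))^2 + 2 * (norm (g x))^2)"
  by (intro lintegrable_add integrable_mult_right L2D assms)
 have "(norm (f x + g x))^2 <= 2 * (norm (f x))^2 + 2 * (norm (g x))^2" for x
 proof -
  have "(norm (f x + g x))^2 <= (norm (f x) + norm (g x))^2"
   by (intro power_mono norm_triangle_ineq) auto
  also have "... <= 2 * (norm (f x))^2 + 2 * (norm (g x))^2"
   using sum_squares_bound[of "norm (f x)" "norm (g x)"] by (simp add: power2_sum)
  finally show ?thesis .
 qed
 then show "AE x in leb X. (norm (f x + g x))^2 <= 2 * (norm (f x))^2 + 2 * (norm (g x))^2"
  by simp
qed

lemma L2_bounded_mult:
 fixes f :: "'a::euclidean_space => 'b::euclidean_space"
 assumes f: "f \<in> L2 X" and a: "a \<in> meas X"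
  and B: "AE x in leb X. \<bar>a x\<bar> <= B"
 shows "(%x. a x *\<^sub>R f x) \<in> L2 X"
proof (rule L2_dominated)
 show "(%x. a x *\<^sub>R f x) \<in> meas X"
  using f a by (auto intro: L2D borel_measurable_scaleR)
 show "integrable (leb X) (%x. B^2 * (norm (f x))^2)"
  using f by (auto intro: L2D borel_measurable_scaleR)
 show "AE x in leb X. (norm (a x *\<^sub>R f x))^2 <= B^2 * (norm (f x))^2"
  using B
 proof eventually_elim
  case (elim x)
  then have "\<bar>a x\<bar>^2 <= B^2" by (intro power_mono) auto
  then show ?case by (auto simp: power_mult_distrib intro!: mult_right_mono)
 qed
qed

lemma L2_scaleR: "f \<in> L2 X ==> (%x. c *\<^sub>R f x) \<in> L2 X"
 by (rule L2_bounded_mult[of f X "%_. c" "\<bar>c\<bar>"]) auto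

lemma L2_cmult: "f \<in> L2 X ==> (%x. c * f x :: real) \<in> L2 X"
 using L2_scaleR[of f X c] by simp

lemma L2_bounded_mult_real:
 fixes f :: "'a::euclidean_space => real"
 assumes "f \<in> L2 X" "a \<in> meas X" "!!x. x \<in> X ==> \<bar>a x\<bar> <= B"
 shows "(%x. a x * f x) \<in> L2 X"
 using L2_bounded_mult[OF assms(1,2), of B] assms(3) AE_I2[of "leb X" "%x. \<bar>a x\<bar> <= B"] by simp

lemma L2_uminus: "f \<in> L2 X ==> (%x. - f x) \<in> L2 X"
 using L2_scaleR[of f X "-1"] by simp

lemma L2_diff: "f \<in> L2 X ==> g \<in> L2 X ==> (%x. f x - g x) \<in> L2 X"
 using L2_add[OF _ L2_uminus, of f X g] by simp

lemma L2_zero: "(%x. 0) \<in> L2 X"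
 by (simp add: L2_def)

lemma L2_sum: "(!!i. i \<in> I ==> f i \<in> L2 X) ==> (%x. \<Sum>i\<in>I. f i x) \<in> L2 X"
 by (induction I rule: infinite_finite_induct) (auto intro: L2_zero L2_add)

lemma L2_component:
 fixes f :: "'a::euclidean_space => real^'n"
 assumes "f \<in> L2 X"
 shows "(%x. f x $ i) \<in> L2 X"
proof (rule L2_dominated)
 have "(%x. f x \<bullet> axis i 1) \<in> meas X"
  by (intro borel_measurable_inner L2D(1)[OF assms] borel_measurable_const)
 then show "(%x. f x $ i) \<in> meas X"
  by (simp add: inner_axis)
 show "integrable (leb X) (%x. (norm (f x))^2)"
  using assms by (rule L2D)
 show "AE x in leb X. (norm (f x $ i))^2 <= (norm (f x))^2"
  using component_le_norm_cart by (intro AE_I2 power_mono) auto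
qed

lemma norm_vec_sq: "(norm (v :: real^'n))^2 = (SUM i. (v $ i)^2)"
 unfolding power2_norm_eq_inner by (simp add: inner_vec_def power2_eq_square)

lemma norm_mat_sq: "(norm (v :: real^'n^'m))^2 = (SUM i. SUM j. (v $ i $ j)^2)"
 unfolding power2_norm_eq_inner by (simp add: inner_vec_def power2_eq_square)

lemma L2_vecI:
 fixes f :: "'a::euclidean_space => 'b::euclidean_space^'n"
 assumes "!!i. (%x. f x $ i) \<in> L2 X"
 shows "f \<in> L2 X"
proof -
 have n: "(norm (f x))^2 = (SUM i. (norm (f x $ i))^2)" for x
  by (simp add: power2_norm_eq_inner inner_vec_def)
 have "f \<in> meas X"
 proof (subst borel_measurable_euclidean_space, intro ballI)
  fix b :: "'b^'n" assume "b \<in> Basis"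
  then obtain i c where b: "b = axis i c" by (auto simp: Basis_vec_def)
  have "(%x. f x $ i \<bullet> c) \<in> meas X"
   using assms L2D(1) by (intro borel_measurable_inner) auto
  then show "(%x. f x \<bullet> b) \<in> meas X"
   by (simp add: b inner_axis)
 qed
 moreover have "integrable (leb X) (%x. (norm (f x))^2)"
  unfolding n by (intro lintegrable_sum L2D assms)
 ultimately show ?thesis by (simp add: L2_def)
qed

lemma L2_cong_AE:
 assumes "f \<in> L2 X" "AE x in leb X. f x = g x" "g \<in> meas X"
 shows "g \<in> L2 X"
 by (rule L2_dominated[OF assms(3) L2D(2)[OF assms(1)]]) (use assms(2) in \<open>auto elim!: eventually_mono\<close>)

lemma L2_inner_integrable:
 assumes "f \<in> L2 X" "g \<in> L2 X"
 shows "integrable (leb X) (%x. f x \<bullet> g x)"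
proof (rule lintegrable_bound)
 show "integrable (leb X) (%x. (norm (f x))^2 + (norm (g x))^2)"
  using assms by (auto intro: L2D borel_measurable_scaleR)
 show "(%x. f x \<bullet> g x) \<in> meas X"
  by (intro borel_measurable_inner L2D assms)
 have "norm (f x \<bullet> g x) <= norm ((norm (f x))^2 + (norm (g x))^2)" for x
 proof -
  have "norm (f x \<bullet> g x) <= norm (f x) * norm (g x)"
   using Cauchy_Schwarz_ineq2 by simp
  also have "2 * (norm (f x) * norm (g x)) <= (norm (f x))^2 + (norm (g x))^2"
   using sum_squares_bound[of "norm (f x)" "norm (g x)"] by simp
  then have "norm (f x) * norm (g x) <= (norm (f x))^2 + (norm (g x))^2"
   using mult_nonneg_nonneg[OF norm_ge_zero[of "f x"] norm_ge_zero[of "g x"]] by linarith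
  finally show ?thesis by simp
 qed
 then show "AE x in leb X. norm (f x \<bullet> g x) <= norm ((norm (f x))^2 + (norm (g x))^2)"
  by simp
qed

lemma L2_mult_integrable:
 fixes f g :: "'a::euclidean_space => real"
 shows "f \<in> L2 X ==> g \<in> L2 X ==> integrable (leb X) (%x. f x * g x)"
 using L2_inner_integrable[of f X g] by simp

lemma L2norm_nonneg [simp]: "L2norm X f >= 0"
 by (simp add: L2norm_def)

lemma L2norm_sq: "(L2norm X f)^2 = (LINT x|leb X. (norm (f x))^2)"
 by (simp add: L2norm_def)

lemma L2inner_self: "L2inner X f f = (L2norm X f)^2"
 by (simp add: L2norm_sq L2inner_def power2_norm_eq_inner)

lemma L2inner_commute: "L2inner X f g = L2inner X g f"
 by (simp add: L2inner_def inner_commute)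

lemma L2inner_add_left:
 "f \<in> L2 X ==> g \<in> L2 X ==> h \<in> L2 X ==> L2inner X (%x. f x + g x) h = L2inner X f h + L2inner X g h"
 by (simp add: L2inner_def inner_add_left L2_inner_integrable)

lemma L2inner_diff_left:
 "f \<in> L2 X ==> g \<in> L2 X ==> h \<in> L2 X ==> L2inner X (%x. f x - g x) h = L2inner X f h - L2inner X g h"
 by (simp add: L2inner_def inner_diff_left L2_inner_integrable)

lemma L2inner_add_right:
 "f \<in> L2 X ==> g \<in> L2 X ==> h \<in> L2 X ==> L2inner X h (%x. f x + g x) = L2inner X h f + L2inner X h g"
 by (simp add: L2inner_def inner_add_right L2_inner_integrable)

lemma L2inner_diff_right:
 "f \<in> L2 X ==> g \<in> L2 X ==> h \<in> L2 X ==> L2inner X h (%x. f x - g x) = L2inner X h f - L2inner X h g"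
 by (simp add: L2inner_def inner_diff_right L2_inner_integrable)

lemma L2inner_scaleR_left: "L2inner X (%x. c *\<^sub>R f x) h = c * L2inner X f h"
 by (simp add: L2inner_def)

lemma L2inner_scaleR_right: "L2inner X h (%x. c *\<^sub>R f x) = c * L2inner X h f"
 by (simp add: L2inner_def)

lemma L2norm_scaleR: "L2norm X (%x. c *\<^sub>R f x) = \<bar>c\<bar> * L2norm X f"
 by (simp add: L2norm_def power_mult_distrib real_sqrt_mult)

lemma L2norm_uminus [simp]: "L2norm X (%x. - f x) = L2norm X f"
 by (simp add: L2norm_def)

lemma L2norm_diff_commute: "L2norm X (%x. f x - g x) = L2norm X (%x. g x - f x)"
 by (simp add: L2norm_def norm_minus_commute)

lemma L2norm_diff_sq:
 assumes "f \<in> L2 X" "g \<in> L2 X"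
 shows "(L2norm X (%x. f x - g x))^2 = (L2norm X f)^2 - 2 * L2inner X f g + (L2norm X g)^2"
 using assms
 by (simp add: L2inner_self[symmetric] L2inner_diff_left L2inner_diff_right L2_diff L2inner_commute[of X g f])

lemma L2norm_add_sq:
 assumes "f \<in> L2 X" "g \<in> L2 X"
 shows "(L2norm X (%x. f x + g x))^2 = (L2norm X f)^2 + 2 * L2inner X f g + (L2norm X g)^2"
 using assms
 by (simp add: L2inner_self[symmetric] L2inner_add_left L2inner_add_right L2_add L2inner_commute[of X g f])

text \<open>The squared norm of f - t g is a nonnegative quadratic polynomial in t. On functions
  \<open>L2norm\<close> is only a seminorm, so a vanishing leading coefficient has to be treated
  separately.\<close>

lemma L2_Cauchy_Schwarz:
 assumes "f \<in> L2 X" "g \<in> L2 X"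
 shows "\<bar>L2inner X f g\<bar> <= L2norm X f * L2norm X g"
proof -
 define a b c where "a = (L2norm X f)^2" and "b = L2inner X f g" and "c = (L2norm X g)^2"
 have q: "0 <= a - 2 * t * b + t^2 * c" for t
 proof -
  have "0 <= (L2norm X (%x. f x - t *\<^sub>R g x))^2" by simp
  then show ?thesis
   using L2norm_diff_sq[OF assms(1) L2_scaleR[OF assms(2)], of t]
   by (simp add: L2inner_scaleR_right L2norm_scaleR a_def b_def c_def power_mult_distrib mult_ac)
 qed
 have "b^2 <= a * c"
 proof (cases "c = 0")
  case True
  show ?thesis
  proof (cases "b = 0")
   case False
   \<comment> \<open>With \<open>c = 0\<close> the polynomial is affine in t, and this choice of t
     gives it the value -1.\<close>
   have "0 <= a - 2 * ((a + 1) / (2 * b)) * b"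
    using q[of "(a + 1) / (2 * b)"] True by simp
   with False show ?thesis by simp
  qed (simp add: True)
 next
  case False
  then have c: "c > 0" by (simp add: c_def)
  then show ?thesis
   using q[of "b / c"] by (simp add: field_simps power2_eq_square)
 qed
 then have "b^2 <= (L2norm X f * L2norm X g)^2"
  by (simp add: a_def c_def power_mult_distrib)
 then show ?thesis
  unfolding b_def by (intro power2_le_imp_le[of "\<bar>_\<bar>"]) auto
qed

lemma L2norm_triangle:
 assumes "f \<in> L2 X" "g \<in> L2 X"
 shows "L2norm X (%x. f x + g x) <= L2norm X f + L2norm X g"
proof (rule power2_le_imp_le)
 show "(L2norm X (%x. f x + g x))^2 <= (L2norm X f + L2norm X g)^2"
  using L2norm_add_sq[OF assms] L2_Cauchy_Schwarz[OF assms] by (simp add: power2_sum)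
qed auto

lemma L2norm_triangle_diff:
 assumes "f \<in> L2 X" "g \<in> L2 X"
 shows "L2norm X (%x. f x - g x) <= L2norm X f + L2norm X g"
 using L2norm_triangle[OF assms(1) L2_uminus[OF assms(2)]] by simp

lemma L2norm_sum_le:
 assumes "finite I" "!!i. i \<in> I ==> f i \<in> L2 X"
 shows "L2norm X (%x. \<Sum>i\<in>I. f i x) <= (\<Sum>i\<in>I. L2norm X (f i))"
 using assms
proof (induction I)
 case empty
 then show ?case by (simp add: L2norm_def)
next
 case (insert i I)
 have "L2norm X (%x. f i x + (\<Sum>i\<in>I. f i x)) <= L2norm X (f i) + L2norm X (%x. \<Sum>i\<in>I. f i x)"
  using insert by (intro L2norm_triangle L2_sum) auto
 with insert show ?case by simp
qed

lemma L2norm_mono: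
 assumes "g \<in> L2 X" "AE x in leb X. norm (f x) <= norm (g x)" "f \<in> meas X"
 shows "L2norm X f <= L2norm X g"
 unfolding L2norm_def
proof (intro real_sqrt_le_mono integral_mono_AE)
 show le: "AE x in leb X. (norm (f x))^2 <= (norm (g x))^2"
  using assms(2) by eventually_elim (auto intro: power_mono)
 show "integrable (leb X) (%x. (norm (g x))^2)"
  using assms by (rule_tac L2D)
 show "integrable (leb X) (%x. (norm (f x))^2)"
  using L2D(2) L2_dominated[OF assms(3) L2D(2)[OF assms(1)] le] by blast
qed

lemma L2norm_cong_AE:
 assumes "AE x in leb X. f x = g x" "f \<in> meas X"
  "g \<in> meas X"
 shows "L2norm X f = L2norm X g"
 unfolding L2norm_def
 by (intro arg_cong[where f=sqrt] integral_cong_AE) (use assms in \<open>auto elim!: eventually_mono\<close>)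

lemma L2inner_cong_AE:
 assumes "AE x in leb X. f x = g x" "f \<in> meas X"
  "g \<in> meas X" "h \<in> meas X"
 shows "L2inner X f h = L2inner X g h"
 unfolding L2inner_def
 by (intro integral_cong_AE) (use assms in \<open>auto elim!: eventually_mono\<close>)

lemma L2norm_bounded_mult:
 fixes f :: "'a::euclidean_space => 'b::euclidean_space"
 assumes f: "f \<in> L2 X" and a: "a \<in> meas X"
  and B: "!!x. x \<in> X ==> \<bar>a x\<bar> <= B" "B >= 0"
 shows "L2norm X (%x. a x *\<^sub>R f x) <= B * L2norm X f"
proof -
 have "L2norm X (%x. a x *\<^sub>R f x) <= L2norm X (%x. B *\<^sub>R f x)"
 proof (rule L2norm_mono[OF L2_scaleR[OF f]])
  show "AE x in leb X. norm (a x *\<^sub>R f x) <= norm (B *\<^sub>R f x)"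
   using B by (intro AE_I2) (auto intro: mult_right_mono)
  show "(%x. a x *\<^sub>R f x) \<in> meas X"
   by (intro borel_measurable_scaleR a L2D(1)[OF f])
 qed
 then show ?thesis using B by (simp add: L2norm_scaleR)
qed

section \<open>Limits, completeness and orthogonal projection in L2\<close>

lemma L2_tendsto_inner:
 assumes "!!n. f n \<in> L2 X" "g \<in> L2 X" "h \<in> L2 X" "(%n. L2norm X (%x. f n x - g x)) ----> 0"
 shows "(%n. L2inner X (f n) h) ----> L2inner X g h"
proof (rule LIM_zero_cancel)
 show "(%n. L2inner X (f n) h - L2inner X g h) ----> 0"
 proof (rule Lim_null_comparison)
  show "(%n. L2norm X (%x. f n x - g x) * L2norm X h) ----> 0"
   using tendsto_mult_left_zero[OF assms(4)] .
  show "\<forall>\<^sub>F n in sequentially. norm (L2inner X (f n) h - L2inner X g h)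
    <= L2norm X (%x. f n x - g x) * L2norm X h"
   using L2_Cauchy_Schwarz[OF L2_diff[OF assms(1,2)] assms(3)] assms
   by (simp add: L2inner_diff_left)
 qed
qed

lemma L2_tendsto_norm:
 assumes "!!n. f n \<in> L2 X" "g \<in> L2 X" "(%n. L2norm X (%x. f n x - g x)) ----> 0"
 shows "(%n. L2norm X (f n)) ----> L2norm X g"
proof (rule Lim_null[THEN iffD2], rule Lim_null_comparison[OF _ assms(3)], intro always_eventually allI)
 fix n
 have "L2norm X (%x. (f n x - g x) + g x) <= L2norm X (%x. f n x - g x) + L2norm X g"
  by (intro L2norm_triangle L2_diff assms)
 moreover have "L2norm X (%x. (g x - f n x) + f n x) <= L2norm X (%x. g x - f n x) + L2norm X (f n)"
  by (intro L2norm_triangle L2_diff assms)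
 ultimately show "norm (L2norm X (f n) - L2norm X g) <= L2norm X (%x. f n x - g x)"
  by (simp add: L2norm_diff_commute[of X g])
qed

lemma L2_AE_subseq:
 assumes "!!n. f n \<in> L2 X" "g \<in> L2 X" "(%n. L2norm X (%x. f n x - g x)) ----> 0"
 obtains r where "strict_mono (r :: nat => nat)" "AE x in leb X. (%n. f (r n) x) ----> g x"
proof -
 have "(%n. (L2norm X (%x. f n x - g x))^2) ----> 0"
  using tendsto_power[OF assms(3), of 2] by simp
 then have "(%n. LINT x|leb X. norm ((norm (f n x - g x))^2)) ----> 0"
  by (simp add: L2norm_sq)
 then obtain r where r: "strict_mono (r :: nat => nat)"
  "AE x in leb X. (%n. (norm (f (r n) x - g x))^2) ----> 0"
  using tendsto_L1_AE_subseq[of "leb X" "%n x. (norm (f n x - g x))^2"]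
   L2D(2)[OF L2_diff[OF assms(1,2)]] by blast
 show ?thesis
 proof (rule that[OF r(1)])
  show "AE x in leb X. (%n. f (r n) x) ----> g x"
   using r(2)
  proof eventually_elim
   case (elim x)
   then have "(%n. sqrt ((norm (f (r n) x - g x))^2)) ----> sqrt 0"
    by (rule tendsto_real_sqrt)
   then have "(%n. norm (f (r n) x - g x)) ----> 0" by simp
   then show ?case by (simp add: tendsto_norm_zero_iff LIM_zero_iff)
  qed
 qed
qed

lemma L2_integrable:
 assumes "X \<in> lmeasurable" "f \<in> L2 X"
 shows "integrable (leb X) f"
proof (rule lintegrable_bound)
 interpret finite_measure "leb X" using assms finite_measure_lebesgue_on by blast
 show "integrable (leb X) (%x. 1 + (norm (f x))^2)"
  using assms by (auto intro: L2D borel_measurable_scaleR)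
 show "f \<in> meas X" using assms L2D by blast
 have "norm (f x) <= norm (1 + (norm (f x))^2)" for x
 proof -
  have "2 * norm (f x) <= 1 + (norm (f x))^2"
   using sum_squares_bound[of 1 "norm (f x)"] by simp
  then show ?thesis by (smt (verit) norm_ge_zero real_norm_def)
 qed
 then show "AE x in leb X. norm (f x) <= norm (1 + (norm (f x))^2)"
  by simp
qed

lemma L2_const: "X \<in> lmeasurable ==> (%x. c) \<in> L2 X"
 using finite_measure.integrable_const[OF finite_measure_lebesgue_on] by (auto simp: L2_def)

lemma L2_bounded:
 assumes "X \<in> lmeasurable" "f \<in> meas X" "!!x. x \<in> X ==> norm (f x) <= B"
 shows "f \<in> L2 X"
 by (rule L2_dominated[OF assms(2) finite_measure.integrable_const[OF finite_measure_lebesgue_on[OF assms(1)], of "B^2"]])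
  (use assms(3) in \<open>auto intro!: power_mono\<close>)

lemma L1_le_L2norm:
 assumes "X \<in> lmeasurable" "f \<in> L2 X"
 shows "(LINT x|leb X. norm (f x)) <= L2norm X f * L2norm X (%_. 1::real)"
proof -
 have "(%x. norm (f x)) \<in> L2 X"
  using assms by (auto simp: L2_def)
 from L2_Cauchy_Schwarz[OF this L2_const[OF assms(1), of "1::real"]]
 show ?thesis by (simp add: L2inner_def L2norm_def)
qed

lemma L2_dominated_convergence:
 fixes f :: "nat => 'a::euclidean_space => 'b::euclidean_space"
 assumes f: "!!n. f n \<in> meas X" and g: "g \<in> meas X"
  and h: "h \<in> L2 X"
  and le: "!!n. AE x in leb X. norm (f n x) <= norm (h x)"
  and lim: "AE x in leb X. (%n. f n x) ----> g x"
 shows "g \<in> L2 X" "!!n. f n \<in> L2 X" "(%n. L2norm X (%x. f n x - g x)) ----> 0"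
proof -
 have le': "AE x in leb X. \<forall>n. norm (f n x) <= norm (h x)"
  using le by (simp add: AE_all_countable)
 have gle: "AE x in leb X. norm (g x) <= norm (h x)"
  using le' lim
 proof eventually_elim
  case (elim x)
  then show ?case
   by (intro LIMSEQ_le_const2[OF tendsto_norm[OF elim(2)]]) auto
 qed
 show "g \<in> L2 X"
  by (rule L2_dominated[OF g L2D(2)[OF h]]) (use gle in \<open>auto elim!: eventually_mono intro: power_mono\<close>)
 show "f n \<in> L2 X" for n
  by (rule L2_dominated[OF f L2D(2)[OF h]]) (use le in \<open>auto elim!: eventually_mono intro: power_mono\<close>)
 have "(%n. LINT x|leb X. (norm (f n x - g x))^2) ----> (LINT x|leb X. 0)"
 proof (rule integral_dominated_convergence)
  show "integrable (leb X) (%x. 4 * (norm (h x))^2)"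
   by (intro integrable_mult_right L2D h)
  show "AE x in leb X. (%n. (norm (f n x - g x))^2) ----> 0"
   using lim
  proof eventually_elim
   case (elim x)
   then have "(%n. (norm (f n x - g x))^2) ----> (norm (g x - g x))^2"
    by (intro tendsto_intros)
   then show ?case by simp
  qed
  show "AE x in leb X. norm ((norm (f n x - g x))^2) <= 4 * (norm (h x))^2" for n
   using le' gle
  proof eventually_elim
   case (elim x)
   then have "norm (f n x - g x) <= 2 * norm (h x)"
    using norm_triangle_ineq4[of "f n x" "g x"] by (smt (verit))
   then have "(norm (f n x - g x))^2 <= (2 * norm (h x))^2"
    by (intro power_mono) auto
   then show ?case by (simp add: power_mult_distrib)
  qed
 qed (use f g in measurable)
 then have "(%n. sqrt (LINT x|leb X. (norm (f n x - g x))^2)) ----> sqrt 0"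
  by (intro tendsto_real_sqrt) simp
 then show "(%n. L2norm X (%x. f n x - g x)) ----> 0"
  by (simp add: L2norm_def)
qed

lemma L2_nn_integral:
 "f \<in> L2 X ==> (\<integral>\<^sup>+x. ennreal ((norm (f x))^2) \<partial>leb X) = ennreal ((L2norm X f)^2)"
 unfolding L2norm_sq by (rule nn_integral_eq_integral) (auto intro: L2D)

lemma L2I_nn_integral:
 fixes f :: "'a::euclidean_space => 'b::euclidean_space"
 assumes "f \<in> meas X" "B >= 0"
  "(\<integral>\<^sup>+x. ennreal ((norm (f x))^2) \<partial>leb X) <= ennreal (B^2)"
 shows "f \<in> L2 X" "L2norm X f <= B"
proof -
 have "integrable (leb X) (%x. (norm (f x))^2)"
 proof (rule integrableI_bounded)
  show "(%x. (norm (f x))^2) \<in> meas X"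
   using assms(1) by measurable
  show "(\<integral>\<^sup>+x. ennreal (norm ((norm (f x))^2)) \<partial>leb X) < \<infinity>"
   using le_less_trans[OF assms(3) ennreal_less_top] by simp
 qed
 with assms(1) show f: "f \<in> L2 X" by (simp add: L2_def)
 have "(L2norm X f)^2 <= B^2"
  using assms(3) unfolding L2_nn_integral[OF f] by (simp add: ennreal_le_iff)
 then show "L2norm X f <= B" using assms(2) by (rule power2_le_imp_le)
qed

text \<open>Fatou's lemma for the squares. It also yields that the limit belongs to
  \<open>L2\<close>, and is the way out of the approximation and truncation arguments, where
  convergence is known only almost everywhere.\<close>

lemma L2_Fatou:
 fixes f :: "nat => 'a::euclidean_space => 'b::euclidean_space"
 assumes f: "!!n. f n \<in> L2 X" and g: "g \<in> meas X"
  and le: "eventually (%n. L2norm X (f n) <= B) sequentially"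
  and lim: "AE x in leb X. (%n. f n x) ----> g x"
 shows "g \<in> L2 X" "L2norm X g <= B"
proof -
 obtain n0 where "L2norm X (f n0) <= B"
  using le unfolding eventually_sequentially by blast
 then have B: "B >= 0"
  by (rule order.trans[OF L2norm_nonneg])
 have "(\<integral>\<^sup>+x. ennreal ((norm (g x))^2) \<partial>leb X)
   = (\<integral>\<^sup>+x. liminf (%n. ennreal ((norm (f n x))^2)) \<partial>leb X)"
 proof (rule nn_integral_cong_AE)
  show "AE x in leb X. ennreal ((norm (g x))^2) = liminf (%n. ennreal ((norm (f n x))^2))"
   using lim
  proof eventually_elim
   case (elim x)
   then have "(%n. ennreal ((norm (f n x))^2)) ----> ennreal ((norm (g x))^2)"
    by (intro tendsto_ennrealI tendsto_intros)
   then show ?case by (intro lim_imp_Liminf[symmetric]) auto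
  qed
 qed
 also have "... <= liminf (%n. \<integral>\<^sup>+x. ennreal ((norm (f n x))^2) \<partial>leb X)"
  by (rule nn_integral_liminf) (use f in \<open>auto simp: L2_def\<close>)
 also have "... = liminf (%n. ennreal ((L2norm X (f n))^2))"
  by (simp add: L2_nn_integral[OF f])
 also have "... <= ennreal (B^2)"
 proof (rule Liminf_le)
  show "\<forall>\<^sub>F n in sequentially. ennreal ((L2norm X (f n))^2) <= ennreal (B^2)"
   using le by eventually_elim (auto intro!: ennreal_leI power_mono)
 qed auto
 finally have *: "(\<integral>\<^sup>+x. ennreal ((norm (g x))^2) \<partial>leb X) <= ennreal (B^2)" .
 show "g \<in> L2 X" "L2norm X g <= B"
  using L2I_nn_integral[OF g B *] by auto
qed

text \<open>Riesz-Fischer. Along a subsequence consecutive differences are below 2^-k in L2, hence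
  summable in L1 because the measure of \<open>X\<close> is finite, so the subsequence converges
  almost everywhere. Fatou's lemma for \<open>f n - h l\<close> as l grows gives both membership and
  the rate.\<close>

lemma L2_complete:
 fixes f :: "nat => 'a::euclidean_space => 'b::euclidean_space"
 assumes X: "X \<in> lmeasurable" and f: "!!n. f n \<in> L2 X"
  and C: "!!e. e > 0 ==> \<exists>N. \<forall>m\<ge>N. \<forall>n\<ge>N. L2norm X (%x. f m x - f n x) < e"
 obtains g where "g \<in> L2 X" "(%n. L2norm X (%x. f n x - g x)) ----> 0"
proof -
 have "\<forall>k. \<exists>N. \<forall>m\<ge>N. \<forall>n\<ge>N. L2norm X (%x. f m x - f n x) < (1/2) ^ k"
  using C by simp
 from choice[OF this] obtain N
  where N: "!!k m n. m >= N k ==> n >= N k ==> L2norm X (%x. f m x - f n x) < (1/2) ^ k"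
  by blast
 \<comment> \<open>Summing the thresholds makes \<open>r k\<close> at least \<open>N j\<close> for
   every \<open>j \<le> k\<close>, so no monotonicity of the thresholds has to be arranged.\<close>
 define r where "r k = (\<Sum>j\<le>k. N j)" for k
 have r: "r k >= N k" "r (Suc k) >= N k" for k
  unfolding r_def by (auto simp: sum.atMost_Suc intro: member_le_sum trans_le_add1)
 have r_mono: "l >= k ==> r l >= N k" for k l
  unfolding r_def by (rule member_le_sum) auto
 define h where "h k = f (r k)" for k
 have h: "h k \<in> L2 X" for k unfolding h_def by (rule f)
 have hm [measurable]: "h k \<in> meas X" for k
  using h by (rule L2D)
 define c where "c = L2norm X (%_. 1::real)"
 have I: "(\<integral>\<^sup>+x. ennreal (norm (h (Suc k) x - h k x)) \<partial>leb X) <= ennreal ((1/2) ^ k * c)" for k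
 proof -
  have "(\<integral>\<^sup>+x. ennreal (norm (h (Suc k) x - h k x)) \<partial>leb X)
   = ennreal (LINT x|leb X. norm (h (Suc k) x - h k x))"
   by (intro nn_integral_eq_integral integrable_norm L2_integrable X L2_diff h) auto
  also have "... <= ennreal ((1/2) ^ k * c)"
  proof (rule ennreal_leI)
   have "L2norm X (%x. h (Suc k) x - h k x) <= (1/2) ^ k"
    using N[OF r(2) r(1)] by (simp add: h_def less_imp_le)
   then have "L2norm X (%x. h (Suc k) x - h k x) * c <= (1/2) ^ k * c"
    by (intro mult_right_mono) (auto simp: c_def)
   then show "(LINT x|leb X. norm (h (Suc k) x - h k x)) <= (1/2) ^ k * c"
    using L1_le_L2norm[OF X L2_diff[OF h h], of "Suc k" k] by (simp add: c_def)
  qed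
  finally show ?thesis .
 qed
 have "(\<integral>\<^sup>+x. (\<Sum>k. ennreal (norm (h (Suc k) x - h k x))) \<partial>leb X)
   = (\<Sum>k. \<integral>\<^sup>+x. ennreal (norm (h (Suc k) x - h k x)) \<partial>leb X)"
  by (rule nn_integral_suminf) measurable
 also have "... <= (\<Sum>k. ennreal ((1/2) ^ k * c))"
  by (intro suminf_le I) auto
 also have "... = ennreal (\<Sum>k. (1/2) ^ k * c)"
  by (rule suminf_ennreal2) (auto simp: c_def intro!: summable_mult2 summable_geometric)
 also have "... < \<infinity>" by simp
 finally have fin: "(\<integral>\<^sup>+x. (\<Sum>k. ennreal (norm (h (Suc k) x - h k x))) \<partial>leb X) < \<infinity>" .
 have "AE x in leb X. (\<Sum>k. ennreal (norm (h (Suc k) x - h k x))) ~= \<infinity>"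
  by (rule nn_integral_PInf_AE) (measurable, use fin in auto)
 then have conv: "AE x in leb X. (%k. h k x) ----> lim (%k. h k x)"
 proof eventually_elim
  case (elim x)
  then have "summable (%k. norm (h (Suc k) x - h k x))"
   by (intro summable_suminf_not_top) auto
  then have "summable (%k. h (Suc k) x - h k x)"
   by (rule summable_norm_cancel)
  then have "convergent (%n. \<Sum>k<n. h (Suc k) x - h k x)"
   by (simp add: summable_iff_convergent)
  then have "convergent (%n. (\<Sum>k<n. h (Suc k) x - h k x) + h 0 x)"
   by (intro convergent_add convergent_const)
  then have "convergent (%n. h n x)"
   by (simp add: sum_lessThan_telescope[of "%k. h k x"])
  then show ?case by (simp add: convergent_LIMSEQ_iff)
 qed
 define g where "g x = lim (%k. h k x)" for x
 have gm [measurable]: "g \<in> meas X"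
  unfolding g_def[abs_def] by (rule borel_measurable_lim_metric) measurable
 have est: "(%x. f n x - g x) \<in> L2 X & L2norm X (%x. f n x - g x) <= (1/2) ^ k" if "n >= N k" for n k
 proof -
  have "(%x. f n x - g x) \<in> meas X"
   by (intro borel_measurable_diff L2D(1)[OF f] gm)
  moreover have "eventually (%l. L2norm X (%x. f n x - h l x) <= (1/2) ^ k) sequentially"
   using eventually_ge_at_top[of k]
   by eventually_elim (use N[OF that] r_mono in \<open>auto simp: h_def intro: less_imp_le\<close>)
  moreover have "AE x in leb X. (%l. f n x - h l x) ----> f n x - g x"
   using conv by eventually_elim (auto simp: g_def intro!: tendsto_intros)
  ultimately show ?thesis
   using L2_Fatou[where f="%l x. f n x - h l x" and X=X and g="%x. f n x - g x" and B="(1/2) ^ k",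
     OF L2_diff[OF f h]] by blast
 qed
 have "(%x. f (N 0) x - (f (N 0) x - g x)) \<in> L2 X"
  using L2_diff[OF f[of "N 0"] conjunct1[OF est[of 0 "N 0"]]] by simp
 then have "g \<in> L2 X" by simp
 moreover have "(%n. L2norm X (%x. f n x - g x)) ----> 0"
 proof (rule LIMSEQ_I)
  fix e :: real assume "e > 0"
  then obtain k where "(1/2) ^ k < e"
   using real_arch_pow_inv[of e "1/2"] by auto
  then show "\<exists>no. \<forall>n\<ge>no. norm (L2norm X (%x. f n x - g x) - 0) < e"
   using est[of k] by (intro exI[of _ "N k"]) fastforce
 qed
 ultimately show ?thesis by (rule that)
qed

text \<open>A minimizing sequence for the distance to \<open>V\<close> is Cauchy by the
  parallelogram identity, and orthogonality is the first variation at the minimizer. The subspace is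
  a set of functions, so closedness under addition, scaling and L2 limits enters as separate
  assumptions.\<close>

lemma L2_projection_exists:
 fixes V :: "('a::euclidean_space => 'b::euclidean_space) set"
 assumes X: "X \<in> lmeasurable" and V: "V \<subseteq> L2 X" and ne: "V ~= {}"
  and add: "!!f g. f \<in> V ==> g \<in> V ==> (%x. f x + g x) \<in> V"
  and scale: "!!f c. f \<in> V ==> (%x. c *\<^sub>R f x) \<in> V"
  and closed: "!!f g. (!!n. f n \<in> V) ==> g \<in> L2 X ==> (%n. L2norm X (%x. f n x - g x)) ----> 0 ==> g \<in> V"
  and v: "v \<in> L2 X"
 shows "\<exists>w\<in>V. \<forall>z\<in>V. L2inner X (%x. v x - w x) z = 0"
proof -
 define q where "q w = (L2norm X (%x. v x - w x))^2" for w
 define d where "d = (INF w\<in>V. q w)"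
 have bdd: "bdd_below (q ` V)" by (rule bdd_belowI[of _ 0]) (auto simp: q_def)
 have d: "d <= q w" if "w \<in> V" for w
  unfolding d_def using that bdd by (rule cINF_lower[rotated])
 have "\<forall>n. \<exists>w\<in>V. q w < d + 1 / real (Suc n)"
 proof
  fix n
  have "d < d + 1 / real (Suc n)" by simp
  then show "\<exists>w\<in>V. q w < d + 1 / real (Suc n)"
   using cINF_less_iff[OF ne bdd, of "d + 1 / real (Suc n)"] unfolding d_def by blast
 qed
 then obtain w where w: "!!n. w n \<in> V" "!!n. q (w n) < d + 1 / real (Suc n)"
  by metis
 have wL: "w n \<in> L2 X" for n using w V by blast
 have par: "(L2norm X (%x. w n x - w m x))^2 <= 2 / real (Suc n) + 2 / real (Suc m)" for m n
 proof -
  define a b where "a x = v x - w m x" and "b x = v x - w n x" for x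
  have ab: "a \<in> L2 X" "b \<in> L2 X" unfolding a_def[abs_def] b_def[abs_def] using v wL by (auto intro: L2_diff)
  have "(%x. (1/2) *\<^sub>R (w n x + w m x)) \<in> V" by (intro add scale w)
  from d[OF this] have "4 * d <= 4 * (L2norm X (%x. v x - (1/2) *\<^sub>R (w n x + w m x)))^2"
   by (simp add: q_def)
  also have "... = (L2norm X (%x. 2 *\<^sub>R (v x - (1/2) *\<^sub>R (w n x + w m x))))^2"
   by (simp add: L2norm_scaleR power_mult_distrib)
  also have "(%x. 2 *\<^sub>R (v x - (1/2) *\<^sub>R (w n x + w m x))) = (%x. a x + b x)"
   by (auto simp: a_def b_def fun_eq_iff algebra_simps scaleR_2)
  finally have "4 * d <= (L2norm X (%x. a x + b x))^2" .
  moreover have "(%x. w n x - w m x) = (%x. a x - b x)" by (auto simp: a_def b_def)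
  moreover have "(L2norm X a)^2 < d + 1 / real (Suc m)" "(L2norm X b)^2 < d + 1 / real (Suc n)"
   using w(2) unfolding q_def a_def[abs_def] b_def[abs_def] by auto
  ultimately show ?thesis
   using L2norm_add_sq[OF ab] L2norm_diff_sq[OF ab] by (simp add: add_divide_distrib)
 qed
 have "\<exists>N. \<forall>m\<ge>N. \<forall>n\<ge>N. L2norm X (%x. w m x - w n x) < e" if e: "e > 0" for e
 proof -
  obtain N where N: "4 / real (Suc N) < e^2"
  proof -
   obtain N where "inverse (real (Suc N)) < e^2 / 4"
    using reals_Archimedean[of "e^2 / 4"] e by auto
   then show ?thesis by (intro that[of N]) (simp add: field_simps)
  qed
  have "L2norm X (%x. w m x - w n x) < e" if "m >= N" "n >= N" for m n
  proof (rule power2_less_imp_less)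
   have "2 / real (Suc m) <= 2 / real (Suc N)" "2 / real (Suc n) <= 2 / real (Suc N)"
    using that by (auto intro!: divide_left_mono)
   then show "(L2norm X (%x. w m x - w n x))^2 < e^2"
    using par[of m n] N by simp
  qed (use e in auto)
  then show ?thesis by blast
 qed
 then obtain g where g: "g \<in> L2 X" "(%n. L2norm X (%x. w n x - g x)) ----> 0"
  using L2_complete[of X w] X wL by blast
 have gV: "g \<in> V" using closed[OF w(1) g] .
 have "(%n. L2norm X (%x. (v x - w n x) - (v x - g x))) ----> 0"
  using g(2) by (simp add: L2norm_diff_commute)
 from L2_tendsto_norm[OF _ _ this] have "(%n. L2norm X (%x. v x - w n x)) ----> L2norm X (%x. v x - g x)"
  using v wL g(1) by (simp add: L2_diff)
 then have "(%n. q (w n)) ----> q g"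
  unfolding q_def by (rule tendsto_power)
 moreover have "(%n. d + 1 / real (Suc n)) ----> d + 0"
  by (intro tendsto_intros LIMSEQ_Suc lim_1_over_n)
 ultimately have qg: "q g <= d"
  using w(2) by (intro LIMSEQ_le[of "%n. q (w n)" _ "%n. d + 1 / real (Suc n)"]) (auto intro: less_imp_le)
 have "L2inner X (%x. v x - g x) z = 0" if z: "z \<in> V" for z
 proof -
  define a where "a x = v x - g x" for x
  have a: "a \<in> L2 X" "z \<in> L2 X" unfolding a_def[abs_def] using v g z V by (auto intro: L2_diff)
  have le: "0 <= - 2 * t * L2inner X a z + t^2 * (L2norm X z)^2" for t
  proof -
   have "(%x. g x + t *\<^sub>R z x) \<in> V" by (intro add scale gV z)
   then have "q g <= q (%x. g x + t *\<^sub>R z x)" using d qg by fastforce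
   also have "... = (L2norm X (%x. a x - t *\<^sub>R z x))^2"
    by (simp add: q_def a_def diff_diff_eq)
   also have "... = q g - 2 * t * L2inner X a z + t^2 * (L2norm X z)^2"
    using L2norm_diff_sq[OF a(1) L2_scaleR[OF a(2)], of t]
    by (simp add: q_def a_def[symmetric] L2inner_scaleR_right L2norm_scaleR power_mult_distrib)
   finally show ?thesis by simp
  qed
  define b c where "b = L2inner X a z" and "c = (L2norm X z)^2"
  have c0: "c >= 0" by (simp add: c_def)
  \<comment> \<open>The optimal variation parameter would be b / c; replacing c by c + 1 covers a
    \<open>z\<close> of norm zero and still leaves a strictly negative value unless b = 0.\<close>
  define s where "s = 1 / (c + 1)"
  have s: "s > 0" "s * c <= 1" using c0 by (auto simp: s_def field_simps)
  have "(b * s)^2 * c = b^2 * s * (s * c)" by (simp add: power2_eq_square)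
  also have "... <= b^2 * s * 1" using s by (intro mult_left_mono) auto
  finally have "0 <= - (b^2 * s)"
   using le[of "b * s"] by (simp add: b_def c_def power2_eq_square algebra_simps)
  with s have "b = 0"
   by (metis mult_eq_0_iff neg_0_le_iff_le order_antisym power2_eq_square zero_eq_power2 zero_le_power2
     mult_nonneg_nonneg less_imp_le less_irrefl)
  then show ?thesis by (simp add: b_def a_def[abs_def])
 qed
 with gV show ?thesis by blast
qed

section \<open>Mollification\<close>

lemma continuous_measurable_lebesgue_on:
 fixes g :: "'a::euclidean_space => 'b::euclidean_space"
 assumes "continuous_on UNIV g"
 shows "g \<in> meas X"
proof -
 have "g \<in> borel_measurable lebesgue"
  using borel_measurable_continuous_onI[OF assms] by (auto intro: measurable_completion)
 then show ?thesis by (rule measurable_restrict_space1)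
qed

lemma kcd_measurable: "kcd k (g :: 'a::euclidean_space => real) ==> g \<in> meas X"
 by (intro continuous_measurable_lebesgue_on kcd_continuous)

lemma integrable_bounded_mult:
 fixes f g :: "'a => real"
 assumes "integrable M f" "g \<in> borel_measurable M" "!!x. x \<in> space M ==> \<bar>g x\<bar> <= B"
 shows "integrable M (%x. f x * g x)"
proof (rule lintegrable_bound)
 show "integrable M (%x. B * f x)" using assms(1) by simp
 show "(%x. f x * g x) \<in> borel_measurable M" using assms by simp
 have "\<bar>f x\<bar> * \<bar>g x\<bar> <= \<bar>f x\<bar> * \<bar>B\<bar>" if "x \<in> space M" for x
  using assms(3)[OF that] by (intro mult_left_mono) auto
 then show "AE x in M. norm (f x * g x) <= norm (B * f x)"
  by (intro AE_I2) (simp add: abs_mult mult.commute)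
qed

lemma mean_value_partial:
 fixes g :: "real^'n => real"
 assumes "kcd 1 g"
 obtains t where "0 < t" "t < 1" "g (x + v) - g x = (SUM i. v $ i * partial i g (x + t *\<^sub>R v))"
proof -
 obtain t where "0 < t" "t < 1"
  "g (x + 1 *\<^sub>R v) - g (x + 0 *\<^sub>R v) = (1 - 0) * (SUM i. v $ i * partial i g (x + t *\<^sub>R v))"
  using MVT2[of 0 1 "%t. g (x + t *\<^sub>R v)", OF zero_less_one has_derivative_along_line[OF assms]] by blast
 then show ?thesis by (intro that[of t]) auto
qed

lemma sum_abs_component_le:
 fixes v :: "real^'n"
 assumes "!!i. \<bar>c i\<bar> <= B i"
 shows "\<bar>SUM i. v $ i * c i\<bar> <= (SUM i. B i) * norm v"
proof -
 have "\<bar>SUM i. v $ i * c i\<bar> <= (SUM i. \<bar>v $ i * c i\<bar>)" by (rule sum_abs)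
 also have "... <= (SUM i. B i * norm v)"
  using assms component_le_norm_cart[of v]
  by (intro sum_mono) (auto simp: abs_mult mult.commute intro!: mult_mono order.trans[OF abs_ge_zero assms])
 finally show ?thesis by (simp add: sum_distrib_right)
qed

lemma Cc_lipschitz:
 fixes g :: "real^'n => real"
 assumes "Cc 1 UNIV g"
 obtains L where "L > 0" "!!a b. \<bar>g a - g b\<bar> <= L * norm (a - b)"
proof -
 have "\<forall>i. \<exists>B>0. \<forall>x. \<bar>partial i g x\<bar> <= B"
  using Cc_bounded[OF Cc_partial[of 0 UNIV g]] assms by (metis One_nat_def)
 then obtain B where B: "!!i. B i > 0" "!!i x. \<bar>partial i g x\<bar> <= B i" by metis
 show ?thesis
 proof (rule that[of "SUM i. B i"])
  show "(SUM i. B i) > 0" using B by (intro sum_pos) auto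
  fix a b
  obtain t where "g (b + (a - b)) - g b = (SUM i. (a - b) $ i * partial i g (b + t *\<^sub>R (a - b)))"
   using mean_value_partial[OF Cc_kcd[OF assms]] by metis
  then show "\<bar>g a - g b\<bar> <= (SUM i. B i) * norm (a - b)"
   using sum_abs_component_le[of "%i. partial i g (b + t *\<^sub>R (a - b))" B "a - b"] B by simp
 qed
qed

text \<open>A quadratic remainder that is uniform in \<open>z\<close> can be integrated against any
  integrable function; this is what differentiates mollifications under the integral sign.\<close>

lemma Cc_taylor:
 fixes g :: "real^'n => real"
 assumes "Cc 2 UNIV g"
 obtains C where "C > 0" "!!z h. \<bar>g (z + h) - g z - (SUM i. h $ i * partial i g z)\<bar> <= C * (norm h)^2"
proof -
 have "\<forall>i. \<exists>L>0. \<forall>a b. \<bar>partial i g a - partial i g b\<bar> <= L * norm (a - b)"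
  using Cc_lipschitz[OF Cc_partial[of 1 UNIV g]] assms by (metis Suc_1)
 then obtain L where L: "!!i. L i > 0" "!!i a b. \<bar>partial i g a - partial i g b\<bar> <= L i * norm (a - b)"
  by metis
 show ?thesis
 proof (rule that[of "SUM i. L i"])
  show "(SUM i. L i) > 0" using L by (intro sum_pos) auto
  fix z h
  have "kcd 1 g" using Cc_kcd[OF assms] by (rule kcd_mono) simp
  then obtain t where t: "0 < t" "t < 1" "g (z + h) - g z = (SUM i. h $ i * partial i g (z + t *\<^sub>R h))"
   using mean_value_partial by metis
  have "\<bar>partial i g (z + t *\<^sub>R h) - partial i g z\<bar> <= L i * norm h" for i
  proof -
   have "norm (t *\<^sub>R h) <= norm h" using t by (simp add: mult_left_le_one_le)
   then have "L i * norm (t *\<^sub>R h) <= L i * norm h" using L(1)[of i] by (intro mult_left_mono) auto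
   with L(2)[of i "z + t *\<^sub>R h" z] show ?thesis by simp
  qed
  then have "\<bar>SUM i. h $ i * (partial i g (z + t *\<^sub>R h) - partial i g z)\<bar>
    <= (SUM i. L i * norm h) * norm h"
   by (rule sum_abs_component_le)
  then show "\<bar>g (z + h) - g z - (SUM i. h $ i * partial i g z)\<bar> <= (SUM i. L i) * (norm h)^2"
   unfolding t(3) by (simp add: sum_subtractf right_diff_distrib sum_distrib_right power2_eq_square mult.assoc)
 qed
qed

text \<open>The convolution of \<eta> with the extension of \<open>f\<close> by zero; integrating
  over \<open>X\<close> only ignores the irrelevant values of \<open>f\<close> outside.\<close>

definition mol :: "(real^'n) set => (real^'n => real) => (real^'n => real) => real^'n => real" where
 "mol X \<eta> f x = (LINT y|leb X. f y * \<eta> (x - y))"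

lemma mol_integrable:
 assumes "integrable (leb X) f" "Cc k UNIV \<eta>"
 shows "integrable (leb X) (%y. f y * \<eta> (x - y))"
proof -
 obtain B where "!!x. \<bar>\<eta> x\<bar> <= B" using Cc_bounded[OF assms(2)] by metis
 then show ?thesis
  by (intro integrable_bounded_mult[OF assms(1) kcd_measurable[OF kcd_shift_reflect[OF Cc_kcd[OF assms(2)]]]])
qed

lemma mol_has_derivative:
 assumes f: "integrable (leb X) f" and \<eta>: "Cc 2 UNIV \<eta>"
 shows "(mol X \<eta> f has_derivative (%h. SUM i. h $ i * mol X (partial i \<eta>) f x)) (at x)"
proof -
 obtain C where C: "C > 0" "!!z h. \<bar>\<eta> (z + h) - \<eta> z - (SUM i. h $ i * partial i \<eta> z)\<bar> <= C * (norm h)^2"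
  using Cc_taylor[OF \<eta>] by metis
 have \<eta>': "Cc 1 UNIV (partial i \<eta>)" for i
  using Cc_partial[of 1 UNIV \<eta>] \<eta> by (simp add: numeral_2_eq_2)
 define D where "D = (LINT y|leb X. \<bar>f y\<bar>)"
 have D: "D >= 0" by (simp add: D_def)
 have fa: "integrable (leb X) (%y. \<bar>f y\<bar>)" using f by (rule integrable_abs)
 have key: "norm (mol X \<eta> f y - mol X \<eta> f x - (SUM i. (y - x) $ i * mol X (partial i \<eta>) f x))
   <= C * (norm (y - x))^2 * D" for y
 proof -
  have "mol X \<eta> f y - mol X \<eta> f x - (SUM i. (y - x) $ i * mol X (partial i \<eta>) f x)
   = (LINT z|leb X. f z * \<eta> (y - z) - f z * \<eta> (x - z) - (SUM i. (y - x) $ i * (f z * partial i \<eta> (x - z))))"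
   unfolding mol_def using mol_integrable[OF f \<eta>] mol_integrable[OF f \<eta>']
   by (simp add: lint_sum)
  also have "norm ... <= (LINT z|leb X. \<bar>f z\<bar> * (C * (norm (y - x))^2))"
  proof (rule lint_norm_bound_integral)
   show "integrable (leb X) (%z. f z * \<eta> (y - z) - f z * \<eta> (x - z) - (SUM i. (y - x) $ i * (f z * partial i \<eta> (x - z))))"
    using mol_integrable[OF f \<eta>] mol_integrable[OF f \<eta>']
    by (intro lintegrable_diff lintegrable_sum integrable_mult_right)
   show "integrable (leb X) (%z. \<bar>f z\<bar> * (C * (norm (y - x))^2))"
    using fa by (rule integrable_mult_left)
   fix z
   have "f z * \<eta> (y - z) - f z * \<eta> (x - z) - (SUM i. (y - x) $ i * (f z * partial i \<eta> (x - z)))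
    = f z * (\<eta> ((x - z) + (y - x)) - \<eta> (x - z) - (SUM i. (y - x) $ i * partial i \<eta> (x - z)))"
    by (simp add: right_diff_distrib sum_distrib_left mult_ac)
   then show "norm (f z * \<eta> (y - z) - f z * \<eta> (x - z) - (SUM i. (y - x) $ i * (f z * partial i \<eta> (x - z))))
     <= \<bar>f z\<bar> * (C * (norm (y - x))^2)"
    using C(2)[of "x - z" "y - x"] by (simp only: real_norm_def abs_mult) (intro mult_left_mono, auto)
  qed
  also have "... = C * (norm (y - x))^2 * D"
   unfolding D_def by (simp add: mult_ac)
  finally show ?thesis .
 qed
 show ?thesis
 proof (rule has_derivativeI_sandwich[of 1])
  show "bounded_linear (%h. SUM i. h $ i * mol X (partial i \<eta>) f x)"
   by (intro bounded_linear_sum bounded_linear_mult_const bounded_linear_vec_nth)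
  show "norm (mol X \<eta> f y - mol X \<eta> f x - (SUM i. (y - x) $ i * mol X (partial i \<eta>) f x)) / norm (y - x)
    <= C * D * norm (y - x)" if "y ~= x" for y
   using key[of y] that by (simp add: divide_le_eq power2_eq_square mult_ac)
  have "((%y. C * D * norm (y - x)) \<longlongrightarrow> C * D * norm (x - x)) (at x)"
   by (intro tendsto_intros)
  then show "((%y. C * D * norm (y - x)) \<longlongrightarrow> 0) (at x)" by simp
 qed auto
qed

lemma partial_mol:
 assumes "integrable (leb X) f" "Cc 2 UNIV \<eta>"
 shows "partial i (mol X \<eta> f) x = mol X (partial i \<eta>) f x"
 using partial_eqI[OF mol_has_derivative[OF assms]] by (simp add: sum_axis_mult)

lemma kcd_mol:
 assumes "integrable (leb X) f"
 shows "test_function UNIV \<eta> ==> kcd k (mol X \<eta> f)"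
proof (induction k arbitrary: \<eta>)
 case 0
 have "mol X \<eta> f differentiable (at x)" for x
  using mol_has_derivative[OF assms test_function_Cc[OF 0]] by (auto simp: differentiable_def)
 then show ?case
  by (auto intro!: continuous_at_imp_continuous_on differentiable_imp_continuous_within)
next
 case (Suc k)
 have "mol X \<eta> f differentiable (at x)" for x
  using mol_has_derivative[OF assms test_function_Cc[OF Suc.prems]] by (auto simp: differentiable_def)
 moreover have "partial i (mol X \<eta> f) = mol X (partial i \<eta>) f" for i
  using partial_mol[OF assms test_function_Cc[OF Suc.prems]] by auto
 ultimately show ?case
  using Suc.IH[OF test_function_partial[OF Suc.prems]] by (simp add: kcd_Suc_iff_partial)
qed

lemma mol_support:
 assumes "!!y. y \<in> X ==> y \<notin> K ==> f y = 0" "!!z. z \<notin> L ==> \<eta> z = 0"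
  "x \<notin> {y + z |y z. y \<in> K & z \<in> L}"
 shows "mol X \<eta> f x = 0"
proof -
 have "f y * \<eta> (x - y) = 0" if "y \<in> X" for y
 proof (cases "y \<in> K")
  case True
  then have "x - y \<notin> L" using assms(3) by (auto simp: algebra_simps)
  then show ?thesis using assms(2) by simp
 qed (use assms(1) that in auto)
 then have "mol X \<eta> f x = (LINT y|leb X. 0)"
  unfolding mol_def by (intro lint_cong) auto
 then show ?thesis by simp
qed

lemma test_function_mol:
 assumes "integrable (leb X) f" "test_function UNIV \<eta>" "compact K" "compact L"
  "!!y. y \<in> X ==> y \<notin> K ==> f y = 0" "!!z. z \<notin> L ==> \<eta> z = 0"
  "{y + z |y z. y \<in> K & z \<in> L} \<subseteq> U"
 shows "test_function U (mol X \<eta> f)"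
 unfolding test_function_iff
 by (intro allI CcI[OF kcd_mol[OF assms(1,2)] compact_sums[OF assms(3,4)] assms(7)] mol_support)
  (use assms in auto)

subsection \<open>Continuity of translations in \<open>L^2\<close>\<close>

text \<open>Clipping \<open>f\<close> at height m and cutting it off at radius m changes it little
  in L2. Continuous functions converging to \<open>f\<close> almost everywhere are clipped and cut
  off in the same way; they then share a square integrable majorant, and dominated convergence
  applies.\<close>

lemma L2_approx_continuous:
 fixes f :: "'a::euclidean_space => real"
 assumes f: "f \<in> L2 UNIV" and e: "e > 0"
 obtains a R where "continuous_on UNIV a" "!!x. norm x > R ==> a x = 0" "a \<in> L2 UNIV" "L2norm UNIV (%x. f x - a x) < e"
proof -
 define cl where "cl m y = max (- real m) (min (real m) y)" for m :: nat and y :: real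
 have cl_cont: "continuous_on UNIV (cl m)" for m
  unfolding cl_def by (intro continuous_intros)
 have cl_le: "\<bar>cl m y\<bar> <= \<bar>y\<bar>" "\<bar>cl m y\<bar> <= real m" for m y
  by (auto simp: cl_def)
 define ct where "ct m x = max 0 (min 1 (real m + 1 - norm x))" for m :: nat and x :: 'a
 have ct_cont: "continuous_on UNIV (ct m)" for m
  unfolding ct_def by (intro continuous_intros)
 have ct: "0 <= ct m x" "ct m x <= 1" "norm x > real m + 1 ==> ct m x = 0" for m x
  by (auto simp: ct_def)
 have fm: "f \<in> borel_measurable (leb UNIV)" using f by (rule L2D)
 have meas: "(%x. cl m (g x) * ct m x) \<in> borel_measurable (leb UNIV)"
  if "g \<in> borel_measurable (leb UNIV)" for g :: "'a => real" and m
 proof -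
  have "(%x. cl m (g x)) \<in> borel_measurable (leb UNIV)"
   by (rule measurable_compose[OF that borel_measurable_continuous_onI[OF cl_cont]])
  then show ?thesis
   by (intro borel_measurable_times continuous_measurable_lebesgue_on[OF ct_cont])
 qed
 have lim1: "(%m. L2norm UNIV (%x. cl m (f x) * ct m x - f x)) ----> 0"
 proof (rule L2_dominated_convergence(3)[OF meas[OF fm] fm f])
  have "\<bar>cl n (f x)\<bar> * \<bar>ct n x\<bar> <= \<bar>f x\<bar> * 1" for n x
   using cl_le ct by (intro mult_mono) auto
  then show "AE x in leb UNIV. norm (cl n (f x) * ct n x) <= norm (f x)" for n
   by (simp add: abs_mult)
  have "(%n. cl n (f x) * ct n x) ----> f x" for x
  proof (rule tendsto_eventually)
   obtain N :: nat where N: "real N >= \<bar>f x\<bar> + norm x" using real_arch_simple by blast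
   show "\<forall>\<^sub>F n in sequentially. cl n (f x) * ct n x = f x"
    using eventually_ge_at_top[of N]
   proof eventually_elim
    case (elim n)
    then have "real n >= \<bar>f x\<bar> + norm x" using N by linarith
    then have "real n >= \<bar>f x\<bar>" "real n >= norm x" by (smt (verit) norm_ge_zero)+
    then show ?case by (auto simp: cl_def ct_def)
   qed
  qed
  then show "AE x in leb UNIV. (%n. cl n (f x) * ct n x) ----> f x" by simp
 qed
 then obtain m where m: "L2norm UNIV (%x. cl m (f x) * ct m x - f x) < e / 2"
  using order_tendstoD(2)[OF lim1, of "e / 2"] e unfolding eventually_sequentially by auto
 have "f measurable_on UNIV"
  using measurable_on_iff_borel_measurable[of UNIV f] fm by simp
 then obtain N g where N: "negligible N" and g: "!!n. continuous_on UNIV (g n)"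
  "!!x. x \<notin> N ==> (%n. g n x) ----> f x"
  unfolding measurable_on_def by auto
 have gm: "g n \<in> borel_measurable (leb UNIV)" for n
  using g(1) by (rule continuous_measurable_lebesgue_on)
 define a where "a n x = cl m (g n x) * ct m x" for n x
 have am: "a n \<in> borel_measurable (leb UNIV)" for n
  unfolding a_def[abs_def] using gm by (rule meas)
 have dom: "(%x. real m * indicator (cball 0 (real m + 1)) x) \<in> L2 (UNIV :: 'a set)"
 proof -
  have "integrable lebesgue (%x::'a. (real m)^2 * indicator (cball 0 (real m + 1)) x)"
   by (intro integrable_mult_right integrable_real_indicator) (simp_all add: emeasure_bounded_finite[OF bounded_cball, unfolded infinity_ennreal_def])
  moreover have "(%x. real m * indicator (cball 0 (real m + 1)) x) \<in> borel_measurable (lebesgue :: 'a measure)"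
   by (intro borel_measurable_times borel_measurable_const borel_measurable_indicator) auto
  moreover have "(norm (real m * indicator (cball 0 (real m + 1)) x))^2 = (real m)^2 * indicator (cball 0 (real m + 1)) x" for x :: 'a
   by (auto simp: indicator_def)
  ultimately show ?thesis by (simp add: L2_def lebesgue_on_UNIV_eq)
 qed
 have bd: "norm (a n x) <= norm (real m * indicator (cball 0 (real m + 1)) x)" for n x
 proof (cases "norm x > real m + 1")
  case True
  then show ?thesis by (simp add: a_def ct)
 next
  case False
  have "\<bar>cl m (g n x)\<bar> * \<bar>ct m x\<bar> <= real m * 1"
   using cl_le ct by (intro mult_mono) auto
  then show ?thesis using False by (simp add: a_def abs_mult)
 qed
 note dc = L2_dominated_convergence[OF am meas[OF fm, of m] dom AE_I2[OF bd]]
 have AE: "AE x in leb UNIV. (%n. a n x) ----> cl m (f x) * ct m x"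
 proof -
  have "AE x in lebesgue. x \<notin> N"
   using N by (simp add: negligible_iff_null_sets AE_not_in)
  then have "AE x in leb UNIV. x \<notin> N" by (simp only: lebesgue_on_UNIV_eq)
  then show ?thesis
  proof eventually_elim
   case (elim x)
   have "isCont (cl m) (f x)"
    using cl_cont continuous_on_eq_continuous_at by blast
   then have "(%n. cl m (g n x)) ----> cl m (f x)"
    using g(2)[OF elim] isCont_tendsto_compose by blast
   then show ?case unfolding a_def by (intro tendsto_intros)
  qed
 qed
 obtain n where n: "L2norm UNIV (%x. a n x - cl m (f x) * ct m x) < e / 2"
  using order_tendstoD(2)[OF dc(3)[OF AE], of "e / 2"] e unfolding eventually_sequentially by auto
 show ?thesis
 proof (rule that[of "a n" "real m + 1"])
  show "continuous_on UNIV (a n)"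
   unfolding a_def using ct_cont
   by (intro continuous_on_mult continuous_on_compose2[OF cl_cont g(1)]) auto
  show "a n x = 0" if "norm x > real m + 1" for x using that by (simp add: a_def ct)
  show "a n \<in> L2 UNIV" by (rule dc(2)[OF AE])
  have "L2norm UNIV (%x. (f x - cl m (f x) * ct m x) - (a n x - cl m (f x) * ct m x))
    <= L2norm UNIV (%x. f x - cl m (f x) * ct m x) + L2norm UNIV (%x. a n x - cl m (f x) * ct m x)"
   by (intro L2norm_triangle_diff L2_diff f dc(1)[OF AE] dc(2)[OF AE])
  then show "L2norm UNIV (%x. f x - a n x) < e"
   using m n by (simp add: L2norm_diff_commute[of UNIV f])
 qed
qed

lemma lborel_shift: "distr lborel borel (%x. x - z) = (lborel :: 'a::euclidean_space measure)"
proof -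
 have "(+) (- z) = (%x. x - z)" by auto
 then show ?thesis using lborel_distr_plus[of "- z"] by simp
qed

lemma lborel_shift_reflect: "distr lborel borel (%z. x - z) = (lborel :: 'a::euclidean_space measure)"
proof -
 have "(lborel :: 'a measure) = density (distr lborel borel (%z. x + (-1) *\<^sub>R z)) (%_. ennreal (\<bar>-1\<bar> ^ DIM('a)))"
  by (rule lborel_affine) simp
 then show ?thesis by (simp add: density_1)
qed

lemma nn_integral_lborel_shift:
 "f \<in> borel_measurable borel ==> (NN x. f (x - z)) = (\<integral>\<^sup>+x. f x \<partial>(lborel :: 'a::euclidean_space measure))"
 by (subst (2) lborel_shift[of z, symmetric]) (simp add: nn_integral_distr)

lemma lborel_integral_shift_reflect:
 fixes f :: "'a::euclidean_space => real"
 assumes "f \<in> borel_measurable borel"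
 shows "(LINT y|lborel. f y) = (LINT z|lborel. f (x - z))"
 by (subst lborel_shift_reflect[of x, symmetric]) (simp add: integral_distr assms)

lemma L2_UNIV_borel:
 fixes g :: "'a::euclidean_space => real"
 assumes "g \<in> borel_measurable borel"
 shows "(\<integral>\<^sup>+x. ennreal ((norm (g x))^2) \<partial>leb UNIV) = (NN x. ennreal ((g x)^2))"
 by (simp add: lebesgue_on_UNIV_eq nn_integral_completion)

lemma borel_UNIV_measurable:
 "g \<in> borel_measurable borel ==> g \<in> borel_measurable (leb UNIV)"
 unfolding lebesgue_on_UNIV_eq by (rule measurable_completion) simp

lemma three_squares: "((a::real) + b + c)^2 <= 3 * (a^2 + b^2 + c^2)"
proof -
 have "0 <= (a - b)^2 + (b - c)^2 + (a - c)^2" by simp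
 then show ?thesis by (simp add: power2_eq_square algebra_simps)
qed

lemma translation_continuous_compact:
 fixes a :: "'a::euclidean_space => real"
 assumes a: "continuous_on UNIV a" "!!x. norm x > R ==> a x = 0" and e: "e > 0"
 obtains d where "d > 0" "!!z. norm z < d ==> (NN x. ennreal ((a (x - z) - a x)^2)) <= ennreal e"
proof -
 define S where "S = cball (0::'a) (\<bar>R\<bar> + 1)"
 define m where "m = measure lborel S"
 have S: "emeasure lborel S = ennreal m"
  unfolding m_def by (rule emeasure_eq_ennreal_measure) (use emeasure_bounded_finite[of S] in \<open>auto simp: S_def\<close>)
 define \<delta> where "\<delta> = sqrt (e / (m + 1))"
 have m0: "m >= 0" by (simp add: m_def)
 have \<delta>: "\<delta> > 0" "\<delta>^2 * m <= e"
  using e m0 by (auto simp: \<delta>_def field_simps)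
 have "uniformly_continuous_on (cball 0 (\<bar>R\<bar> + 2)) a"
  by (intro compact_uniformly_continuous continuous_on_subset[OF a(1)]) auto
 then obtain d where d: "d > 0" "!!x y. x \<in> cball 0 (\<bar>R\<bar> + 2) ==> y \<in> cball 0 (\<bar>R\<bar> + 2) ==> dist y x < d ==> dist (a y) (a x) < \<delta>"
  using \<delta>(1) unfolding uniformly_continuous_on_def by metis
 show ?thesis
 proof (rule that[of "min d 1"])
  fix z :: 'a assume z: "norm z < min d 1"
  have pt: "(a (x - z) - a x)^2 <= \<delta>^2 * indicator S x" for x
  proof (cases "x \<in> S")
   case True
   then have "norm (x - z) <= \<bar>R\<bar> + 2"
    using z norm_triangle_ineq4[of x z] by (simp add: S_def)
   then have "dist (a (x - z)) (a x) < \<delta>"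
    using True z by (intro d(2)) (auto simp: S_def dist_norm norm_minus_commute)
   then have "(a (x - z) - a x)^2 <= \<delta>^2"
    using \<delta>(1) by (simp add: dist_real_def power2_le_iff_abs_le)
   with True show ?thesis by simp
  next
   case False
   then have "norm x > \<bar>R\<bar> + 1" by (simp add: S_def)
   moreover from this have "norm (x - z) > \<bar>R\<bar>"
    using z norm_triangle_ineq2[of x z] by simp
   ultimately show ?thesis using a(2) by simp
  qed
  have "(NN x. ennreal ((a (x - z) - a x)^2)) <= (NN x. ennreal (\<delta>^2) * indicator S x)"
   by (intro nn_integral_mono) (metis pt ennreal_leI ennreal_mult' ennreal_indicator zero_le_power2)
  also have "... = ennreal (\<delta>^2) * emeasure lborel S"
   by (rule nn_integral_cmult_indicator) (simp add: S_def)
  also have "... = ennreal (\<delta>^2 * m)" by (simp add: S ennreal_mult' m0)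
  also have "... <= ennreal e" using \<delta> by (intro ennreal_leI)
  finally show "(NN x. ennreal ((a (x - z) - a x)^2)) <= ennreal e" .
 qed (use d in auto)
qed

lemma L2_translation_continuous:
 fixes g :: "'a::euclidean_space => real"
 assumes g [measurable]: "g \<in> borel_measurable borel" and L: "g \<in> L2 UNIV" and e: "e > 0"
 obtains d where "d > 0" "!!z. norm z < d ==> (NN x. ennreal ((g (x - z) - g x)^2)) <= ennreal e"
proof -
 \<comment> \<open>Splitting into three squares costs a factor 3, and e = 3 (e/12 + e/6 + e/12): the
   outer terms are the approximation error and its translate, the middle one belongs to the
   continuous function.\<close>
 define e' where "e' = sqrt (e / 12)"
 have e': "e' > 0" "e'^2 = e / 12" using e by (auto simp: e'_def)
 have e6: "e / 6 > 0" using e by simp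
 obtain a R where a: "continuous_on UNIV a" "!!x. norm x > R ==> a x = 0" "a \<in> L2 UNIV" "L2norm UNIV (%x. g x - a x) < e'"
  using L2_approx_continuous[OF L e'(1)] by metis
 have am [measurable]: "a \<in> borel_measurable borel" using a(1) by (rule borel_measurable_continuous_onI)
 obtain d where d: "d > 0" "!!z. norm z < d ==> (NN x. ennreal ((a (x - z) - a x)^2)) <= ennreal (e / 6)"
  using translation_continuous_compact[where e="e / 6", OF a(1) a(2) e6] by blast
 define b where "b x = g x - a x" for x
 have bm [measurable]: "b \<in> borel_measurable borel" unfolding b_def by measurable
 have "(NN x. ennreal ((b x)^2)) = ennreal ((L2norm UNIV b)^2)"
  using L2_nn_integral[of b UNIV] L2_diff[OF L a(3)] L2_UNIV_borel[OF bm] by (simp add: b_def[abs_def])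
 also have "... <= ennreal (e / 12)"
 proof (rule ennreal_leI)
  have "(L2norm UNIV b)^2 <= e'^2"
   using a(4) by (intro power_mono) (auto simp: b_def[abs_def])
  then show "(L2norm UNIV b)^2 <= e / 12" by (simp only: e'(2))
 qed
 finally have b: "(NN x. ennreal ((b x)^2)) <= ennreal (e / 12)" .
 show ?thesis
 proof (rule that[OF d(1)])
  fix z :: 'a assume z: "norm z < d"
  have "(NN x. ennreal ((g (x - z) - g x)^2))
   <= (NN x. 3 * (ennreal ((b (x - z))^2) + ennreal ((a (x - z) - a x)^2) + ennreal ((b x)^2)))"
  proof (rule nn_integral_mono)
   fix x
   have "(g (x - z) - g x)^2 = (b (x - z) + (a (x - z) - a x) + (- b x))^2" by (simp add: b_def)
   also have "... <= 3 * ((b (x - z))^2 + (a (x - z) - a x)^2 + (- b x)^2)" by (rule three_squares)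
   finally have "ennreal ((g (x - z) - g x)^2) <= ennreal (3 * ((b (x - z))^2 + (a (x - z) - a x)^2 + (b x)^2))"
    by (intro ennreal_leI) simp
   then show "ennreal ((g (x - z) - g x)^2) <= 3 * (ennreal ((b (x - z))^2) + ennreal ((a (x - z) - a x)^2) + ennreal ((b x)^2))"
    by (simp add: ennreal_mult')
  qed
  also have "... = 3 * ((NN x. ennreal ((b (x - z))^2)) + (NN x. ennreal ((a (x - z) - a x)^2)) + (NN x. ennreal ((b x)^2)))"
   by (simp add: nn_integral_cmult nn_integral_add)
  also have "(NN x. ennreal ((b (x - z))^2)) = (NN x. ennreal ((b x)^2))"
   by (rule nn_integral_lborel_shift) measurable
  also have "3 * ((NN x. ennreal ((b x)^2)) + (NN x. ennreal ((a (x - z) - a x)^2)) + (NN x. ennreal ((b x)^2)))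
    <= 3 * (ennreal (e / 12) + ennreal (e / 6) + ennreal (e / 12))"
   by (intro mult_left_mono add_mono b d(2)[OF z]) auto
  also have "... = ennreal e"
   using e ennreal_mult'[of 3 "e / 3"] by (simp flip: ennreal_plus)
  finally show "(NN x. ennreal ((g (x - z) - g x)^2)) <= ennreal e" .
 qed
qed

text \<open>The centre need not be the origin: a kernel centred at a small vector translates the
  support of the mollified function by about that vector, which is used to push it away from the
  boundary.\<close>

definition mollifier :: "(real^'n => real) => real^'n => real => bool" where
 "mollifier \<kappa> c \<epsilon> \<longleftrightarrow> test_function UNIV \<kappa> & (\<forall>z. \<kappa> z >= 0) & (LINT z|lborel. \<kappa> z) = 1 & (\<forall>z. z \<notin> cball c \<epsilon> --> \<kappa> z = 0)"

lemma Cc_integrable: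
 fixes f :: "real^'n => real"
 assumes "Cc k UNIV f"
 shows "integrable lborel f"
proof -
 obtain K where K: "compact K" "!!x. x \<notin> K ==> f x = 0"
  using assms unfolding Cc_def by blast
 have "integrable lborel (%x. indicator K x *\<^sub>R f x)"
  by (rule borel_integrable_compact[OF K(1)]) (use assms in \<open>auto intro: kcd_continuous Cc_kcd\<close>)
 moreover have "(%x. indicator K x *\<^sub>R f x) = f" using K(2) by (auto simp: indicator_def fun_eq_iff)
 ultimately show ?thesis by simp
qed

lemma mollifier_exists:
 assumes "\<epsilon> > 0"
 obtains \<kappa> :: "real^'n => real" where "mollifier \<kappa> c \<epsilon>"
proof -
 define b :: "real^'n => real" where "b = bump c (\<epsilon>/2) \<epsilon>"
 have tb: "test_function UNIV b" unfolding b_def using assms by (intro test_function_bump) auto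
 have bi: "integrable lborel b" using Cc_integrable test_function_Cc[OF tb] by blast
 define I where "I = (LINT z|lborel. b z)"
 have "I ~= 0"
 proof
  assume "I = 0"
  then have "AE z in lborel. b z = 0"
   using integral_nonneg_eq_0_iff_AE[OF bi] AE_I2[of lborel "%z. 0 <= b z"] by (simp add: I_def bump_bounds b_def)
  then have "AE z in lborel. z \<notin> ball c (\<epsilon>/2)"
  proof eventually_elim
   case (elim z)
   then show ?case
    using bump_1[of "\<epsilon>/2" \<epsilon> z c] assms by (auto simp: b_def dist_commute)
  qed
  then have "emeasure lborel (ball c (\<epsilon>/2)) = 0"
   by (subst (asm) AE_iff_measurable[of "ball c (\<epsilon>/2)"]) auto
  then have "ball c (\<epsilon>/2) = {}"
   using open_not_negligible[of "ball c (\<epsilon>/2)"] negligible_iff_emeasure0[of "ball c (\<epsilon>/2)"] by auto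
  then show False using assms by simp
 qed
 moreover have "I >= 0" unfolding I_def by (intro lint_nonneg) (simp add: b_def bump_bounds)
 ultimately have I: "I > 0" by simp
 show ?thesis
 proof (rule that[of "%z. (1 / I) * b z"], unfold mollifier_def, intro conjI allI impI)
  show "test_function UNIV (%z. (1 / I) * b z)"
   using tb unfolding test_function_iff by (auto intro: Cc_cmult simp del: times_divide_eq_left)
  show "(LINT z|lborel. (1 / I) * b z) = 1" using I by (simp add: I_def[symmetric])
  show "0 <= (1 / I) * b z" for z using I bump_bounds(1)[of c "\<epsilon>/2" \<epsilon> z] by (simp add: b_def)
  show "(1 / I) * b z = 0" if "z \<notin> cball c \<epsilon>" for z
   using that assms by (auto simp: b_def dist_commute intro!: bump_0)
 qed
qed

lemma mollifier_nn_integral: "mollifier \<kappa> c \<epsilon> ==> (NN z. ennreal (\<kappa> z)) = 1"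
 using nn_integral_eq_integral[of lborel \<kappa>] Cc_integrable[OF test_function_Cc, of \<kappa>]
 by (auto simp: mollifier_def)

lemma mollifier_borel: "mollifier \<kappa> c \<epsilon> ==> \<kappa> \<in> borel_measurable borel"
 unfolding mollifier_def test_function_def by (auto intro: borel_measurable_continuous_onI kcd_continuous)

text \<open>Jensen's inequality for the probability density \<kappa>, as Cauchy-Schwarz with the
  weight written as a product of square roots, followed by Tonelli: the error is an average over
  \<open>z\<close> of the squared distances between \<open>g\<close> and its translates.\<close>

lemma mol_error:
 fixes g :: "real^'n => real"
 assumes g [measurable]: "g \<in> borel_measurable borel" and \<kappa>: "mollifier \<kappa> c \<epsilon>"
  and gi: "integrable lborel g"
  and om: "!!z. z \<in> cball c \<epsilon> ==> (NN x. ennreal ((g (x - z) - g x)^2)) <= ennreal e"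
 shows "(NN x. ennreal (((LINT y|lborel. g y * \<kappa> (x - y)) - g x)^2)) <= ennreal e"
proof -
 have [measurable]: "\<kappa> \<in> borel_measurable borel" using mollifier_borel[OF \<kappa>] .
 have k0: "\<kappa> z >= 0" for z using \<kappa> by (simp add: mollifier_def)
 have tk: "test_function UNIV \<kappa>" using \<kappa> by (simp add: mollifier_def)
 have ki: "integrable lborel \<kappa>" using Cc_integrable[OF test_function_Cc[OF tk]] .
 obtain B where B: "!!x. \<bar>\<kappa> x\<bar> <= B" using Cc_bounded[OF test_function_Cc[OF tk]] by metis
 have pt: "ennreal (((LINT y|lborel. g y * \<kappa> (x - y)) - g x)^2)
   <= (NN z. ennreal ((g (x - z) - g x)^2) * ennreal (\<kappa> z))" for x
 proof -
  have int0: "integrable lborel (%y. g y * \<kappa> (x - y))"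
   by (rule integrable_bounded_mult[OF gi _ B]) measurable
  have int1: "integrable lborel (%z. g (x - z) * \<kappa> z)"
   using int0 integrable_distr_eq[of "%z. x - z" lborel borel "%y. g y * \<kappa> (x - y)"]
   by (simp add: lborel_shift_reflect)
  have "(LINT y|lborel. g y * \<kappa> (x - y)) = (LINT z|lborel. g (x - z) * \<kappa> z)"
   by (subst lborel_integral_shift_reflect[of _ x]) auto
  moreover have "(LINT z|lborel. g x * \<kappa> z) = g x" using \<kappa> by (simp add: mollifier_def)
  ultimately have eq: "(LINT y|lborel. g y * \<kappa> (x - y)) - g x = (LINT z|lborel. (g (x - z) - g x) * \<kappa> z)"
   using int1 ki by (simp add: left_diff_distrib)
  have int2: "integrable lborel (%z. (g (x - z) - g x) * \<kappa> z)"
   unfolding left_diff_distrib using int1 ki by (intro lintegrable_diff integrable_mult_right)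
  have "ennreal \<bar>(LINT y|lborel. g y * \<kappa> (x - y)) - g x\<bar> <= (NN z. ennreal \<bar>(g (x - z) - g x) * \<kappa> z\<bar>)"
   unfolding eq using integral_norm_bound_ennreal[OF int2] by simp
  also have "... = (NN z. ennreal (\<bar>g (x - z) - g x\<bar> * sqrt (\<kappa> z)) * ennreal (sqrt (\<kappa> z)))"
   by (intro nn_integral_cong) (simp add: k0 abs_mult flip: ennreal_mult')
  finally have "(ennreal \<bar>(LINT y|lborel. g y * \<kappa> (x - y)) - g x\<bar>)^2
    <= (NN z. ennreal (\<bar>g (x - z) - g x\<bar> * sqrt (\<kappa> z)) * ennreal (sqrt (\<kappa> z)))^2"
   by (rule power_mono) simp
  also have "... <= (NN z. (ennreal (\<bar>g (x - z) - g x\<bar> * sqrt (\<kappa> z)))^2) * (NN z. (ennreal (sqrt (\<kappa> z)))^2)"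
   by (rule Cauchy_Schwarz_nn_integral) measurable
  also have "(NN z. (ennreal (sqrt (\<kappa> z)))^2) = 1"
   using mollifier_nn_integral[OF \<kappa>] by (simp add: ennreal_power k0)
  also have "(NN z. (ennreal (\<bar>g (x - z) - g x\<bar> * sqrt (\<kappa> z)))^2) = (NN z. ennreal ((g (x - z) - g x)^2) * ennreal (\<kappa> z))"
   by (intro nn_integral_cong) (simp add: ennreal_power k0 power_mult_distrib ennreal_mult')
  finally show ?thesis by (simp add: ennreal_power)
 qed
 have "(NN x. ennreal (((LINT y|lborel. g y * \<kappa> (x - y)) - g x)^2))
   <= (NN x. (NN z. ennreal ((g (x - z) - g x)^2) * ennreal (\<kappa> z)))"
  by (intro nn_integral_mono pt)
 also have "... = (NN z. (NN x. ennreal ((g (x - z) - g x)^2) * ennreal (\<kappa> z)))"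
  by (rule lborel_pair.Fubini') measurable
 also have "... <= (NN z. ennreal e * ennreal (\<kappa> z))"
 proof (rule nn_integral_mono)
  fix z
  have "(NN x. ennreal ((g (x - z) - g x)^2) * ennreal (\<kappa> z)) = (NN x. ennreal ((g (x - z) - g x)^2)) * ennreal (\<kappa> z)"
   by (rule nn_integral_multc) measurable
  also have "... <= ennreal e * ennreal (\<kappa> z)"
  proof (cases "z \<in> cball c \<epsilon>")
   case True
   then show ?thesis by (intro mult_right_mono om) auto
  next
   case False
   then have "\<kappa> z = 0" using \<kappa> unfolding mollifier_def by blast
   then show ?thesis by simp
  qed
  finally show "(NN x. ennreal ((g (x - z) - g x)^2) * ennreal (\<kappa> z)) <= ennreal e * ennreal (\<kappa> z)" .
 qed
 also have "... = ennreal e"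
  using mollifier_nn_integral[OF \<kappa>] by (simp add: nn_integral_cmult)
 finally show ?thesis .
qed

lemma L2_zero_extension:
 fixes f :: "'a::euclidean_space => 'b::euclidean_space"
 assumes "X \<in> sets lebesgue" "f \<in> L2 X"
 shows "(%x. indicator X x *\<^sub>R f x) \<in> L2 UNIV" "L2norm UNIV (%x. indicator X x *\<^sub>R f x) = L2norm X f"
proof -
 have eq: "(norm (indicator X x *\<^sub>R f x))^2 = indicator X x *\<^sub>R (norm (f x))^2" for x
  by (auto simp: indicator_def)
 have s: "X \<inter> space lebesgue \<in> sets lebesgue" using assms(1) by simp
 show "(%x. indicator X x *\<^sub>R f x) \<in> L2 UNIV"
  using L2D[OF assms(2)]
  unfolding L2_def mem_Collect_eq eq borel_measurable_restrict_space_iff[OF s]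
   integrable_restrict_space[OF s] lebesgue_on_UNIV_eq by blast
 show "L2norm UNIV (%x. indicator X x *\<^sub>R f x) = L2norm X f"
  unfolding L2norm_def eq using assms(1) by (simp add: lebesgue_on_UNIV_eq integral_restrict_space)
qed

text \<open>\<open>f\<close> is replaced by a Borel representative \<open>g\<close> of its extension
  by zero, since Tonelli's theorem is applied to \<open>g (x - z)\<close> as a function of two
  variables. The kernels may be off-centre as long as their supports shrink to the origin.\<close>

theorem mol_tendsto:
 fixes f :: "real^'n => real"
 assumes X: "X \<in> lmeasurable" and f: "f \<in> L2 X"
  and \<kappa>: "!!n. mollifier (\<kappa> n) (c n) (\<epsilon> n)" and lim: "(%n. norm (c n) + \<epsilon> n) ----> 0"
 shows "(%n. L2norm UNIV (%x. mol X (\<kappa> n) f x - indicator X x * f x)) ----> 0"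
  "(%x. mol X (\<kappa> n) f x) \<in> L2 UNIV"
proof -
 define F where "F x = indicator X x * f x" for x
 have X': "X \<in> sets lebesgue" using X by blast
 have F: "F \<in> L2 UNIV" using L2_zero_extension(1)[OF X' f] by (simp add: F_def[abs_def])
 have Fm: "F \<in> borel_measurable lebesgue" using L2D(1)[OF F] by (simp add: lebesgue_on_UNIV_eq)
 have Fi: "integrable lebesgue F"
  using L2_integrable[OF X f] X' by (simp add: F_def[abs_def] integrable_restrict_space)
 obtain g where g: "g \<in> borel_measurable lborel" "AE x in lborel. F x = g x"
  using completion_ex_borel_measurable_real[OF Fm] by blast
 then have gb [measurable]: "g \<in> borel_measurable borel" by simp
 have AE: "AE x in lebesgue. F x = g x" using g(2) by (rule AE_completion)
 have gL: "g \<in> L2 UNIV"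
  by (rule L2_cong_AE[OF F _ borel_UNIV_measurable[OF gb]]) (use AE in \<open>simp only: lebesgue_on_UNIV_eq\<close>)
 have "integrable lebesgue g"
  using Fi AE gb by (subst integrable_cong_AE[symmetric, of F lebesgue g]) (auto intro: measurable_completion Fm)
 then have gi: "integrable lborel g"
  using integrable_completion[of g lborel] by simp
 have molg: "mol X \<eta> f x = (LINT y|lborel. g y * \<eta> (x - y))" if "test_function UNIV \<eta>" for \<eta> x
 proof -
  have c: "continuous_on UNIV (%y. \<eta> (x - y))"
   using test_function_kcd[OF that] kcd_shift_reflect kcd_continuous by blast
  have [measurable]: "(%y. \<eta> (x - y)) \<in> borel_measurable borel"
   using c by (rule borel_measurable_continuous_onI)
  have "mol X \<eta> f x = (LINT y|lebesgue. F y * \<eta> (x - y))"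
   unfolding mol_def using X' by (simp add: integral_restrict_space F_def mult.assoc)
  also have "... = (LINT y|lebesgue. g y * \<eta> (x - y))"
  proof (rule integral_cong_AE)
   have e: "(%y. \<eta> (x - y)) \<in> borel_measurable lebesgue"
    by (intro measurable_completion) simp
   then show "(%y. F y * \<eta> (x - y)) \<in> borel_measurable lebesgue"
    by (intro borel_measurable_times Fm)
   show "(%y. g y * \<eta> (x - y)) \<in> borel_measurable lebesgue"
    by (intro measurable_completion) simp
   show "AE y in lebesgue. F y * \<eta> (x - y) = g y * \<eta> (x - y)"
    using AE by eventually_elim simp
  qed
  also have "... = (LINT y|lborel. g y * \<eta> (x - y))"
   by (rule integral_completion) measurable
  finally show ?thesis .
 qed
 have tk: "test_function UNIV (\<kappa> n)" for n using \<kappa>[of n] by (simp add: mollifier_def)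
 have mm: "mol X (\<kappa> n) f \<in> borel_measurable (leb UNIV)" for n
  by (rule kcd_measurable[OF kcd_mol[OF L2_integrable[OF X f] tk, of 0]])
 have bound: "(%x. mol X (\<kappa> n) f x - F x) \<in> L2 UNIV & L2norm UNIV (%x. mol X (\<kappa> n) f x - F x) <= sqrt e"
  if "e > 0" "!!z. z \<in> cball (c n) (\<epsilon> n) ==> (NN x. ennreal ((g (x - z) - g x)^2)) <= ennreal e" for e n
 proof -
  have m1: "(%x. mol X (\<kappa> n) f x - F x) \<in> borel_measurable (leb UNIV)"
   by (intro borel_measurable_diff mm L2D(1)[OF F])
  have mb: "mol X (\<kappa> n) f \<in> borel_measurable borel"
   by (intro borel_measurable_continuous_onI kcd_continuous[OF kcd_mol[OF L2_integrable[OF X f] tk, of 0]])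
  have "(\<integral>\<^sup>+x. ennreal ((norm (mol X (\<kappa> n) f x - F x))^2) \<partial>leb UNIV)
    = (\<integral>\<^sup>+x. ennreal ((norm (mol X (\<kappa> n) f x - g x))^2) \<partial>leb UNIV)"
  proof (rule nn_integral_cong_AE)
   show "AE x in leb UNIV. ennreal ((norm (mol X (\<kappa> n) f x - F x))^2)
     = ennreal ((norm (mol X (\<kappa> n) f x - g x))^2)"
    unfolding lebesgue_on_UNIV_eq using AE by eventually_elim simp
  qed
  also have "... = (NN x. ennreal ((mol X (\<kappa> n) f x - g x)^2))"
   by (rule L2_UNIV_borel) (intro borel_measurable_diff mb gb)
  also have "... <= ennreal e"
   unfolding molg[OF tk] by (rule mol_error[OF gb \<kappa> gi that(2)])
  finally have "(\<integral>\<^sup>+x. ennreal ((norm (mol X (\<kappa> n) f x - F x))^2) \<partial>leb UNIV) <= ennreal ((sqrt e)^2)"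
   using that(1) by simp
  from L2I_nn_integral[OF m1 _ this] that(1) show ?thesis by simp
 qed
 have "(%n. L2norm UNIV (%x. mol X (\<kappa> n) f x - F x)) ----> 0"
 proof (rule LIMSEQ_I)
  fix r :: real assume r: "r > 0"
  define e where "e = (r / 2)^2"
  have e: "e > 0" "sqrt e < r" using r by (auto simp: e_def)
  obtain d where d: "d > 0" "!!z. norm z < d ==> (NN x. ennreal ((g (x - z) - g x)^2)) <= ennreal e"
   using L2_translation_continuous[OF gb gL e(1)] by metis
  obtain N where N: "!!n. n >= N ==> norm (c n) + \<epsilon> n < d"
   using order_tendstoD(2)[OF lim d(1)] unfolding eventually_sequentially by blast
  have "norm (L2norm UNIV (%x. mol X (\<kappa> n) f x - F x) - 0) < r" if n: "n >= N" for n
  proof -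
   have "norm z < d" if "z \<in> cball (c n) (\<epsilon> n)" for z
    using that N[OF n] norm_triangle_ineq2[of z "c n"] by (auto simp: dist_norm norm_minus_commute)
   then show ?thesis using bound[OF e(1), of n] d(2) e(2) by fastforce
  qed
  then show "\<exists>no. \<forall>n\<ge>no. norm (L2norm UNIV (%x. mol X (\<kappa> n) f x - F x) - 0) < r" by blast
 qed
 then show "(%n. L2norm UNIV (%x. mol X (\<kappa> n) f x - indicator X x * f x)) ----> 0"
  by (simp add: F_def)
 show "(%x. mol X (\<kappa> n) f x) \<in> L2 UNIV"
 proof -
  \<comment> \<open>A crude bound valid for every shift. With it the error estimate applies for each
    single \<open>n\<close>, not only for large ones, and so yields membership in \<open>L2\<close>;
    the summand 1 only ensures positivity.\<close>
  have om: "(NN x. ennreal ((g (x - z) - g x)^2)) <= ennreal (4 * (L2norm UNIV g)^2 + 1)" for z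
  proof -
   have gg: "(NN x. ennreal ((g x)^2)) = ennreal ((L2norm UNIV g)^2)"
    using L2_nn_integral[OF gL] L2_UNIV_borel[OF gb] by simp
   have "(NN x. ennreal ((g (x - z) - g x)^2)) <= (NN x. 2 * (ennreal ((g (x - z))^2) + ennreal ((g x)^2)))"
   proof (rule nn_integral_mono)
    fix x
    have "(g (x - z) - g x)^2 <= 2 * ((g (x - z))^2 + (g x)^2)"
     using zero_le_power2[of "g (x - z) + g x"] by (simp add: power2_eq_square algebra_simps)
    then show "ennreal ((g (x - z) - g x)^2) <= 2 * (ennreal ((g (x - z))^2) + ennreal ((g x)^2))"
     by (metis ennreal_leI ennreal_mult' ennreal_numeral ennreal_plus zero_le_numeral zero_le_power2)
   qed
   also have "... = 2 * ((NN x. ennreal ((g (x - z))^2)) + (NN x. ennreal ((g x)^2)))"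
    by (simp add: nn_integral_cmult nn_integral_add)
   also have "(NN x. ennreal ((g (x - z))^2)) = (NN x. ennreal ((g x)^2))"
    by (rule nn_integral_lborel_shift) measurable
   also have "2 * ((NN x. ennreal ((g x)^2)) + (NN x. ennreal ((g x)^2))) = ennreal (4 * (L2norm UNIV g)^2)"
    unfolding gg by (simp add: ennreal_mult' flip: ennreal_plus)
   also have "... <= ennreal (4 * (L2norm UNIV g)^2 + 1)" by (intro ennreal_leI) simp
   finally show ?thesis .
  qed
  have "(%x. mol X (\<kappa> n) f x - F x) \<in> L2 UNIV"
   using bound[of "4 * (L2norm UNIV g)^2 + 1" n] om by (simp add: add_nonneg_pos)
  from L2_add[OF this F] show ?thesis by simp
 qed
qed

section \<open>Weak derivatives\<close>

lemma integral_lebesgue_on_support: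
 fixes g :: "'a::euclidean_space => real"
 assumes "X \<in> sets lebesgue" "continuous_on UNIV g" "!!x. x \<notin> X ==> g x = 0"
 shows "(LINT x|leb X. g x) = (LINT x|lborel. g x)"
proof -
 have "(LINT x|leb X. g x) = (LINT x|lebesgue. indicator X x *\<^sub>R g x)"
  using assms(1) by (simp add: integral_restrict_space)
 also have "(%x. indicator X x *\<^sub>R g x) = g"
  using assms(3) by (auto simp: indicator_def fun_eq_iff)
 also have "(LINT x|lebesgue. g x) = (LINT x|lborel. g x)"
  by (rule integral_completion) (use assms(2) borel_measurable_continuous_onI in auto)
 finally show ?thesis .
qed

text \<open>By translation invariance the difference quotients have integral zero. They are bounded
  by the Lipschitz constant and, for steps of length at most 1, supported in one compact set, so the
  limit may be taken under the integral.\<close>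

lemma integral_partial_eq_0:
 fixes \<psi> :: "real^'n => real"
 assumes \<psi>: "Cc 1 UNIV \<psi>"
 shows "(LINT x|lborel. partial i \<psi> x) = 0"
proof -
 obtain K where K: "compact K" "!!x. x \<notin> K ==> \<psi> x = 0"
  using \<psi> unfolding Cc_def by blast
 obtain L where L: "L > 0" "!!a b. \<bar>\<psi> a - \<psi> b\<bar> <= L * norm (a - b)"
  using Cc_lipschitz[OF \<psi>] by blast
 define e :: "real^'n" where "e = axis i 1"
 have ne: "norm e = 1" by (simp add: e_def)
 define K' where "K' = {x + y |x y. x \<in> K & y \<in> cball 0 1}"
 have K': "compact K'" unfolding K'_def by (rule compact_sums[OF K(1)]) auto
 define t where "t n = inverse (real (Suc n))" for n
 have t: "0 < t n" "t n <= 1" for n by (auto simp: t_def field_simps)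
 have "continuous_on UNIV \<psi>" using kcd_continuous Cc_kcd[OF \<psi>] by blast
 then have [measurable]: "\<psi> \<in> borel_measurable borel" by (rule borel_measurable_continuous_onI)
 define q where "q n x = (\<psi> (x + t n *\<^sub>R e) - \<psi> x) / t n" for n x
 have q0: "(LINT x|lborel. q n x) = 0" for n
 proof -
  have i1: "integrable lborel \<psi>" by (rule Cc_integrable[OF \<psi>])
  have eq: "distr lborel borel (%x. x + t n *\<^sub>R e) = (lborel :: (real^'n) measure)"
   using lborel_shift[of "- t n *\<^sub>R e"] by simp
  have "integrable lborel (%x. \<psi> (x + t n *\<^sub>R e))"
   using integrable_distr_eq[of "%x. x + t n *\<^sub>R e" lborel borel \<psi>] i1 by (simp add: eq)
  moreover have "(LINT x|lborel. \<psi> (x + t n *\<^sub>R e)) = (LINT x|lborel. \<psi> x)"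
   using integral_distr[of "%x. x + t n *\<^sub>R e" lborel borel \<psi>] by (simp add: eq)
  ultimately show ?thesis using i1 by (simp add: q_def)
 qed
 have "(%n. LINT x|lborel. q n x) ----> (LINT x|lborel. partial i \<psi> x)"
 proof (rule integral_dominated_convergence[where w="%x. L * indicator K' x"])
  show "partial i \<psi> \<in> borel_measurable lborel"
   using borel_measurable_continuous_onI[OF kcd_continuous[OF kcd_partial'[OF Cc_kcd[OF \<psi>], of 0]]] by simp
  show "integrable lborel (%x. L * indicator K' x)"
   using K' compact_imp_closed[OF K'] emeasure_bounded_finite[OF compact_imp_bounded[OF K']]
   by (intro integrable_mult_right integrable_real_indicator) auto
  show "q n \<in> borel_measurable lborel" for n unfolding q_def by measurable
  show "AE x in lborel. (%n. q n x) ----> partial i \<psi> x"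
  proof (rule AE_I2)
   fix x
   have "((%h. (\<psi> (x + (0 + h) *\<^sub>R e) - \<psi> (x + 0 *\<^sub>R e)) / h) \<longlongrightarrow> partial i \<psi> (x + 0 *\<^sub>R e)) (at 0)"
    using has_derivative_along_axis[OF Cc_kcd[OF \<psi>], of x i 0] unfolding DERIV_def e_def .
   then have lim: "((%h. (\<psi> (x + h *\<^sub>R e) - \<psi> x) / h) \<longlongrightarrow> partial i \<psi> x) (at 0)" by simp
   have "t ----> 0" unfolding t_def by (rule LIMSEQ_inverse_real_of_nat)
   moreover have "t n ~= 0" for n using t(1)[of n] by simp
   ultimately have "filterlim t (at 0) sequentially"
    unfolding filterlim_at by simp
   from filterlim_compose[OF lim this] show "(%n. q n x) ----> partial i \<psi> x"
    by (simp add: q_def)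
  qed
  show "AE x in lborel. norm (q n x) <= L * indicator K' x" for n
  proof (rule AE_I2)
   fix x
   show "norm (q n x) <= L * indicator K' x"
   proof (cases "x \<in> K'")
    case True
    have "\<bar>\<psi> (x + t n *\<^sub>R e) - \<psi> x\<bar> <= L * t n"
     using L(2)[of "x + t n *\<^sub>R e" x] t[of n] ne by simp
    then show ?thesis using True t[of n] by (simp add: q_def field_simps)
   next
    case False
    have a: "x \<notin> K" using False unfolding K'_def by (auto dest: spec[of _ x] spec[of _ 0])
    have b: "x + t n *\<^sub>R e \<notin> K"
    proof
     assume "x + t n *\<^sub>R e \<in> K"
     then have "(x + t n *\<^sub>R e) + (- (t n *\<^sub>R e)) \<in> K'"
      unfolding K'_def using t[of n] ne
      by (intro CollectI exI[of _ "x + t n *\<^sub>R e"] exI[of _ "- (t n *\<^sub>R e)"]) simp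
     then show False using False by simp
    qed
    show ?thesis using K(2)[OF a] K(2)[OF b] L(1) by (simp add: q_def False)
   qed
  qed
 qed
 then have "(%n::nat. 0) ----> (LINT x|lborel. partial i \<psi> x)" by (simp add: q0)
 then show ?thesis using LIMSEQ_unique tendsto_const by blast
qed

lemma integral_partial_on:
 assumes "X \<in> sets lebesgue" "Cc 1 X \<psi>"
 shows "(LINT x|leb X. partial i \<psi> x) = 0"
proof -
 obtain K where K: "compact K" "K \<subseteq> X" "!!x. x \<notin> K ==> \<psi> x = 0"
  using assms(2) unfolding Cc_def by blast
 have "(LINT x|leb X. partial i \<psi> x) = (LINT x|lborel. partial i \<psi> x)"
 proof (rule integral_lebesgue_on_support[OF assms(1)])
  show "continuous_on UNIV (partial i \<psi>)"
   using kcd_continuous[OF kcd_partial'[OF Cc_kcd[OF assms(2)], of 0]] by simp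
  show "partial i \<psi> x = 0" if "x \<notin> X" for x
   using partial_outside_support[OF K(1), of \<psi> x i] K(2,3) that by blast
 qed
 then show ?thesis using integral_partial_eq_0[OF Cc_mono[OF assms(2)]] by simp
qed

lemma kcd_L2: "X \<in> lmeasurable ==> bounded X ==> kcd k a ==> (a :: real^'n => real) \<in> L2 X"
 using kcd_bounded_on[of k a X] L2_bounded[of X a] kcd_measurable[of k a X]
 by (metis real_norm_def)

lemma L2_kcd_mult:
 fixes a :: "real^'n => real"
 assumes "bounded X" "kcd k a" "f \<in> L2 X"
 shows "(%x. a x * f x) \<in> L2 X"
 using kcd_bounded_on[OF assms(2,1)] L2_bounded_mult_real[OF assms(3) kcd_measurable[OF assms(2)]] by metis

lemma integral_by_parts_on:
 assumes "X \<in> lmeasurable" "bounded X" "kcd 1 f" "kcd 1 g" "Cc 1 X (%x. f x * g x)"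
 shows "(LINT x|leb X. f x * partial i g x) = - (LINT x|leb X. partial i f x * g x)"
proof -
 note L = kcd_L2[OF assms(1,2)]
 have "0 = (LINT x|leb X. partial i (%x. f x * g x) x)"
  using integral_partial_on[OF _ assms(5)] assms(1) by auto
 also have "... = (LINT x|leb X. partial i f x * g x + f x * partial i g x)"
  by (intro arg_cong[where f="integral\<^sup>L (leb X)"] ext partial_mult assms)
 also have "... = (LINT x|leb X. partial i f x * g x) + (LINT x|leb X. f x * partial i g x)"
  using L[OF kcd_partial'[OF assms(3), of 0]] L[OF kcd_partial'[OF assms(4), of 0]] L[OF assms(3)] L[OF assms(4)]
  by (intro lint_add L2_mult_integrable) auto
 finally show ?thesis by simp
qed

lemma L2_restrict:
 fixes f :: "'a::euclidean_space => real"
 assumes "f \<in> L2 T" "S \<subseteq> T" "S \<in> sets lebesgue" "T \<in> sets lebesgue"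
 shows "f \<in> L2 S" "L2norm S f <= L2norm T f"
proof -
 have m: "f \<in> borel_measurable (leb S)"
  using measurable_restrict_mono[OF L2D(1)[OF assms(1)] assms(2)] .
 have iT: "integrable lebesgue (%x. indicator T x *\<^sub>R (norm (f x))^2)"
  using L2D(2)[OF assms(1)] integrable_restrict_space[of T lebesgue "%x. (norm (f x))^2"] assms(4) by simp
 have "integrable lebesgue (%x. indicator S x *\<^sub>R (indicator T x *\<^sub>R (norm (f x))^2))"
  by (rule integrable_mult_indicator[OF assms(3) iT])
 moreover have eq: "indicator S x *\<^sub>R (indicator T x *\<^sub>R (norm (f x))^2) = indicator S x *\<^sub>R (norm (f x))^2" for x
  using assms(2) by (auto simp: indicator_def)
 ultimately have iS: "integrable lebesgue (%x. indicator S x *\<^sub>R (norm (f x))^2)" by (simp only: eq)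
 then show "f \<in> L2 S"
  using m assms(3) by (simp add: L2_def integrable_restrict_space)
 show "L2norm S f <= L2norm T f"
  unfolding L2norm_def
 proof (rule real_sqrt_le_mono)
  have "(LINT x|lebesgue. indicator S x *\<^sub>R (norm (f x))^2) <= (LINT x|lebesgue. indicator T x *\<^sub>R (norm (f x))^2)"
   by (rule integral_mono[OF iS iT]) (use assms(2) in \<open>auto simp: indicator_def\<close>)
  then show "(LINT x|leb S. (norm (f x))^2) <= (LINT x|leb T. (norm (f x))^2)"
   using assms(3,4) by (simp add: integral_restrict_space)
 qed
qed

text \<open>The last hypothesis is the identity defining a weak derivative for the single test
  function \<kappa> (x - y) of y. Against \<open>wd0\<close> it holds at every \<open>x\<close>,
  because that notion imposes no support condition on the test function.\<close>

lemma partial_mol_weak: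
 assumes "integrable (leb X) f" "test_function UNIV \<kappa>"
  and "(LINT y|leb X. f y * partial i (%y. \<kappa> (x - y)) y) = - (LINT y|leb X. g y * \<kappa> (x - y))"
 shows "partial i (mol X \<kappa> f) x = mol X \<kappa> g x"
proof -
 have "(LINT y|leb X. f y * partial i (%y. \<kappa> (x - y)) y) = - (LINT y|leb X. f y * partial i \<kappa> (x - y))"
  by (simp add: partial_shift_reflect test_function_kcd[OF assms(2)])
 then show ?thesis
  using assms(3) by (simp add: partial_mol[OF assms(1) test_function_Cc[OF assms(2)]] mol_def)
qed

lemma mollifier_seq_centered:
 obtains \<kappa> :: "nat => real^'n => real" where "!!n. mollifier (\<kappa> n) 0 (inverse (real (Suc n)))"
proof -
 have "\<forall>n. \<exists>\<kappa>::real^'n => real. mollifier \<kappa> 0 (inverse (real (Suc n)))"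
 proof
  fix n
  have "inverse (real (Suc n)) > 0" by simp
  then show "\<exists>\<kappa>::real^'n => real. mollifier \<kappa> 0 (inverse (real (Suc n)))"
   using mollifier_exists by blast
 qed
 from choice[OF this] show ?thesis using that by blast
qed

lemma mollifier_test: "mollifier \<kappa> c \<epsilon> ==> test_function UNIV \<kappa>"
 by (simp add: mollifier_def)

lemma mollifier_0: "mollifier \<kappa> c \<epsilon> ==> z \<notin> cball c \<epsilon> ==> \<kappa> z = 0"
 by (simp add: mollifier_def)

lemma compact_sum_cball_eventually:
 fixes K :: "(real^'n) set"
 assumes "compact K" "open U" "K \<subseteq> U"
 obtains d where "d > 0" "{y + z |y z. y \<in> K & z \<in> cball 0 d} \<subseteq> U"
proof -
 obtain d where d: "d > 0" "!!x. x \<in> K ==> cball x d \<subseteq> U"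
 proof (cases "K = {} \<or> U = UNIV")
  case True
  then show ?thesis using that[of 1] by auto
 next
  case False
  have "0 < setdist K (- U)"
   using False assms by (intro setdist_gt_0_compact_closed[THEN iffD2]) auto
  moreover have "cball x (setdist K (- U) / 2) \<subseteq> U" if "x \<in> K" for x
  proof
   fix y assume y: "y \<in> cball x (setdist K (- U) / 2)"
   show "y \<in> U"
   proof (rule ccontr)
    assume "y \<notin> U"
    then have "setdist K (- U) <= dist x y" using that by (intro setdist_le_dist) auto
    with y \<open>0 < setdist K (- U)\<close> show False by simp
   qed
  qed
  ultimately show ?thesis using that[of "setdist K (- U) / 2"] by simp
 qed
 show ?thesis
  by (rule that[OF d(1)]) (use d(2) in \<open>force simp: dist_norm\<close>)
qed

text \<open>The same approximating sequence works for the function and all its derivatives.\<close>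

lemma Cc1_approx:
 fixes \<phi> :: "real^'n => real"
 assumes \<phi>: "Cc 1 U \<phi>" and U: "open U"
 obtains \<Phi> where "!!n. test_function U (\<Phi> n)"
  "(%n. L2norm UNIV (%x. \<Phi> n x - \<phi> x)) ----> 0"
  "!!i. (%n. L2norm UNIV (%x. partial i (\<Phi> n) x - partial i \<phi> x)) ----> 0"
  "!!n. \<Phi> n \<in> L2 UNIV" "!!n i. partial i (\<Phi> n) \<in> L2 UNIV"
proof -
 obtain K where K: "compact K" "K \<subseteq> U" "!!x. x \<notin> K ==> \<phi> x = 0"
  using \<phi> unfolding Cc_def by blast
 have Kl: "K \<in> lmeasurable" "bounded K" "K \<in> sets lebesgue"
  using K(1) lmeasurable_compact compact_imp_bounded by blast+
 have \<phi>K: "Cc 1 K \<phi>" by (rule CcI[OF Cc_kcd[OF \<phi>] K(1) subset_refl K(3)])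
 have \<phi>L: "\<phi> \<in> L2 K" "partial i \<phi> \<in> L2 K" for i
  by (rule kcd_L2[OF Kl(1,2) Cc_kcd[OF \<phi>]], rule kcd_L2[OF Kl(1,2) kcd_partial'[OF Cc_kcd[OF \<phi>], of 0]]) simp
 have int: "integrable (leb K) \<phi>" by (rule L2_integrable[OF Kl(1) \<phi>L(1)])
 obtain d where d: "d > 0" "{y + z |y z. y \<in> K & z \<in> cball 0 d} \<subseteq> U"
  by (rule compact_sum_cball_eventually[OF K(1) U K(2)])
 obtain N where N: "inverse (real (Suc N)) < d" using reals_Archimedean[OF d(1)] by blast
 obtain \<kappa>0 :: "nat => real^'n => real" where \<kappa>0: "!!n. mollifier (\<kappa>0 n) 0 (inverse (real (Suc n)))"
  by (rule mollifier_seq_centered) blast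
 define \<kappa> where "\<kappa> n = \<kappa>0 (n + N)" for n
 have \<kappa>: "mollifier (\<kappa> n) 0 (inverse (real (Suc (n + N))))" for n unfolding \<kappa>_def by (rule \<kappa>0)
 have lim: "(%n. norm (0::real^'n) + inverse (real (Suc (n + N)))) ----> 0"
  using LIMSEQ_ignore_initial_segment[OF LIMSEQ_inverse_real_of_nat, of N] by simp
 have sub: "inverse (real (Suc (n + N))) <= d" for n
 proof -
  have "inverse (real (Suc (n + N))) <= inverse (real (Suc N))" by (rule le_imp_inverse_le) auto
  with N show ?thesis by linarith
 qed
 define \<Phi> where "\<Phi> n = mol K (\<kappa> n) \<phi>" for n
 have der: "partial i (\<Phi> n) = mol K (\<kappa> n) (partial i \<phi>)" for i n
 proof
  fix x
  show "partial i (\<Phi> n) x = mol K (\<kappa> n) (partial i \<phi>) x"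
   unfolding \<Phi>_def
  proof (rule partial_mol_weak[OF int mollifier_test[OF \<kappa>]])
   show "(LINT y|leb K. \<phi> y * partial i (%y. \<kappa> n (x - y)) y) = - (LINT y|leb K. partial i \<phi> y * \<kappa> n (x - y))"
   proof (rule integral_by_parts_on[OF Kl(1,2) Cc_kcd[OF \<phi>]])
    show k: "kcd 1 (%y. \<kappa> n (x - y))"
     by (intro kcd_shift_reflect test_function_kcd[OF mollifier_test[OF \<kappa>]])
    show "Cc 1 K (%y. \<phi> y * \<kappa> n (x - y))"
     using Cc_mult[OF \<phi>K k] by (simp add: mult.commute)
   qed
  qed
 qed
 have ind: "indicator K x * \<phi> x = \<phi> x" "indicator K x * partial i \<phi> x = partial i \<phi> x" for x i
  using K(3) partial_outside_support[OF K(1), of \<phi> x i] by (auto simp: indicator_def)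
 show ?thesis
 proof (rule that[of \<Phi>])
  show "test_function U (\<Phi> n)" for n
   unfolding \<Phi>_def
  proof (rule test_function_mol[OF int mollifier_test[OF \<kappa>] K(1) compact_cball[of 0 d]])
   show "\<kappa> n z = 0" if "z \<notin> cball 0 d" for z
    using mollifier_0[OF \<kappa>[of n]] sub[of n] that by (meson subset_cball subsetD)
  qed (use K d in auto)
  show "(%n. L2norm UNIV (%x. \<Phi> n x - \<phi> x)) ----> 0"
   using mol_tendsto(1)[OF Kl(1) \<phi>L(1) \<kappa> lim] by (simp add: \<Phi>_def ind)
  show "(%n. L2norm UNIV (%x. partial i (\<Phi> n) x - partial i \<phi> x)) ----> 0" for i
   using mol_tendsto(1)[OF Kl(1) \<phi>L(2) \<kappa> lim] by (simp add: der ind)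
  show "\<Phi> n \<in> L2 UNIV" for n
   using mol_tendsto(2)[OF Kl(1) \<phi>L(1) \<kappa> lim] by (simp add: \<Phi>_def)
  show "partial i (\<Phi> n) \<in> L2 UNIV" for n i
   using mol_tendsto(2)[OF Kl(1) \<phi>L(2) \<kappa> lim] by (simp add: der)
 qed
qed

text \<open>
 A weak derivative tested against a class \<open>T\<close>: compactly supported \<open>C\<^sup>1\<close> functions give the usual
 notion, all \<open>C\<^sup>1\<close> functions give weak differentiability of the extension by zero, the
 substitute for a vanishing trace.
\<close>

definition wdT :: "((real^'n => real) => bool) => (real^'n) set => 'n => (real^'n => real) => (real^'n => real) => bool" where
 "wdT T X i f g \<longleftrightarrow> f \<in> L2 X & g \<in> L2 X &
   (\<forall>\<phi>. T \<phi> --> (LINT x|leb X. f x * partial i \<phi> x) = - (LINT x|leb X. g x * \<phi> x))"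

abbreviation "wd X \<equiv> wdT (Cc 1 X) X"
abbreviation "wd0 X \<equiv> wdT (kcd 1) X"

text \<open>Closure under C^1 factors is what the product rule asks for: a coefficient of the
  function is moved over to the test function.\<close>

definition test_class :: "((real^'n => real) => bool) => bool" where
 "test_class T \<longleftrightarrow> (\<forall>\<phi>. T \<phi> --> kcd 1 \<phi>) & (\<forall>a \<phi>. T \<phi> --> kcd 1 a --> T (%x. a x * \<phi> x))"

lemma test_class_wd [simp]: "test_class (Cc 1 X)" "test_class (kcd 1)"
 by (auto simp: test_class_def intro: Cc_kcd Cc_mult kcd_mult)

lemma wdT_D:
 assumes "wdT T X i f g"
 shows "f \<in> L2 X" "g \<in> L2 X"
  "T \<phi> ==> (LINT x|leb X. f x * partial i \<phi> x) = - (LINT x|leb X. g x * \<phi> x)"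
 using assms by (auto simp: wdT_def)

lemma wd0_imp_wd: "wd0 X i f g ==> wd X i f g"
 by (auto simp: wdT_def dest: Cc_kcd)

context
 fixes X :: "(real^'n) set"
 assumes op: "open X" and bd: "bounded X"
begin

lemma dom_lmeasurable: "X \<in> lmeasurable"
 using op bd by (rule lmeasurable_open[rotated])

lemma dom_sets: "X \<in> sets lebesgue"
 using dom_lmeasurable by blast

lemma test_int:
 fixes f \<phi> :: "real^'n => real"
 assumes "f \<in> L2 X" "kcd k \<phi>"
 shows "integrable (leb X) (%x. f x * \<phi> x)"
 by (rule L2_mult_integrable[OF assms(1) kcd_L2[OF dom_lmeasurable bd assms(2)]])

lemma test_int_partial:
 fixes f \<phi> :: "real^'n => real"
 assumes "f \<in> L2 X" "kcd 1 \<phi>"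
 shows "integrable (leb X) (%x. f x * partial i \<phi> x)"
 using test_int[OF assms(1) kcd_partial'[OF assms(2), of 0]] by simp

lemma wdT_add:
 assumes T: "test_class T" and f: "wdT T X i f f'" and g: "wdT T X i g g'"
 shows "wdT T X i (%x. f x + g x) (%x. f' x + g' x)"
 unfolding wdT_def
proof (intro conjI allI impI)
 fix \<phi> assume \<phi>: "T \<phi>"
 then have k: "kcd 1 \<phi>" using T by (simp add: test_class_def)
 note L = wdT_D(1,2)[OF f] wdT_D(1,2)[OF g]
 show "(LINT x|leb X. (f x + g x) * partial i \<phi> x) = - (LINT x|leb X. (f' x + g' x) * \<phi> x)"
  using wdT_D(3)[OF f \<phi>] wdT_D(3)[OF g \<phi>]
  by (simp add: distrib_right test_int[OF L(2) k] test_int[OF L(4) k] test_int_partial[OF L(1) k] test_int_partial[OF L(3) k])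
qed (auto intro!: L2_add wdT_D(1,2)[OF f] wdT_D(1,2)[OF g])

lemma wdT_zero: "wdT T X i (%x. 0) (%x. 0)"
 by (simp add: wdT_def L2_zero)

lemma wdT_sum:
 assumes "test_class T" "!!k. k \<in> I ==> wdT T X i (f k) (f' k)"
 shows "wdT T X i (%x. \<Sum>k\<in>I. f k x) (%x. \<Sum>k\<in>I. f' k x)"
 using assms(2) by (induction I rule: infinite_finite_induct) (auto intro: wdT_zero wdT_add[OF assms(1)])

lemma wdT_cmult: "wdT T X i f f' ==> wdT T X i (%x. c * f x) (%x. c * f' x)"
 by (simp add: wdT_def L2_cmult mult.assoc)

lemma wdT_uminus: "wdT T X i f f' ==> wdT T X i (%x. - f x) (%x. - f' x)"
 using wdT_cmult[of T i f f' "-1"] by simp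

lemma wdT_diff:
 "test_class T ==> wdT T X i f f' ==> wdT T X i g g' ==> wdT T X i (%x. f x - g x) (%x. f' x - g' x)"
 using wdT_add[OF _ _ wdT_uminus, of T i f f' g g'] by simp

lemma wdT_mult:
 assumes T: "test_class T" and f: "wdT T X i f f'" and a: "kcd 1 a"
 shows "wdT T X i (%x. a x * f x) (%x. partial i a x * f x + a x * f' x)"
 unfolding wdT_def
proof (intro conjI allI impI)
 have a': "kcd 0 (partial i a)" using kcd_partial'[OF a, of 0] by simp
 note L = wdT_D(1,2)[OF f]
 show "(%x. a x * f x) \<in> L2 X"
  by (rule L2_kcd_mult[OF bd a L(1)])
 show "(%x. partial i a x * f x + a x * f' x) \<in> L2 X"
  by (intro L2_add L2_kcd_mult[OF bd a' L(1)] L2_kcd_mult[OF bd a L(2)])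
 fix \<phi> assume \<phi>: "T \<phi>"
 then have k: "kcd 1 \<phi>" and p: "T (%x. a x * \<phi> x)" using T a by (auto simp: test_class_def)
 have i1: "integrable (leb X) (%x. (partial i a x * f x) * \<phi> x)"
  by (rule test_int[OF L2_kcd_mult[OF bd a' L(1)] k])
 have i2: "integrable (leb X) (%x. (a x * f x) * partial i \<phi> x)"
  by (rule test_int_partial[OF L2_kcd_mult[OF bd a L(1)] k])
 have i3: "integrable (leb X) (%x. (a x * f' x) * \<phi> x)"
  by (rule test_int[OF L2_kcd_mult[OF bd a L(2)] k])
 have "(LINT x|leb X. f x * partial i (%x. a x * \<phi> x) x) = (LINT x|leb X. (partial i a x * f x) * \<phi> x + (a x * f x) * partial i \<phi> x)"
  by (intro lint_cong refl) (simp only: partial_mult[OF a k], simp add: algebra_simps)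
 also have "... = (LINT x|leb X. (partial i a x * f x) * \<phi> x) + (LINT x|leb X. (a x * f x) * partial i \<phi> x)"
  by (rule lint_add[OF i1 i2])
 finally have "(LINT x|leb X. (a x * f x) * partial i \<phi> x) = - (LINT x|leb X. f' x * (a x * \<phi> x)) - (LINT x|leb X. (partial i a x * f x) * \<phi> x)"
  using wdT_D(3)[OF f p] by simp
 also have "(LINT x|leb X. f' x * (a x * \<phi> x)) = (LINT x|leb X. (a x * f' x) * \<phi> x)"
  by (intro lint_cong refl) (simp add: mult_ac)
 also have "- ... - (LINT x|leb X. (partial i a x * f x) * \<phi> x) = - (LINT x|leb X. (partial i a x * f x) * \<phi> x + (a x * f' x) * \<phi> x)"
  by (simp add: lint_add[OF i1 i3])
 also have "... = - (LINT x|leb X. (partial i a x * f x + a x * f' x) * \<phi> x)"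
  by (simp add: distrib_right)
 finally show "(LINT x|leb X. a x * f x * partial i \<phi> x) = - (LINT x|leb X. (partial i a x * f x + a x * f' x) * \<phi> x)" .
qed

lemma wdT_cong_AE:
 assumes T: "test_class T" and f: "wdT T X i f f'" and "AE x in leb X. f x = g x" "AE x in leb X. f' x = g' x"
  and g: "g \<in> L2 X" "g' \<in> L2 X"
 shows "wdT T X i g g'"
 unfolding wdT_def
proof (intro conjI allI impI g)
 fix \<phi> assume \<phi>: "T \<phi>"
 then have k: "kcd 1 \<phi>" using T by (simp add: test_class_def)
 note L = wdT_D(1,2)[OF f]
 have "(LINT x|leb X. f x * partial i \<phi> x) = (LINT x|leb X. g x * partial i \<phi> x)"
  by (rule integral_cong_AE)
   (use assms(3) in \<open>auto elim!: eventually_mono intro!: borel_measurable_integrable test_int_partial[OF _ k] L g\<close>)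
 moreover have "(LINT x|leb X. f' x * \<phi> x) = (LINT x|leb X. g' x * \<phi> x)"
  by (rule integral_cong_AE)
   (use assms(4) in \<open>auto elim!: eventually_mono intro!: borel_measurable_integrable test_int[OF _ k] L g\<close>)
 ultimately show "(LINT x|leb X. g x * partial i \<phi> x) = - (LINT x|leb X. g' x * \<phi> x)"
  using wdT_D(3)[OF f \<phi>] by simp
qed

lemma L2_tendsto_integral:
 fixes f k :: "real^'n => real" and h :: "nat => real^'n => real"
 assumes "f \<in> L2 X" "!!n. h n \<in> L2 UNIV" "k \<in> L2 UNIV" "(%n. L2norm UNIV (%x. h n x - k x)) ----> 0"
 shows "(%n. LINT x|leb X. f x * h n x) ----> (LINT x|leb X. f x * k x)"
proof -
 note r = L2_restrict[OF _ subset_UNIV dom_sets]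
 have d: "(%x. h n x - k x) \<in> L2 UNIV" for n using assms by (intro L2_diff)
 have "(%n. L2norm X (%x. h n x - k x)) ----> 0"
  by (rule tendsto_sandwich[OF _ _ tendsto_const assms(4)]) (use r(2)[OF d] in auto)
 then have "(%n. L2inner X (h n) f) ----> L2inner X k f"
  by (intro L2_tendsto_inner r(1) assms) auto
 then show ?thesis by (simp add: L2inner_def mult.commute)
qed

lemma Cc_L2_UNIV:
 fixes \<phi> :: "real^'n => real"
 assumes "Cc k UNIV \<phi>" shows "\<phi> \<in> L2 UNIV"
proof -
 have k: "Cc k UNIV (%x. \<phi> x * \<phi> x)" using Cc_mult[OF assms Cc_kcd[OF assms]] .
 have "integrable lborel (%x. (\<phi> x)^2)" using Cc_integrable[OF k] by (simp add: power2_eq_square)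
 then have "integrable lebesgue (%x. (\<phi> x)^2)" by (simp add: integrable_completion borel_measurable_integrable)
 then show ?thesis
  using kcd_measurable[OF Cc_kcd[OF assms], of UNIV] by (simp add: L2_def lebesgue_on_UNIV_eq)
qed

text \<open>Mollification approximates a C^1 test function and its derivatives in L2 by smooth ones
  supported in \<open>U\<close>, and both integrals are continuous in that sense. The open set is
  \<open>X\<close> for \<open>wd\<close> and the whole space for \<open>wd0\<close>.\<close>

lemma test_ext:
 fixes f g :: "real^'n => real"
 assumes fg: "f \<in> L2 X" "g \<in> L2 X" and U: "open U" and \<phi>: "Cc 1 U \<phi>"
  and id: "!!\<phi>. test_function U \<phi> ==> (LINT x|leb X. f x * partial i \<phi> x) = - (LINT x|leb X. g x * \<phi> x)"
 shows "(LINT x|leb X. f x * partial i \<phi> x) = - (LINT x|leb X. g x * \<phi> x)"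
proof -
 obtain \<Phi> where \<Phi>: "!!n. test_function U (\<Phi> n)"
  "(%n. L2norm UNIV (%x. \<Phi> n x - \<phi> x)) ----> 0"
  "!!i. (%n. L2norm UNIV (%x. partial i (\<Phi> n) x - partial i \<phi> x)) ----> 0"
  "!!n. \<Phi> n \<in> L2 UNIV" "!!n i. partial i (\<Phi> n) \<in> L2 UNIV"
  using Cc1_approx[OF \<phi> U] by blast
 have \<phi>U: "Cc 1 UNIV \<phi>" using Cc_mono[OF \<phi>] by simp
 have L: "\<phi> \<in> L2 UNIV" "partial i \<phi> \<in> L2 UNIV"
  using Cc_L2_UNIV[OF \<phi>U] Cc_L2_UNIV[of 0 "partial i \<phi>"] Cc_partial[of 0 UNIV \<phi>] \<phi>U by auto
 have "(%n. LINT x|leb X. f x * partial i (\<Phi> n) x) ----> (LINT x|leb X. f x * partial i \<phi> x)"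
  by (rule L2_tendsto_integral[OF fg(1) \<Phi>(5) L(2) \<Phi>(3)])
 moreover have "(%n. - (LINT x|leb X. g x * \<Phi> n x)) ----> - (LINT x|leb X. g x * \<phi> x)"
  by (rule tendsto_minus[OF L2_tendsto_integral[OF fg(2) \<Phi>(4) L(1) \<Phi>(2)]])
 ultimately show ?thesis
  unfolding id[OF \<Phi>(1)] using LIMSEQ_unique by blast
qed

lemma has_weak_partial_imp_wd:
 assumes "f \<in> L2 X" "g \<in> L2 X" "has_weak_partial X i f g"
 shows "wd X i f g"
 unfolding wdT_def using assms test_ext[OF assms(1,2) op] by (auto simp: has_weak_partial_def)

lemma L2_locally_integrable:
 assumes "f \<in> L2 X"
 shows "locally_integrable_on X f"
 unfolding locally_integrable_on_def
proof (intro allI impI)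
 fix K assume K: "compact K & K \<subseteq> X"
 then have "K \<in> lmeasurable" by (simp add: lmeasurable_compact)
 then show "integrable (leb K) f"
  using L2_restrict(1)[OF assms _ _ dom_sets] K by (intro L2_integrable) auto
qed

lemma wd_imp_has_weak_partial:
 assumes "wd X i f g" shows "has_weak_partial X i f g"
 unfolding has_weak_partial_def
 using wdT_D[OF assms] L2_locally_integrable test_function_Cc by blast

text \<open>As \<open>X\<close> is bounded, multiplying the test function by a bump that is 1 on a
  ball around \<open>X\<close> changes none of the integrals and makes the support compact.\<close>

lemma wd0_smoothI:
 assumes fg: "f \<in> L2 X" "g \<in> L2 X"
  and id: "!!\<phi>. test_function UNIV \<phi> ==> (LINT x|leb X. f x * partial i \<phi> x) = - (LINT x|leb X. g x * \<phi> x)"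
 shows "wd0 X i f g"
 unfolding wdT_def
proof (intro conjI allI impI fg)
 fix \<phi> :: "real^'n => real" assume \<phi>: "kcd 1 \<phi>"
 obtain R where R: "R > 0" "X \<subseteq> ball 0 R"
  using bounded_subset_ballD[OF bd] by blast
 define c :: "real^'n => real" where "c = bump 0 R (R + 1)"
 have c: "test_function UNIV c" unfolding c_def using R by (intro test_function_bump) auto
 have c1: "c x = 1" if "x \<in> ball 0 R" for x
  unfolding c_def using that R by (intro bump_1) auto
 have p: "Cc 1 UNIV (%x. \<phi> x * c x)" by (rule Cc_mult[OF test_function_Cc[OF c] \<phi>])
 have pc: "partial i c x = 0" if "x \<in> ball 0 R" for x
 proof (rule partial_eqI[of c "%_. 0"])
  have "((%x. 1) has_derivative (%_. 0)) (at x)" by simp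
  then show "(c has_derivative (%_. 0)) (at x)"
   by (rule has_derivative_transform_within_open[where s="ball 0 R"]) (use that c1 in auto)
 qed
 have e: "\<phi> x * c x = \<phi> x" "partial i (%x. \<phi> x * c x) x = partial i \<phi> x" if "x \<in> X" for x
  using that R c1[of x] pc[of x] partial_mult[OF \<phi> test_function_kcd[OF c]] by auto
 have "(LINT x|leb X. f x * partial i \<phi> x) = (LINT x|leb X. f x * partial i (%x. \<phi> x * c x) x)"
  by (intro lint_cong) (auto simp: e)
 also have "... = - (LINT x|leb X. g x * (\<phi> x * c x))"
  by (rule test_ext[OF fg open_UNIV p id])
 also have "(LINT x|leb X. g x * (\<phi> x * c x)) = (LINT x|leb X. g x * \<phi> x)"
  by (intro lint_cong) (auto simp: e)
 finally show "(LINT x|leb X. f x * partial i \<phi> x) = - (LINT x|leb X. g x * \<phi> x)" .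
qed

lemma integral_test_restrict:
 fixes h :: "real^'n => real"
 assumes "K \<subseteq> X" "K \<in> sets lebesgue" "!!x. x \<in> X ==> x \<notin> K ==> h x = 0"
 shows "(LINT x|leb X. h x) = (LINT x|leb K. h x)"
 using assms dom_sets
 by (auto simp: integral_restrict_space intro!: lint_cong split: split_indicator)

text \<open>Test with mollifications of the sign of \<open>h\<close>, which are bounded uniformly.\<close>

lemma fundamental_lemma:
 fixes h :: "real^'n => real"
 assumes h: "locally_integrable_on X h" and 0: "!!\<phi>. test_function X \<phi> ==> (LINT x|leb X. h x * \<phi> x) = 0"
 shows "AE x in leb X. h x = 0"
proof -
 have main: "AE x in leb K. h x = 0" if K: "compact K" "K \<subseteq> X" for K
 proof -
  obtain d where d: "d > 0" "{y + z |y z. y \<in> K & z \<in> cball 0 d} \<subseteq> X"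
   using compact_sum_cball_eventually[OF K(1) op K(2)] by blast
  define K' where "K' = {y + z |y z. y \<in> K & z \<in> cball (0::real^'n) d}"
  have K': "compact K'" "K' \<subseteq> X" unfolding K'_def using d(2) compact_sums[OF K(1) compact_cball[of 0 d]] by blast+
  have KK': "K \<subseteq> K'" unfolding K'_def using d(1) by force
  have l: "K \<in> lmeasurable" "K' \<in> lmeasurable" "K \<in> sets lebesgue" "K' \<in> sets lebesgue"
   using K K' lmeasurable_compact by blast+
  have hi: "integrable (leb K') h" "integrable (leb K) h"
   using h K K' unfolding locally_integrable_on_def by blast+
  define s where "s x = sgn (h x)" for x
  have sm: "s \<in> borel_measurable (leb K)"
   unfolding s_def using hi(2) by measurable
  have s1: "\<bar>s x\<bar> <= 1" for x by (simp add: s_def sgn_if)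
  have sL: "s \<in> L2 K" by (rule L2_bounded[OF l(1) sm, of 1]) (use s1 in simp)
  have si: "integrable (leb K) s" by (rule L2_integrable[OF l(1) sL])
  obtain N where N: "inverse (real (Suc N)) < d" using reals_Archimedean[OF d(1)] by blast
  obtain \<kappa>0 :: "nat => real^'n => real" where \<kappa>0: "!!n. mollifier (\<kappa>0 n) 0 (inverse (real (Suc n)))"
   by (rule mollifier_seq_centered) blast
  define \<kappa> where "\<kappa> n = \<kappa>0 (n + N)" for n
  have \<kappa>: "mollifier (\<kappa> n) 0 (inverse (real (Suc (n + N))))" for n unfolding \<kappa>_def by (rule \<kappa>0)
  have lim: "(%n. norm (0::real^'n) + inverse (real (Suc (n + N)))) ----> 0"
   using LIMSEQ_ignore_initial_segment[OF LIMSEQ_inverse_real_of_nat, of N] by simp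
  have sub: "inverse (real (Suc (n + N))) <= d" for n
  proof -
   have "inverse (real (Suc (n + N))) <= inverse (real (Suc N))" by (rule le_imp_inverse_le) auto
   with N show ?thesis by linarith
  qed
  have k0: "\<kappa> n z = 0" if "z \<notin> cball 0 d" for n z
  proof -
   have "z \<notin> cball 0 (inverse (real (Suc (n + N))))" using that sub[of n] by auto
   then show ?thesis by (rule mollifier_0[OF \<kappa>[of n]])
  qed
  define m where "m n = mol K (\<kappa> n) s" for n
  have supp: "m n x = 0" if "x \<notin> K'" for n x
   unfolding m_def by (rule mol_support[of K K s "cball 0 d"]) (use k0 that in \<open>auto simp: K'_def\<close>)
  have tm: "test_function X (m n)" for n
   unfolding m_def
   by (rule test_function_mol[OF si mollifier_test[OF \<kappa>] K(1) compact_cball[of 0 d]]) (use d k0 in auto)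
  have m1: "\<bar>m n x\<bar> <= 1" for n x
  proof -
   have kn: "\<kappa> n z >= 0" for z using \<kappa>[of n] by (simp add: mollifier_def)
   have ci: "Cc 1 UNIV (\<kappa> n)" using mollifier_test[OF \<kappa>] test_function_Cc by blast
   have ki: "integrable lborel (\<kappa> n)" by (rule Cc_integrable[OF ci])
   have ki': "integrable lborel (%y. \<kappa> n (x - y))"
    using integrable_distr_eq[of "%y. x - y" lborel borel "\<kappa> n"] ki mollifier_borel[OF \<kappa>[of n]]
    by (simp add: lborel_shift_reflect)
   have int1: "(LINT y|lborel. \<kappa> n (x - y)) = 1"
    using lborel_integral_shift_reflect[OF mollifier_borel[OF \<kappa>[of n]], of x] \<kappa>[of n] by (simp add: mollifier_def)
   have kil: "integrable lebesgue (%y. \<kappa> n (x - y))"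
    using ki' by (simp add: integrable_completion borel_measurable_integrable)
   have iK: "integrable (leb K) (%y. \<kappa> n (x - y))"
    using integrable_mult_indicator[OF l(3) kil] l(3) by (simp add: integrable_restrict_space)
   have "\<bar>m n x\<bar> <= (LINT y|leb K. \<kappa> n (x - y))"
    unfolding m_def mol_def real_norm_def[symmetric]
   proof (rule lint_norm_bound_integral[OF mol_integrable[OF si ci] iK])
    fix y
    have "\<bar>s y\<bar> * \<bar>\<kappa> n (x - y)\<bar> <= 1 * \<kappa> n (x - y)"
     using s1 kn by (intro mult_mono) auto
    then show "norm (s y * \<kappa> n (x - y)) <= \<kappa> n (x - y)" by (simp add: abs_mult)
   qed
   also have "... = (LINT y|lebesgue. indicator K y *\<^sub>R \<kappa> n (x - y))"
    using l(3) by (simp add: integral_restrict_space)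
   also have "... <= (LINT y|lebesgue. \<kappa> n (x - y))"
    by (rule integral_mono[OF integrable_mult_indicator[OF l(3) kil] kil]) (use kn in \<open>auto simp: indicator_def\<close>)
   also have "... = 1" using int1 integral_completion[of "%y. \<kappa> n (x - y)" lborel] ki'
    by (simp add: borel_measurable_integrable)
   finally show ?thesis .
  qed
  have mL: "m n \<in> L2 UNIV" for n unfolding m_def using mol_tendsto(2)[OF l(1) sL \<kappa> lim] by simp
  have sL': "(%x. indicator K x * s x) \<in> L2 UNIV" using L2_zero_extension(1)[OF l(3) sL] by simp
  obtain r where r: "strict_mono (r :: nat => nat)" "AE x in leb UNIV. (%n. m (r n) x) ----> indicator K x * s x"
   using L2_AE_subseq[OF mL sL' mol_tendsto(1)[OF l(1) sL \<kappa> lim, folded m_def]] by blast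
  have AEr: "AE x in leb K'. (%n. m (r n) x) ----> indicator K x * s x"
   using r(2) l(4) by (auto simp: lebesgue_on_UNIV_eq AE_restrict_space_iff elim!: eventually_mono)
  have "(%n. LINT x|leb K'. h x * m (r n) x) ----> (LINT x|leb K'. h x * (indicator K x * s x))"
  proof (rule integral_dominated_convergence)
   show "integrable (leb K') (%x. \<bar>h x\<bar>)" using hi(1) by (rule integrable_abs)
   show "(%x. h x * m (r n) x) \<in> borel_measurable (leb K')" for n
    by (intro borel_measurable_times borel_measurable_integrable[OF hi(1)] kcd_measurable[OF test_function_kcd[OF tm]])
   show "(%x. h x * (indicator K x * s x)) \<in> borel_measurable (leb K')"
    using measurable_restrict_mono[OF L2D(1)[OF sL'] subset_UNIV]
    by (intro borel_measurable_times[OF borel_measurable_integrable[OF hi(1)]]) auto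
   show "AE x in leb K'. (%n. h x * m (r n) x) ----> h x * (indicator K x * s x)"
    using AEr by eventually_elim (intro tendsto_intros)
   show "AE x in leb K'. norm (h x * m (r n) x) <= \<bar>h x\<bar>" for n
    using m1 by (intro AE_I2) (auto simp: abs_mult mult_left_le)
  qed
  moreover have "(LINT x|leb K'. h x * m (r n) x) = 0" for n
   using 0[OF tm] integral_test_restrict[OF K'(2) l(4), of "%x. h x * m (r n) x"] supp by simp
  ultimately have "(%n::nat. 0) ----> (LINT x|leb K'. h x * (indicator K x * s x))"
   by (simp only:)
  from LIMSEQ_unique[OF this tendsto_const]
  have "(LINT x|leb K'. h x * (indicator K x * s x)) = 0" .
  moreover have "(LINT x|leb K'. h x * (indicator K x * s x)) = (LINT x|leb K. \<bar>h x\<bar>)"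
   using l(3,4) KK'
   by (auto simp: integral_restrict_space s_def abs_sgn intro!: lint_cong split: split_indicator)
  ultimately have "AE x in leb K. \<bar>h x\<bar> = 0"
   using integral_nonneg_eq_0_iff_AE[OF integrable_abs[OF hi(2)]] by simp
  then show ?thesis by simp
 qed
 obtain C :: "nat => (real^'n) set" where C: "!!n. compact (C n)" "!!n. C n \<subseteq> X" "\<Union>(range C) = X"
  using open_Union_compact_subsets[OF op] by metis
 have "AE x in lebesgue. \<forall>n. x \<in> C n --> h x = 0"
  unfolding AE_all_countable
 proof
  fix n
  have "C n \<in> sets lebesgue" using lmeasurable_compact[OF C(1)] by blast
  then show "AE x in lebesgue. x \<in> C n --> h x = 0"
   using main[OF C(1)[of n] C(2)[of n]] by (simp add: AE_restrict_space_iff)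
 qed
 then have "AE x in lebesgue. x \<in> X --> h x = 0"
  by eventually_elim (use C(3) in auto)
 then show ?thesis using dom_sets by (simp add: AE_restrict_space_iff)
qed

end

section \<open>Representatives of weak derivatives, Sobolev spaces and the Helmholtz
  projection\<close>

lemma lebesgue_on_measurable_AE:
 fixes f g :: "'a::euclidean_space => 'b::euclidean_space"
 assumes X: "X \<in> sets lebesgue" and f: "f \<in> meas X"
  and ae: "AE x in leb X. f x = g x"
 shows "g \<in> meas X"
proof -
 have s: "X \<inter> space lebesgue \<in> sets lebesgue" using X by simp
 have "(%x. indicator X x *\<^sub>R f x) \<in> borel_measurable lebesgue"
  using f unfolding borel_measurable_restrict_space_iff[OF s] .
 moreover have "AE x in lebesgue. indicator X x *\<^sub>R f x = indicator X x *\<^sub>R g x"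
  using ae X by (auto simp: AE_restrict_space_iff indicator_def elim!: eventually_mono)
 ultimately have "(%x. indicator X x *\<^sub>R g x) \<in> borel_measurable lebesgue"
  by (rule borel_measurable_AE)
 then show ?thesis unfolding borel_measurable_restrict_space_iff[OF s] .
qed

lemma L2_AE_eq:
 fixes f g :: "'a::euclidean_space => 'b::euclidean_space"
 assumes "X \<in> sets lebesgue" "f \<in> L2 X" "AE x in leb X. f x = g x"
 shows "g \<in> L2 X" "L2norm X g = L2norm X f"
proof -
 have m: "g \<in> meas X"
  by (rule lebesgue_on_measurable_AE[OF assms(1) L2D(1)[OF assms(2)] assms(3)])
 show "g \<in> L2 X" by (rule L2_cong_AE[OF assms(2,3) m])
 show "L2norm X g = L2norm X f"
  by (rule sym, rule L2norm_cong_AE[OF assms(3) L2D(1)[OF assms(2)] m])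
qed

text \<open>Divergence free and curl free in the sense of distributions, without boundary condition.
  Being a gradient is replaced by being curl free, a local property that survives mollification and
  that follows directly from orthogonality to compactly supported divergence free fields.\<close>

definition harmonic_field :: "(real^'n) set => (real^'n => real^'n) => bool" where
 "harmonic_field X G \<longleftrightarrow> G \<in> L2 X &
   (\<forall>\<phi>. test_function X \<phi> --> (SUM i. LINT x|leb X. G x $ i * partial i \<phi> x) = 0) &
   (\<forall>\<phi> i j. test_function X \<phi> -->
    (LINT x|leb X. G x $ i * partial j \<phi> x) = (LINT x|leb X. G x $ j * partial i \<phi> x))"

context
 fixes X :: "(real^'n) set"
 assumes op: "open X" and bd: "bounded X"
begin

lemmas dl = dom_lmeasurable[OF op bd]
lemmas ds = dom_sets[OF op bd]

lemma locally_integrable_test: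
 assumes g: "locally_integrable_on X g" and \<phi>: "test_function X \<phi>"
 shows "integrable (leb X) (%x. g x * \<phi> x)"
proof -
 obtain K where K: "compact K" "K \<subseteq> X" "!!x. x \<notin> K ==> \<phi> x = 0"
  using test_function_Cc[OF \<phi>, of 0] unfolding Cc_def by blast
 obtain B where B: "!!x. \<bar>\<phi> x\<bar> <= B" using Cc_bounded[OF test_function_Cc[OF \<phi>, of 0]] by blast
 have Ks: "K \<in> sets lebesgue" using lmeasurable_compact[OF K(1)] by blast
 have "integrable (leb K) g" using g K unfolding locally_integrable_on_def by blast
 then have "integrable (leb K) (%x. g x * \<phi> x)"
  by (rule integrable_bounded_mult[OF _ kcd_measurable[OF test_function_kcd[OF \<phi>, of 0]] B])
 then have "integrable lebesgue (%x. indicator K x *\<^sub>R (g x * \<phi> x))"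
  using Ks by (simp add: integrable_restrict_space)
 also have "(%x. indicator K x *\<^sub>R (g x * \<phi> x)) = (%x. indicator X x *\<^sub>R (g x * \<phi> x))"
  using K(2,3) by (auto simp: fun_eq_iff indicator_def)
 finally show ?thesis using ds by (simp add: integrable_restrict_space)
qed

lemma locally_integrable_diff:
 "locally_integrable_on X f ==> locally_integrable_on X g ==> locally_integrable_on X (%x. f x - g x)"
 unfolding locally_integrable_on_def by auto

lemma has_weak_partial_unique:
 assumes "has_weak_partial X i f g" "has_weak_partial X i f g'"
 shows "AE x in leb X. g x = g' x"
proof -
 have l: "locally_integrable_on X g" "locally_integrable_on X g'"
  using assms by (auto simp: has_weak_partial_def)
 have "AE x in leb X. g x - g' x = 0"
 proof (rule fundamental_lemma[OF op bd locally_integrable_diff[OF l]])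
  fix \<phi> assume \<phi>: "test_function X \<phi>"
  have "(LINT x|leb X. f x * partial i \<phi> x) = - (LINT x|leb X. g x * \<phi> x)"
   "(LINT x|leb X. f x * partial i \<phi> x) = - (LINT x|leb X. g' x * \<phi> x)"
   using assms \<phi> unfolding has_weak_partial_def by blast+
  then show "(LINT x|leb X. (g x - g' x) * \<phi> x) = 0"
   using locally_integrable_test[OF l(1) \<phi>] locally_integrable_test[OF l(2) \<phi>]
   by (simp add: left_diff_distrib)
 qed
 then show ?thesis by simp
qed

lemma wd_unique: "wd X i f g ==> wd X i f g' ==> AE x in leb X. g x = g' x"
 using has_weak_partial_unique wd_imp_has_weak_partial[OF op bd] by blast

text \<open>The choice made in \<open>wpartial\<close> agrees almost everywhere with any weak
  derivative at hand and inherits its square integrability, which \<open>has_weak_partial\<close>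
  alone, being local, does not give.\<close>

lemma wd_wpartial:
 assumes "wd X i f g"
 shows "wd X i f (wpartial X i f)" "AE x in leb X. wpartial X i f x = g x"
proof -
 have g: "has_weak_partial X i f g" by (rule wd_imp_has_weak_partial[OF op bd assms])
 then have w: "has_weak_partial X i f (wpartial X i f)"
  using someI[of "has_weak_partial X i f", OF g] unfolding wpartial_def by blast
 then show ae: "AE x in leb X. wpartial X i f x = g x"
  using g by (rule has_weak_partial_unique)
 have "wpartial X i f \<in> L2 X"
  by (rule L2_AE_eq(1)[OF ds wdT_D(2)[OF assms]]) (use ae in \<open>auto elim!: eventually_mono\<close>)
 then show "wd X i f (wpartial X i f)"
  by (rule has_weak_partial_imp_wd[OF op bd wdT_D(1)[OF assms] _ w])
qed

lemma H1_wd: "f \<in> H1 X ==> wd X i f (wpartial X i f)"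
 using wd_wpartial(1) has_weak_partial_imp_wd[OF op bd] unfolding H1_def by blast

lemma H1_L2: "f \<in> H1 X ==> f \<in> L2 X" "f \<in> H1 X ==> wpartial X i f \<in> L2 X"
 using wdT_D(1,2)[OF H1_wd] by blast+

lemma H1I: "(!!i. wd X i f (g i)) ==> f \<in> H1 X"
 unfolding H1_def using wdT_D(1,2) wd_imp_has_weak_partial[OF op bd] by blast

lemma test_wd:
 assumes "kcd 1 \<phi>"
 shows "wd X i \<phi> (partial i \<phi>)"
 unfolding wdT_def
proof (intro conjI allI impI)
 show "\<phi> \<in> L2 X" by (rule kcd_L2[OF dl bd assms])
 show "partial i \<phi> \<in> L2 X" by (rule kcd_L2[OF dl bd kcd_partial'[OF assms, of 0]]) simp
 fix \<psi> assume "Cc 1 X \<psi>"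
 then show "(LINT x|leb X. \<phi> x * partial i \<psi> x) = - (LINT x|leb X. partial i \<phi> x * \<psi> x)"
  by (intro integral_by_parts_on[OF dl bd assms] Cc_mult Cc_kcd[of 1 X \<psi>] assms)
qed

lemma test_wd0:
 assumes "Cc 1 X \<phi>"
 shows "wd0 X i \<phi> (partial i \<phi>)"
 unfolding wdT_def
proof (intro conjI allI impI)
 have k: "kcd 1 \<phi>" using Cc_kcd[OF assms] .
 show "\<phi> \<in> L2 X" by (rule kcd_L2[OF dl bd k])
 show "partial i \<phi> \<in> L2 X" by (rule kcd_L2[OF dl bd kcd_partial'[OF k, of 0]]) simp
 fix \<psi> :: "real^'n => real" assume \<psi>: "kcd 1 \<psi>"
 have "Cc 1 X (%x. \<phi> x * \<psi> x)" using Cc_mult[OF assms \<psi>] by (simp add: mult.commute)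
 then show "(LINT x|leb X. \<phi> x * partial i \<psi> x) = - (LINT x|leb X. partial i \<phi> x * \<psi> x)"
  by (rule integral_by_parts_on[OF dl bd k \<psi>])
qed

lemma wdT_limit:
 assumes T: "test_class T" and F: "!!n. wdT T X i (F n) (F' n)" and f: "f \<in> L2 X" "f' \<in> L2 X"
  and lim: "(%n. L2norm X (%x. F n x - f x)) ----> 0" "(%n. L2norm X (%x. F' n x - f' x)) ----> 0"
 shows "wdT T X i f f'"
 unfolding wdT_def
proof (intro conjI allI impI f)
 fix \<phi> assume \<phi>: "T \<phi>"
 then have k: "kcd 1 \<phi>" using T by (simp add: test_class_def)
 have L: "\<phi> \<in> L2 X" "partial i \<phi> \<in> L2 X"
  using kcd_L2[OF dl bd k] kcd_L2[OF dl bd kcd_partial'[OF k, of 0]] by auto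
 have 1: "(%n. L2inner X (F n) (partial i \<phi>)) ----> L2inner X f (partial i \<phi>)"
  by (rule L2_tendsto_inner[OF wdT_D(1)[OF F] f(1) L(2) lim(1)])
 have "(%n. - L2inner X (F' n) \<phi>) ----> - L2inner X f' \<phi>"
  by (intro tendsto_minus L2_tendsto_inner[OF wdT_D(2)[OF F] f(2) L(1) lim(2)])
 moreover have "L2inner X (F n) (partial i \<phi>) = - L2inner X (F' n) \<phi>" for n
  using wdT_D(3)[OF F \<phi>] by (simp add: L2inner_def)
 ultimately have "L2inner X f (partial i \<phi>) = - L2inner X f' \<phi>"
  using LIMSEQ_unique[OF 1] by simp
 then show "(LINT x|leb X. f x * partial i \<phi> x) = - (LINT x|leb X. f' x * \<phi> x)"
  by (simp add: L2inner_def)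
qed

lemma H10_approx:
 assumes "f \<in> H10 X"
 obtains \<Phi> where "!!k. test_function X (\<Phi> k)" "(%k. L2norm X (%x. \<Phi> k x - f x)) ----> 0"
  "!!i. (%k. L2norm X (%x. partial i (\<Phi> k) x - wpartial X i f x)) ----> 0"
 using assms unfolding H10_def by blast

text \<open>For test functions no boundary term arises, whatever C^1 function they are paired with,
  and the identity is stable under L2 limits of the functions and their derivatives. This is the
  only way in which the zero boundary values enter as a test identity.\<close>

lemma H10_wd0:
 assumes "f \<in> H10 X"
 shows "wd0 X i f (wpartial X i f)"
proof -
 have f: "f \<in> H1 X" using assms by (simp add: H10_def)
 obtain \<Phi> where \<Phi>: "!!k. test_function X (\<Phi> k)" "(%k. L2norm X (%x. \<Phi> k x - f x)) ----> 0"
  "!!i. (%k. L2norm X (%x. partial i (\<Phi> k) x - wpartial X i f x)) ----> 0"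
  using H10_approx[OF assms] by blast
 show ?thesis
  by (rule wdT_limit[OF _ test_wd0[OF test_function_Cc[OF \<Phi>(1)]] H1_L2(1)[OF f] H1_L2(2)[OF f] \<Phi>(2,3)]) (rule test_class_wd)
qed

text \<open>Both second derivatives are moved to the smooth test function, where the order of
  differentiation is immaterial; the fundamental lemma then compares them.\<close>

lemma wd_commute:
 assumes "wd X i f a" "wd X j f b" "wd X j a c" "wd X i b d"
 shows "AE x in leb X. c x = d x"
proof -
 have "AE x in leb X. c x - d x = 0"
 proof (rule fundamental_lemma[OF op bd])
  show "locally_integrable_on X (%x. c x - d x)"
   by (intro L2_locally_integrable[OF op bd] L2_diff wdT_D(2)[OF assms(3)] wdT_D(2)[OF assms(4)])
  fix \<phi> assume \<phi>: "test_function X \<phi>"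
  note C = test_function_Cc[OF \<phi>, of 1] test_function_Cc[OF test_function_partial[OF \<phi>], of 1]
  have "(LINT x|leb X. c x * \<phi> x) = (LINT x|leb X. f x * partial i (partial j \<phi>) x)"
   using wdT_D(3)[OF assms(3) C(1)] wdT_D(3)[OF assms(1) C(2)] by simp
  also have "... = (LINT x|leb X. f x * partial j (partial i \<phi>) x)"
   by (simp add: partial_commute[OF test_function_kcd[OF \<phi>]])
  also have "... = (LINT x|leb X. d x * \<phi> x)"
   using wdT_D(3)[OF assms(4) C(1)] wdT_D(3)[OF assms(2) C(2)] by simp
  finally show "(LINT x|leb X. (c x - d x) * \<phi> x) = 0"
   using test_int[OF op bd wdT_D(2)[OF assms(3)] test_function_kcd[OF \<phi>, of 1]]
    test_int[OF op bd wdT_D(2)[OF assms(4)] test_function_kcd[OF \<phi>, of 1]]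
   by (simp add: left_diff_distrib)
 qed
 then show ?thesis by simp
qed

subsection \<open>The Helmholtz projection\<close>

lemma grad_L2: "\<phi> \<in> H1 X ==> grad X \<phi> \<in> L2 X"
 by (rule L2_vecI) (simp add: grad_def H1_L2)

lemma L2inner_vec:
 fixes f g :: "real^'n => real^'n"
 assumes "f \<in> L2 X" "g \<in> L2 X"
 shows "L2inner X f g = (SUM i. LINT x|leb X. f x $ i * g x $ i)"
 unfolding L2inner_def inner_vec_def inner_real_def
 by (intro lint_sum L2_mult_integrable L2_component assms)

text \<open>Justifies the choice in \<open>helmholtz\<close>: the defining conditions of
  \<open>gradients_perp\<close> are continuous for the L2 norm, so the space is closed and the
  projection exists.\<close>

lemma helmholtz_works:
 assumes v: "v \<in> L2 X"
 shows "helmholtz X v \<in> gradients_perp X"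
  "!!z. z \<in> gradients_perp X ==> L2inner X (%x. v x - helmholtz X v x) z = 0"
proof -
 have "\<exists>w\<in>gradients_perp X. \<forall>z\<in>gradients_perp X. L2inner X (%x. v x - w x) z = 0"
 proof (rule L2_projection_exists[OF dl _ _ _ _ _ v])
  show "gradients_perp X \<subseteq> L2 X" by (auto simp: gradients_perp_def)
  have "(%x. 0) \<in> gradients_perp X" by (simp add: gradients_perp_def L2_zero L2inner_def)
  then show "gradients_perp X ~= {}" by blast
  show "(%x. f x + g x) \<in> gradients_perp X" if "f \<in> gradients_perp X" "g \<in> gradients_perp X" for f g
   using that by (simp add: gradients_perp_def L2_add L2inner_add_left grad_L2)
  show "(%x. c *\<^sub>R f x) \<in> gradients_perp X" if "f \<in> gradients_perp X" for f c
   using that by (simp add: gradients_perp_def L2_scaleR L2inner_scaleR_left)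
  show "g \<in> gradients_perp X" if f: "!!n. f n \<in> gradients_perp X" and g: "g \<in> L2 X"
   and lim: "(%n. L2norm X (%x. f n x - g x)) ----> 0" for f :: "nat => real^'n => real^'n" and g
  proof -
   have "L2inner X g (grad X \<phi>) = 0" if "\<phi> \<in> H1 X" for \<phi>
   proof -
    have "(%n. L2inner X (f n) (grad X \<phi>)) ----> L2inner X g (grad X \<phi>)"
     by (rule L2_tendsto_inner[OF _ g grad_L2[OF that] lim]) (use f in \<open>simp add: gradients_perp_def\<close>)
    moreover have "(%n. L2inner X (f n) (grad X \<phi>)) = (%n. 0)"
     using f that by (auto simp: gradients_perp_def)
    ultimately have "(%n::nat. 0) ----> L2inner X g (grad X \<phi>)" by (simp only:)
    from LIMSEQ_unique[OF this tendsto_const] show ?thesis .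
   qed
   with g show ?thesis by (simp add: gradients_perp_def)
  qed
 qed
 then have "\<exists>w. w \<in> gradients_perp X & (\<forall>z\<in>gradients_perp X. L2inner X (%x. v x - w x) z = 0)"
  by blast
 from someI_ex[OF this]
 show "helmholtz X v \<in> gradients_perp X"
  "!!z. z \<in> gradients_perp X ==> L2inner X (%x. v x - helmholtz X v x) z = 0"
  unfolding helmholtz_def by blast+
qed

lemma gradients_perp_L2: "w \<in> gradients_perp X ==> w \<in> L2 X"
 by (simp add: gradients_perp_def)

lemma helmholtz_L2: "v \<in> L2 X ==> helmholtz X v \<in> L2 X"
 using helmholtz_works(1) gradients_perp_L2 by blast

lemma helmholtz_norm:
 assumes v: "v \<in> L2 X"
 shows "L2norm X (helmholtz X v) <= L2norm X v"
proof -
 let ?w = "helmholtz X v"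
 have "L2inner X (%x. v x - ?w x) ?w = 0"
  using helmholtz_works[OF v] by blast
 then have "L2inner X v ?w = (L2norm X ?w)^2"
  using v helmholtz_L2[OF v] by (simp add: L2inner_diff_left L2inner_self)
 moreover have "\<bar>L2inner X v ?w\<bar> <= L2norm X v * L2norm X ?w"
  by (rule L2_Cauchy_Schwarz[OF v helmholtz_L2[OF v]])
 ultimately have "L2norm X ?w * L2norm X ?w <= L2norm X v * L2norm X ?w"
  by (simp add: power2_eq_square)
 then show ?thesis
  by (cases "L2norm X ?w = 0") (auto simp: mult_le_cancel_right less_le)
qed

text \<open>The field is divergence free with compact support, hence orthogonal to every gradient:
  both terms turn into the same mixed derivative of \<phi>. Whatever is orthogonal to
  \<open>gradients_perp\<close> can be tested with it, and the result is the vanishing of a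
  component of the curl.\<close>

lemma curl_free_test_field:
 assumes \<phi>: "test_function X \<phi>"
 shows "(%x. partial j \<phi> x *\<^sub>R axis i 1 - partial i \<phi> x *\<^sub>R axis j 1) \<in> gradients_perp X"
  (is "?a \<in> _")
proof -
 have L: "partial j \<phi> \<in> L2 X" for j
  using kcd_L2[OF dl bd smooth_partial[of \<phi> 0]] test_function_kcd[OF \<phi>] by blast
 have a: "?a \<in> L2 X"
  by (rule L2_vecI) (auto simp: axis_def intro!: L2_diff L2_uminus L2_cmult[OF L] L2_zero L split: if_splits)
 moreover have "L2inner X ?a (grad X \<psi>) = 0" if \<psi>: "\<psi> \<in> H1 X" for \<psi>
 proof -
  note C = test_function_Cc[OF test_function_partial[OF \<phi>], of 1]
  have "L2inner X ?a (grad X \<psi>)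
   = (LINT x|leb X. wpartial X i \<psi> x * partial j \<phi> x - wpartial X j \<psi> x * partial i \<phi> x)"
   unfolding L2inner_def
   by (simp add: inner_diff_left inner_commute[of "axis _ _"] inner_axis grad_def mult.commute)
  also have "... = (LINT x|leb X. wpartial X i \<psi> x * partial j \<phi> x) - (LINT x|leb X. wpartial X j \<psi> x * partial i \<phi> x)"
   by (rule lint_diff) (intro L2_mult_integrable H1_L2[OF \<psi>] L)+
  also have "... = - (LINT x|leb X. \<psi> x * partial i (partial j \<phi>) x) + (LINT x|leb X. \<psi> x * partial j (partial i \<phi>) x)"
   using wdT_D(3)[OF H1_wd[OF \<psi>] C] by simp
  also have "... = 0"
   by (simp add: partial_commute[OF test_function_kcd[OF \<phi>], of i j])
  finally show ?thesis .
 qed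
 ultimately show ?thesis by (simp add: gradients_perp_def)
qed

lemma harmonic_fieldI:
 assumes G: "G \<in> L2 X" and perp: "!!z. z \<in> gradients_perp X ==> L2inner X G z = 0"
  and div: "!!\<phi>. test_function X \<phi> ==> (SUM i. LINT x|leb X. G x $ i * partial i \<phi> x) = 0"
 shows "harmonic_field X G"
 unfolding harmonic_field_def
proof (intro conjI allI impI G div)
 fix \<phi> i j assume \<phi>: "test_function X \<phi>"
 have L: "partial j \<phi> \<in> L2 X" for j
  using kcd_L2[OF dl bd smooth_partial[of \<phi> 0]] test_function_kcd[OF \<phi>] by blast
 have "0 = L2inner X G (%x. partial j \<phi> x *\<^sub>R axis i 1 - partial i \<phi> x *\<^sub>R axis j 1)"
  using perp[OF curl_free_test_field[OF \<phi>]] by simp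
 also have "... = (LINT x|leb X. G x $ i * partial j \<phi> x - G x $ j * partial i \<phi> x)"
  unfolding L2inner_def by (simp add: inner_diff_right inner_axis mult.commute)
 also have "... = (LINT x|leb X. G x $ i * partial j \<phi> x) - (LINT x|leb X. G x $ j * partial i \<phi> x)"
  by (rule lint_diff) (intro L2_mult_integrable L2_component[OF G] L)+
 finally show "(LINT x|leb X. G x $ i * partial j \<phi> x) = (LINT x|leb X. G x $ j * partial i \<phi> x)"
  by simp
qed auto

end

section \<open>Fields tangential to the boundary\<close>

text \<open>
 Interior points have charts too, with \<open>\<rho>\<close> an affine function that is positive on the ball.
\<close>

definition chart :: "(real^'n) set => real^'n => real => (real^'n => real) => real^'n => bool" where
 "chart X c r \<rho> e \<longleftrightarrow> r > 0 & kcd 3 \<rho> & norm e = 1 & (\<forall>x\<in>ball c r. x \<in> X \<longleftrightarrow> \<rho> x > 0) &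
   (\<forall>x t. \<rho> (x + t *\<^sub>R e) = \<rho> x + t)"

lemma smooth_step_deriv:
 obtains s' B where "!!t. (smooth_step has_real_derivative s' t) (at t)" "B > 0" "!!t. \<bar>s' t\<bar> <= B"
  "!!t. t < 0 \<or> t > 1 ==> s' t = 0"
proof -
 define s' where "s' t = frechet_derivative smooth_step (at t) 1" for t :: real
 have d: "(smooth_step has_real_derivative s' t) (at t)" for t
 proof -
  have h: "(smooth_step has_derivative frechet_derivative smooth_step (at t)) (at t)"
   using kcd_has_derivative[OF kcd_smooth_step[of 1]] by simp
  have "frechet_derivative smooth_step (at t) h = s' t * h" for h
   using linear_scale[OF has_derivative_linear[OF h], of h 1] by (simp add: s'_def)
  then have "frechet_derivative smooth_step (at t) = (%h. s' t * h)" by blast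
  with h show ?thesis unfolding has_field_derivative_def by simp
 qed
 have z: "s' t = 0" if "t < 0 \<or> t > 1" for t
 proof -
  have "\<exists>c. ((%_. c) has_real_derivative s' t) (at t)"
  proof (cases "t < 0")
   case True
   have "((%_. 0) has_real_derivative s' t) (at t)"
    by (rule has_field_derivative_transform_within_open[OF d, where S="{..<0}"])
     (use True in \<open>auto simp: smooth_step_0\<close>)
   then show ?thesis by blast
  next
   case False
   have "((%_. 1) has_real_derivative s' t) (at t)"
    by (rule has_field_derivative_transform_within_open[OF d, where S="{1<..}"])
     (use False that in \<open>auto simp: smooth_step_1\<close>)
   then show ?thesis by blast
  qed
  then show ?thesis using DERIV_const DERIV_unique by blast
 qed
 have "continuous_on {0..1} s'"
 proof -
  have "kcd 1 smooth_step" by (rule kcd_smooth_step)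
  then have "kcd 0 (%t. frechet_derivative smooth_step (at t) 1)"
   using k_times_cont_diff.simps(2)[of 0 smooth_step] by simp
  then show ?thesis unfolding s'_def by (rule kcd_continuous)
 qed
 then have "bounded (s' ` {0..1})" by (intro compact_imp_bounded compact_continuous_image) auto
 then obtain B where B: "B > 0" "!!t. t \<in> {0..1} ==> \<bar>s' t\<bar> <= B" unfolding bounded_pos by auto
 have "\<bar>s' t\<bar> <= B" for t
  using B z[of t] by (cases "t \<in> {0..1}") auto
 with d z B(1) show ?thesis by (intro that[of s' B])
qed

text \<open>The cut-off \<eta> n is a smooth step of n \<rho> - 1: it is 0 where n \<rho> \<le> 1
  and 1 where n \<rho> \<ge> 2. Its derivative has size n but lives where \<rho> \<le> 2/n, so
  \<eta>' \<rho> is bounded uniformly in n. Against any factor of size O(\<rho>) the commutator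
  terms are therefore dominated, and at each point of the domain they are eventually zero.\<close>

lemma chart_cutoff:
 assumes ch: "chart X c r \<rho> e"
 obtains \<eta> \<eta>' :: "nat => real^'n => real" and B where
  "!!n. kcd 3 (\<eta> n)" "!!n i x. partial i (\<eta> n) x = \<eta>' n x * partial i \<rho> x"
  "!!n x. 0 <= \<eta> n x" "!!n x. \<eta> n x <= 1" "!!x. \<rho> x > 0 ==> (%n. \<eta> n x) ----> 1"
  "B > 0" "!!n x. \<rho> x > 0 ==> \<bar>\<eta>' n x\<bar> * \<rho> x <= B" "!!x. \<rho> x > 0 ==> eventually (%n. \<eta>' n x = 0) sequentially"
  "!!n k a K. k <= 3 ==> kcd k a ==> compact K ==> K \<subseteq> ball c r ==> (!!x. x \<notin> K ==> a x = 0) ==> Cc k X (%x. \<eta> n x * a x)"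
  "!!n. continuous_on UNIV (\<eta>' n)"
proof -
 have \<rho>: "kcd 3 \<rho>" and in_dom: "!!x. x \<in> ball c r ==> x \<in> X \<longleftrightarrow> \<rho> x > 0"
  using ch by (auto simp: chart_def)
 obtain s' B where s': "!!t. (smooth_step has_real_derivative s' t) (at t)" "B > 0" "!!t. \<bar>s' t\<bar> <= B"
  "!!t. t < 0 \<or> t > 1 ==> s' t = 0" using smooth_step_deriv by blast
 define \<eta> where "\<eta> n x = smooth_step (real n * \<rho> x - 1)" for n :: nat and x
 define \<eta>' where "\<eta>' n x = s' (real n * \<rho> x - 1) * real n" for n :: nat and x
 have inner: "kcd 3 (%x. real n * \<rho> x - 1)" for n by (intro kcd_diff kcd_mult kcd_const \<rho>)
 have k1: "kcd 1 (%x. real n * \<rho> x - 1)" for n by (rule kcd_mono[OF inner]) simp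
 have \<rho>1: "kcd 1 \<rho>" by (rule kcd_mono[OF \<rho>]) simp
 have big: "eventually (%n. real n * \<rho> x - 1 > 1) sequentially" if "\<rho> x > 0" for x
 proof -
  obtain N :: nat where N: "real N > 2 / \<rho> x" using reals_Archimedean2 by blast
  show ?thesis using eventually_ge_at_top[of N]
  proof eventually_elim
   case (elim n)
   then have "real n > 2 / \<rho> x" using N by linarith
   then show ?case using that by (simp add: field_simps)
  qed
 qed
 show ?thesis
 proof (rule that[of \<eta> \<eta>' "2 * B"])
  show "kcd 3 (\<eta> n)" for n unfolding \<eta>_def by (rule kcd_compose_real[OF kcd_smooth_step inner])
  show "partial i (\<eta> n) x = \<eta>' n x * partial i \<rho> x" for n i x
  proof -
   have "partial i (\<eta> n) x = s' (real n * \<rho> x - 1) * partial i (%x. real n * \<rho> x - 1) x"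
    unfolding \<eta>_def by (rule partial_compose_real[OF s'(1) k1])
   also have "partial i (%x. real n * \<rho> x - 1) x = real n * partial i \<rho> x"
    using partial_diff[OF kcd_mult[OF kcd_const \<rho>1] kcd_const, of i "real n" 1 x] partial_cmult[OF \<rho>1, of i "real n" x]
    by simp
   finally show ?thesis by (simp add: \<eta>'_def)
  qed
  show "0 <= \<eta> n x" "\<eta> n x <= 1" for n x by (auto simp: \<eta>_def smooth_step_bounds)
  show "(%n. \<eta> n x) ----> 1" if "\<rho> x > 0" for x
   by (rule tendsto_eventually) (use big[OF that] in \<open>eventually_elim, simp add: \<eta>_def smooth_step_1\<close>)
  show "2 * B > 0" using s'(2) by simp
  show "\<bar>\<eta>' n x\<bar> * \<rho> x <= 2 * B" if "\<rho> x > 0" for n x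
  proof (cases "real n * \<rho> x - 1 > 1")
   case True
   then show ?thesis using s'(2,4) by (simp add: \<eta>'_def)
  next
   case False
   have "\<bar>\<eta>' n x\<bar> * \<rho> x = \<bar>s' (real n * \<rho> x - 1)\<bar> * (real n * \<rho> x)"
    by (simp add: \<eta>'_def abs_mult)
   also have "... <= B * 2" using False s' that by (intro mult_mono) auto
   finally show ?thesis by simp
  qed
  show "eventually (%n. \<eta>' n x = 0) sequentially" if "\<rho> x > 0" for x
   using big[OF that] by eventually_elim (simp add: \<eta>'_def s'(4))
  show "Cc k X (%x. \<eta> n x * a x)"
   if a: "k <= 3" "kcd k a" "compact K" "K \<subseteq> ball c r" "!!x. x \<notin> K ==> a x = 0" for n k a K
  proof (rule CcI[where K="K \<inter> {x. real n * \<rho> x >= 1}"])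
   show "kcd k (%x. \<eta> n x * a x)"
    unfolding \<eta>_def by (intro kcd_mult a(2) kcd_mono[OF kcd_compose_real[OF kcd_smooth_step inner] a(1)])
   have "closed {x. real n * \<rho> x >= 1}"
    by (intro closed_Collect_le continuous_on_mult continuous_on_const kcd_continuous[OF \<rho>])
   then show "compact (K \<inter> {x. real n * \<rho> x >= 1})" by (rule compact_Int_closed[OF a(3)])
   show "K \<inter> {x. real n * \<rho> x >= 1} \<subseteq> X"
   proof
    fix x assume x: "x \<in> K \<inter> {x. real n * \<rho> x >= 1}"
    then have "real n * \<rho> x > 0" by simp
    then have "\<rho> x > 0" by (simp add: zero_less_mult_iff)
    then show "x \<in> X" using x a(4) in_dom by blast
   qed
   show "\<eta> n x * a x = 0" if "x \<notin> K \<inter> {x. real n * \<rho> x >= 1}" for x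
    using that a(5)[of x] by (auto simp: \<eta>_def smooth_step_0)
  qed
  show "continuous_on UNIV (\<eta>' n)" for n
  proof -
   have "\<eta>' n = (%x. frechet_derivative smooth_step (at (real n * \<rho> x - 1)) 1 * real n)"
   proof
    fix x
    have "frechet_derivative smooth_step (at (real n * \<rho> x - 1)) = (*) (s' (real n * \<rho> x - 1))"
     using s'(1)[of "real n * \<rho> x - 1"] unfolding has_field_derivative_def
     by (rule frechet_derivative_at[symmetric])
    then show "\<eta>' n x = frechet_derivative smooth_step (at (real n * \<rho> x - 1)) 1 * real n"
     by (simp add: \<eta>'_def)
   qed
   moreover have "kcd 0 (%t. frechet_derivative smooth_step (at t) 1)"
    using k_times_cont_diff.simps(2)[of 0 smooth_step] kcd_smooth_step[of 1] by simp
   then have "continuous_on UNIV (%t. frechet_derivative smooth_step (at t) 1)" by simp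
   ultimately show ?thesis
    by (auto intro!: continuous_on_mult continuous_on_const
      continuous_on_compose2[of UNIV "%t. frechet_derivative smooth_step (at t) 1"]
      continuous_on_diff kcd_continuous[OF \<rho>])
  qed
 qed
qed

context
 fixes X :: "(real^'n) set"
 assumes op: "open X" and bd: "bounded X"
begin

lemma int_L2: "f \<in> L2 X ==> integrable (leb X) (f :: real^'n => real)"
 by (rule L2_integrable[OF dom_lmeasurable[OF op bd]])

text \<open>There is no flux through the boundary, since \<open>\<tau>\<close> is tangential up to \<open>O(\<rho>)\<close>.\<close>

lemma noflux:
 assumes ch: "chart X c r \<rho> e" and K: "compact K" "K \<subseteq> ball c r"
  and \<tau>: "!!j. kcd 1 (\<tau> j)" "!!j x. x \<notin> K ==> \<tau> j x = 0"
  and C: "!!x. x \<in> X ==> x \<in> K ==> \<bar>SUM j. \<tau> j x * partial j \<rho> x\<bar> <= C * \<rho> x"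
  and f: "!!j. wd X j f (g j)"
 shows "(SUM j. LINT x|leb X. \<tau> j x * g j x) = - (SUM j. LINT x|leb X. partial j (\<tau> j) x * f x)"
proof -
 have in_dom: "!!x. x \<in> ball c r ==> x \<in> X \<longleftrightarrow> \<rho> x > 0" and \<rho>: "kcd 3 \<rho>"
  using ch by (auto simp: chart_def)
 obtain \<eta> \<eta>' B where \<eta>: "!!n. kcd 3 (\<eta> n)" "!!n i x. partial i (\<eta> n) x = \<eta>' n x * partial i \<rho> x"
  "!!n x. 0 <= \<eta> n x" "!!n x. \<eta> n x <= 1" "!!x. \<rho> x > 0 ==> (%n. \<eta> n x) ----> 1"
  "B > 0" "!!n x. \<rho> x > 0 ==> \<bar>\<eta>' n x\<bar> * \<rho> x <= B" "!!x. \<rho> x > 0 ==> eventually (%n. \<eta>' n x = 0) sequentially"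
  "!!n k a K. k <= 3 ==> kcd k a ==> compact K ==> K \<subseteq> ball c r ==> (!!x. x \<notin> K ==> a x = 0) ==> Cc k X (%x. \<eta> n x * a x)"
  "!!n. continuous_on UNIV (\<eta>' n)"
  using chart_cutoff[OF ch] by blast
 have \<eta>1: "kcd 1 (\<eta> n)" for n by (rule kcd_mono[OF \<eta>(1)]) simp
 have fL: "f \<in> L2 X" and gL: "!!j. g j \<in> L2 X" using wdT_D(1,2)[OF f] by blast+
 have \<tau>0: "kcd 0 (partial j (\<tau> j))" for j using kcd_partial'[OF \<tau>(1), of 0] by simp
 have ptl: "partial j (%x. \<eta> n x * \<tau> j x) x = \<eta> n x * partial j (\<tau> j) x + \<eta>' n x * (\<tau> j x * partial j \<rho> x)" for n j x
  by (simp add: partial_mult[OF \<eta>1 \<tau>(1)] \<eta>(2))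
 \<comment> \<open>The contribution of the derivative of the cut-off. Tangentiality of \<tau> up to
   O(\<rho>) bounds it by a multiple of |f|, so it disappears by dominated convergence.\<close>
 define Q where "Q n x = \<eta>' n x * (SUM j. \<tau> j x * partial j \<rho> x) * f x" for n x
 have i\<eta>D: "integrable (leb X) (%x. \<eta> n x * (partial j (\<tau> j) x * f x))" for n j
  by (rule int_L2[OF L2_kcd_mult[OF bd \<eta>1 L2_kcd_mult[OF bd \<tau>0 fL]]])
 have kc: "kcd 0 (\<eta>' n)" for n using \<eta>(10) by simp
 have \<rho>0: "kcd 0 (partial j \<rho>)" for j using kcd_partial'[OF \<rho>, of 0] by simp
 have \<tau>k0: "kcd 0 (\<tau> j)" for j using kcd_mono[OF \<tau>(1), of 0] by simp
 have kQ: "kcd 0 (%x. \<eta>' n x * (\<tau> j x * partial j \<rho> x))" for n j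
  by (intro kcd_mult kc \<rho>0 \<tau>k0)
 have iQ: "integrable (leb X) (%x. \<eta>' n x * (\<tau> j x * partial j \<rho> x) * f x)" for n j
  by (rule int_L2[OF L2_kcd_mult[OF bd kQ fL]])
 have id: "(SUM j. LINT x|leb X. \<eta> n x * (partial j (\<tau> j) x * f x)) + (LINT x|leb X. Q n x)
   = - (SUM j. LINT x|leb X. \<eta> n x * (\<tau> j x * g j x))" for n
 proof -
  have "(LINT x|leb X. \<eta> n x * (partial j (\<tau> j) x * f x)) + (LINT x|leb X. \<eta>' n x * (\<tau> j x * partial j \<rho> x) * f x)
    = - (LINT x|leb X. \<eta> n x * (\<tau> j x * g j x))" for j
  proof -
   have c: "Cc 1 X (%x. \<eta> n x * \<tau> j x)" by (rule \<eta>(9)[OF _ \<tau>(1) K \<tau>(2)]) simp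
   have "(LINT x|leb X. \<eta> n x * (partial j (\<tau> j) x * f x)) + (LINT x|leb X. \<eta>' n x * (\<tau> j x * partial j \<rho> x) * f x)
    = (LINT x|leb X. f x * partial j (%x. \<eta> n x * \<tau> j x) x)"
    unfolding ptl by (subst lint_add[OF i\<eta>D iQ, symmetric]) (simp add: algebra_simps)
   also have "... = - (LINT x|leb X. g j x * (\<eta> n x * \<tau> j x))" by (rule wdT_D(3)[OF f c])
   finally show ?thesis by (simp add: mult_ac)
  qed
  then have "(SUM j. (LINT x|leb X. \<eta> n x * (partial j (\<tau> j) x * f x)) + (LINT x|leb X. \<eta>' n x * (\<tau> j x * partial j \<rho> x) * f x))
    = (SUM j. - (LINT x|leb X. \<eta> n x * (\<tau> j x * g j x)))" by simp
  moreover have "(LINT x|leb X. Q n x) = (SUM j. LINT x|leb X. \<eta>' n x * (\<tau> j x * partial j \<rho> x) * f x)"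
   unfolding Q_def sum_distrib_left sum_distrib_right by (rule lint_sum[OF iQ])
  ultimately show ?thesis by (simp add: sum.distrib sum_negf)
 qed
 have pos: "\<rho> x > 0" if "x \<in> X" "x \<in> K" for x using in_dom that K(2) by blast
 have lim\<eta>: "(%n. LINT x|leb X. \<eta> n x * (a x * h x)) ----> (LINT x|leb X. a x * h x)"
  if a: "!!x. x \<notin> K ==> a x = 0" "kcd 0 a" "h \<in> L2 X" for a h
 proof (rule integral_dominated_convergence)
  have ia: "integrable (leb X) (%x. a x * h x)" by (rule int_L2[OF L2_kcd_mult[OF bd a(2,3)]])
  then show "integrable (leb X) (%x. \<bar>a x * h x\<bar>)" by (rule integrable_abs)
  show "(%x. a x * h x) \<in> meas X" using ia by (rule borel_measurable_integrable)
  show "(%x. \<eta> n x * (a x * h x)) \<in> meas X" for n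
   by (intro borel_measurable_times[OF kcd_measurable[OF \<eta>1]] borel_measurable_integrable[OF ia])
  show "AE x in leb X. norm (\<eta> n x * (a x * h x)) <= \<bar>a x * h x\<bar>" for n
   using \<eta>(3,4) by (intro AE_I2) (simp add: abs_mult mult_left_le_one_le)
  show "AE x in leb X. (%n. \<eta> n x * (a x * h x)) ----> a x * h x"
  proof (rule AE_I2)
   fix x assume x: "x \<in> space (leb X)"
   show "(%n. \<eta> n x * (a x * h x)) ----> a x * h x"
   proof (cases "x \<in> K")
    case True
    then have "\<rho> x > 0" using x pos by simp
    from tendsto_mult_right[OF \<eta>(5)[OF this], of "a x * h x"] show ?thesis by simp
   qed (simp add: a)
  qed
 qed
 have limQ: "(%n. LINT x|leb X. Q n x) ----> (LINT x|leb X. 0)"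
 proof (rule integral_dominated_convergence)
  show "integrable (leb X) (%x. (\<bar>C\<bar> * B) * \<bar>f x\<bar>)"
   by (intro integrable_mult_right integrable_abs int_L2 fL)
  show "(%x. Q n x) \<in> meas X" for n
   unfolding Q_def by (intro borel_measurable_times L2D(1)[OF fL] borel_measurable_sum kcd_measurable[OF kc] kcd_measurable[OF \<tau>(1)] kcd_measurable[OF \<rho>0])
  show "AE x in leb X. norm (Q n x) <= (\<bar>C\<bar> * B) * \<bar>f x\<bar>" for n
  proof (rule AE_I2)
   fix x assume x: "x \<in> space (leb X)"
   show "norm (Q n x) <= (\<bar>C\<bar> * B) * \<bar>f x\<bar>"
   proof (cases "x \<in> K")
    case True
    then have p: "\<rho> x > 0" using x pos by simp
    have "\<bar>\<eta>' n x\<bar> * \<bar>SUM j. \<tau> j x * partial j \<rho> x\<bar> <= \<bar>\<eta>' n x\<bar> * (\<bar>C\<bar> * \<rho> x)"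
    proof (rule mult_left_mono)
     have "C * \<rho> x <= \<bar>C\<bar> * \<rho> x" using p by (intro mult_right_mono) auto
     then show "\<bar>SUM j. \<tau> j x * partial j \<rho> x\<bar> <= \<bar>C\<bar> * \<rho> x" using C[of x] x True by simp
    qed simp
    also have "... = \<bar>C\<bar> * (\<bar>\<eta>' n x\<bar> * \<rho> x)" by simp
    also have "... <= \<bar>C\<bar> * B" using \<eta>(7)[OF p] by (intro mult_left_mono) auto
    finally have "\<bar>\<eta>' n x\<bar> * \<bar>SUM j. \<tau> j x * partial j \<rho> x\<bar> * \<bar>f x\<bar> <= (\<bar>C\<bar> * B) * \<bar>f x\<bar>"
     by (rule mult_right_mono) simp
    then show ?thesis by (simp add: Q_def abs_mult)
   next
    case False
    then show ?thesis using \<eta>(6) by (simp add: Q_def \<tau>(2))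
   qed
  qed
  show "AE x in leb X. (%n. Q n x) ----> 0"
  proof (rule AE_I2)
   fix x assume x: "x \<in> space (leb X)"
   show "(%n. Q n x) ----> 0"
   proof (cases "x \<in> K")
    case True
    then have p: "\<rho> x > 0" using x pos by simp
    show ?thesis by (rule tendsto_eventually) (use \<eta>(8)[OF p] in \<open>eventually_elim, simp add: Q_def\<close>)
   qed (simp add: Q_def \<tau>(2))
  qed
 qed simp
 have "(%n. (SUM j. LINT x|leb X. \<eta> n x * (partial j (\<tau> j) x * f x)) + (LINT x|leb X. Q n x))
   ----> (SUM j. LINT x|leb X. partial j (\<tau> j) x * f x) + (LINT x|leb X. 0)"
  by (intro tendsto_add tendsto_sum lim\<eta> limQ \<tau>0 fL partial_outside_support[OF K(1)] \<tau>(2))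
 moreover have "(%n. - (SUM j. LINT x|leb X. \<eta> n x * (\<tau> j x * g j x)))
   ----> - (SUM j. LINT x|leb X. \<tau> j x * g j x)"
  by (intro tendsto_minus tendsto_sum lim\<eta> \<tau>(2) \<tau>k0 gL)
 ultimately show ?thesis
  unfolding id using LIMSEQ_unique by fastforce
qed

end

context
 fixes X :: "(real^'n) set"
 assumes op: "open X" and bd: "bounded X"
begin

text \<open>Tangential derivatives of a function vanishing on the boundary vanish there as well.\<close>

lemma tangential_wd0:
 assumes ch: "chart X c r \<rho> e" and K: "compact K" "K \<subseteq> ball c r"
  and \<tau>: "!!j. kcd 2 (\<tau> j)" "!!j x. x \<notin> K ==> \<tau> j x = 0"
  and C: "!!x. x \<in> X ==> x \<in> K ==> \<bar>SUM j. \<tau> j x * partial j \<rho> x\<bar> <= C * \<rho> x"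
  and v: "!!j. wd0 X j v (D j)" and D: "!!j l. wd X l (D j) (E l j)"
 shows "wd0 X l (%x. SUM j. \<tau> j x * D j x) (%x. SUM j. (partial l (\<tau> j) x * D j x + \<tau> j x * E l j x))"
proof (rule wd0_smoothI[OF op bd])
 have \<tau>1: "kcd 1 (\<tau> j)" and \<tau>p: "kcd 1 (partial l (\<tau> j))" for j l
  using \<tau>(1) by (auto intro: kcd_mono[of 2] kcd_partial'[of 2])
 have vL: "v \<in> L2 X" and DL: "!!j. D j \<in> L2 X" and EL: "!!l j. E l j \<in> L2 X"
  using wdT_D(1,2)[OF v] wdT_D(2)[OF D] by blast+
 show "(%x. SUM j. \<tau> j x * D j x) \<in> L2 X"
  by (intro L2_sum L2_kcd_mult[OF bd \<tau>1] DL)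
 show "(%x. SUM j. (partial l (\<tau> j) x * D j x + \<tau> j x * E l j x)) \<in> L2 X"
  by (intro L2_sum L2_add L2_kcd_mult[OF bd \<tau>1] L2_kcd_mult[OF bd \<tau>p] DL EL)
 fix \<psi> :: "real^'n => real" assume \<psi>: "test_function UNIV \<psi>"
 note k\<psi> = test_function_kcd[OF \<psi>]
 have p\<psi>: "kcd k (partial l \<psi>)" for k l by (rule smooth_partial[OF k\<psi>])
 have t\<psi>: "kcd 2 (%x. \<tau> j x * \<psi> x)" for j by (intro kcd_mult \<tau>(1) k\<psi>)
 have t\<psi>1: "kcd 1 (%x. \<tau> j x * \<psi> x)" for j by (intro kcd_mult \<tau>1 k\<psi>)
 have A: "(LINT x|leb X. (\<tau> j x * D j x) * partial l \<psi> x)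
   = - (LINT x|leb X. v x * partial j (%x. \<tau> j x * partial l \<psi> x) x)" for j
  using wdT_D(3)[OF v[of j] kcd_mult[OF \<tau>1[of j] p\<psi>[of 1 l]]] by (simp add: mult_ac)
 have B: "(LINT x|leb X. (partial l (\<tau> j) x * D j x) * \<psi> x)
   = - (LINT x|leb X. v x * partial j (%x. partial l (\<tau> j) x * \<psi> x) x)" for j
  using wdT_D(3)[OF v[of j] kcd_mult[OF \<tau>p[of l j] k\<psi>[of 1]]] by (simp add: mult_ac)
 have comm: "AE x in leb X. E l j x = E j l x" for j
  by (rule wd_commute[OF op bd wd0_imp_wd[OF v] wd0_imp_wd[OF v] D D])
 obtain M where M: "M > 0" "!!x. \<bar>\<psi> x\<bar> <= M" using Cc_bounded[OF test_function_Cc[OF \<psi>, of 0]] by blast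
 \<comment> \<open>The derivative \<open>D l\<close> need not vanish on the boundary, so this
   integration by parts is the one for which \<tau> has to be tangential. The others only move
   derivatives off \<open>v\<close>, which vanishes there. Interchanging \<open>l\<close> and
   \<open>j\<close> in \<open>E\<close> is what brings a divergence along \<tau> into play.\<close>
 have "(SUM j. LINT x|leb X. (\<tau> j x * \<psi> x) * E j l x)
   = - (SUM j. LINT x|leb X. partial j (%x. \<tau> j x * \<psi> x) x * D l x)"
 proof (rule noflux[OF op bd ch K t\<psi>1 _ _ D])
  show "\<tau> j x * \<psi> x = 0" if "x \<notin> K" for j x using \<tau>(2)[OF that] by simp
  show "\<bar>SUM j. \<tau> j x * \<psi> x * partial j \<rho> x\<bar> <= (M * \<bar>C\<bar>) * \<rho> x" if "x \<in> X" "x \<in> K" for x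
  proof -
   have "\<rho> x > 0" using ch that K(2) unfolding chart_def by blast
   then have "C * \<rho> x <= \<bar>C\<bar> * \<rho> x" by (intro mult_right_mono) auto
   then have "\<bar>SUM j. \<tau> j x * partial j \<rho> x\<bar> <= \<bar>C\<bar> * \<rho> x" using C[OF that] by simp
   then have "\<bar>\<psi> x\<bar> * \<bar>SUM j. \<tau> j x * partial j \<rho> x\<bar> <= M * (\<bar>C\<bar> * \<rho> x)"
    using M by (intro mult_mono) auto
   moreover have "(SUM j. \<tau> j x * \<psi> x * partial j \<rho> x) = \<psi> x * (SUM j. \<tau> j x * partial j \<rho> x)"
    by (simp add: sum_distrib_left mult_ac)
   ultimately show ?thesis by (simp add: abs_mult)
  qed
 qed
 also have "... = (SUM j. LINT x|leb X. v x * partial l (partial j (%x. \<tau> j x * \<psi> x)) x)"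
 proof -
  have "(LINT x|leb X. v x * partial l (partial j (%x. \<tau> j x * \<psi> x)) x)
    = - (LINT x|leb X. D l x * partial j (%x. \<tau> j x * \<psi> x) x)" for j
   by (rule wdT_D(3)[OF v[of l]], rule kcd_partial'[OF t\<psi>]) simp
  then show ?thesis by (simp add: sum_negf mult.commute)
 qed
 finally have E1: "(SUM j. LINT x|leb X. (\<tau> j x * \<psi> x) * E j l x)
   = (SUM j. LINT x|leb X. v x * partial l (partial j (%x. \<tau> j x * \<psi> x)) x)" .
 have E2: "(LINT x|leb X. (\<tau> j x * \<psi> x) * E j l x) = (LINT x|leb X. (\<tau> j x * E l j x) * \<psi> x)" for j
 proof (rule integral_cong_AE)
  show "AE x in leb X. (\<tau> j x * \<psi> x) * E j l x = (\<tau> j x * E l j x) * \<psi> x"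
   using comm[of j] by eventually_elim simp
 qed (intro borel_measurable_times kcd_measurable[OF \<tau>1] kcd_measurable[OF k\<psi>[of 1]] L2D(1)[OF EL])+
 have pt: "- partial j (%x. \<tau> j x * partial l \<psi> x) x = partial j (%x. partial l (\<tau> j) x * \<psi> x) x
   - partial l (partial j (%x. \<tau> j x * \<psi> x)) x" for j x
 proof -
  have "partial l (partial j (%x. \<tau> j x * \<psi> x)) x = partial j (partial l (%x. \<tau> j x * \<psi> x)) x"
   by (rule partial_commute[OF t\<psi>])
  also have "partial l (%x. \<tau> j x * \<psi> x) = (%x. partial l (\<tau> j) x * \<psi> x + \<tau> j x * partial l \<psi> x)"
   by (rule ext, rule partial_mult[OF \<tau>1 k\<psi>])
  also have "partial j (%x. partial l (\<tau> j) x * \<psi> x + \<tau> j x * partial l \<psi> x) x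
    = partial j (%x. partial l (\<tau> j) x * \<psi> x) x + partial j (%x. \<tau> j x * partial l \<psi> x) x"
   by (rule partial_add[OF kcd_mult[OF \<tau>p k\<psi>] kcd_mult[OF \<tau>1 p\<psi>]])
  finally show ?thesis by simp
 qed
 have iv: "integrable (leb X) (%x. v x * a x)" if "kcd 0 a" for a
  by (rule L2_mult_integrable[OF vL kcd_L2[OF dom_lmeasurable[OF op bd] bd that]])
 have k1: "kcd 0 (partial j (%x. partial l (\<tau> j) x * \<psi> x))" for j
  by (rule kcd_partial'[OF kcd_mult[OF \<tau>p k\<psi>]]) simp
 have k2: "kcd 0 (partial l (partial j (%x. \<tau> j x * \<psi> x)))" for j
  by (rule kcd_partial'[OF kcd_partial'[OF t\<psi>, of 1], of 0]) simp_all
 have "(LINT x|leb X. (\<tau> j x * D j x) * partial l \<psi> x)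
   = (LINT x|leb X. v x * partial j (%x. partial l (\<tau> j) x * \<psi> x) x)
    - (LINT x|leb X. v x * partial l (partial j (%x. \<tau> j x * \<psi> x)) x)" for j
 proof -
  have "(LINT x|leb X. (\<tau> j x * D j x) * partial l \<psi> x)
    = (LINT x|leb X. v x * (- partial j (%x. \<tau> j x * partial l \<psi> x) x))"
   unfolding A by simp
  also have "... = (LINT x|leb X. v x * partial j (%x. partial l (\<tau> j) x * \<psi> x) x
    - v x * partial l (partial j (%x. \<tau> j x * \<psi> x)) x)"
   unfolding pt by (simp add: right_diff_distrib)
  finally show ?thesis by (simp only: lint_diff[OF iv[OF k1] iv[OF k2]])
 qed
 then have "(SUM j. LINT x|leb X. (\<tau> j x * D j x) * partial l \<psi> x)
   = - (SUM j. LINT x|leb X. (partial l (\<tau> j) x * D j x) * \<psi> x)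
    - (SUM j. LINT x|leb X. (\<tau> j x * E l j x) * \<psi> x)"
  unfolding E2[symmetric] E1 B by (simp add: sum_subtractf sum_negf)
 moreover have "(LINT x|leb X. (SUM j. \<tau> j x * D j x) * partial l \<psi> x)
   = (SUM j. LINT x|leb X. (\<tau> j x * D j x) * partial l \<psi> x)"
  unfolding sum_distrib_right
  by (intro lint_sum test_int_partial[OF op bd] L2_kcd_mult[OF bd \<tau>1] DL k\<psi>)
 moreover have "(LINT x|leb X. (SUM j. (partial l (\<tau> j) x * D j x + \<tau> j x * E l j x)) * \<psi> x)
   = (SUM j. LINT x|leb X. (partial l (\<tau> j) x * D j x) * \<psi> x)
    + (SUM j. LINT x|leb X. (\<tau> j x * E l j x) * \<psi> x)"
 proof -
  have i1: "integrable (leb X) (%x. (partial l (\<tau> j) x * D j x) * \<psi> x)"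
   and i2: "integrable (leb X) (%x. (\<tau> j x * E l j x) * \<psi> x)" for j
   by (rule test_int[OF op bd L2_kcd_mult[OF bd \<tau>p DL] k\<psi>[of 1]],
     rule test_int[OF op bd L2_kcd_mult[OF bd \<tau>1 EL] k\<psi>[of 1]])
  show ?thesis
   unfolding sum_distrib_right distrib_right
   by (subst lint_sum)
    (auto simp: i1 i2 sum.distrib intro!: lintegrable_add i1 i2)
 qed
 ultimately show "(LINT x|leb X. (SUM j. \<tau> j x * D j x) * partial l \<psi> x)
   = - (LINT x|leb X. (SUM j. (partial l (\<tau> j) x * D j x + \<tau> j x * E l j x)) * \<psi> x)"
  by simp
qed

lemma chart_closure_nonneg:
 assumes ch: "chart X c r \<rho> e" and x: "x \<in> closure X" "x \<in> ball c r"
 shows "\<rho> x >= 0"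
proof (rule ccontr)
 assume "\<not> \<rho> x >= 0"
 then have neg: "\<rho> x < 0" by simp
 have "continuous_on UNIV \<rho>" using ch kcd_continuous unfolding chart_def by blast
 then have "open {y. \<rho> y < 0}" by (intro open_Collect_less continuous_on_const)
 then have "open ({y. \<rho> y < 0} \<inter> ball c r)" by (intro open_Int) auto
 moreover have "x \<in> {y. \<rho> y < 0} \<inter> ball c r" using neg x by simp
 ultimately obtain y where "y \<in> X" "y \<in> {y. \<rho> y < 0} \<inter> ball c r"
  using x(1) unfolding closure_iff_nhds_not_empty by blast
 then show False using ch unfolding chart_def by force
qed

text \<open>Mollify with a kernel centred at a small multiple of \<open>e\<close>: this first pushes the support into \<open>X\<close>.\<close>

lemma wd0_approx:
 assumes ch: "chart X c r \<rho> e" and K: "compact K" "K \<subseteq> ball c r"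
  and q: "!!i. wd0 X i q (g i)" "!!x. x \<in> X ==> x \<notin> K ==> q x = 0"
 obtains \<Phi> where "!!n. test_function X (\<Phi> n)"
  "!!i. (%n. L2norm X (%x. partial i (\<Phi> n) x - g i x)) ----> 0"
proof -
 have r: "r > 0" and \<rho>: "kcd 3 \<rho>" and e: "norm e = 1" and in_dom: "!!x. x \<in> ball c r ==> x \<in> X \<longleftrightarrow> \<rho> x > 0"
  and shift: "!!x t. \<rho> (x + t *\<^sub>R e) = \<rho> x + t"
  using ch by (auto simp: chart_def)
 have qL: "q \<in> L2 X" and gL: "!!i. g i \<in> L2 X" using wdT_D(1,2)[OF q(1)] by blast+
 note l = dom_lmeasurable[OF op bd] and s = dom_sets[OF op bd]
 define K0 where "K0 = K \<inter> closure X"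
 have K0: "compact K0" "K0 \<subseteq> ball c r" unfolding K0_def using K by (auto intro: compact_Int_closed)
 obtain d where d: "d > 0" "{y + z |y z. y \<in> K0 & z \<in> cball 0 d} \<subseteq> ball c r"
  using compact_sum_cball_eventually[OF K0(1) open_ball K0(2)] by blast
 have \<rho>1: "kcd 1 \<rho>" by (rule kcd_mono[OF \<rho>]) simp
 \<comment> \<open>On the ball \<rho> coincides with a compactly supported C^1 function, whose
   global Lipschitz constant serves for \<rho> there.\<close>
 have "Cc 1 UNIV (%x. \<rho> x * bump c r (r + 1) x)"
  by (rule Cc_mult[OF test_function_Cc[OF test_function_bump] \<rho>1]) (use r in auto)
 then obtain L where L: "L > 0" "!!a b. \<bar>\<rho> a * bump c r (r + 1) a - \<rho> b * bump c r (r + 1) b\<bar> <= L * norm (a - b)"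
  using Cc_lipschitz by blast
 have Lip: "\<bar>\<rho> a - \<rho> b\<bar> <= L * norm (a - b)" if "a \<in> ball c r" "b \<in> ball c r" for a b
 proof -
  have "bump c r (r + 1) a = 1" "bump c r (r + 1) b = 1"
   using that r by (auto intro!: bump_1 simp: dist_commute)
  then show ?thesis using L(2)[of a b] by simp
 qed
 define t where "t n = (d / 2) * inverse (real (Suc n))" for n
 \<comment> \<open>Shifting by t along \<open>e\<close> raises \<rho> by exactly t, while a
   displacement of length \<epsilon> lowers it by at most L \<epsilon> < t; so the sum of a point of
   the closure and a point of the kernel's support has \<rho> > 0.\<close>
 define \<epsilon> where "\<epsilon> n = t n / (2 * (L + 1))" for n
 have t: "t n > 0" "t n <= d / 2" for n using d(1) by (auto simp: t_def field_simps)
 have \<epsilon>: "\<epsilon> n > 0" "\<epsilon> n <= t n" "L * \<epsilon> n < t n" for n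
 proof -
  show "\<epsilon> n > 0" using t(1)[of n] L(1) by (simp add: \<epsilon>_def)
  show "\<epsilon> n <= t n" using t(1)[of n] L(1) by (simp add: \<epsilon>_def divide_le_eq)
  show "L * \<epsilon> n < t n" using t(1)[of n] L(1) by (simp add: \<epsilon>_def field_simps add_pos_pos)
 qed
 have "\<exists>\<kappa>. mollifier \<kappa> (t n *\<^sub>R e) (\<epsilon> n)" for n using mollifier_exists[OF \<epsilon>(1)] by blast
 then have "\<forall>n. \<exists>\<kappa>. mollifier \<kappa> (t n *\<^sub>R e) (\<epsilon> n)" by blast
 from choice[OF this] obtain \<kappa> where \<kappa>: "!!n. mollifier (\<kappa> n) (t n *\<^sub>R e) (\<epsilon> n)" by blast
 have tlim: "t ----> 0"
  unfolding t_def using tendsto_mult_right_zero[OF LIMSEQ_inverse_real_of_nat] by blast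
 have elim: "\<epsilon> ----> 0"
  unfolding \<epsilon>_def using tendsto_divide[OF tlim tendsto_const, of "2 * (L + 1)"] L(1) by simp
 have lim: "(%n. norm (t n *\<^sub>R e) + \<epsilon> n) ----> 0"
  using tendsto_add[OF tendsto_rabs[OF tlim] elim] e by simp
 have supp: "{y + z |y z. y \<in> K0 & z \<in> cball (t n *\<^sub>R e) (\<epsilon> n)} \<subseteq> X" for n
 proof clarify
  fix y z assume y: "y \<in> K0" and z: "z \<in> cball (t n *\<^sub>R e) (\<epsilon> n)"
  define w where "w = z - t n *\<^sub>R e"
  have w: "norm w <= \<epsilon> n" using z by (simp add: w_def dist_norm norm_minus_commute)
  have wd: "norm w <= d" using w \<epsilon>(2)[of n] t(2)[of n] d(1) by linarith
  have "norm z <= norm (t n *\<^sub>R e) + norm w" using norm_triangle_ineq[of "t n *\<^sub>R e" w] by (simp add: w_def)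
  then have zd: "norm z <= d" using w \<epsilon>(2)[of n] t[of n] e by simp
  have "w \<in> cball 0 d" "z \<in> cball 0 d" using wd zd by simp_all
  then have b1: "y + w \<in> ball c r" "y + z \<in> ball c r"
   using d(2) y by blast+
  have b0: "y \<in> ball c r" using y K0(2) by blast
  have "\<rho> y >= 0" using chart_closure_nonneg[OF ch _ b0] y by (simp add: K0_def)
  moreover have "\<bar>\<rho> (y + w) - \<rho> y\<bar> <= L * norm w" using Lip[OF b1(1) b0] by simp
  moreover have "L * norm w <= L * \<epsilon> n" using w L(1) by (intro mult_left_mono) auto
  moreover have "\<rho> (y + z) = \<rho> (y + w) + t n"
   using shift[of "y + w" "t n"] by (simp add: w_def algebra_simps)
  ultimately have "\<rho> (y + z) > 0" using \<epsilon>(3)[of n] by linarith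
  then show "y + z \<in> X" using in_dom[OF b1(2)] by simp
 qed
 define \<Phi> where "\<Phi> n = mol X (\<kappa> n) q" for n
 have qi: "integrable (leb X) q" by (rule int_L2[OF op bd qL])
 have q0: "q y = 0" if "y \<in> X" "y \<notin> K0" for y
  using q(2)[OF that(1)] that closure_subset unfolding K0_def by blast
 have der: "partial i (\<Phi> n) = mol X (\<kappa> n) (g i)" for i n
  unfolding \<Phi>_def
  by (rule ext, rule partial_mol_weak[OF qi mollifier_test[OF \<kappa>]], rule wdT_D(3)[OF q(1)],
    rule kcd_shift_reflect[OF test_function_kcd[OF mollifier_test[OF \<kappa>]]])
 show ?thesis
 proof (rule that[of \<Phi>])
  show "test_function X (\<Phi> n)" for n
   unfolding \<Phi>_def
   by (rule test_function_mol[OF qi mollifier_test[OF \<kappa>] K0(1) compact_cball q0 mollifier_0[OF \<kappa>[of n]] supp[of n]])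
  show "(%n. L2norm X (%x. partial i (\<Phi> n) x - g i x)) ----> 0" for i
  proof (rule tendsto_sandwich[OF _ _ tendsto_const mol_tendsto(1)[OF l gL[of i] \<kappa> lim]])
   show "eventually (%n. 0 <= L2norm X (%x. partial i (\<Phi> n) x - g i x)) sequentially" by simp
   show "eventually (%n. L2norm X (%x. partial i (\<Phi> n) x - g i x)
     <= L2norm UNIV (%x. mol X (\<kappa> n) (g i) x - indicator X x * g i x)) sequentially"
   proof (intro always_eventually allI)
    fix n
    have "(%x. mol X (\<kappa> n) (g i) x - indicator X x * g i x) \<in> L2 UNIV"
     using L2_zero_extension(1)[OF s gL[of i]] mol_tendsto(2)[OF l gL[of i] \<kappa> lim] by (intro L2_diff) auto
    from L2_restrict(2)[OF this subset_UNIV s]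
    have "L2norm X (%x. mol X (\<kappa> n) (g i) x - indicator X x * g i x)
      <= L2norm UNIV (%x. mol X (\<kappa> n) (g i) x - indicator X x * g i x)" by simp
    moreover have "L2norm X (%x. mol X (\<kappa> n) (g i) x - indicator X x * g i x) = L2norm X (%x. partial i (\<Phi> n) x - g i x)"
     unfolding L2norm_def der by (intro arg_cong[where f=sqrt] lint_cong) auto
    ultimately show "L2norm X (%x. partial i (\<Phi> n) x - g i x)
     <= L2norm UNIV (%x. mol X (\<kappa> n) (g i) x - indicator X x * g i x)" by simp
   qed
  qed
 qed
qed

text \<open>A function in a chart whose extension by zero is weakly differentiable can be used as a
  test function for a harmonic field: it is approximated by genuine test functions, and only the
  convergence of their derivatives matters.\<close>

lemma harmonic_pairing:
 assumes G: "harmonic_field X G"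
  and ch: "chart X c r \<rho> e" and K: "compact K" "K \<subseteq> ball c r"
  and q: "!!i. wd0 X i q (g i)" "!!x. x \<in> X ==> x \<notin> K ==> q x = 0"
 shows "(SUM i. LINT x|leb X. G x $ i * g i x) = 0"
  "(LINT x|leb X. G x $ i * g j x) = (LINT x|leb X. G x $ j * g i x)"
proof -
 obtain \<Phi> where \<Phi>: "!!n. test_function X (\<Phi> n)"
  "!!i. (%n. L2norm X (%x. partial i (\<Phi> n) x - g i x)) ----> 0"
  using wd0_approx[OF ch K q] by blast
 have GL: "(%x. G x $ i) \<in> L2 X" for i using G L2_component unfolding harmonic_field_def by blast
 have pL: "partial i (\<Phi> n) \<in> L2 X" for i n
  by (rule kcd_L2[OF dom_lmeasurable[OF op bd] bd smooth_partial[OF test_function_kcd[OF \<Phi>(1)], of 0]])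
 have lim: "(%n. LINT x|leb X. G x $ i * partial j (\<Phi> n) x) ----> (LINT x|leb X. G x $ i * g j x)" for i j
  using L2_tendsto_inner[OF pL wdT_D(2)[OF q(1)] GL \<Phi>(2)[of j], of i] by (simp add: L2inner_def mult.commute)
 have "(%n. SUM i. LINT x|leb X. G x $ i * partial i (\<Phi> n) x) ----> (SUM i. LINT x|leb X. G x $ i * g i x)"
  by (intro tendsto_sum lim)
 moreover have "(%n. SUM i. LINT x|leb X. G x $ i * partial i (\<Phi> n) x) = (%n. 0)"
  using G \<Phi>(1) unfolding harmonic_field_def by blast
 ultimately have "(%n::nat. 0) ----> (SUM i. LINT x|leb X. G x $ i * g i x)" by (simp only:)
 from LIMSEQ_unique[OF this tendsto_const]
 show "(SUM i. LINT x|leb X. G x $ i * g i x) = 0" .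
 have "(LINT x|leb X. G x $ i * partial j (\<Phi> n) x) = (LINT x|leb X. G x $ j * partial i (\<Phi> n) x)" for n
  using G \<Phi>(1) unfolding harmonic_field_def by blast
 then show "(LINT x|leb X. G x $ i * g j x) = (LINT x|leb X. G x $ j * g i x)"
  using LIMSEQ_unique[OF lim[of i j]] lim[of j i] by simp
qed

end

declare One_nat_def [simp del]

section \<open>A Rellich identity\<close>

lemma L2_tendsto_inner2:
 assumes f: "!!n. f n \<in> L2 X" "f' \<in> L2 X" and g: "!!n. g n \<in> L2 X" "g' \<in> L2 X"
  and lim: "(%n. L2norm X (%x. f n x - f' x)) ----> 0" "(%n. L2norm X (%x. g n x - g' x)) ----> 0"
 shows "(%n. L2inner X (f n) (g n)) ----> L2inner X f' g'"
proof -
 have a: "(%n. L2inner X (%x. f n x - f' x) (g n)) ----> 0"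
 proof (rule Lim_null_comparison)
  show "\<forall>\<^sub>F n in sequentially. norm (L2inner X (%x. f n x - f' x) (g n)) <= L2norm X (%x. f n x - f' x) * L2norm X (g n)"
   using L2_Cauchy_Schwarz[OF L2_diff[OF f(1) f(2)] g(1)] by simp
  show "(%n. L2norm X (%x. f n x - f' x) * L2norm X (g n)) ----> 0"
   using tendsto_mult[OF lim(1) L2_tendsto_norm[OF g lim(2)]] by simp
 qed
 have b: "(%n. L2inner X f' (g n)) ----> L2inner X f' g'"
  using L2_tendsto_inner[OF g f(2) lim(2)] by (simp add: L2inner_commute)
 have "L2inner X (%x. f n x - f' x) (g n) + L2inner X f' (g n) = L2inner X (f n) (g n)" for n
  using L2inner_diff_left[OF f(1) f(2) g(1)] by simp
 then show ?thesis using tendsto_add[OF a b] by simp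
qed

context
 fixes X :: "(real^'n) set"
 assumes op: "open X" and bd: "bounded X"
begin

text \<open>The divergence of b |g|^2 - 2 (b . g) g. The terms with derivatives of g are 2 b .
  (\<nabla>g) g, once with each sign because the curl vanishes, and a multiple of div g; only
  derivatives of b survive.\<close>

lemma rellich_pointwise:
 fixes g b :: "'n => real^'n => real"
 assumes g: "!!i. kcd 1 (g i)" and b: "!!i. kcd 1 (b i)"
  and div: "(SUM i. partial i (g i) x) = 0" and curl: "!!i j. partial i (g j) x = partial j (g i) x"
 shows "(SUM i. partial i (%x. b i x * (SUM j. g j x * g j x) - 2 * ((SUM j. b j x * g j x) * g i x)) x)
  = (SUM i. SUM j. partial i (b i) x * (g j x * g j x)) - 2 * (SUM i. SUM j. partial i (b j) x * (g i x * g j x))"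
proof -
 have kgg: "kcd 1 (%x. SUM j. g j x * g j x)" and kbg: "kcd 1 (%x. SUM j. b j x * g j x)"
  by (intro kcd_sum kcd_mult g b)+
 have 1: "partial i (%x. SUM j. g j x * g j x) x = (SUM j. 2 * (g j x * partial i (g j) x))" for i
  by (subst partial_sum) (auto intro!: kcd_mult g sum.cong simp: partial_mult[OF g g])
 have 2: "partial i (%x. SUM j. b j x * g j x) x = (SUM j. partial i (b j) x * g j x + b j x * partial i (g j) x)" for i
  by (subst partial_sum) (auto intro!: kcd_mult g b sum.cong simp: partial_mult[OF b g])
 have 3: "partial i (%x. b i x * (SUM j. g j x * g j x) - 2 * ((SUM j. b j x * g j x) * g i x)) x
  = partial i (b i) x * (SUM j. g j x * g j x) + b i x * (SUM j. 2 * (g j x * partial i (g j) x))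
   - 2 * ((SUM j. partial i (b j) x * g j x + b j x * partial i (g j) x) * g i x + (SUM j. b j x * g j x) * partial i (g i) x)" for i
 proof -
  have "partial i (%x. b i x * (SUM j. g j x * g j x) - 2 * ((SUM j. b j x * g j x) * g i x)) x
   = partial i (%x. b i x * (SUM j. g j x * g j x)) x - partial i (%x. 2 * ((SUM j. b j x * g j x) * g i x)) x"
   by (rule partial_diff[OF kcd_mult[OF b kgg] kcd_mult[OF kcd_const kcd_mult[OF kbg g]]])
  also have "partial i (%x. 2 * ((SUM j. b j x * g j x) * g i x)) x = 2 * partial i (%x. (SUM j. b j x * g j x) * g i x) x"
   by (rule partial_cmult[OF kcd_mult[OF kbg g]])
  finally show ?thesis
   unfolding partial_mult[OF b kgg] partial_mult[OF kbg g] 1 2 .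
 qed
 have sw: "(SUM i. SUM j. b j x * partial i (g j) x * g i x) = (SUM i. SUM j. b i x * (g j x * partial i (g j) x))"
  by (subst sum.swap) (simp add: curl mult_ac)
 have dv: "(SUM i. (SUM j. b j x * g j x) * partial i (g i) x) = 0"
  unfolding sum_distrib_left[symmetric] div by simp
 have "(SUM i. partial i (%x. b i x * (SUM j. g j x * g j x) - 2 * ((SUM j. b j x * g j x) * g i x)) x)
  = (SUM i. SUM j. partial i (b i) x * (g j x * g j x)) + 2 * (SUM i. SUM j. b i x * (g j x * partial i (g j) x))
   - 2 * ((SUM i. SUM j. partial i (b j) x * g j x * g i x) + (SUM i. SUM j. b j x * partial i (g j) x * g i x)
    + (SUM i. (SUM j. b j x * g j x) * partial i (g i) x))"
  unfolding sum.cong[OF refl 3]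
  by (simp add: sum_subtractf sum.distrib sum_distrib_left sum_distrib_right distrib_right distrib_left mult_ac)
 then show ?thesis unfolding sw dv by (simp add: mult_ac)
qed

text \<open>\<open>G\<close> is mollified at a scale below the distance from the support of
  \<open>b\<close> to the complement of \<open>X\<close>. For x in that support the kernel centred
  at x is then a test function in \<open>X\<close>, so the mollified field is smooth and classically
  divergence and curl free where the pointwise identity is integrated.\<close>

lemma rellich_compact:
 assumes G: "harmonic_field X G" and b: "!!j. Cc 1 X (b j)"
 shows "(SUM i. SUM j. LINT x|leb X. partial i (b i) x * (G x $ j * G x $ j))
   = 2 * (SUM i. SUM j. LINT x|leb X. partial i (b j) x * (G x $ i * G x $ j))"
proof -
 note l = dom_lmeasurable[OF op bd] and s = dom_sets[OF op bd]
 have GL: "(%x. G x $ i) \<in> L2 X" for i using G L2_component unfolding harmonic_field_def by blast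
 have Gi: "integrable (leb X) (%x. G x $ i)" for i by (rule int_L2[OF op bd GL])
 have "\<forall>j. \<exists>K. compact K & K \<subseteq> X & (\<forall>x. x \<notin> K --> b j x = 0)" using b unfolding Cc_def by blast
 from choice[OF this] obtain Kj where Kj: "!!j. compact (Kj j)" "!!j. Kj j \<subseteq> X" "!!j x. x \<notin> Kj j ==> b j x = 0"
  by blast
 define K where "K = (\<Union>j. Kj j)"
 have K: "compact K" "K \<subseteq> X" "!!j x. x \<notin> K ==> b j x = 0"
  unfolding K_def using Kj by (auto intro: compact_UN)
 obtain d where d: "d > 0" "{y + z |y z. y \<in> K & z \<in> cball 0 d} \<subseteq> X"
  using compact_sum_cball_eventually[OF K(1) op K(2)] by blast
 obtain N where N: "inverse (real (Suc N)) < d" using reals_Archimedean[OF d(1)] by blast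
 obtain \<kappa>0 :: "nat => real^'n => real" where \<kappa>0: "!!n. mollifier (\<kappa>0 n) 0 (inverse (real (Suc n)))"
  by (rule mollifier_seq_centered) blast
 define \<kappa> where "\<kappa> n = \<kappa>0 (n + N)" for n
 have \<kappa>: "mollifier (\<kappa> n) 0 (inverse (real (Suc (n + N))))" for n unfolding \<kappa>_def by (rule \<kappa>0)
 have lim: "(%n. norm (0::real^'n) + inverse (real (Suc (n + N)))) ----> 0"
  using LIMSEQ_ignore_initial_segment[OF LIMSEQ_inverse_real_of_nat, of N] by simp
 have k0: "\<kappa> n z = 0" if "z \<notin> cball 0 d" for n z
 proof -
  have "inverse (real (Suc (n + N))) <= inverse (real (Suc N))" by (rule le_imp_inverse_le) auto
  then have "inverse (real (Suc (n + N))) <= d" using N by linarith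
  then have "z \<notin> cball 0 (inverse (real (Suc (n + N))))" using that by auto
  then show ?thesis by (rule mollifier_0[OF \<kappa>[of n]])
 qed
 note tk = mollifier_test[OF \<kappa>]
 define g where "g n i = mol X (\<kappa> n) (%x. G x $ i)" for n i
 have kg: "kcd k (g n i)" for k n i unfolding g_def by (rule kcd_mol[OF Gi tk])
 have gL: "g n i \<in> L2 X" for n i by (rule kcd_L2[OF l bd kg[of 0]])
 have glim: "(%n. L2norm X (%x. g n i x - G x $ i)) ----> 0" for i
 proof (rule tendsto_sandwich[OF _ _ tendsto_const mol_tendsto(1)[OF l GL[of i] \<kappa> lim]])
  show "eventually (%n. 0 <= L2norm X (%x. g n i x - G x $ i)) sequentially" by simp
  show "eventually (%n. L2norm X (%x. g n i x - G x $ i)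
    <= L2norm UNIV (%x. mol X (\<kappa> n) (%x. G x $ i) x - indicator X x * G x $ i)) sequentially"
  proof (intro always_eventually allI)
   fix n
   have "(%x. mol X (\<kappa> n) (%x. G x $ i) x - indicator X x * G x $ i) \<in> L2 UNIV"
    using L2_zero_extension(1)[OF s GL[of i]] mol_tendsto(2)[OF l GL[of i] \<kappa> lim] by (intro L2_diff) auto
   from L2_restrict(2)[OF this subset_UNIV s]
   have "L2norm X (%x. mol X (\<kappa> n) (%x. G x $ i) x - indicator X x * G x $ i)
     <= L2norm UNIV (%x. mol X (\<kappa> n) (%x. G x $ i) x - indicator X x * G x $ i)" by simp
   moreover have "L2norm X (%x. mol X (\<kappa> n) (%x. G x $ i) x - indicator X x * G x $ i) = L2norm X (%x. g n i x - G x $ i)"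
    unfolding L2norm_def g_def by (intro arg_cong[where f=sqrt] lint_cong) auto
   ultimately show "L2norm X (%x. g n i x - G x $ i)
     <= L2norm UNIV (%x. mol X (\<kappa> n) (%x. G x $ i) x - indicator X x * G x $ i)" by simp
  qed
 qed
 have pg: "partial j (g n i) x = - (LINT y|leb X. G y $ i * partial j (%y. \<kappa> n (x - y)) y)" for n i j x
  unfolding g_def partial_mol[OF Gi test_function_Cc[OF tk]] mol_def
  by (simp add: partial_shift_reflect[OF test_function_kcd[OF tk]])
 have tx: "test_function X (%y. \<kappa> n (x - y))" if x: "x \<in> K" for n x
  unfolding test_function_iff
 proof (intro allI CcI[where K="cball x d"])
  show "kcd k (%y. \<kappa> n (x - y))" for k by (rule kcd_shift_reflect[OF test_function_kcd[OF tk]])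
  show "cball x d \<subseteq> X"
  proof
   fix y assume "y \<in> cball x d"
   then have "y - x \<in> cball 0 d" by (simp add: dist_norm norm_minus_commute)
   then have "x + (y - x) \<in> X" using d(2) x by blast
   then show "y \<in> X" by simp
  qed
  show "\<kappa> n (x - y) = 0" if "y \<notin> cball x d" for y
   by (rule k0) (use that in \<open>simp add: dist_norm norm_minus_commute\<close>)
 qed auto
 have gdiv: "(SUM i. partial i (g n i) x) = 0" if "x \<in> K" for n x
  using G tx[OF that] unfolding harmonic_field_def pg sum_negf by simp
 have gcurl: "partial i (g n j) x = partial j (g n i) x" if "x \<in> K" for n x i j
  using G tx[OF that, of n] unfolding harmonic_field_def pg by simp
 define Fn where "Fn n i x = b i x * (SUM j. g n j x * g n j x) - 2 * ((SUM j. b j x * g n j x) * g n i x)" for n i x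
 have kb: "kcd 1 (b j)" for j by (rule Cc_kcd[OF b])
 have kb0: "kcd 0 (partial i (b j))" for i j using kcd_partial'[OF kb, of 0] by simp
 have bout: "partial i (b j) x = 0" if "x \<notin> K" for i j x
  by (rule partial_outside_support[OF K(1) K(3) that])
 have "Cc 1 X (Fn n i)" for n i
  unfolding Fn_def
  by (rule CcI[OF _ K(1,2)]) (auto intro!: kcd_diff kcd_mult kcd_sum kcd_const kb kg simp: K(3))
 note CF = this
 have Fpt: "(SUM i. partial i (Fn n i) x) =
   (SUM i. SUM j. partial i (b i) x * (g n j x * g n j x)) - 2 * (SUM i. SUM j. partial i (b j) x * (g n i x * g n j x))" for n x
 proof (cases "x \<in> K")
  case True
  show ?thesis unfolding Fn_def by (rule rellich_pointwise[OF kg kb gdiv[OF True] gcurl[OF True]])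
 next
  case False
  have "partial i (Fn n i) x = 0" for i
   by (rule partial_outside_support[OF K(1) _ False]) (simp add: Fn_def K(3))
  then show ?thesis by (simp add: bout[OF False])
 qed
 have ii: "integrable (leb X) (%x. a x * (g n i x * g n j x))" if "kcd 0 a" for a n i j
  using L2_mult_integrable[OF L2_kcd_mult[OF bd that gL] gL] by (simp add: mult.assoc)
 have "0 = (SUM i. LINT x|leb X. partial i (Fn n i) x)" for n
  using integral_partial_on[OF s CF] by simp
 also have "(SUM i. LINT x|leb X. partial i (Fn n i) x) = (LINT x|leb X. (SUM i. partial i (Fn n i) x))" for n
 proof (rule lint_sum[symmetric])
  fix i
  show "integrable (leb X) (partial i (Fn n i))"
   by (rule int_L2[OF op bd kcd_L2[OF l bd kcd_partial'[OF Cc_kcd[OF CF], of 0]]]) simp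
 qed
 also have "(LINT x|leb X. (SUM i. partial i (Fn n i) x))
  = (SUM i. SUM j. LINT x|leb X. partial i (b i) x * (g n j x * g n j x))
   - 2 * (SUM i. SUM j. LINT x|leb X. partial i (b j) x * (g n i x * g n j x))" for n
 proof -
  have "integrable (leb X) (%x. SUM i. SUM j. partial i (b i) x * (g n j x * g n j x))"
   "integrable (leb X) (%x. 2 * (SUM i. SUM j. partial i (b j) x * (g n i x * g n j x)))"
   by (intro integrable_mult_right lintegrable_sum ii kb0)+
  then show ?thesis
   unfolding Fpt
   by (simp add: lint_diff lint_sum
     lintegrable_sum ii[OF kb0])
 qed
 finally have eq: "(SUM i. SUM j. LINT x|leb X. partial i (b i) x * (g n j x * g n j x))
   = 2 * (SUM i. SUM j. LINT x|leb X. partial i (b j) x * (g n i x * g n j x))" for n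
  by simp
 have lim2: "(%n. LINT x|leb X. a x * (g n i x * g n j x)) ----> (LINT x|leb X. a x * (G x $ i * G x $ j))"
  if a: "kcd 0 a" for a i j
 proof -
  obtain B where B: "B > 0" "!!x. x \<in> X ==> \<bar>a x\<bar> <= B" using kcd_bounded_on[OF a bd] by blast
  have "(%n. L2norm X (%x. a x * g n i x - a x * G x $ i)) ----> 0"
  proof (rule tendsto_sandwich[OF _ _ tendsto_const])
   show "eventually (%n. 0 <= L2norm X (%x. a x * g n i x - a x * G x $ i)) sequentially" by simp
   show "eventually (%n. L2norm X (%x. a x * g n i x - a x * G x $ i) <= B * L2norm X (%x. g n i x - G x $ i)) sequentially"
   proof (intro always_eventually allI)
    fix n
    have "L2norm X (%x. a x *\<^sub>R (g n i x - G x $ i)) <= B * L2norm X (%x. g n i x - G x $ i)"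
     by (rule L2norm_bounded_mult[OF L2_diff[OF gL GL] kcd_measurable[OF a] B(2)]) (use B(1) in auto)
    then show "L2norm X (%x. a x * g n i x - a x * G x $ i) <= B * L2norm X (%x. g n i x - G x $ i)"
     by (simp add: right_diff_distrib)
   qed
   show "(%n. B * L2norm X (%x. g n i x - G x $ i)) ----> 0"
    using tendsto_mult_right_zero[OF glim] .
  qed
  from L2_tendsto_inner2[OF L2_kcd_mult[OF bd a gL] L2_kcd_mult[OF bd a GL] gL GL this glim]
  show ?thesis by (simp add: L2inner_def mult.assoc)
 qed
 have "(%n. SUM i. SUM j. LINT x|leb X. partial i (b i) x * (g n j x * g n j x))
   ----> (SUM i. SUM j. LINT x|leb X. partial i (b i) x * (G x $ j * G x $ j))"
  by (intro tendsto_sum lim2 kb0)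
 moreover have "(%n. 2 * (SUM i. SUM j. LINT x|leb X. partial i (b j) x * (g n i x * g n j x)))
   ----> 2 * (SUM i. SUM j. LINT x|leb X. partial i (b j) x * (G x $ i * G x $ j))"
  by (intro tendsto_mult tendsto_const tendsto_sum lim2 kb0)
 ultimately show ?thesis unfolding eq using LIMSEQ_unique by blast
qed

text \<open>The identity extends to fields vanishing on the boundary, by cutting off near the boundary.\<close>

lemma rellich:
 assumes G: "harmonic_field X G" and ch: "chart X c r \<rho> e" and K: "compact K" "K \<subseteq> ball c r"
  and b: "!!j. kcd 1 (b j)" "!!j x. x \<notin> K ==> b j x = 0"
  and C: "!!j x. x \<in> X ==> x \<in> K ==> \<bar>b j x\<bar> <= C * \<rho> x"
 shows "(SUM i. SUM j. LINT x|leb X. partial i (b i) x * (G x $ j * G x $ j))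
   = 2 * (SUM i. SUM j. LINT x|leb X. partial i (b j) x * (G x $ i * G x $ j))"
proof -
 have in_dom: "!!x. x \<in> ball c r ==> x \<in> X \<longleftrightarrow> \<rho> x > 0" and \<rho>: "kcd 3 \<rho>"
  using ch by (auto simp: chart_def)
 obtain \<eta> \<eta>' B where \<eta>: "!!n. kcd 3 (\<eta> n)" "!!n i x. partial i (\<eta> n) x = \<eta>' n x * partial i \<rho> x"
  "!!n x. 0 <= \<eta> n x" "!!n x. \<eta> n x <= 1" "!!x. \<rho> x > 0 ==> (%n. \<eta> n x) ----> 1"
  "B > 0" "!!n x. \<rho> x > 0 ==> \<bar>\<eta>' n x\<bar> * \<rho> x <= B" "!!x. \<rho> x > 0 ==> eventually (%n. \<eta>' n x = 0) sequentially"
  "!!n k a K. k <= 3 ==> kcd k a ==> compact K ==> K \<subseteq> ball c r ==> (!!x. x \<notin> K ==> a x = 0) ==> Cc k X (%x. \<eta> n x * a x)"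
  "!!n. continuous_on UNIV (\<eta>' n)"
  using chart_cutoff[OF ch] by blast
 have \<eta>1: "kcd 1 (\<eta> n)" for n by (rule kcd_mono[OF \<eta>(1)]) simp
 have GL: "(%x. G x $ i) \<in> L2 X" for i using G L2_component unfolding harmonic_field_def by blast
 have iG: "integrable (leb X) (%x. G x $ i * G x $ j)" for i j by (rule L2_mult_integrable[OF GL GL])
 have cb: "Cc 1 X (%x. \<eta> n x * b j x)" for n j by (rule \<eta>(9)[OF _ b(1) K b(2)]) simp
 have ptl: "partial i (%x. \<eta> n x * b j x) x = \<eta> n x * partial i (b j) x + \<eta>' n x * partial i \<rho> x * b j x" for n i j x
  by (simp add: partial_mult[OF \<eta>1 b(1)] \<eta>(2))
 have kb0: "kcd 0 (partial i (b j))" for i j using kcd_partial'[OF b(1), of 0] by simp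
 have k\<rho>0: "kcd 0 (partial i \<rho>)" for i using kcd_partial'[OF \<rho>, of 0] by simp
 have bout: "partial i (b j) x = 0" if "x \<notin> K" for i j x
  by (rule partial_outside_support[OF K(1) b(2) that])
 have lim: "(%n. LINT x|leb X. partial i (%x. \<eta> n x * b j x) x * h x) ----> (LINT x|leb X. partial i (b j) x * h x)"
  if h: "integrable (leb X) h" for i j h
 proof -
  obtain B1 where B1: "B1 > 0" "!!x. x \<in> K ==> \<bar>partial i (b j) x\<bar> <= B1"
   using kcd_bounded_on[OF kb0 compact_imp_bounded[OF K(1)]] by blast
  obtain B2 where B2: "B2 > 0" "!!x. x \<in> K ==> \<bar>partial i \<rho> x\<bar> <= B2"
   using kcd_bounded_on[OF k\<rho>0 compact_imp_bounded[OF K(1)]] by blast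
  show ?thesis
  proof (rule integral_dominated_convergence)
   show "integrable (leb X) (%x. (B1 + B2 * (\<bar>C\<bar> * B)) * \<bar>h x\<bar>)"
    by (intro integrable_mult_right integrable_abs h)
   show "(%x. partial i (b j) x * h x) \<in> meas X"
    by (intro borel_measurable_times kcd_measurable[OF kb0] borel_measurable_integrable[OF h])
   show "(%x. partial i (%x. \<eta> n x * b j x) x * h x) \<in> meas X" for n
    by (intro borel_measurable_times borel_measurable_integrable[OF h] kcd_measurable[OF kcd_partial'[OF Cc_kcd[OF cb], of 0]]) simp
   show "AE x in leb X. norm (partial i (%x. \<eta> n x * b j x) x * h x) <= (B1 + B2 * (\<bar>C\<bar> * B)) * \<bar>h x\<bar>" for n
   proof (rule AE_I2)
    fix x assume x: "x \<in> space (leb X)"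
    have "\<bar>\<eta> n x * partial i (b j) x + \<eta>' n x * partial i \<rho> x * b j x\<bar> <= B1 + B2 * (\<bar>C\<bar> * B)"
    proof (cases "x \<in> K")
     case True
     have p: "\<rho> x > 0" using x True K(2) in_dom by auto
     have "\<bar>\<eta> n x * partial i (b j) x\<bar> <= 1 * B1"
      unfolding abs_mult using \<eta>(3,4)[of n x] B1 True by (intro mult_mono) auto
     moreover have "\<bar>\<eta>' n x * partial i \<rho> x * b j x\<bar> <= B2 * (\<bar>C\<bar> * B)"
     proof -
      have "\<bar>\<eta>' n x\<bar> * \<bar>b j x\<bar> <= \<bar>\<eta>' n x\<bar> * (\<bar>C\<bar> * \<rho> x)"
      proof (rule mult_left_mono)
       have "C * \<rho> x <= \<bar>C\<bar> * \<rho> x" using p by (intro mult_right_mono) auto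
       then show "\<bar>b j x\<bar> <= \<bar>C\<bar> * \<rho> x" using C[of x j] x True by simp
      qed simp
      also have "... = \<bar>C\<bar> * (\<bar>\<eta>' n x\<bar> * \<rho> x)" by simp
      also have "... <= \<bar>C\<bar> * B" using \<eta>(7)[OF p] by (intro mult_left_mono) auto
      finally have bb: "\<bar>\<eta>' n x\<bar> * \<bar>b j x\<bar> <= \<bar>C\<bar> * B" .
      have "\<bar>partial i \<rho> x\<bar> * (\<bar>\<eta>' n x\<bar> * \<bar>b j x\<bar>) <= B2 * (\<bar>C\<bar> * B)"
       by (rule mult_mono[OF B2(2)[OF True] bb]) (use B2(1) in auto)
      then show ?thesis by (simp add: abs_mult mult_ac)
     qed
     ultimately show ?thesis by linarith
    next
     case False
     then show ?thesis using B1(1) B2(1) \<eta>(6) by (simp add: bout b(2))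
    qed
    then show "norm (partial i (%x. \<eta> n x * b j x) x * h x) <= (B1 + B2 * (\<bar>C\<bar> * B)) * \<bar>h x\<bar>"
     unfolding ptl real_norm_def abs_mult[of _ "h x"] by (rule mult_right_mono) simp
   qed
   show "AE x in leb X. (%n. partial i (%x. \<eta> n x * b j x) x * h x) ----> partial i (b j) x * h x"
   proof (rule AE_I2)
    fix x assume x: "x \<in> space (leb X)"
    show "(%n. partial i (%x. \<eta> n x * b j x) x * h x) ----> partial i (b j) x * h x"
    proof (cases "x \<in> K")
     case True
     have p: "\<rho> x > 0" using x True K(2) in_dom by auto
     have "(%n. \<eta> n x * partial i (b j) x) ----> 1 * partial i (b j) x"
      by (intro tendsto_mult \<eta>(5)[OF p] tendsto_const)
     moreover have "(%n. \<eta>' n x * partial i \<rho> x * b j x) ----> 0"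
      by (rule tendsto_eventually) (use \<eta>(8)[OF p] in \<open>eventually_elim, simp\<close>)
     ultimately have "(%n. (\<eta> n x * partial i (b j) x + \<eta>' n x * partial i \<rho> x * b j x) * h x)
       ----> (1 * partial i (b j) x + 0) * h x"
      by (rule tendsto_mult[OF tendsto_add tendsto_const])
     then show ?thesis unfolding ptl by (simp only: mult_1 add_0_right)
    qed (simp add: ptl bout b(2))
   qed
  qed
 qed
 have "(%n. SUM i. SUM j. LINT x|leb X. partial i (%x. \<eta> n x * b i x) x * (G x $ j * G x $ j))
   ----> (SUM i. SUM j. LINT x|leb X. partial i (b i) x * (G x $ j * G x $ j))"
  by (intro tendsto_sum lim iG)
 moreover have "(%n. 2 * (SUM i. SUM j. LINT x|leb X. partial i (%x. \<eta> n x * b j x) x * (G x $ i * G x $ j)))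
   ----> 2 * (SUM i. SUM j. LINT x|leb X. partial i (b j) x * (G x $ i * G x $ j))"
  by (intro tendsto_mult tendsto_const tendsto_sum lim iG)
 ultimately show ?thesis
  unfolding rellich_compact[OF G cb] using LIMSEQ_unique by blast
qed

end

section \<open>Matrix multiples of the velocity\<close>

text \<open>\<open>mdW\<close> and \<open>mddW\<close> are the first and second weak derivatives of \<open>Mu\<close> given by the Leibniz rule.\<close>

definition mW :: "('n => 'n => real^'n => real) => (real^'n => real^'n) => 'n => real^'n => real" where
 "mW M u i x = (SUM k. M i k x * u x $ k)"

definition mdW :: "('n => 'n => real^'n => real) => (real^'n) set => (real^'n => real^'n) => 'n => 'n => real^'n => real" where
 "mdW M X u j i x = (SUM k. partial j (M i k) x * u x $ k + M i k x * pd X u j k x)"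

definition mddW :: "('n => 'n => real^'n => real) => (real^'n) set => (real^'n => real^'n) => 'n => 'n => 'n => real^'n => real" where
 "mddW M X u l j i x = (\<Sum>k\<in>UNIV.
   (partial l (partial j (M i k)) x * u x $ k + partial j (M i k) x * pd X u l k x)
   + (partial l (M i k) x * pd X u j k x + M i k x * pdd X u l j k x))"

context
 fixes X :: "(real^'n) set"
 assumes op: "open X" and bd: "bounded X"
begin

lemma vec_H2_H10_wd:
 assumes "u \<in> vec_H2_H10 X"
 shows "wd0 X j (%x. u x $ k) (pd X u j k)"
  "wd X l (pd X u j k) (pdd X u l j k)"
  "(%x. u x $ k) \<in> L2 X" "pd X u j k \<in> L2 X"
  "pdd X u l j k \<in> L2 X"
proof -
 have u: "(%x. u x $ k) \<in> H2 X" "(%x. u x $ k) \<in> H10 X" using assms by (auto simp: vec_H2_H10_def)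
 show a: "wd0 X j (%x. u x $ k) (pd X u j k)" by (rule H10_wd0[OF op bd u(2)])
 show b: "wd X l (pd X u j k) (pdd X u l j k)"
  using u(1) by (intro H1_wd[OF op bd]) (simp add: H2_def)
 show "(%x. u x $ k) \<in> L2 X" "pd X u j k \<in> L2 X" "pdd X u l j k \<in> L2 X"
  using wdT_D(1,2)[OF a] wdT_D(2)[OF b] by auto
qed

lemma mW_wd0:
 assumes u: "u \<in> vec_H2_H10 X" and M: "!!k. kcd 1 (M i k)"
 shows "wd0 X j (mW M u i) (mdW M X u j i)"
 unfolding mW_def[abs_def] mdW_def[abs_def]
 by (intro wdT_sum[OF op bd] wdT_mult[OF op bd] vec_H2_H10_wd[OF u] M test_class_wd)

lemma mdW_wd:
 assumes u: "u \<in> vec_H2_H10 X" and M: "!!k. kcd 2 (M i k)"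
 shows "wd X l (mdW M X u j i) (mddW M X u l j i)"
proof -
 have k1: "kcd 1 (M i k)" "kcd 1 (partial j (M i k))" for k
  using M by (auto intro: kcd_mono[of 2] kcd_partial'[of 2])
 show ?thesis
  unfolding mdW_def[abs_def] mddW_def[abs_def]
  by (intro wdT_sum[OF op bd] wdT_add[OF op bd] wdT_mult[OF op bd] wd0_imp_wd vec_H2_H10_wd[OF u] k1 test_class_wd)
qed

text \<open>
 A field \<open>B u\<close> whose tangential part vanishes on the boundary does not contribute to the pressure,
 since the antisymmetric part of its gradient vanishes on the boundary.
\<close>

lemma normal_part_pairing:
 assumes G: "harmonic_field X G" and u: "u \<in> vec_H2_H10 X"
  and ch: "chart X c r \<rho> e" and K: "compact K" "K \<subseteq> ball c r"
  and M: "!!i k. kcd 2 (M i k)" "!!i k x. x \<notin> K ==> M i k x = 0"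
  and C: "!!i j k x. x \<in> X ==> x \<in> K ==> \<bar>M i k x * partial j \<rho> x - M j k x * partial i \<rho> x\<bar> <= C * \<rho> x"
 shows "(SUM i. SUM j. LINT x|leb X. G x $ i * (mddW M X u j j i x - mddW M X u i j j x)) = 0"
proof -
 have GL: "(%x. G x $ i) \<in> L2 X" for i using G L2_component unfolding harmonic_field_def by blast
 have M1: "kcd 1 (M i k)" "kcd 1 (partial j (M i k))" for i j k
  using M(1) by (auto intro: kcd_mono[of 2] kcd_partial'[of 2])
 note dW = wd0_imp_wd[OF mW_wd0[OF u M1(1)]] and ddW = mdW_wd[OF u M(1)]
 have ddL: "mddW M X u l j i \<in> L2 X" for l j i by (rule wdT_D(2)[OF ddW])
 have zero: "mdW M X u j i x = 0" if "x \<notin> K" for j i x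
  unfolding mdW_def using M(2)[OF that] partial_outside_support[OF K(1) M(2) that] by simp
 define S where "S i j x = mdW M X u j i x - mdW M X u i j x" for i j x
 have S0: "wd0 X m (S i j) (%x. mddW M X u m j i x - mddW M X u m i j x)" for m i j
 proof -
  \<comment> \<open>For each k the first order part of \<open>S i j\<close> is the derivative of the
    k-th component of u along \<open>M i k\<close> times the j-th minus \<open>M j k\<close> times
    the i-th unit vector. Hypothesis \<open>C\<close> says that this direction is tangential up to
    O(\<rho>); the rest of \<open>S i j\<close> is a multiple of u.\<close>
  define \<tau> where "\<tau> k l x = (if l = j then M i k x else 0) - (if l = i then M j k x else 0)" for k l x
  have \<tau>2: "kcd 2 (\<tau> k l)" for k l
   unfolding \<tau>_def by (cases "l = j"; cases "l = i") (auto intro!: kcd_diff kcd_uminus M(1) kcd_const)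
  have sum\<tau>: "(SUM l. \<tau> k l x * f l) = M i k x * f j - M j k x * f i" for k x f
  proof -
   have "(SUM l. \<tau> k l x * f l) = (SUM l. (if l = j then M i k x * f l else 0)) - (SUM l. (if l = i then M j k x * f l else 0))"
    unfolding sum_subtractf[symmetric] by (rule sum.cong) (auto simp: \<tau>_def left_diff_distrib)
   then show ?thesis by simp
  qed
  have T: "wd0 X m (%x. SUM l. \<tau> k l x * pd X u l k x)
    (%x. SUM l. (partial m (\<tau> k l) x * pd X u l k x + \<tau> k l x * pdd X u m l k x))" for k
  proof (rule tangential_wd0[OF op bd ch K \<tau>2 _ _ vec_H2_H10_wd(1,2)[OF u]])
   show "\<tau> k l x = 0" if "x \<notin> K" for l x using M(2)[OF that] by (simp add: \<tau>_def)
   show "\<bar>SUM l. \<tau> k l x * partial l \<rho> x\<bar> <= C * \<rho> x" if "x \<in> X" "x \<in> K" for x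
    unfolding sum\<tau> by (rule C[OF that])
  qed
  have L: "wd0 X m (%x. (partial j (M i k) x - partial i (M j k) x) * u x $ k)
    (%x. partial m (%x. partial j (M i k) x - partial i (M j k) x) x * u x $ k + (partial j (M i k) x - partial i (M j k) x) * pd X u m k x)" for k
   by (intro wdT_mult[OF op bd] test_class_wd vec_H2_H10_wd[OF u] kcd_diff M1)
  have Seq: "S i j x = (SUM k. (partial j (M i k) x - partial i (M j k) x) * u x $ k + (SUM l. \<tau> k l x * pd X u l k x))" for x
   unfolding S_def mdW_def sum\<tau> sum_subtractf[symmetric] by (rule sum.cong) (auto simp: algebra_simps)
  obtain g where g: "wd0 X m (S i j) g"
   by (rule that, unfold ext[of "S i j", OF Seq], rule wdT_sum[OF op bd test_class_wd(2)],
     rule wdT_add[OF op bd test_class_wd(2) L T])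
  have w: "wd X m (S i j) (%x. mddW M X u m j i x - mddW M X u m i j x)"
   unfolding S_def[abs_def] by (rule wdT_diff[OF op bd test_class_wd(1) ddW ddW])
  have "AE x in leb X. g x = mddW M X u m j i x - mddW M X u m i j x"
   by (rule wd_unique[OF op bd wd0_imp_wd[OF g] w])
  from wdT_cong_AE[OF op bd test_class_wd(2) g AE_I2[OF refl] this wdT_D(1)[OF w] wdT_D(2)[OF w]]
  show ?thesis .
 qed
 have pair: "(LINT x|leb X. G x $ i * (mddW M X u j j i x - mddW M X u j i j x))
   = (LINT x|leb X. G x $ j * (mddW M X u i j i x - mddW M X u i i j x))" for i j
  by (rule harmonic_pairing(2)[OF op bd G ch K S0]) (simp add: S_def zero)
 have comm: "AE x in leb X. mddW M X u j i j x = mddW M X u i j j x" for i j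
  by (rule wd_commute[OF op bd dW dW ddW ddW])
 have iI: "integrable (leb X) (%x. G x $ i * mddW M X u l j k x)" for i l j k
  by (rule L2_mult_integrable[OF GL ddL])
 have X1: "(LINT x|leb X. G x $ i * (mddW M X u j j i x - mddW M X u i j j x))
   = (LINT x|leb X. G x $ i * (mddW M X u j j i x - mddW M X u j i j x))" for i j
 proof (rule integral_cong_AE)
  show "AE x in leb X. G x $ i * (mddW M X u j j i x - mddW M X u i j j x) = G x $ i * (mddW M X u j j i x - mddW M X u j i j x)"
   using comm[of j i] by eventually_elim simp
 qed (intro borel_measurable_times borel_measurable_diff L2D(1)[OF GL] L2D(1)[OF ddL])+
 \<comment> \<open>Since \<open>S i j\<close> vanishes on the boundary and \<open>G\<close> is curl
   free, the indices of \<open>G\<close> and of the derivative can be exchanged; \<open>S\<close>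
   being antisymmetric, renaming the indices gives V = - V.\<close>
 define V where "V = (SUM i. SUM j. LINT x|leb X. G x $ i * (mddW M X u j j i x - mddW M X u j i j x))"
 have "V = (SUM i. SUM j. LINT x|leb X. G x $ j * (mddW M X u i j i x - mddW M X u i i j x))"
  unfolding V_def by (intro sum.cong refl pair)
 also have "... = (SUM i. SUM j. LINT x|leb X. G x $ i * (mddW M X u j i j x - mddW M X u j j i x))"
  by (rule sum.swap)
 also have "... = - V"
  unfolding V_def sum_negf[symmetric]
  by (intro sum.cong refl) (simp add: right_diff_distrib iI)
 finally have X0: "V = 0" by simp
 have "(SUM i. SUM j. LINT x|leb X. G x $ i * (mddW M X u j j i x - mddW M X u i j j x)) = V"
  unfolding V_def by (intro sum.cong refl X1)
 with X0 show ?thesis by simp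
qed

text \<open>The columns of \<open>M\<close> are orthogonal to the gradient of \<rho>, so the
  divergence of \<open>M u\<close> consists of tangential derivatives of components of u and
  multiples of u. It vanishes on the boundary with u, and its gradient pairs to zero with a
  divergence free field.\<close>

lemma tangential_part_pairing:
 assumes G: "harmonic_field X G" and u: "u \<in> vec_H2_H10 X"
  and ch: "chart X c r \<rho> e" and K: "compact K" "K \<subseteq> ball c r"
  and M: "!!i k. kcd 2 (M i k)" "!!i k x. x \<notin> K ==> M i k x = 0"
  and C: "!!k x. (SUM j. M j k x * partial j \<rho> x) = 0"
 shows "(SUM i. SUM j. LINT x|leb X. G x $ i * mddW M X u i j j x) = 0"
proof -
 have GL: "(%x. G x $ i) \<in> L2 X" for i using G L2_component unfolding harmonic_field_def by blast
 have M1: "kcd 1 (M i k)" "kcd 1 (partial j (M i k))" for i j k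
  using M(1) by (auto intro: kcd_mono[of 2] kcd_partial'[of 2])
 note ddW = mdW_wd[OF u M(1)]
 have ddL: "mddW M X u l j i \<in> L2 X" for l j i by (rule wdT_D(2)[OF ddW])
 have zero: "mdW M X u j i x = 0" if "x \<notin> K" for j i x
  unfolding mdW_def using M(2)[OF that] partial_outside_support[OF K(1) M(2) that] by simp
 define q where "q x = (SUM j. mdW M X u j j x)" for x
 have q0: "wd0 X m q (%x. SUM j. mddW M X u m j j x)" for m
 proof -
  have T: "wd0 X m (%x. SUM l. M l k x * pd X u l k x)
    (%x. SUM l. (partial m (M l k) x * pd X u l k x + M l k x * pdd X u m l k x))" for k
  proof (rule tangential_wd0[OF op bd ch K M(1) M(2) _ vec_H2_H10_wd(1,2)[OF u]])
   show "\<bar>SUM l. M l k x * partial l \<rho> x\<bar> <= 0 * \<rho> x" for x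
    unfolding C by simp
  qed
  have L: "wd0 X m (%x. (SUM j. partial j (M j k) x) * u x $ k)
    (%x. partial m (%x. SUM j. partial j (M j k) x) x * u x $ k + (SUM j. partial j (M j k) x) * pd X u m k x)" for k
   by (intro wdT_mult[OF op bd] test_class_wd vec_H2_H10_wd[OF u] kcd_sum M1)
  have qeq: "q x = (SUM k. (SUM j. partial j (M j k) x) * u x $ k + (SUM l. M l k x * pd X u l k x))" for x
  proof -
   have "q x = (SUM k. SUM j. partial j (M j k) x * u x $ k + M j k x * pd X u j k x)"
    unfolding q_def mdW_def by (rule sum.swap)
   then show ?thesis by (simp add: sum.distrib sum_distrib_right)
  qed
  obtain g where g: "wd0 X m q g"
   by (rule that, unfold ext[of q, OF qeq], rule wdT_sum[OF op bd test_class_wd(2)],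
     rule wdT_add[OF op bd test_class_wd(2) L T])
  have w: "wd X m q (%x. SUM j. mddW M X u m j j x)"
   unfolding q_def[abs_def] by (rule wdT_sum[OF op bd test_class_wd(1) ddW])
  have "AE x in leb X. g x = (SUM j. mddW M X u m j j x)"
   by (rule wd_unique[OF op bd wd0_imp_wd[OF g] w])
  from wdT_cong_AE[OF op bd test_class_wd(2) g AE_I2[OF refl] this wdT_D(1)[OF w] wdT_D(2)[OF w]]
  show ?thesis .
 qed
 have iI: "integrable (leb X) (%x. G x $ i * mddW M X u l j k x)" for i l j k
  by (rule L2_mult_integrable[OF GL ddL])
 have "(SUM i. LINT x|leb X. G x $ i * (SUM j. mddW M X u i j j x)) = 0"
  by (rule harmonic_pairing(1)[OF op bd G ch K q0]) (simp add: q_def zero)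
 then show ?thesis by (simp add: sum_distrib_left iI)
qed

end

section \<open>Tangential and normal cut-off matrices in a chart\<close>

definition gradsq :: "(real^'n => real) => real^'n => real" where
 "gradsq \<rho> x = (SUM i. (partial i \<rho> x)^2)"

text \<open>The squared length of the projection of \<open>G\<close> orthogonal to the gradient of
  \<rho>, in the form of Pythagoras.\<close>

definition tangsq :: "(real^'n => real) => (real^'n => real^'n) => real^'n => real" where
 "tangsq \<rho> G x = (norm (G x))^2 - (SUM i. partial i \<rho> x * G x $ i)^2 / gradsq \<rho> x"

definition tangential :: "(real^'n => real) => (real^'n => real) => real => 'n => 'n => real^'n => real" where
 "tangential \<rho> \<theta> s i k x = \<theta> x * (cos (\<rho> x * (1 / s)))^2 *
   ((if i = k then 1 else 0) - partial i \<rho> x * (partial k \<rho> x / gradsq \<rho> x))"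

text \<open>On the boundary the cosine is 1 and only the normal projection remains. Inside, the
  matrix also receives what the cosine removes from \<open>tangential\<close>, so that the two
  always add up to \<theta> times the identity.\<close>

definition normal :: "(real^'n => real) => (real^'n => real) => real => 'n => 'n => real^'n => real" where
 "normal \<rho> \<theta> s i k x = (if i = k then 1 else 0) * \<theta> x - tangential \<rho> \<theta> s i k x"

text \<open>Along the unit vector \<open>e\<close> the function \<rho> grows with speed 1. This
  holds at every point of the space, not only in the ball, so division by \<open>gradsq\<close>
  never leaves the class of C^2 functions.\<close>

lemma gradsq_ge_1:
 assumes "chart X c r \<rho> e"
 shows "gradsq \<rho> x >= 1"
proof -
 have k: "kcd 1 \<rho>" and e: "norm e = 1" and sh: "!!x t. \<rho> (x + t *\<^sub>R e) = \<rho> x + t"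
  using assms kcd_mono[of 3 \<rho> 1] by (auto simp: chart_def)
 have "((%t. \<rho> (x + t *\<^sub>R e)) has_real_derivative (SUM i. e $ i * partial i \<rho> (x + 0 *\<^sub>R e))) (at 0)"
  by (rule has_derivative_along_line[OF k])
 moreover have "((%t. \<rho> (x + t *\<^sub>R e)) has_real_derivative 1) (at 0)"
  unfolding sh by (auto intro!: derivative_eq_intros)
 ultimately have "(SUM i. e $ i * partial i \<rho> x) = 1"
  using DERIV_unique by fastforce
 then have "e \<bullet> (\<chi> i. partial i \<rho> x) = 1" by (simp add: inner_vec_def)
 then have "1 <= norm (\<chi> i. partial i \<rho> x)"
  using norm_cauchy_schwarz[of e "\<chi> i. partial i \<rho> x"] e by simp
 then have "1 <= (norm (\<chi> i. partial i \<rho> x))^2" by (rule one_le_power)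
 then show ?thesis by (simp add: gradsq_def norm_vec_sq)
qed

lemma kcd_gradsq:
 assumes "kcd 3 \<rho>"
 shows "kcd 2 (gradsq \<rho>)"
proof -
 have "kcd 2 (partial i \<rho>)" for i using kcd_partial'[OF assms, of 2] by simp
 then show ?thesis unfolding gradsq_def[abs_def] by (intro kcd_sum kcd_power)
qed

lemma kcd_normal_direction:
 assumes "chart X c r \<rho> e"
 shows "kcd 2 (%x. partial k \<rho> x / gradsq \<rho> x)"
proof -
 have k: "kcd 3 \<rho>" using assms by (simp add: chart_def)
 have "kcd 2 (partial k \<rho>)" using kcd_partial'[OF k, of 2] by simp
 moreover have "gradsq \<rho> x ~= 0" for x using gradsq_ge_1[OF assms, of x] by simp
 ultimately show ?thesis by (intro kcd_divide kcd_gradsq[OF k])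
qed

lemma kcd_tangential:
 assumes ch: "chart X c r \<rho> e" and \<theta>: "kcd 2 \<theta>"
 shows "kcd 2 (tangential \<rho> \<theta> s i k)"
proof -
 have k: "kcd 3 \<rho>" using ch by (simp add: chart_def)
 have k2: "kcd 2 (partial i \<rho>)" "kcd 2 \<rho>" using kcd_partial'[OF k, of 2] kcd_mono[OF k] by simp_all
 show ?thesis
  unfolding tangential_def[abs_def]
  by (intro kcd_mult kcd_diff kcd_power kcd_compose_real[OF kcd_cos] kcd_const \<theta> k2 kcd_normal_direction[OF ch])
qed

lemma kcd_normal:
 assumes "chart X c r \<rho> e" and "kcd 2 \<theta>"
 shows "kcd 2 (normal \<rho> \<theta> s i k)"
 unfolding normal_def[abs_def] by (intro kcd_diff kcd_mult kcd_const assms kcd_tangential[OF assms])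

lemma tangential_annihilates_normal:
 assumes "chart X c r \<rho> e"
 shows "(SUM j. tangential \<rho> \<theta> s j k x * partial j \<rho> x) = 0"
proof -
 have g: "gradsq \<rho> x ~= 0" using gradsq_ge_1[OF assms, of x] by simp
 have "(SUM j. tangential \<rho> \<theta> s j k x * partial j \<rho> x)
  = \<theta> x * (cos (\<rho> x * (1 / s)))^2 * ((SUM j. (if j = k then partial j \<rho> x else 0))
    - (SUM j. (partial j \<rho> x)^2) * (partial k \<rho> x / gradsq \<rho> x))"
  unfolding sum_distrib_right sum_subtractf[symmetric] sum_distrib_left tangential_def
  by (rule sum.cong) (auto simp: algebra_simps power2_eq_square)
 also have "(SUM j. (partial j \<rho> x)^2) * (partial k \<rho> x / gradsq \<rho> x) = partial k \<rho> x"
  using g by (simp add: gradsq_def[symmetric])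
 finally show ?thesis by simp
qed

text \<open>The part of \<open>normal\<close> containing products of derivatives of \<rho> is
  symmetric and cancels. What remains carries the factor 1 - cos^2 = sin^2 of \<rho>/s, which is at
  most \<rho>/s.\<close>

lemma normal_commutator:
 fixes \<rho> :: "real^'n => real"
 assumes "s > 0" "\<rho> x > 0" "\<bar>\<theta> x\<bar> <= B" "!!i. \<bar>partial i \<rho> x\<bar> <= V"
 shows "\<bar>normal \<rho> \<theta> s i k x * partial j \<rho> x - normal \<rho> \<theta> s j k x * partial i \<rho> x\<bar> <= (B * (1 / s) * (2 * V)) * \<rho> x"
proof -
 define d where "d i k = (if i = k then 1 else 0 :: real)" for i k :: 'n
 define S where "S = (sin (\<rho> x * (1 / s)))^2"
 have c: "(cos (\<rho> x * (1 / s)))^2 = 1 - S" by (simp add: S_def cos_squared_eq)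
 have eq: "normal \<rho> \<theta> s i k x * partial j \<rho> x - normal \<rho> \<theta> s j k x * partial i \<rho> x
   = \<theta> x * S * (d i k * partial j \<rho> x - d j k * partial i \<rho> x)"
  unfolding normal_def tangential_def c d_def[symmetric] by (simp add: algebra_simps)
 have S: "0 <= S" "S <= \<rho> x * (1 / s)"
 proof -
  have a: "\<bar>sin (\<rho> x * (1 / s))\<bar> <= \<rho> x * (1 / s)"
   using abs_sin_x_le_abs_x[of "\<rho> x * (1 / s)"] assms(1,2) by simp
  have "S = \<bar>sin (\<rho> x * (1 / s))\<bar> * \<bar>sin (\<rho> x * (1 / s))\<bar>" by (simp add: S_def power2_eq_square)
  also have "... <= 1 * \<bar>sin (\<rho> x * (1 / s))\<bar>" by (rule mult_right_mono) auto
  finally show "S <= \<rho> x * (1 / s)" using a by simp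
 qed (simp add: S_def)
 have "\<bar>d i k * partial j \<rho> x - d j k * partial i \<rho> x\<bar> <= 2 * V"
  using assms(4)[of i] assms(4)[of j] by (auto simp: d_def)
 then have "\<bar>\<theta> x\<bar> * S * \<bar>d i k * partial j \<rho> x - d j k * partial i \<rho> x\<bar> <= B * (\<rho> x * (1 / s)) * (2 * V)"
  using S assms order.trans[OF abs_ge_zero assms(3)] by (intro mult_mono) auto
 then show ?thesis unfolding eq abs_mult using S(1) by (simp add: mult_ac)
qed

lemma tangsq_bounds:
 assumes "gradsq \<rho> x >= 1"
 shows "0 <= tangsq \<rho> G x" "tangsq \<rho> G x <= (norm (G x))^2"
  "tangsq \<rho> G x = (SUM k. (G x $ k - (SUM i. partial i \<rho> x * G x $ i) * (partial k \<rho> x / gradsq \<rho> x))^2)"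
proof -
 define a where "a = (SUM i. partial i \<rho> x * G x $ i)"
 define g where "g = gradsq \<rho> x"
 have g: "g > 0" using assms by (simp add: g_def)
 have "(SUM k. (G x $ k - a * (partial k \<rho> x / g))^2)
  = (SUM k. (G x $ k)^2 - 2 * (a / g) * (partial k \<rho> x * G x $ k) + (a / g)^2 * (partial k \<rho> x)^2)"
  by (rule sum.cong) (auto simp: power2_eq_square algebra_simps)
 also have "... = (norm (G x))^2 - 2 * (a / g) * a + (a / g)^2 * g"
  by (simp add: sum.distrib sum_subtractf norm_vec_sq a_def g_def gradsq_def sum_distrib_left)
 also have "... = tangsq \<rho> G x"
  using g by (simp add: tangsq_def a_def[symmetric] g_def[symmetric] power2_eq_square)
 finally show eq: "tangsq \<rho> G x = (SUM k. (G x $ k - (SUM i. partial i \<rho> x * G x $ i) * (partial k \<rho> x / gradsq \<rho> x))^2)"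
  by (simp add: a_def g_def)
 show "0 <= tangsq \<rho> G x" unfolding eq by (intro sum_nonneg) auto
 show "tangsq \<rho> G x <= (norm (G x))^2" using assms by (simp add: tangsq_def)
qed

lemma tangential_apply:
 "(SUM i. G x $ i * tangential \<rho> \<theta> s i k x)
  = \<theta> x * ((cos (\<rho> x * (1 / s)))^2 * (G x $ k - (SUM i. partial i \<rho> x * G x $ i) * (partial k \<rho> x / gradsq \<rho> x)))"
proof -
 have "(SUM i. G x $ i * tangential \<rho> \<theta> s i k x)
  = (SUM i. \<theta> x * (cos (\<rho> x * (1 / s)))^2 * ((if i = k then G x $ i else 0) - (partial i \<rho> x * G x $ i) * (partial k \<rho> x / gradsq \<rho> x)))"
  unfolding tangential_def by (rule sum.cong) (auto simp: algebra_simps)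
 also have "... = \<theta> x * (cos (\<rho> x * (1 / s)))^2 * ((SUM i. (if i = k then G x $ i else 0)) - (SUM i. partial i \<rho> x * G x $ i) * (partial k \<rho> x / gradsq \<rho> x))"
  by (simp only: sum_distrib_left[symmetric] sum_subtractf sum_distrib_right[symmetric])
 finally show ?thesis by (simp add: mult.assoc)
qed

context
 fixes X :: "(real^'n) set"
 assumes op: "open X" and bd: "bounded X"
begin

text \<open>
 The Rellich identity for \<open>b = \<theta> (s/2) sin(2\<rho>/s) \<nabla>\<rho>/|\<nabla>\<rho>|^2\<close>: since \<open>b\<close> is of size \<open>s\<close>, only the
 derivative of the sine matters. It weighs the difference of the tangential and the normal parts by
 \<open>cos(2\<rho>/s) = cos^2(\<rho>/s) - sin^2(\<rho>/s)\<close>.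
\<close>

lemma tangential_equipartition:
 assumes ch: "chart X c r \<rho> e" and K: "compact K" "K \<subseteq> ball c r"
  and \<theta>: "kcd 2 \<theta>" "!!x. x \<notin> K ==> \<theta> x = 0" "!!x. \<theta> x >= 0"
 obtains C where "C >= 0" "!!s G. s > 0 ==> harmonic_field X G ==>
   2 * (LINT x|leb X. \<theta> x * ((cos (\<rho> x * (1 / s)))^2 * tangsq \<rho> G x))
    <= (LINT x|leb X. \<theta> x * (norm (G x))^2) + C * s * (L2norm X G)^2"
proof -
 have in_dom: "!!x. x \<in> ball c r ==> x \<in> X \<longleftrightarrow> \<rho> x > 0" and \<rho>: "kcd 3 \<rho>"
  using ch by (auto simp: chart_def)
 have \<rho>1: "kcd 1 \<rho>" "kcd 0 \<rho>" "kcd 0 (partial i \<rho>)" for i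
  using kcd_mono[OF \<rho>, of 1] kcd_mono[OF \<rho>, of 0] kcd_partial'[OF \<rho>, of 0] by simp_all
 define m where "m j x = partial j \<rho> x / gradsq \<rho> x" for j x
 define v where "v j x = \<theta> x * m j x" for j x
 have m2: "kcd 2 (m j)" for j unfolding m_def[abs_def] by (rule kcd_normal_direction[OF ch])
 have v2: "kcd 2 (v j)" for j unfolding v_def[abs_def] by (intro kcd_mult \<theta>(1) m2)
 have v1: "kcd 1 (v j)" "kcd 0 (v j)" "kcd 0 (partial i (v j))" for i j
  using kcd_mono[OF v2, of 1] kcd_mono[OF v2, of 0] kcd_partial'[OF v2, of 0] by simp_all
 have v0: "v j x = 0" "partial i (v j) x = 0" if "x \<notin> K" for i j x
 proof -
  show "v j x = 0" using \<theta>(2)[OF that] by (simp add: v_def)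
  show "partial i (v j) x = 0"
   by (rule partial_outside_support[OF K(1) _ that]) (simp add: v_def \<theta>(2))
 qed
 have "\<forall>j. \<exists>B>0. \<forall>x\<in>K. \<bar>v j x\<bar> <= B" using kcd_bounded_on[OF v1(2) compact_imp_bounded[OF K(1)]] by metis
 then obtain Bv where Bv: "!!j. Bv j > 0" "!!j x. x \<in> K ==> \<bar>v j x\<bar> <= Bv j" by metis
 define V where "V = (SUM j. Bv j)"
 have V: "\<bar>v j x\<bar> <= V" if "x \<in> K" for j x
 proof -
  have "Bv j <= V" unfolding V_def by (rule member_le_sum) (use Bv(1) less_imp_le in auto)
  then show ?thesis using Bv(2)[OF that, of j] by linarith
 qed
 have "\<forall>p. \<exists>B>0. \<forall>x\<in>K. \<bar>partial (fst p) (v (snd p)) x\<bar> <= B"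
  using kcd_bounded_on[OF v1(3) compact_imp_bounded[OF K(1)]] by metis
 then obtain Bd where Bd: "!!p. Bd p > 0" "!!p x. x \<in> K ==> \<bar>partial (fst p) (v (snd p)) x\<bar> <= Bd p" by metis
 define D where "D = (SUM p. Bd p)"
 have D: "\<bar>partial i (v j) x\<bar> <= D" for i j x
 proof (cases "x \<in> K")
  case True
  have "Bd (i, j) <= D" unfolding D_def by (rule member_le_sum) (use Bd(1) less_imp_le in auto)
  then show ?thesis using Bd(2)[OF True, of "(i, j)"] by simp
 next
  case False
  have "D >= 0" unfolding D_def by (rule sum_nonneg) (use Bd(1) less_imp_le in auto)
  then show ?thesis using v0(2)[OF False] by simp
 qed
 have D0: "D >= 0" using order.trans[OF abs_ge_zero D] .
 define n where "n = real CARD('n)"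
 show ?thesis
 proof (rule that[of "2 * (n * (n * D))"])
  show "0 <= 2 * (n * (n * D))" using D0 by (simp add: n_def)
  fix s :: real and G :: "real^'n => real^'n"
  assume s: "s > 0" and G: "harmonic_field X G"
  have GL: "(%x. G x $ i) \<in> L2 X" "G \<in> L2 X" for i using G L2_component unfolding harmonic_field_def by blast+
  \<comment> \<open>The gradient of \<open>w\<close> is cos(2\<rho>/s) times that of \<rho>,
    independent of s in size. Two bounds are used: |w| \<le> |\<rho>| makes b vanish on the boundary
    as the Rellich identity requires, and |w| \<le> s/2 makes all terms without the derivative of w
    of order s.\<close>
  define w where "w x = (s / 2) * sin (\<rho> x * (2 / s))" for x
  define C2 where "C2 x = cos (\<rho> x * (2 / s))" for x
  have kr: "kcd k (%x. \<rho> x * (2 / s))" if "kcd k \<rho>" for k by (intro kcd_mult kcd_const that)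
  have w1: "kcd 1 w" "kcd 0 w" unfolding w_def[abs_def]
   by (intro kcd_mult kcd_const kcd_compose_real[OF kcd_sin] kr \<rho>1)+
  have pw: "partial i w x = C2 x * partial i \<rho> x" for i x
  proof -
   have "partial i w x = (s / 2) * partial i (%x. sin (\<rho> x * (2 / s))) x"
    unfolding w_def[abs_def] by (rule partial_cmult[OF kcd_compose_real[OF kcd_sin kr[OF \<rho>1(1)]]])
   also have "partial i (%x. sin (\<rho> x * (2 / s))) x = C2 x * partial i (%x. \<rho> x * (2 / s)) x"
    unfolding C2_def by (rule partial_compose_real[OF DERIV_sin kr[OF \<rho>1(1)]])
   also have "partial i (%x. \<rho> x * (2 / s)) x = partial i \<rho> x * (2 / s)"
    using partial_cmult[OF \<rho>1(1), of i "2 / s" x] by (simp add: mult.commute)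
   finally show ?thesis using s by simp
  qed
  have ws: "\<bar>w x\<bar> <= s / 2" for x
  proof -
   have "(s / 2) * \<bar>sin (\<rho> x * (2 / s))\<bar> <= (s / 2) * 1" using s by (intro mult_left_mono) auto
   then show ?thesis using s by (simp add: w_def abs_mult)
  qed
  have wr: "\<bar>w x\<bar> <= \<bar>\<rho> x\<bar>" for x
  proof -
   have "(s / 2) * \<bar>sin (\<rho> x * (2 / s))\<bar> <= (s / 2) * \<bar>\<rho> x * (2 / s)\<bar>"
    by (intro mult_left_mono abs_sin_x_le_abs_x) (use s in simp)
   then show ?thesis using s by (simp add: w_def abs_mult)
  qed
  define b where "b j x = w x * v j x" for j x
  have kb: "kcd 1 (b j)" for j unfolding b_def[abs_def] by (intro kcd_mult w1 v1)
  have pb: "partial i (b j) x = C2 x * partial i \<rho> x * v j x + w x * partial i (v j) x" for i j x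
   unfolding b_def[abs_def] partial_mult[OF w1(1) v1(1)] pw by simp
  have R: "(SUM i. SUM j. LINT x|leb X. partial i (b i) x * (G x $ j * G x $ j))
   = 2 * (SUM i. SUM j. LINT x|leb X. partial i (b j) x * (G x $ i * G x $ j))"
  proof (rule rellich[OF op bd G ch K kb])
   show "b j x = 0" if "x \<notin> K" for j x using v0(1)[OF that] by (simp add: b_def)
   show "\<bar>b j x\<bar> <= V * \<rho> x" if "x \<in> X" "x \<in> K" for j x
   proof -
    have "\<rho> x > 0" using that K(2) in_dom by blast
    then have "\<bar>w x\<bar> * \<bar>v j x\<bar> <= \<rho> x * V"
     using wr[of x] V[OF that(2)] by (intro mult_mono) auto
    then show ?thesis by (simp add: b_def abs_mult mult.commute)
   qed
  qed
  define H where "H x = (SUM i. SUM j. partial i (b i) x * (G x $ j * G x $ j))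
   - 2 * (SUM i. SUM j. partial i (b j) x * (G x $ i * G x $ j))" for x
  have kb0: "kcd 0 (partial i (b j))" for i j using kcd_partial'[OF kb, of 0] by simp
  have ii: "integrable (leb X) (%x. a x * (G x $ i * G x $ j))" if "kcd 0 a" for a i j
   using L2_mult_integrable[OF L2_kcd_mult[OF bd that GL(1)] GL(1)] by (simp add: mult.assoc)
  have iH: "integrable (leb X) H"
   unfolding H_def by (intro lintegrable_diff integrable_mult_right lintegrable_sum ii kb0)
  have H0: "(LINT x|leb X. H x) = 0"
  proof -
   have "integrable (leb X) (%x. SUM i. SUM j. partial i (b i) x * (G x $ j * G x $ j))"
    "integrable (leb X) (%x. 2 * (SUM i. SUM j. partial i (b j) x * (G x $ i * G x $ j)))"
    by (intro integrable_mult_right lintegrable_sum ii kb0)+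
   then show ?thesis
    unfolding H_def using R
    by (simp add: lint_diff lint_sum
      lintegrable_sum ii[OF kb0])
  qed
  define cs where "cs x = (cos (\<rho> x * (1 / s)))^2" for x
  have C2cs: "C2 x = 2 * cs x - 1" for x
   using cos_double_cos[of "\<rho> x * (1 / s)"] by (simp add: C2_def cs_def mult.commute)
  have cs01: "0 <= cs x" "cs x <= 1" for x
   using abs_cos_le_one[of "\<rho> x * (1 / s)"] by (auto simp: cs_def abs_square_le_1 simp del: abs_cos_le_one)
  have key: "2 * (\<theta> x * (cs x * tangsq \<rho> G x)) <= \<theta> x * (norm (G x))^2 + H x + 2 * (n * (n * D)) * s * (norm (G x))^2" for x
  proof -
   define a where "a = (SUM i. partial i \<rho> x * G x $ i)"
   define N where "N = a^2 / gradsq \<rho> x"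
   define E where "E = (SUM i. SUM j. w x * partial i (v i) x * (G x $ j * G x $ j))
    - 2 * (SUM i. SUM j. w x * partial i (v j) x * (G x $ i * G x $ j))"
   have g1: "gradsq \<rho> x >= 1" by (rule gradsq_ge_1[OF ch])
   have N0: "N >= 0" using g1 by (simp add: N_def)
   have s1: "(SUM i. SUM j. C2 x * partial i \<rho> x * v i x * (G x $ j * G x $ j)) = \<theta> x * C2 x * (norm (G x))^2"
   proof -
    have "(SUM i. SUM j. C2 x * partial i \<rho> x * v i x * (G x $ j * G x $ j))
     = (SUM i. (\<theta> x * C2 x / gradsq \<rho> x) * ((partial i \<rho> x)^2 * (SUM j. (G x $ j)^2)))"
     unfolding sum_distrib_left by (intro sum.cong refl) (simp add: v_def m_def power2_eq_square)
    also have "... = (\<theta> x * C2 x / gradsq \<rho> x) * (gradsq \<rho> x * (norm (G x))^2)"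
     unfolding sum_distrib_left[symmetric] sum_distrib_right[symmetric] gradsq_def[symmetric] norm_vec_sq[symmetric] ..
    finally show ?thesis using g1 by simp
   qed
   have s2: "(SUM i. SUM j. C2 x * partial i \<rho> x * v j x * (G x $ i * G x $ j)) = \<theta> x * C2 x * N"
   proof -
    have "(SUM i. SUM j. C2 x * partial i \<rho> x * v j x * (G x $ i * G x $ j))
     = (SUM i. SUM j. (\<theta> x * C2 x / gradsq \<rho> x) * ((partial i \<rho> x * G x $ i) * (partial j \<rho> x * G x $ j)))"
     by (intro sum.cong refl) (simp add: v_def m_def)
    also have "... = (\<theta> x * C2 x / gradsq \<rho> x) * (a * a)"
     unfolding a_def sum_product by (simp only: sum_distrib_left[symmetric])
    finally show ?thesis by (simp add: N_def power2_eq_square)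
   qed
   have HE: "H x = \<theta> x * C2 x * ((norm (G x))^2 - 2 * N) + E"
    unfolding H_def pb distrib_right sum.distrib s1 s2 E_def by (simp add: algebra_simps)
   have Eb: "\<bar>E\<bar> <= 2 * (n * (n * D)) * s * (norm (G x))^2"
   proof -
    have t: "\<bar>w x * p * (G x $ i * G x $ j)\<bar> <= (s / 2) * D * (norm (G x))^2" if "\<bar>p\<bar> <= D" for p i j
    proof -
     have "\<bar>w x\<bar> * \<bar>p\<bar> * (\<bar>G x $ i\<bar> * \<bar>G x $ j\<bar>) <= (s / 2) * D * (norm (G x) * norm (G x))"
      using ws[of x] that component_le_norm_cart[of "G x"] D0 s by (intro mult_mono) auto
     then show ?thesis by (simp add: abs_mult power2_eq_square)
    qed
    have dbl: "\<bar>SUM i. SUM j. w x * p i j * (G x $ i' i j * G x $ j' i j)\<bar> <= n * (n * ((s / 2) * D * (norm (G x))^2))"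
     if p: "!!i j. \<bar>p i j\<bar> <= D" for p :: "'n => 'n => real" and i' j' :: "'n => 'n => 'n"
    proof -
     have "\<bar>SUM i. SUM j. w x * p i j * (G x $ i' i j * G x $ j' i j)\<bar>
       <= (\<Sum>i::'n\<in>UNIV. \<Sum>j::'n\<in>UNIV. (s / 2) * D * (norm (G x))^2)"
      by (intro order.trans[OF sum_abs] sum_mono t p)
     then show ?thesis by (simp add: n_def)
    qed
    have e1: "\<bar>SUM i. SUM j. w x * partial i (v i) x * (G x $ j * G x $ j)\<bar> <= n * (n * ((s / 2) * D * (norm (G x))^2))"
     by (rule dbl[of "%i j. partial i (v i) x" "%i j. j" "%i j. j"]) (rule D)
    have e2: "\<bar>SUM i. SUM j. w x * partial i (v j) x * (G x $ i * G x $ j)\<bar> <= n * (n * ((s / 2) * D * (norm (G x))^2))"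
     by (rule dbl[of "%i j. partial i (v j) x" "%i j. i" "%i j. j"]) (rule D)
    define Y where "Y = n * (n * ((s / 2) * D * (norm (G x))^2))"
    have Y: "2 * (n * (n * D)) * s * (norm (G x))^2 = 4 * Y" by (simp add: Y_def)
    have Y0: "Y >= 0" using D0 s by (simp add: Y_def n_def)
    show ?thesis
     unfolding Y E_def using e1 e2 Y0 unfolding Y_def[symmetric] by linarith
   qed
   have T: "tangsq \<rho> G x = (norm (G x))^2 - N" by (simp add: tangsq_def N_def a_def)
   \<comment> \<open>The right-hand side exceeds the left-hand side by twice sin^2(\<rho>/s) times
     the normal part \<open>N\<close>.\<close>
   have "2 * (cs x * tangsq \<rho> G x) <= (norm (G x))^2 + C2 x * ((norm (G x))^2 - 2 * N)"
   proof -
    have "(norm (G x))^2 + C2 x * ((norm (G x))^2 - 2 * N) - 2 * (cs x * tangsq \<rho> G x) = 2 * ((1 - cs x) * N)"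
     unfolding C2cs T by (simp add: algebra_simps)
    moreover have "0 <= 2 * ((1 - cs x) * N)" using cs01(2)[of x] N0 by simp
    ultimately show ?thesis by linarith
   qed
   then have "\<theta> x * (2 * (cs x * tangsq \<rho> G x)) <= \<theta> x * ((norm (G x))^2 + C2 x * ((norm (G x))^2 - 2 * N))"
    by (rule mult_left_mono[OF _ \<theta>(3)])
   then show ?thesis using Eb unfolding HE by (simp add: algebra_simps)
  qed
  have \<theta>0: "kcd 0 \<theta>" by (rule kcd_mono[OF \<theta>(1)]) simp
  have csk: "kcd 0 cs" unfolding cs_def[abs_def] by (intro kcd_power kcd_compose_real[OF kcd_cos] kcd_mult \<rho>1 kcd_const)
  have in2: "integrable (leb X) (%x. (norm (G x))^2)" by (rule L2D(2)[OF GL(2)])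
  have i\<theta>: "integrable (leb X) (%x. \<theta> x * (norm (G x))^2)"
  proof -
   have "\<theta> x * (norm (G x))^2 = (SUM i. \<theta> x * (G x $ i * G x $ i))" for x
    unfolding norm_vec_sq sum_distrib_left by (simp only: power2_eq_square)
   then show ?thesis by (simp only:) (intro lintegrable_sum ii \<theta>0)
  qed
  have iT: "integrable (leb X) (%x. \<theta> x * (cs x * tangsq \<rho> G x))"
  proof -
   have gi: "kcd 0 (%x. \<theta> x * cs x * (partial i \<rho> x * m j x))" for i j
    by (intro kcd_mult \<theta>0 csk \<rho>1 kcd_mono[OF m2, of 0]) simp
   have "\<theta> x * (cs x * tangsq \<rho> G x) = (SUM i. \<theta> x * cs x * (G x $ i * G x $ i))
     - (SUM i. SUM j. (\<theta> x * cs x * (partial i \<rho> x * m j x)) * (G x $ i * G x $ j))" for x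
   proof -
    have "(SUM i. SUM j. (\<theta> x * cs x * (partial i \<rho> x * m j x)) * (G x $ i * G x $ j))
     = (SUM i. SUM j. (\<theta> x * cs x / gradsq \<rho> x) * ((partial i \<rho> x * G x $ i) * (partial j \<rho> x * G x $ j)))"
     by (intro sum.cong refl) (simp add: m_def)
    also have "... = (\<theta> x * cs x / gradsq \<rho> x) * (SUM i. partial i \<rho> x * G x $ i)^2"
     unfolding power2_eq_square sum_product by (simp only: sum_distrib_left[symmetric])
    finally have X: "(SUM i. SUM j. (\<theta> x * cs x * (partial i \<rho> x * m j x)) * (G x $ i * G x $ j))
     = (\<theta> x * cs x / gradsq \<rho> x) * (SUM i. partial i \<rho> x * G x $ i)^2" .
    have Y: "(SUM i. \<theta> x * cs x * (G x $ i * G x $ i)) = \<theta> x * cs x * (norm (G x))^2"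
     unfolding norm_vec_sq sum_distrib_left by (simp only: power2_eq_square)
    show ?thesis unfolding tangsq_def X Y by (simp add: right_diff_distrib)
   qed
   then show ?thesis
    by (simp only:) (intro lintegrable_diff lintegrable_sum ii gi kcd_mult \<theta>0 csk)
  qed
  have "(LINT x|leb X. 2 * (\<theta> x * (cs x * tangsq \<rho> G x)))
   <= (LINT x|leb X. \<theta> x * (norm (G x))^2 + H x + 2 * (n * (n * D)) * s * (norm (G x))^2)"
   by (intro integral_mono lintegrable_add integrable_mult_right iT iH i\<theta> in2 key)
  also have "... = (LINT x|leb X. \<theta> x * (norm (G x))^2) + 0 + 2 * (n * (n * D)) * s * (L2norm X G)^2"
   unfolding L2norm_sq using i\<theta> iH in2 H0 by simp
  finally show "2 * (LINT x|leb X. \<theta> x * ((cos (\<rho> x * (1 / s)))^2 * tangsq \<rho> G x))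
    <= (LINT x|leb X. \<theta> x * (norm (G x))^2) + 2 * (n * (n * D)) * s * (L2norm X G)^2"
   by (simp add: cs_def)
 qed
qed

end

section \<open>The estimate of the Stokes pressure\<close>

lemma L2norm_component_le:
 fixes f :: "'a::euclidean_space => real^'n"
 assumes "f \<in> L2 X"
 shows "L2norm X (%x. f x $ i) <= L2norm X f"
 using component_le_norm_cart
 by (intro L2norm_mono[OF assms] L2D(1)[OF L2_component[OF assms]] AE_I2) auto

text \<open>At an interior point a coordinate plus a constant large enough to be positive on the
  ball is taken for \<rho>. At a boundary point it is \<sigma> times the i-th coordinate minus
  \<gamma>; as \<gamma> does not depend on that coordinate and \<sigma>^2 = 1, it grows at unit
  speed along \<sigma> times the i-th unit vector.\<close>

lemma chart_exists:
 fixes X :: "(real^'n) set"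
 assumes dom: "bounded_domain X" and bdry: "has_Ck_boundary 3 X" and x: "x \<in> closure X"
 shows "\<exists>r \<rho> e. chart X x r \<rho> e"
proof (cases "x \<in> X")
 case True
 have "open X" using dom by (simp add: bounded_domain_def)
 then obtain r where r: "r > 0" "ball x r \<subseteq> X" using True open_contains_ball by blast
 define i :: 'n where "i = undefined"
 define a where "a = \<bar>x $ i\<bar> + r"
 have "chart X x r (%y. y $ i + a) (axis i 1)"
  unfolding chart_def
 proof (intro conjI ballI allI)
  show "kcd 3 (%y::real^'n. y $ i + a)" by (intro kcd_add kcd_nth kcd_const)
  show "norm (axis i (1::real) :: real^'n) = 1" by simp
  fix y assume y: "y \<in> ball x r"
  have "\<bar>(y - x) $ i\<bar> <= norm (y - x)" by (rule component_le_norm_cart)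
  also have "... < r" using y by (simp add: dist_norm norm_minus_commute)
  finally have "y $ i + a > 0" by (simp add: a_def)
  then show "y \<in> X \<longleftrightarrow> y $ i + a > 0" using y r by auto
 qed (auto simp: r axis_def)
 then show ?thesis by blast
next
 case False
 then have "x \<in> frontier X"
  using x dom by (simp add: frontier_def bounded_domain_def interior_open)
 from bdry[unfolded has_Ck_boundary_def, THEN bspec, OF this]
 obtain r i \<sigma> and \<gamma> :: "real^'n => real" where r: "r > 0" and \<sigma>: "\<sigma> \<in> {-1, 1::real}" and \<gamma>: "kcd 3 \<gamma>"
  and ind': "\<forall>y z. (\<forall>j. j ~= i --> y $ j = z $ j) --> \<gamma> y = \<gamma> z"
  and eq: "X \<inter> ball x r = {y \<in> ball x r. \<sigma> * y $ i > \<gamma> y}"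
  by (elim exE conjE bexE)
 have ind: "\<gamma> y = \<gamma> z" if "!!j. j ~= i ==> y $ j = z $ j" for y z
  using ind' that by presburger
 have "chart X x r (%y. \<sigma> * y $ i - \<gamma> y) (\<sigma> *\<^sub>R axis i 1)"
  unfolding chart_def
 proof (intro conjI ballI allI)
  show "kcd 3 (%y. \<sigma> * y $ i - \<gamma> y)" by (intro kcd_diff kcd_mult kcd_nth kcd_const \<gamma>)
  show "norm (\<sigma> *\<^sub>R axis i (1::real) :: real^'n) = 1" using \<sigma> by auto
  show "y \<in> X \<longleftrightarrow> \<sigma> * y $ i - \<gamma> y > 0" if "y \<in> ball x r" for y
  proof -
   have "y \<in> X \<longleftrightarrow> y \<in> X \<inter> ball x r" using that by blast
   then show ?thesis unfolding eq using that by simp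
  qed
  fix y t
  have "\<gamma> (y + t *\<^sub>R (\<sigma> *\<^sub>R axis i 1)) = \<gamma> y" by (rule ind) (simp add: axis_def)
  moreover have "\<sigma> * (t * \<sigma>) = t" using \<sigma> by auto
  ultimately show "\<sigma> * (y + t *\<^sub>R (\<sigma> *\<^sub>R axis i 1)) $ i - \<gamma> (y + t *\<^sub>R (\<sigma> *\<^sub>R axis i 1)) = \<sigma> * y $ i - \<gamma> y + t"
   by (simp add: axis_def algebra_simps)
 qed (rule r)
 then show ?thesis by blast
qed

lemma sum_telescoping_partition:
 fixes b :: "nat => real"
 shows "(\<Sum>m<M. b m * (\<Prod>l<m. 1 - b l)) = 1 - (\<Prod>l<M. 1 - b l)"
 by (induction M) (auto simp: algebra_simps)

text \<open>Each bump is multiplied by the complements of its predecessors. The sum telescopes to 1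
  minus the product of all complements, and on \<open>X\<close> some bump equals 1; no division by a
  sum of bumps is involved.\<close>

lemma chart_partition:
 fixes X :: "(real^'n) set"
 assumes dom: "bounded_domain X" and bdry: "has_Ck_boundary 3 X"
 obtains M :: nat and c r \<rho> e \<theta> K where
  "!!m. m < M ==> chart X (c m) (r m) (\<rho> m) (e m)" "!!m. m < M ==> compact (K m)"
  "!!m. m < M ==> K m \<subseteq> ball (c m) (r m)" "!!m. kcd 2 (\<theta> m)"
  "!!m x. m < M ==> x \<notin> K m ==> \<theta> m x = 0" "!!m x. \<theta> m x >= (0::real)" "!!x. x \<in> X ==> (\<Sum>m<M. \<theta> m x) = 1"
proof -
 have "\<forall>x. \<exists>p. x \<in> closure X --> chart X x (fst p) (fst (snd p)) (snd (snd p))"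
  using chart_exists[OF dom bdry] by force
 from choice[OF this] obtain p where
  p: "!!x. x \<in> closure X ==> chart X x (fst (p x)) (fst (snd (p x))) (snd (snd (p x)))" by blast
 define R where "R x = fst (p x)" for x
 have Rpos: "R x > 0" if "x \<in> closure X" for x using p[OF that] by (simp add: R_def chart_def)
 have "compact (closure X)" using dom by (simp add: bounded_domain_def compact_closure)
 then obtain Y where Y: "finite Y" "Y \<subseteq> closure X" "closure X \<subseteq> (\<Union>x\<in>Y. ball x (R x / 2))"
 proof (rule compactE_image[where C="closure X" and f="%x. ball x (R x / 2)"])
  show "closure X \<subseteq> (\<Union>x\<in>closure X. ball x (R x / 2))" using Rpos by force
 qed auto
 obtain f where f: "bij_betw f {0..<card Y} Y" using ex_bij_betw_nat_finite[OF Y(1)] by blast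
 define M where "M = card Y"
 have fX: "f m \<in> closure X" if "m < M" for m
  using bij_betwE[OF f] Y(2) that by (auto simp: M_def)
 define b where "b m = bump (f m) (R (f m) / 2) (3 * R (f m) / 4)" for m
 define \<theta> where "\<theta> m x = b m x * (\<Prod>l<m. 1 - b l x)" for m x
 have b01: "0 <= b m x" "b m x <= 1" for m x by (auto simp: b_def bump_bounds)
 show ?thesis
 proof (rule that[of M f "%m. R (f m)" "%m. fst (snd (p (f m)))" "%m. snd (snd (p (f m)))" "%m. cball (f m) (3 * R (f m) / 4)" \<theta>])
  show "chart X (f m) (R (f m)) (fst (snd (p (f m)))) (snd (snd (p (f m))))" if "m < M" for m
   unfolding R_def by (rule p[OF fX[OF that]])
  show "cball (f m) (3 * R (f m) / 4) \<subseteq> ball (f m) (R (f m))" if "m < M" for m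
   using Rpos[OF fX[OF that]] by auto
  show "kcd 2 (\<theta> m)" for m
   unfolding \<theta>_def[abs_def] b_def by (intro kcd_mult kcd_prod kcd_diff kcd_const kcd_bump)
  show "\<theta> m x = 0" if "m < M" "x \<notin> cball (f m) (3 * R (f m) / 4)" for m x
  proof -
   have "b m x = 0"
    unfolding b_def using that Rpos[OF fX[OF that(1)]] by (intro bump_0) (auto simp: dist_commute)
   then show ?thesis by (simp add: \<theta>_def)
  qed
  show "0 <= \<theta> m x" for m x unfolding \<theta>_def using b01 by (intro mult_nonneg_nonneg prod_nonneg) auto
  show "(\<Sum>m<M. \<theta> m x) = 1" if "x \<in> X" for x
  proof -
   have "x \<in> closure X" using that closure_subset by blast
   then obtain y where y: "y \<in> Y" "x \<in> ball y (R y / 2)" using Y(3) by blast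
   have "y \<in> f ` {0..<M}" using f y(1) by (simp add: bij_betw_def M_def)
   then obtain l where l: "l < M" "f l = y" by auto
   have "b l x = 1"
    unfolding b_def l(2) using y Y(2) Rpos[of y] by (intro bump_1) (auto simp: dist_commute)
   then have "(\<Prod>l<M. 1 - b l x) = 0" using l(1) by (intro prod_zero) auto
   then show ?thesis unfolding \<theta>_def using sum_telescoping_partition[of "%m. b m x" M] by simp
  qed
 qed auto
qed

context
 fixes X :: "(real^'n) set"
 assumes op: "open X" and bd: "bounded X"
begin

lemma vec_H2_H10_L2:
 assumes u: "u \<in> vec_H2_H10 X"
 shows "u \<in> L2 X" "vgrad X u \<in> L2 X" "vlaplace X u \<in> L2 X"
  "L2norm X (pd X u j k) <= L2norm X (vgrad X u)"
proof -
 note w = vec_H2_H10_wd[OF op bd u]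
 show "u \<in> L2 X" by (rule L2_vecI) (rule w)
 show g: "vgrad X u \<in> L2 X" by (intro L2_vecI) (simp add: vgrad_def w)
 show "vlaplace X u \<in> L2 X" by (rule L2_vecI) (simp add: vlaplace_def, intro L2_sum w)
 have "L2norm X (%x. vgrad X u x $ k $ j) <= L2norm X (vgrad X u)"
 proof (rule L2norm_mono[OF g])
  have "norm (vgrad X u x $ k $ j) <= norm (vgrad X u x)" for x
   using component_le_norm_cart[of "vgrad X u x $ k" j] Finite_Cartesian_Product.norm_nth_le[of "vgrad X u x" k] by simp
  then show "AE x in leb X. norm (vgrad X u x $ k $ j) <= norm (vgrad X u x)" by simp
  show "(%x. vgrad X u x $ k $ j) \<in> meas X"
   using L2D(1)[OF w(4)] by (simp add: vgrad_def)
 qed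
 then show "L2norm X (pd X u j k) <= L2norm X (vgrad X u)"
  by (simp add: vgrad_def)
qed

lemma weighted_pairing_bound:
 fixes G :: "real^'n => real^'n"
 assumes G: "G \<in> L2 X" and a: "kcd 0 a" "!!x. x \<in> X ==> \<bar>a x\<bar> <= B" "B >= 0" and f: "f \<in> L2 X" "L2norm X f <= F"
 shows "\<bar>LINT x|leb X. G x $ i * (a x * f x)\<bar> <= B * (L2norm X G * F)"
proof -
 have "\<bar>LINT x|leb X. G x $ i * (a x * f x)\<bar> <= L2norm X (%x. G x $ i) * L2norm X (%x. a x * f x)"
  using L2_Cauchy_Schwarz[OF L2_component[OF G, of i] L2_kcd_mult[OF bd a(1) f(1)]] by (simp add: L2inner_def)
 also have "... <= L2norm X G * (B * F)"
 proof (rule mult_mono)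
  show "L2norm X (%x. G x $ i) <= L2norm X G" by (rule L2norm_component_le[OF G])
  have "L2norm X (%x. a x *\<^sub>R f x) <= B * L2norm X f"
   by (rule L2norm_bounded_mult[OF f(1) kcd_measurable[OF a(1)] a(2,3)])
  also have "... <= B * F" using f(2) a(3) by (rule mult_left_mono)
  finally show "L2norm X (%x. a x * f x) <= B * F" by simp
 qed auto
 finally show ?thesis by (simp add: mult_ac)
qed

text \<open>The normal field drops out, and so does the gradient of the divergence of the tangential
  field. There remains the Laplacian of Pu, whose Leibniz expansion contains second derivatives of u
  only in P \<Delta>u; all other terms have coefficients bounded on \<open>X\<close>. The bound
  \<open>C\<close> comes from derivatives of P and is obtained for a fixed layer width
  \<open>s\<close>.\<close>

lemma chart_curlcurl:
 assumes ch: "chart X c r \<rho> e" and K: "compact K" "K \<subseteq> ball c r"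
  and \<theta>: "kcd 2 \<theta>" "!!x. x \<notin> K ==> \<theta> x = 0" and s: "s > 0"
 obtains C where "C >= 0" "!!G u. harmonic_field X G ==> u \<in> vec_H2_H10 X ==>
  \<bar>(SUM i. SUM j. LINT x|leb X. G x $ i * (mddW (normal \<rho> \<theta> s) X u j j i x - mddW (normal \<rho> \<theta> s) X u i j j x))
   + (SUM i. SUM j. LINT x|leb X. G x $ i * (mddW (tangential \<rho> \<theta> s) X u j j i x - mddW (tangential \<rho> \<theta> s) X u i j j x))
   - (SUM i. SUM k. LINT x|leb X. G x $ i * (tangential \<rho> \<theta> s i k x * vlaplace X u x $ k))\<bar>
  <= C * (L2norm X G * (L2norm X u + L2norm X (vgrad X u)))"
proof -
 have in_dom: "!!x. x \<in> ball c r ==> x \<in> X \<longleftrightarrow> \<rho> x > 0" and \<rho>: "kcd 3 \<rho>"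
  using ch by (auto simp: chart_def)
 define P where "P = tangential \<rho> \<theta> s"
 define N where "N = normal \<rho> \<theta> s"
 have P2: "kcd 2 (P i k)" for i k unfolding P_def by (rule kcd_tangential[OF ch \<theta>(1)])
 have N2: "kcd 2 (N i k)" for i k unfolding N_def by (rule kcd_normal[OF ch \<theta>(1)])
 have P0: "P i k x = 0" and N0: "N i k x = 0" if "x \<notin> K" for i k x
  using \<theta>(2)[OF that] by (simp_all add: P_def N_def normal_def tangential_def)
 have P1: "kcd 0 (P i k)" "kcd 0 (partial j (P i k))" "kcd 0 (partial j (partial j (P i k)))" for i j k
  using kcd_mono[OF P2, of 0] kcd_partial'[OF P2, of 0] kcd_partial'[OF kcd_partial'[OF P2, of 1], of 0] by simp_all
 have \<rho>0: "kcd 0 (partial j \<rho>)" for j using kcd_partial'[OF \<rho>, of 0] by simp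
 obtain T where T: "T > 0" "!!x. x \<in> K ==> \<bar>\<theta> x\<bar> <= T"
  using kcd_bounded_on[OF \<theta>(1) compact_imp_bounded[OF K(1)]] by blast
 have "\<forall>j. \<exists>B>0. \<forall>x\<in>K. \<bar>partial j \<rho> x\<bar> <= B" using kcd_bounded_on[OF \<rho>0 compact_imp_bounded[OF K(1)]] by metis
 then obtain Br where Br: "!!j. Br j > 0" "!!j x. x \<in> K ==> \<bar>partial j \<rho> x\<bar> <= Br j" by metis
 define V where "V = (SUM j. Br j)"
 have V: "\<bar>partial j \<rho> x\<bar> <= V" if "x \<in> K" for j x
 proof -
  have "Br j <= V" unfolding V_def by (rule member_le_sum) (use Br(1) less_imp_le in auto)
  then show ?thesis using Br(2)[OF that, of j] by linarith
 qed
 have "\<forall>q. \<exists>B>0. \<forall>x\<in>X. \<bar>partial (fst q) (P (fst (snd q)) (snd (snd q))) x\<bar> <= B"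
  using kcd_bounded_on[OF P1(2) bd] by metis
 then obtain B1 where B1: "!!q. B1 q > 0" "!!q x. x \<in> X ==> \<bar>partial (fst q) (P (fst (snd q)) (snd (snd q))) x\<bar> <= B1 q" by metis
 have "\<forall>q. \<exists>B>0. \<forall>x\<in>X. \<bar>partial (fst q) (partial (fst q) (P (fst (snd q)) (snd (snd q)))) x\<bar> <= B"
  using kcd_bounded_on[OF P1(3) bd] by metis
 then obtain B2 where B2: "!!q. B2 q > 0" "!!q x. x \<in> X ==> \<bar>partial (fst q) (partial (fst q) (P (fst (snd q)) (snd (snd q)))) x\<bar> <= B2 q" by metis
 define C where "C = (SUM i. SUM j. SUM k. B2 (j, i, k) + 2 * B1 (j, i, k))"
 have C0: "C >= 0" unfolding C_def by (intro sum_nonneg add_nonneg_nonneg mult_nonneg_nonneg less_imp_le[OF B1(1)] less_imp_le[OF B2(1)]) auto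
 show ?thesis
 proof (rule that[OF C0])
  fix G u assume G: "harmonic_field X G" and u: "u \<in> vec_H2_H10 X"
  have GL: "G \<in> L2 X" "(%x. G x $ i) \<in> L2 X" for i using G L2_component unfolding harmonic_field_def by blast+
  note w = vec_H2_H10_wd[OF op bd u] and uL = vec_H2_H10_L2[OF u]
  define D where "D j k = pd X u j k" for j k
  define E where "E l j k = wpartial X l (D j k)" for l j k
  have DL: "D j k \<in> L2 X" and EL: "E l j k \<in> L2 X" for l j k unfolding D_def E_def by (rule w)+
  define A where "A = L2norm X u + L2norm X (vgrad X u)"
  have uk: "L2norm X (%x. u x $ k) <= A" for k
   using L2norm_component_le[OF uL(1), of k] L2norm_nonneg[of X "vgrad X u"] unfolding A_def by linarith
  have dk: "L2norm X (D j k) <= A" for j k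
   using uL(4)[of j k] L2norm_nonneg[of X u] unfolding A_def D_def by linarith
  have X1: "(SUM i. SUM j. LINT x|leb X. G x $ i * (mddW N X u j j i x - mddW N X u i j j x)) = 0"
  proof (rule normal_part_pairing[OF op bd G u ch K N2 N0])
   show "\<bar>N i k x * partial j \<rho> x - N j k x * partial i \<rho> x\<bar> <= (T * (1 / s) * (2 * V)) * \<rho> x"
    if "x \<in> X" "x \<in> K" for i j k x
   proof -
    have "\<rho> x > 0" using in_dom that K(2) by blast
    then show ?thesis unfolding N_def by (rule normal_commutator[where \<rho>=\<rho> and \<theta>=\<theta> and x=x, OF s _ T(2)[OF that(2)] V[OF that(2)]])
   qed
  qed
  have ddL: "mddW P X u l j i \<in> L2 X" for l j i by (rule wdT_D(2)[OF mdW_wd[OF op bd u P2]])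
  have iI: "integrable (leb X) (%x. G x $ i * mddW P X u l j k x)" for i l j k
   by (rule L2_mult_integrable[OF GL(2) ddL])
  have X2: "(SUM i. SUM j. LINT x|leb X. G x $ i * mddW P X u i j j x) = 0"
  proof (rule tangential_part_pairing[OF op bd G u ch K P2])
   show "P i k x = 0" if "x \<notin> K" for i k x by (rule P0[OF that])
   show "(SUM j. P j k x * partial j \<rho> x) = 0" for k x
    unfolding P_def by (rule tangential_annihilates_normal[OF ch])
  qed
  have X3: "(SUM i. SUM j. LINT x|leb X. G x $ i * (mddW P X u j j i x - mddW P X u i j j x))
   = (SUM i. SUM j. LINT x|leb X. G x $ i * mddW P X u j j i x)"
   using X2 by (simp add: right_diff_distrib iI sum_subtractf)
  define a1 where "a1 i j k = (LINT x|leb X. G x $ i * (partial j (partial j (P i k)) x * u x $ k))" for i j k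
  define a2 where "a2 i j k = (LINT x|leb X. G x $ i * (partial j (P i k) x * D j k x))" for i j k
  define a3 where "a3 i j k = (LINT x|leb X. G x $ i * (P i k x * E j j k x))" for i j k
  have i1: "integrable (leb X) (%x. G x $ i * (partial j (partial j (P i k)) x * u x $ k))"
   and i2: "integrable (leb X) (%x. G x $ i * (partial j (P i k) x * D j k x))"
   and i3: "integrable (leb X) (%x. G x $ i * (P i k x * E j j k x))" for i j k
   by (rule L2_mult_integrable[OF GL(2) L2_kcd_mult[OF bd P1(3) w(3)]],
     rule L2_mult_integrable[OF GL(2) L2_kcd_mult[OF bd P1(2) DL]],
     rule L2_mult_integrable[OF GL(2) L2_kcd_mult[OF bd P1(1) EL]])
  have X4: "(LINT x|leb X. G x $ i * mddW P X u j j i x) = (SUM k. a1 i j k + a2 i j k + (a2 i j k + a3 i j k))" for i j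
  proof -
   note i12 = lintegrable_add[OF i1 i2] and i23 = lintegrable_add[OF i2 i3]
   show ?thesis
    unfolding mddW_def D_def[symmetric] E_def[symmetric] sum_distrib_left distrib_left a1_def a2_def a3_def
    by (simp only: lint_sum[OF lintegrable_add[OF i12 i23]]
      lint_add[OF i12 i23] lint_add[OF i1 i2]
      lint_add[OF i2 i3])
  qed
  have X5: "(SUM i. SUM k. LINT x|leb X. G x $ i * (P i k x * vlaplace X u x $ k))
   = (SUM i. SUM j. SUM k. a3 i j k)"
  proof -
   have "(LINT x|leb X. G x $ i * (P i k x * vlaplace X u x $ k)) = (SUM j. a3 i j k)" for i k
    unfolding vlaplace_def vec_lambda_beta D_def[symmetric] E_def[symmetric] sum_distrib_left a3_def
    by (simp add: i3)
   then have "(SUM i. SUM k. LINT x|leb X. G x $ i * (P i k x * vlaplace X u x $ k))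
     = (SUM i. SUM k. SUM j. a3 i j k)" by (simp only:)
   also have "... = (SUM i. SUM j. SUM k. a3 i j k)"
    by (intro sum.cong refl sum.swap)
   finally show ?thesis .
  qed
  have b1: "\<bar>a1 i j k\<bar> <= B2 (j, i, k) * (L2norm X G * A)" for i j k
   unfolding a1_def by (rule weighted_pairing_bound[OF GL(1) P1(3) _ less_imp_le[OF B2(1)] w(3) uk]) (use B2(2)[of _ "(j, i, k)"] in simp)
  have b2: "\<bar>a2 i j k\<bar> <= B1 (j, i, k) * (L2norm X G * A)" for i j k
   unfolding a2_def by (rule weighted_pairing_bound[OF GL(1) P1(2) _ less_imp_le[OF B1(1)] DL dk]) (use B1(2)[of _ "(j, i, k)"] in simp)
  have "(SUM i. SUM j. LINT x|leb X. G x $ i * mddW P X u j j i x)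
   - (SUM i. SUM j. SUM k. a3 i j k) = (SUM i. SUM j. SUM k. a1 i j k + 2 * a2 i j k)"
   unfolding X4 sum_subtractf[symmetric] by (intro sum.cong refl) simp
  also have "\<bar>...\<bar> <= (SUM i. SUM j. SUM k. (B2 (j, i, k) + 2 * B1 (j, i, k)) * (L2norm X G * A))"
  proof (intro order.trans[OF sum_abs] sum_mono)
   fix i j k
   have "\<bar>a1 i j k + 2 * a2 i j k\<bar> <= \<bar>a1 i j k\<bar> + 2 * \<bar>a2 i j k\<bar>" by linarith
   also have "... <= (B2 (j, i, k) + 2 * B1 (j, i, k)) * (L2norm X G * A)"
    using b1[of i j k] b2[of i j k] by (simp add: distrib_right)
   finally show "\<bar>a1 i j k + 2 * a2 i j k\<bar> <= (B2 (j, i, k) + 2 * B1 (j, i, k)) * (L2norm X G * A)" .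
  qed
  also have "... = C * (L2norm X G * A)" by (simp only: C_def sum_distrib_right)
  finally have "\<bar>(SUM i. SUM j. LINT x|leb X. G x $ i * mddW P X u j j i x)
   - (SUM i. SUM j. SUM k. a3 i j k)\<bar> <= C * (L2norm X G * A)" .
  then show "\<bar>(SUM i. SUM j. LINT x|leb X. G x $ i * (mddW (normal \<rho> \<theta> s) X u j j i x - mddW (normal \<rho> \<theta> s) X u i j j x))
   + (SUM i. SUM j. LINT x|leb X. G x $ i * (mddW (tangential \<rho> \<theta> s) X u j j i x - mddW (tangential \<rho> \<theta> s) X u i j j x))
   - (SUM i. SUM k. LINT x|leb X. G x $ i * (tangential \<rho> \<theta> s i k x * vlaplace X u x $ k))\<bar>
  <= C * (L2norm X G * (L2norm X u + L2norm X (vgrad X u)))"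
   unfolding P_def[symmetric] N_def[symmetric] A_def[symmetric] X1 X3 X5 by simp
 qed
qed

end

section \<open>Patching the charts together\<close>

lemma square_convex_sum:
 fixes t y :: "nat => real"
 assumes "!!m. t m >= 0" "(\<Sum>m<M. t m) = 1"
 shows "(\<Sum>m<M. t m * y m)^2 <= (\<Sum>m<M. t m * (y m)^2)"
proof -
 define a where "a = (\<Sum>m<M. t m * y m)"
 have "0 <= (\<Sum>m<M. t m * (y m - a)^2)" using assms(1) by (intro sum_nonneg) auto
 also have "... = (\<Sum>m<M. t m * (y m)^2 - (2 * a) * (t m * y m) + a^2 * t m)"
  by (rule sum.cong) (auto simp: power2_eq_square algebra_simps)
 also have "... = (\<Sum>m<M. t m * (y m)^2) - (2 * a) * a + a^2 * 1"
  by (simp only: sum.distrib sum_subtractf sum_distrib_left[symmetric] a_def[symmetric] assms(2))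
 finally show ?thesis by (simp add: a_def[symmetric] power2_eq_square)
qed

context
 fixes X :: "(real^'n) set"
 assumes op: "open X" and bd: "bounded X"
begin

text \<open>At every point \<open>Z\<close> is a convex combination, with weights \<theta>, of
  tangential parts of \<open>G\<close> multiplied by cos^2. Jensen's inequality and cos^4 \<le>
  cos^2 lead to the integrals of the equipartition estimate, which sum to 2 |Z|^2 \<le> (1 + 1/2)
  |G|^2 in L2 norms.\<close>

lemma tangential_field_bound:
 fixes \<theta> :: "nat => real^'n => real"
 assumes ch: "!!m. m < M ==> chart X (c m) (r m) (\<rho> m) (e m)"
  and \<theta>: "!!m. kcd 2 (\<theta> m)" "!!m x. \<theta> m x >= 0" "!!x. x \<in> X ==> (\<Sum>m<M. \<theta> m x) = 1"
  and G: "G \<in> L2 X"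
  and eq: "!!m. m < M ==> 2 * (LINT x|leb X. \<theta> m x * ((cos (\<rho> m x * (1 / s)))^2 * tangsq (\<rho> m) G x))
    <= (LINT x|leb X. \<theta> m x * (norm (G x))^2) + C m * s * (L2norm X G)^2"
  and s: "(\<Sum>m<M. C m) * s <= 1 / 2"
  and Z: "!!x. Z x = (\<chi> k. \<Sum>m<M. SUM i. tangential (\<rho> m) (\<theta> m) s i k x * G x $ i)"
 shows "Z \<in> L2 X" "(L2norm X Z)^2 <= 3 / 4 * (L2norm X G)^2"
proof -
 have GL: "(%x. G x $ i) \<in> L2 X" for i by (rule L2_component[OF G])
 have kt: "kcd 2 (tangential (\<rho> m) (\<theta> m) s i k)" if "m < M" for m i k by (rule kcd_tangential[OF ch[OF that] \<theta>(1)])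
 show ZL: "Z \<in> L2 X"
  by (rule L2_vecI) (unfold Z vec_lambda_beta, intro L2_sum L2_kcd_mult[OF bd kt GL], simp)
 define cs where "cs m x = (cos (\<rho> m x * (1 / s)))^2" for m x
 have cs01: "0 <= cs m x" "cs m x <= 1" for m x
  using abs_cos_le_one[of "\<rho> m x * (1 / s)"] by (auto simp: cs_def abs_square_le_1 simp del: abs_cos_le_one)
 define y where "y m k x = cs m x * (G x $ k - (SUM i. partial i (\<rho> m) x * G x $ i) * (partial k (\<rho> m) x / gradsq (\<rho> m) x))" for m k x
 have ty: "(SUM i. tangential (\<rho> m) (\<theta> m) s i k x * G x $ i) = \<theta> m x * y m k x" for m k x
  unfolding y_def cs_def tangential_apply[symmetric] by (simp add: mult.commute)
 have Zk: "Z x $ k = (\<Sum>m<M. \<theta> m x * y m k x)" for x k unfolding Z vec_lambda_beta ty ..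
 have ysq: "(SUM k. (y m k x)^2) <= cs m x * tangsq (\<rho> m) G x" if "m < M" for m x
 proof -
  have g: "gradsq (\<rho> m) x >= 1" by (rule gradsq_ge_1[OF ch[OF that]])
  have "(SUM k. (y m k x)^2) = (cs m x)^2 * tangsq (\<rho> m) G x"
   unfolding tangsq_bounds(3)[OF g] y_def sum_distrib_left by (simp only: power_mult_distrib)
  also have "... <= cs m x * tangsq (\<rho> m) G x"
  proof (rule mult_right_mono[OF _ tangsq_bounds(1)[OF g]])
   show "(cs m x)^2 <= cs m x" using cs01[of m x] by (simp add: power2_eq_square mult_left_le)
  qed
  finally show ?thesis .
 qed
 have pt: "(norm (Z x))^2 <= (\<Sum>m<M. \<theta> m x * (cs m x * tangsq (\<rho> m) G x))" if x: "x \<in> X" for x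
 proof -
  have "(norm (Z x))^2 = (SUM k. (\<Sum>m<M. \<theta> m x * y m k x)^2)" by (simp add: norm_vec_sq Zk)
  also have "... <= (SUM k. \<Sum>m<M. \<theta> m x * (y m k x)^2)"
   by (intro sum_mono square_convex_sum \<theta>(2) \<theta>(3)[OF x])
  also have "... = (\<Sum>m<M. \<theta> m x * (SUM k. (y m k x)^2))"
   by (subst sum.swap) (simp add: sum_distrib_left)
  also have "... <= (\<Sum>m<M. \<theta> m x * (cs m x * tangsq (\<rho> m) G x))"
   by (intro sum_mono mult_left_mono ysq \<theta>(2)) simp
  finally show ?thesis .
 qed
 have in2: "integrable (leb X) (%x. (norm (G x))^2)" by (rule L2D(2)[OF G])
 have bm: "integrable (leb X) (%x. b x * (norm (G x))^2)"
  if b: "b \<in> meas X" "!!x. x \<in> X ==> \<bar>b x\<bar> <= 1" for b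
  using integrable_bounded_mult[OF in2 b(1), of 1] b(2) by (simp add: mult.commute)
 have \<theta>1: "\<bar>\<theta> m x\<bar> <= 1" if "x \<in> X" "m < M" for x m
  using member_le_sum[of m "{..<M}" "%m. \<theta> m x"] \<theta>(2,3) that by auto
 have \<theta>m: "\<theta> m \<in> meas X" for m by (rule kcd_measurable[OF \<theta>(1)])
 have i\<theta>: "integrable (leb X) (%x. \<theta> m x * (norm (G x))^2)" if "m < M" for m
  by (rule bm[OF \<theta>m \<theta>1[OF _ that]])
 have iT: "integrable (leb X) (%x. \<theta> m x * (cs m x * tangsq (\<rho> m) G x))" if m: "m < M" for m
 proof (rule lintegrable_bound[OF i\<theta>[OF m]])
  have \<rho>3: "kcd 3 (\<rho> m)" using ch[OF m] by (simp add: chart_def)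
  have \<rho>0: "kcd 0 (partial i (\<rho> m))" for i using kcd_partial'[OF \<rho>3, of 0] by simp
  have "tangsq (\<rho> m) G \<in> meas X"
   unfolding tangsq_def[abs_def] gradsq_def
   by (intro borel_measurable_diff borel_measurable_power borel_measurable_divide borel_measurable_sum borel_measurable_times
     kcd_measurable[OF \<rho>0] L2D(1)[OF GL] measurable_compose[OF L2D(1)[OF G] borel_measurable_norm])
  then show "(%x. \<theta> m x * (cs m x * tangsq (\<rho> m) G x)) \<in> meas X"
   unfolding cs_def
   by (intro borel_measurable_times \<theta>m kcd_measurable[OF kcd_power[OF kcd_compose_real[OF kcd_cos[of 0] kcd_mult[OF kcd_mono[OF \<rho>3] kcd_const]]]]) auto
  show "AE x in leb X. norm (\<theta> m x * (cs m x * tangsq (\<rho> m) G x)) <= norm (\<theta> m x * (norm (G x))^2)"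
  proof (rule AE_I2)
   fix x
   have g: "gradsq (\<rho> m) x >= 1" by (rule gradsq_ge_1[OF ch[OF m]])
   have "cs m x * tangsq (\<rho> m) G x <= 1 * (norm (G x))^2"
    using cs01[of m x] tangsq_bounds(1,2)[OF g, of G] by (intro mult_mono) auto
   then show "norm (\<theta> m x * (cs m x * tangsq (\<rho> m) G x)) <= norm (\<theta> m x * (norm (G x))^2)"
    using \<theta>(2)[of m x] cs01[of m x] tangsq_bounds(1)[OF g, of G] by (auto simp: abs_mult intro: mult_left_mono)
  qed
 qed
 have "2 * (L2norm X Z)^2 <= 2 * (LINT x|leb X. (\<Sum>m<M. \<theta> m x * (cs m x * tangsq (\<rho> m) G x)))"
  unfolding L2norm_sq by (intro mult_left_mono integral_mono L2D(2)[OF ZL] lintegrable_sum iT) (auto intro: pt)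
 also have "... = (\<Sum>m<M. 2 * (LINT x|leb X. \<theta> m x * (cs m x * tangsq (\<rho> m) G x)))"
  by (subst lint_sum) (auto simp: iT sum_distrib_left)
 also have "... <= (\<Sum>m<M. (LINT x|leb X. \<theta> m x * (norm (G x))^2) + C m * s * (L2norm X G)^2)"
  unfolding cs_def by (intro sum_mono eq) simp
 also have "... = (LINT x|leb X. (\<Sum>m<M. \<theta> m x * (norm (G x))^2)) + (\<Sum>m<M. C m) * s * (L2norm X G)^2"
  by (subst lint_sum) (auto simp: i\<theta> sum.distrib sum_distrib_right)
 also have "(LINT x|leb X. (\<Sum>m<M. \<theta> m x * (norm (G x))^2)) = (L2norm X G)^2"
  unfolding L2norm_sq by (intro lint_cong refl) (simp add: sum_distrib_right[symmetric] \<theta>(3))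
 also have "(L2norm X G)^2 + (\<Sum>m<M. C m) * s * (L2norm X G)^2 <= (L2norm X G)^2 + 1 / 2 * (L2norm X G)^2"
  by (intro add_left_mono mult_right_mono s) simp
 finally show "(L2norm X Z)^2 <= 3 / 4 * (L2norm X G)^2" by simp
qed

text \<open>The normal and tangential fields of all charts add up to u on \<open>X\<close>, but
  \<open>mddW\<close> is given by Leibniz formulas and second derivatives by
  \<open>wpartial\<close>. Uniqueness of weak derivatives, applied once for each order, identifies
  the two almost everywhere.\<close>

lemma curlcurl_decomposition:
 fixes \<theta> :: "nat => real^'n => real"
 assumes u: "u \<in> vec_H2_H10 X" and ch: "!!m. m < M ==> chart X (c m) (r m) (\<rho> m) (e m)"
  and \<theta>: "!!m. kcd 2 (\<theta> m)" "!!x. x \<in> X ==> (\<Sum>m<M. \<theta> m x) = 1"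
 shows "AE x in leb X. pdd X u l j i x
  = (\<Sum>m<M. mddW (normal (\<rho> m) (\<theta> m) s) X u l j i x + mddW (tangential (\<rho> m) (\<theta> m) s) X u l j i x)"
proof -
 note w = vec_H2_H10_wd[OF op bd u]
 have kt: "kcd 2 (tangential (\<rho> m) (\<theta> m) s i k)" "kcd 2 (normal (\<rho> m) (\<theta> m) s i k)" if "m < M" for m i k
  by (rule kcd_tangential[OF ch[OF that] \<theta>(1)], rule kcd_normal[OF ch[OF that] \<theta>(1)])
 have kt1: "kcd 1 (tangential (\<rho> m) (\<theta> m) s i k)" "kcd 1 (normal (\<rho> m) (\<theta> m) s i k)" if "m < M" for m i k
  using kcd_mono[OF kt(1)[OF that], of 1] kcd_mono[OF kt(2)[OF that], of 1] by simp_all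
 define F where "F x = (\<Sum>m<M. mW (normal (\<rho> m) (\<theta> m) s) u i x + mW (tangential (\<rho> m) (\<theta> m) s) u i x)" for x
 define F' where "F' x = (\<Sum>m<M. mdW (normal (\<rho> m) (\<theta> m) s) X u j i x + mdW (tangential (\<rho> m) (\<theta> m) s) X u j i x)" for x
 define F'' where "F'' x = (\<Sum>m<M. mddW (normal (\<rho> m) (\<theta> m) s) X u l j i x + mddW (tangential (\<rho> m) (\<theta> m) s) X u l j i x)" for x
 have FF': "wd X j F F'"
  unfolding F_def[abs_def] F'_def[abs_def]
  by (intro wdT_sum[OF op bd test_class_wd(1)] wdT_add[OF op bd test_class_wd(1)] wd0_imp_wd mW_wd0[OF op bd u] kt1) auto
 have F'F'': "wd X l F' F''"
  unfolding F'_def[abs_def] F''_def[abs_def]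
  by (intro wdT_sum[OF op bd test_class_wd(1)] wdT_add[OF op bd test_class_wd(1)] mdW_wd[OF op bd u] kt) auto
 have Fu: "F x = u x $ i" if "x \<in> X" for x
 proof -
  have "mW (normal (\<rho> m) (\<theta> m) s) u i x + mW (tangential (\<rho> m) (\<theta> m) s) u i x = \<theta> m x * u x $ i" for m
  proof -
   have "mW (normal (\<rho> m) (\<theta> m) s) u i x + mW (tangential (\<rho> m) (\<theta> m) s) u i x
    = (SUM k. if i = k then \<theta> m x * u x $ k else 0)"
    unfolding mW_def sum.distrib[symmetric] normal_def by (rule sum.cong) (auto simp: algebra_simps)
   then show ?thesis by simp
  qed
  then show ?thesis using \<theta>(2)[OF that] by (simp add: F_def sum_distrib_right[symmetric])
 qed
 have "wd X j F (pd X u j i)"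
  by (rule wdT_cong_AE[OF op bd test_class_wd(1) wd0_imp_wd[OF w(1)] _ AE_I2[OF refl] wdT_D(1)[OF FF'] w(4)])
   (use Fu in \<open>auto intro: AE_I2\<close>)
 from wd_unique[OF op bd FF' this] have "AE x in leb X. F' x = pd X u j i x" .
 from wdT_cong_AE[OF op bd test_class_wd(1) F'F'' this AE_I2[OF refl] w(4) wdT_D(2)[OF F'F'']]
 have "wd X l (pd X u j i) F''" .
 from wd_unique[OF op bd w(2) this] show ?thesis unfolding F''_def .
qed

lemma harmonic_curlcurl_bound:
 assumes dom: "bounded_domain X" and bdry: "has_Ck_boundary 3 X"
 obtains C where "C >= 0" "!!G u. harmonic_field X G ==> u \<in> vec_H2_H10 X ==>
  \<bar>SUM i. SUM j. LINT x|leb X. G x $ i *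
    (pdd X u j j i x - pdd X u i j j x)\<bar>
   <= L2norm X G * (sqrt (3 / 4) * L2norm X (vlaplace X u) + C * (L2norm X u + L2norm X (vgrad X u)))"
proof (rule chart_partition[OF dom bdry])
 fix M :: nat and c r \<rho> e K and \<theta> :: "nat => real^'n => real"
 assume P: "!!m. m < M ==> chart X (c m) (r m) (\<rho> m) (e m)" "!!m. m < M ==> compact (K m)"
  "!!m. m < M ==> K m \<subseteq> ball (c m) (r m)" "!!m. kcd 2 (\<theta> m)"
  "!!m x. m < M ==> x \<notin> K m ==> \<theta> m x = 0" "!!m x. \<theta> m x >= 0" "!!x. x \<in> X ==> (\<Sum>m<M. \<theta> m x) = 1"
 have ex: "\<exists>C. m < M --> C >= 0 & (\<forall>s G. s > 0 --> harmonic_field X G -->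
   2 * (LINT x|leb X. \<theta> m x * ((cos (\<rho> m x * (1 / s)))^2 * tangsq (\<rho> m) G x))
    <= (LINT x|leb X. \<theta> m x * (norm (G x))^2) + C * s * (L2norm X G)^2)" for m
 proof (cases "m < M")
  case True
  show ?thesis
  proof (rule tangential_equipartition[OF op bd P(1)[OF True] P(2)[OF True] P(3)[OF True] P(4) P(5)[OF True] P(6)])
   fix C assume "C >= 0" "!!s G. s > 0 ==> harmonic_field X G ==>
   2 * (LINT x|leb X. \<theta> m x * ((cos (\<rho> m x * (1 / s)))^2 * tangsq (\<rho> m) G x))
    <= (LINT x|leb X. \<theta> m x * (norm (G x))^2) + C * s * (L2norm X G)^2"
   then show ?thesis by (intro exI[of _ C]) blast
  qed
 qed simp
 have "\<exists>C1. \<forall>m. m < M --> C1 m >= 0 & (\<forall>s G. s > 0 --> harmonic_field X G -->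
   2 * (LINT x|leb X. \<theta> m x * ((cos (\<rho> m x * (1 / s)))^2 * tangsq (\<rho> m) G x))
    <= (LINT x|leb X. \<theta> m x * (norm (G x))^2) + C1 m * s * (L2norm X G)^2)"
  by (rule choice[OF allI], rule ex)
 then obtain C1 where C1: "!!m. m < M ==> C1 m >= 0" "!!m s G. m < M ==> s > 0 ==> harmonic_field X G ==>
   2 * (LINT x|leb X. \<theta> m x * ((cos (\<rho> m x * (1 / s)))^2 * tangsq (\<rho> m) G x))
    <= (LINT x|leb X. \<theta> m x * (norm (G x))^2) + C1 m * s * (L2norm X G)^2" by blast
 define S where "S = (\<Sum>m<M. C1 m)"
 have S0: "S >= 0" unfolding S_def by (intro sum_nonneg C1) simp
 \<comment> \<open>The equipartition constants are independent of the layer width, so s can be fixed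
   by their sum. The constants from \<open>chart_curlcurl\<close> are obtained for this s and hence
   chosen only afterwards.\<close>
 define s where "s = 1 / (2 * (S + 1))"
 have s: "s > 0" "S * s <= 1 / 2" using S0 by (auto simp: s_def field_simps)
 define CC where "CC A G u = (SUM i. SUM j. LINT x|leb X. G x $ i * (mddW A X u j j i x - mddW A X u i j j x))"
  for A :: "'n => 'n => real^'n => real" and G u :: "real^'n => real^'n"
 define LL where "LL m G u = (SUM i. SUM k. LINT x|leb X. G x $ i * (tangential (\<rho> m) (\<theta> m) s i k x * vlaplace X u x $ k))"
  for m and G u :: "real^'n => real^'n"
 define N where "N G u = L2norm X G * (L2norm X u + L2norm X (vgrad X u))" for G u :: "real^'n => real^'n"
 have ex: "\<exists>C. m < M --> C >= 0 & (\<forall>G u. harmonic_field X G --> u \<in> vec_H2_H10 X -->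
  \<bar>CC (normal (\<rho> m) (\<theta> m) s) G u + CC (tangential (\<rho> m) (\<theta> m) s) G u - LL m G u\<bar> <= C * N G u)" for m
 proof (cases "m < M")
  case True
  show ?thesis
  proof (rule chart_curlcurl[OF op bd P(1)[OF True] P(2)[OF True] P(3)[OF True] P(4) P(5)[OF True] s(1)])
   fix C assume "C >= 0" "!!G u. harmonic_field X G ==> u \<in> vec_H2_H10 X ==>
    \<bar>(SUM i. SUM j. LINT x|leb X. G x $ i * (mddW (normal (\<rho> m) (\<theta> m) s) X u j j i x - mddW (normal (\<rho> m) (\<theta> m) s) X u i j j x))
     + (SUM i. SUM j. LINT x|leb X. G x $ i * (mddW (tangential (\<rho> m) (\<theta> m) s) X u j j i x - mddW (tangential (\<rho> m) (\<theta> m) s) X u i j j x))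
     - (SUM i. SUM k. LINT x|leb X. G x $ i * (tangential (\<rho> m) (\<theta> m) s i k x * vlaplace X u x $ k))\<bar>
    <= C * (L2norm X G * (L2norm X u + L2norm X (vgrad X u)))"
   then show ?thesis unfolding CC_def LL_def N_def by (intro exI[of _ C]) blast
  qed
 qed simp
 have "\<exists>C2. \<forall>m. m < M --> C2 m >= 0 & (\<forall>G u. harmonic_field X G --> u \<in> vec_H2_H10 X -->
  \<bar>CC (normal (\<rho> m) (\<theta> m) s) G u + CC (tangential (\<rho> m) (\<theta> m) s) G u - LL m G u\<bar> <= C2 m * N G u)"
  by (rule choice[OF allI], rule ex)
 then obtain C2 where C2: "!!m. m < M ==> C2 m >= 0" "!!m G u. m < M ==> harmonic_field X G ==> u \<in> vec_H2_H10 X ==>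
  \<bar>CC (normal (\<rho> m) (\<theta> m) s) G u + CC (tangential (\<rho> m) (\<theta> m) s) G u - LL m G u\<bar> <= C2 m * N G u" by blast
 show ?thesis
 proof (rule that[of "\<Sum>m<M. C2 m"])
  show "0 <= (\<Sum>m<M. C2 m)" by (intro sum_nonneg C2) simp
  fix G u assume G: "harmonic_field X G" and u: "u \<in> vec_H2_H10 X"
  have GL: "G \<in> L2 X" "(%x. G x $ i) \<in> L2 X" for i using G L2_component unfolding harmonic_field_def by blast+
  note w = vec_H2_H10_wd[OF op bd u] and uL = vec_H2_H10_L2[OF op bd u]
  have DL: "(%x. vlaplace X u x $ k) \<in> L2 X" for k by (rule L2_component[OF uL(3)])
  define nA tA where "nA m = normal (\<rho> m) (\<theta> m) s" and "tA m = tangential (\<rho> m) (\<theta> m) s" for m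
  have k2: "kcd 2 (nA m i k)" "kcd 2 (tA m i k)" if "m < M" for m i k
   unfolding nA_def tA_def by (rule kcd_normal[OF P(1)[OF that] P(4)], rule kcd_tangential[OF P(1)[OF that] P(4)])
  have ddL: "mddW (nA m) X u l j i \<in> L2 X" "mddW (tA m) X u l j i \<in> L2 X" if m: "m < M" for m l j i
   by (rule wdT_D(2)[OF mdW_wd[OF op bd u]], rule k2(1)[OF m], rule wdT_D(2)[OF mdW_wd[OF op bd u]], rule k2(2)[OF m])
  have iA: "integrable (leb X) (%x. G x $ i * (mddW (nA m) X u j j i x - mddW (nA m) X u i j j x))"
   "integrable (leb X) (%x. G x $ i * (mddW (tA m) X u j j i x - mddW (tA m) X u i j j x))" if "m < M" for m i j
   by (intro L2_mult_integrable GL L2_diff ddL that)+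
  have dec: "AE x in leb X. pdd X u l j i x
   = (\<Sum>m<M. mddW (normal (\<rho> m) (\<theta> m) s) X u l j i x + mddW (tangential (\<rho> m) (\<theta> m) s) X u l j i x)" for l j i
   by (rule curlcurl_decomposition[OF u]) (rule P; assumption)+
  have L1: "(LINT x|leb X. G x $ i *
    (pdd X u j j i x - pdd X u i j j x))
   = (\<Sum>m<M. (LINT x|leb X. G x $ i * (mddW (nA m) X u j j i x - mddW (nA m) X u i j j x))
     + (LINT x|leb X. G x $ i * (mddW (tA m) X u j j i x - mddW (tA m) X u i j j x)))" for i j
  proof -
   have "(LINT x|leb X. G x $ i *
    (pdd X u j j i x - pdd X u i j j x))
    = (LINT x|leb X. (\<Sum>m<M. G x $ i * (mddW (nA m) X u j j i x - mddW (nA m) X u i j j x)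
      + G x $ i * (mddW (tA m) X u j j i x - mddW (tA m) X u i j j x)))"
   proof (rule integral_cong_AE)
    show "(%x. G x $ i * (pdd X u j j i x - pdd X u i j j x)) \<in> meas X"
     by (intro borel_measurable_times borel_measurable_diff L2D(1)[OF GL(2)] L2D(1)[OF w(5)])
    show "(%x. \<Sum>m<M. G x $ i * (mddW (nA m) X u j j i x - mddW (nA m) X u i j j x)
      + G x $ i * (mddW (tA m) X u j j i x - mddW (tA m) X u i j j x)) \<in> meas X"
     by (intro borel_measurable_sum borel_measurable_add borel_measurable_integrable iA) auto
    show "AE x in leb X. G x $ i * (pdd X u j j i x - pdd X u i j j x)
     = (\<Sum>m<M. G x $ i * (mddW (nA m) X u j j i x - mddW (nA m) X u i j j x)
      + G x $ i * (mddW (tA m) X u j j i x - mddW (tA m) X u i j j x))"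
     using dec[of j j i] dec[of i j j]
    proof eventually_elim
     case (elim x)
     show ?case
      unfolding elim(1) elim(2) nA_def[symmetric] tA_def[symmetric] sum_subtractf[symmetric] sum_distrib_left
      by (rule sum.cong) (auto simp: algebra_simps)
    qed
   qed
   also have "... = (\<Sum>m<M. (LINT x|leb X. G x $ i * (mddW (nA m) X u j j i x - mddW (nA m) X u i j j x)
      + G x $ i * (mddW (tA m) X u j j i x - mddW (tA m) X u i j j x)))"
    by (intro lint_sum lintegrable_add iA) auto
   also have "... = (\<Sum>m<M. (LINT x|leb X. G x $ i * (mddW (nA m) X u j j i x - mddW (nA m) X u i j j x))
     + (LINT x|leb X. G x $ i * (mddW (tA m) X u j j i x - mddW (tA m) X u i j j x)))"
    by (intro sum.cong refl lint_add iA) auto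
   finally show ?thesis .
  qed
  have sw: "(SUM i. SUM j. \<Sum>m<M. q m i j) = (\<Sum>m<M. SUM i. SUM j. q m i j)" for q :: "nat => 'n => 'n => real"
  proof -
   have "(SUM i. SUM j. \<Sum>m<M. q m i j) = (SUM i. \<Sum>m<M. SUM j. q m i j)"
    by (intro sum.cong refl sum.swap)
   also have "... = (\<Sum>m<M. SUM i. SUM j. q m i j)" by (rule sum.swap)
   finally show ?thesis .
  qed
  have main: "(SUM i. SUM j. LINT x|leb X. G x $ i *
    (pdd X u j j i x - pdd X u i j j x))
   = (\<Sum>m<M. CC (nA m) G u + CC (tA m) G u)"
   unfolding L1 sw CC_def by (simp add: sum.distrib)
  \<comment> \<open>The tangential matrices are moved from the Laplacian to \<open>G\<close>;
    Cauchy-Schwarz then keeps the full norm of the Laplacian and puts the gain into the norm of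
    \<open>Z\<close>.\<close>
  define Z where "Z x = (\<chi> k. \<Sum>m<M. SUM i. tangential (\<rho> m) (\<theta> m) s i k x * G x $ i)" for x
  note Zb = tangential_field_bound[OF P(1) P(4) P(6) P(7) GL(1) C1(2)[OF _ s(1) G] s(2)[unfolded S_def] Z_def]
  have i3: "integrable (leb X) (%x. G x $ i * (tA m i k x * vlaplace X u x $ k))" if "m < M" for m i k
   by (rule L2_mult_integrable[OF GL(2) L2_kcd_mult[OF bd k2(2)[OF that] DL]])
  have LZ: "(\<Sum>m<M. LL m G u) = L2inner X Z (vlaplace X u)"
  proof -
   have "L2inner X Z (vlaplace X u) = (SUM k. LINT x|leb X. Z x $ k * vlaplace X u x $ k)"
    by (rule L2inner_vec[OF op bd Zb(1) uL(3)])
   also have "... = (SUM k. \<Sum>m<M. SUM i. LINT x|leb X. G x $ i * (tA m i k x * vlaplace X u x $ k))"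
   proof (rule sum.cong[OF refl])
    fix k
    have "(LINT x|leb X. Z x $ k * vlaplace X u x $ k)
     = (LINT x|leb X. (\<Sum>m<M. SUM i. G x $ i * (tA m i k x * vlaplace X u x $ k)))"
     unfolding Z_def vec_lambda_beta sum_distrib_right tA_def by (simp only: mult_ac)
    also have "... = (\<Sum>m<M. (LINT x|leb X. (SUM i. G x $ i * (tA m i k x * vlaplace X u x $ k))))"
     by (intro lint_sum lintegrable_sum i3) auto
    also have "... = (\<Sum>m<M. SUM i. LINT x|leb X. G x $ i * (tA m i k x * vlaplace X u x $ k))"
     by (intro sum.cong refl lint_sum i3) auto
    finally show "(LINT x|leb X. Z x $ k * vlaplace X u x $ k)
     = (\<Sum>m<M. SUM i. LINT x|leb X. G x $ i * (tA m i k x * vlaplace X u x $ k))" .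
   qed
   also have "... = (\<Sum>m<M. SUM k. SUM i. LINT x|leb X. G x $ i * (tA m i k x * vlaplace X u x $ k))"
    by (rule sum.swap)
   also have "... = (\<Sum>m<M. LL m G u)"
    unfolding LL_def tA_def by (intro sum.cong refl sum.swap)
   finally show ?thesis by simp
  qed
  have "\<bar>L2inner X Z (vlaplace X u)\<bar> <= L2norm X Z * L2norm X (vlaplace X u)"
   by (rule L2_Cauchy_Schwarz[OF Zb(1) uL(3)])
  also have "... <= (sqrt (3 / 4) * L2norm X G) * L2norm X (vlaplace X u)"
  proof (rule mult_right_mono)
   have "(L2norm X Z)^2 <= (sqrt (3 / 4) * L2norm X G)^2" using Zb(2) by (simp add: power_mult_distrib)
   then show "L2norm X Z <= sqrt (3 / 4) * L2norm X G" by (rule power2_le_imp_le) simp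
  qed simp
  finally have Zf: "\<bar>\<Sum>m<M. LL m G u\<bar> <= L2norm X G * (sqrt (3 / 4) * L2norm X (vlaplace X u))"
   unfolding LZ by (simp add: mult_ac)
  have "\<bar>(\<Sum>m<M. CC (nA m) G u + CC (tA m) G u) - (\<Sum>m<M. LL m G u)\<bar> <= (\<Sum>m<M. C2 m * N G u)"
   unfolding sum_subtractf[symmetric] nA_def tA_def
   by (intro order.trans[OF sum_abs] sum_mono C2(2) G u) simp
  also have "... = L2norm X G * ((\<Sum>m<M. C2 m) * (L2norm X u + L2norm X (vgrad X u)))"
   by (simp add: sum_distrib_right[symmetric] N_def mult_ac)
  finally show "\<bar>SUM i. SUM j. LINT x|leb X. G x $ i *
    (pdd X u j j i x - pdd X u i j j x)\<bar>
   <= L2norm X G * (sqrt (3 / 4) * L2norm X (vlaplace X u) + (\<Sum>m<M. C2 m) * (L2norm X u + L2norm X (vgrad X u)))"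
   using Zf unfolding main distrib_left by linarith
 qed
qed

end

section \<open>The Stokes pressure gradient as a harmonic field\<close>

context
 fixes X :: "(real^'n) set"
 assumes op: "open X" and bd: "bounded X"
begin

lemma vdiv_H1:
 assumes u: "u \<in> vec_H2_H10 X"
 shows "vdiv X u \<in> H1 X"
  "AE x in leb X. grad X (vdiv X u) x $ i = (SUM j. pdd X u i j j x)"
proof -
 have w: "wd X i (vdiv X u) (%x. SUM j. pdd X u i j j x)" for i
  unfolding vdiv_def[abs_def]
  by (intro wdT_sum[OF op bd test_class_wd(1)] vec_H2_H10_wd(2)[OF op bd u])
 show "vdiv X u \<in> H1 X" by (rule H1I[OF op bd w])
 show "AE x in leb X. grad X (vdiv X u) x $ i = (SUM j. pdd X u i j j x)"
  using wd_wpartial(2)[OF op bd w, of i] by (simp add: grad_def)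
qed

lemma laplace_minus_grad_div_inner:
 assumes u: "u \<in> vec_H2_H10 X" and z: "z \<in> L2 X"
 shows "L2inner X z (vlaplace X u) - L2inner X z (grad X (vdiv X u))
  = (SUM i. SUM j. LINT x|leb X. z x $ i *
    (pdd X u j j i x - pdd X u i j j x))"
proof -
 note w = vec_H2_H10_wd[OF op bd u] and uL = vec_H2_H10_L2[OF op bd u] and V = vdiv_H1[OF u]
 have gL: "grad X (vdiv X u) \<in> L2 X" by (rule grad_L2[OF op bd V(1)])
 have zL: "(%x. z x $ i) \<in> L2 X" for i by (rule L2_component[OF z])
 have i: "integrable (leb X) (%x. z x $ i * pdd X u l j k x)" for i j k l
  by (rule L2_mult_integrable[OF zL w(5)])
 have "L2inner X z (grad X (vdiv X u))
  = (SUM i. LINT x|leb X. (SUM j. z x $ i * pdd X u i j j x))"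
  unfolding L2inner_vec[OF op bd z gL]
 proof (intro sum.cong refl integral_cong_AE)
  fix i
  show "(%x. z x $ i * grad X (vdiv X u) x $ i) \<in> meas X"
   by (intro borel_measurable_times L2D(1)[OF zL] L2D(1)[OF L2_component[OF gL]])
  show "(%x. SUM j. z x $ i * pdd X u i j j x) \<in> meas X"
   by (intro borel_measurable_sum borel_measurable_integrable i)
  show "AE x in leb X. z x $ i * grad X (vdiv X u) x $ i = (SUM j. z x $ i * pdd X u i j j x)"
   using V(2)[of i] by eventually_elim (simp add: sum_distrib_left)
 qed
 also have "... = (SUM i. SUM j. LINT x|leb X. z x $ i * pdd X u i j j x)"
  by (intro sum.cong refl lint_sum i)
 finally have 1: "L2inner X z (grad X (vdiv X u)) = ..." .
 have "L2inner X z (vlaplace X u)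
  = (SUM i. LINT x|leb X. (SUM j. z x $ i * pdd X u j j i x))"
  unfolding L2inner_vec[OF op bd z uL(3)] vlaplace_def vec_lambda_beta sum_distrib_left ..
 also have "... = (SUM i. SUM j. LINT x|leb X. z x $ i * pdd X u j j i x)"
  by (intro sum.cong refl lint_sum i)
 finally have 2: "L2inner X z (vlaplace X u) = ..." .
 show ?thesis
  unfolding 1 2 sum_subtractf[symmetric] right_diff_distrib
  by (intro sum.cong refl lint_diff[symmetric] i)
qed

text \<open>The divergence of \<Delta>u and that of the gradient of div u coincide as distributions:
  after both derivatives have been moved from u to the gradient of \<phi>, the two sums contain the
  same third derivatives of \<phi>.\<close>

lemma laplace_minus_grad_div_free:
 assumes u: "u \<in> vec_H2_H10 X" and \<phi>: "test_function X \<phi>"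
 shows "(SUM i. SUM j. LINT x|leb X. partial i \<phi> x *
    (pdd X u j j i x - pdd X u i j j x)) = 0"
proof -
 note w = vec_H2_H10_wd[OF op bd u]
 have tp: "test_function X (partial i \<phi>)" "test_function X (partial j (partial i \<phi>))" for i j
  by (intro test_function_partial \<phi>)+
 have two: "(LINT x|leb X. partial i \<phi> x * pdd X u l j k x)
  = (LINT x|leb X. u x $ k * partial j (partial l (partial i \<phi>)) x)" for i j k l
  using wdT_D(3)[OF w(2)[of l j k] test_function_Cc[OF tp(1)[of i]]] wdT_D(3)[OF w(1)[of j k] test_function_kcd[OF tp(2)[of l i]]]
  by (simp add: mult.commute)
 have i: "integrable (leb X) (%x. partial i \<phi> x * pdd X u l j k x)" for i j k l
  by (rule L2_mult_integrable[OF kcd_L2[OF dom_lmeasurable[OF op bd] bd test_function_kcd[OF tp(1), of 0]] w(5)])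
 have c: "partial i (partial j (partial k \<phi>)) = partial j (partial i (partial k \<phi>))" for i j k
  by (rule ext, rule partial_commute, rule test_function_kcd[OF tp(1)])
 have c': "partial i (partial j (partial k \<phi>)) = partial i (partial k (partial j \<phi>))" for i j k
  by (rule arg_cong[where f="partial i"], rule ext, rule partial_commute, rule test_function_kcd[OF \<phi>])
 have "(SUM i. SUM j. LINT x|leb X. partial i \<phi> x *
    (pdd X u j j i x - pdd X u i j j x))
   = (SUM i. SUM j. LINT x|leb X. partial i \<phi> x * pdd X u j j i x)
   - (SUM i. SUM j. LINT x|leb X. partial i \<phi> x * pdd X u i j j x)"
  unfolding sum_subtractf[symmetric] right_diff_distrib by (intro sum.cong refl lint_diff i)
 also have "... = (SUM i. SUM j. LINT x|leb X. u x $ i * partial j (partial j (partial i \<phi>)) x)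
   - (SUM j. SUM i. LINT x|leb X. u x $ j * partial j (partial i (partial i \<phi>)) x)"
  unfolding two by (rule arg_cong2[where f="(-)", OF refl sum.swap])
 also have "... = 0"
  unfolding c[of _ _ _, symmetric] by (simp add: c[of j j' for j j'] c')
 finally show ?thesis .
qed

text \<open>The pressure gradient is orthogonal to \<open>gradients_perp\<close>, being the
  complement of a projection minus a gradient; hence it is curl free. Paired with the gradient of a
  test function the projection drops out, leaving the divergence of \<Delta>u minus the gradient of
  div u, which is zero. Paired with itself the projection drops out again, which gives the formula
  for the norm.\<close>

lemma grad_pS_harmonic:
 assumes u: "u \<in> vec_H2_H10 X"
 shows "harmonic_field X (grad_pS X u)" "grad_pS X u \<in> L2 X"
  "(L2norm X (grad_pS X u))^2 = (SUM i. SUM j. LINT x|leb X. grad_pS X u x $ i *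
    (pdd X u j j i x - pdd X u i j j x))"
proof -
 note uL = vec_H2_H10_L2(3)[OF op bd u] and V = vdiv_H1(1)[OF u]
 note h = helmholtz_works[OF op bd uL] and hL = helmholtz_L2[OF op bd uL]
 have gL: "grad X (vdiv X u) \<in> L2 X" by (rule grad_L2[OF op bd V])
 have dL: "(%x. vlaplace X u x - helmholtz X (vlaplace X u) x) \<in> L2 X" by (rule L2_diff[OF uL hL])
 show GL: "grad_pS X u \<in> L2 X" unfolding grad_pS_def[abs_def] by (rule L2_diff[OF dL gL])
 have split: "L2inner X z (grad_pS X u) = L2inner X z (vlaplace X u) - L2inner X z (helmholtz X (vlaplace X u)) - L2inner X z (grad X (vdiv X u))"
  if z: "z \<in> L2 X" for z
  unfolding grad_pS_def[abs_def] by (simp add: L2inner_diff_right[OF dL gL z] L2inner_diff_right[OF uL hL z])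
 have perp: "L2inner X (grad_pS X u) z = 0" if z: "z \<in> gradients_perp X" for z
 proof -
  have zL: "z \<in> L2 X" by (rule gradients_perp_L2[OF op bd z])
  have "L2inner X (grad_pS X u) z = L2inner X (%x. vlaplace X u x - helmholtz X (vlaplace X u) x) z - L2inner X (grad X (vdiv X u)) z"
   unfolding grad_pS_def[abs_def] by (rule L2inner_diff_left[OF dL gL zL])
  also have "L2inner X (grad X (vdiv X u)) z = 0"
   using z V by (simp add: gradients_perp_def L2inner_commute[of _ _ z])
  finally show ?thesis using h(2)[OF z] by simp
 qed
 show "harmonic_field X (grad_pS X u)"
 proof (rule harmonic_fieldI[OF op bd GL perp])
  fix \<phi> assume \<phi>: "test_function X \<phi>"
  have tw: "wd X i \<phi> (partial i \<phi>)" for i by (rule test_wd[OF op bd test_function_kcd[OF \<phi>]])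
  have \<phi>1: "\<phi> \<in> H1 X" by (rule H1I[OF op bd tw])
  define z where "z x = (\<chi> i. partial i \<phi> x)" for x
  have zi: "(%x. z x $ i) \<in> L2 X" for i unfolding z_def using wdT_D(2)[OF tw] by simp
  have zL: "z \<in> L2 X" by (rule L2_vecI[OF zi])
  have "AE x in leb X. \<forall>i\<in>UNIV. wpartial X i \<phi> x = partial i \<phi> x"
   by (rule eventually_ball_finite[OF finite]) (use wd_wpartial(2)[OF op bd tw] in blast)
  then have ae: "AE x in leb X. grad X \<phi> x = z x" by eventually_elim (simp add: grad_def z_def)
  have "L2inner X z (helmholtz X (vlaplace X u)) = L2inner X (grad X \<phi>) (helmholtz X (vlaplace X u))"
   by (rule L2inner_cong_AE[OF ae L2D(1)[OF grad_L2[OF op bd \<phi>1]] L2D(1)[OF zL] L2D(1)[OF hL], symmetric])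
  also have "... = 0" using h(1) \<phi>1 by (simp add: gradients_perp_def L2inner_commute[of _ "grad X \<phi>"])
  finally have "L2inner X z (grad_pS X u) = 0"
   unfolding split[OF zL] using laplace_minus_grad_div_inner[OF u zL] laplace_minus_grad_div_free[OF u \<phi>] by (simp add: z_def)
  then show "(SUM i. LINT x|leb X. grad_pS X u x $ i * partial i \<phi> x) = 0"
   by (simp add: L2inner_vec[OF op bd zL GL] z_def mult.commute)
 qed
 show "(L2norm X (grad_pS X u))^2 = (SUM i. SUM j. LINT x|leb X. grad_pS X u x $ i *
    (pdd X u j j i x - pdd X u i j j x))"
  unfolding laplace_minus_grad_div_inner[OF u GL, symmetric] L2inner_self[symmetric] split[OF GL] using perp[OF h(1)] by simp
qed

lemma grad_pS_bound:
 assumes dom: "bounded_domain X" and bdry: "has_Ck_boundary 3 X"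
 obtains C where "C >= 0" "!!u. u \<in> vec_H2_H10 X ==>
  L2norm X (grad_pS X u) <= sqrt (3 / 4) * L2norm X (vlaplace X u) + C * (L2norm X u + L2norm X (vgrad X u))"
proof (rule harmonic_curlcurl_bound[OF op bd dom bdry])
 fix C assume C: "C >= 0" "!!G u. harmonic_field X G ==> u \<in> vec_H2_H10 X ==>
  \<bar>SUM i. SUM j. LINT x|leb X. G x $ i *
    (pdd X u j j i x - pdd X u i j j x)\<bar>
   <= L2norm X G * (sqrt (3 / 4) * L2norm X (vlaplace X u) + C * (L2norm X u + L2norm X (vgrad X u)))"
 show thesis
 proof (rule that[OF C(1)])
  fix u assume u: "u \<in> vec_H2_H10 X"
  let ?g = "L2norm X (grad_pS X u)" and ?r = "sqrt (3 / 4) * L2norm X (vlaplace X u) + C * (L2norm X u + L2norm X (vgrad X u))"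
  have "?g * ?g <= ?g * ?r"
   using C(2)[OF grad_pS_harmonic(1)[OF u] u] unfolding grad_pS_harmonic(3)[OF u, symmetric] by (simp add: power2_eq_square)
  moreover have "0 <= ?r" using C(1) by (intro add_nonneg_nonneg mult_nonneg_nonneg) auto
  ultimately show "?g <= ?r"
   by (cases "?g = 0") (auto simp: mult_le_cancel_left less_le)
 qed
qed

end

section \<open>The Sobolev inequality\<close>

text \<open>As \<open>real^'n\<close> is not a product type, Lebesgue measure on it is identified
  with a product measure by computing the measure of boxes. The coordinates are two named elements
  exhausting the index type.\<close>

lemma lborel_two:
 fixes i j :: "'n::finite"
 assumes ij: "i ~= j" "(UNIV :: 'n set) = {i, j}"
 shows "(lborel :: (real^'n) measure) = distr (lborel \<Otimes>\<^sub>M lborel) borel (%(a, b). a *\<^sub>R axis i 1 + b *\<^sub>R axis j 1)"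
  (is "_ = distr _ _ ?T")
proof (rule lborel_eqI)
 fix l u :: "real^'n" assume le: "!!b. b \<in> Basis ==> l \<bullet> b <= u \<bullet> b"
 have B: "(Basis :: (real^'n) set) = {axis i 1, axis j 1}" using ij by (auto simp: Basis_vec_def)
 have le': "l $ k <= u $ k" for k using le[of "axis k 1"] by (simp add: cart_eq_inner_axis)
 have [measurable]: "?T \<in> borel_measurable (lborel \<Otimes>\<^sub>M lborel)" by measurable
 have "?T -` box l u = {l $ i<..<u $ i} \<times> {l $ j<..<u $ j}"
 proof -
  have "?T p \<in> box l u \<longleftrightarrow> (l $ i < fst p & fst p < u $ i) & (l $ j < snd p & snd p < u $ j)" for p
  proof -
   have "?T p \<in> box l u \<longleftrightarrow> (\<forall>k\<in>UNIV. l $ k < ?T p $ k & ?T p $ k < u $ k)" by (simp add: mem_box_cart)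
   also have "... \<longleftrightarrow> (\<forall>k\<in>{i, j}. l $ k < ?T p $ k & ?T p $ k < u $ k)" unfolding ij(2) ..
   also have "... \<longleftrightarrow> (l $ i < fst p & fst p < u $ i) & (l $ j < snd p & snd p < u $ j)"
    using ij(1) by (auto simp: case_prod_beta axis_def)
   finally show ?thesis .
  qed
  then show ?thesis by (auto simp del: mem_box)
 qed
 then have "emeasure (distr (lborel \<Otimes>\<^sub>M lborel) borel ?T) (box l u) = ennreal (u $ i - l $ i) * ennreal (u $ j - l $ j)"
  using le' by (simp add: emeasure_distr space_pair_measure lborel.emeasure_pair_measure_Times)
 also have "... = (\<Prod>b\<in>Basis. (u - l) \<bullet> b)"
  unfolding B using ij(1) le' by (simp add: axis_eq_axis inner_axis ennreal_mult)
 finally show "emeasure (distr (lborel \<Otimes>\<^sub>M lborel) borel ?T) (box l u) = (\<Prod>b\<in>Basis. (u - l) \<bullet> b)" .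
qed simp

lemma lborel_three:
 fixes i j k :: "'n::finite"
 assumes ijk: "i ~= j" "i ~= k" "j ~= k" "(UNIV :: 'n set) = {i, j, k}"
 shows "(lborel :: (real^'n) measure) = distr (lborel \<Otimes>\<^sub>M (lborel \<Otimes>\<^sub>M lborel)) borel (%(a, b, c). a *\<^sub>R axis i 1 + b *\<^sub>R axis j 1 + c *\<^sub>R axis k 1)"
  (is "_ = distr _ _ ?T")
proof (rule lborel_eqI)
 fix l u :: "real^'n" assume le: "!!b. b \<in> Basis ==> l \<bullet> b <= u \<bullet> b"
 have B: "(Basis :: (real^'n) set) = {axis i 1, axis j 1, axis k 1}" using ijk by (auto simp: Basis_vec_def)
 have le': "l $ k <= u $ k" for k using le[of "axis k 1"] by (simp add: cart_eq_inner_axis)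
 have [measurable]: "?T \<in> borel_measurable (lborel \<Otimes>\<^sub>M (lborel \<Otimes>\<^sub>M lborel))" by measurable
 have "?T -` box l u = {l $ i<..<u $ i} \<times> ({l $ j<..<u $ j} \<times> {l $ k<..<u $ k})"
 proof -
  have "?T p \<in> box l u \<longleftrightarrow> (l $ i < fst p & fst p < u $ i) & (l $ j < fst (snd p) & fst (snd p) < u $ j)
    & (l $ k < snd (snd p) & snd (snd p) < u $ k)" for p
  proof -
   have "?T p \<in> box l u \<longleftrightarrow> (\<forall>m\<in>UNIV. l $ m < ?T p $ m & ?T p $ m < u $ m)" by (simp add: mem_box_cart)
   also have "... \<longleftrightarrow> (\<forall>m\<in>{i, j, k}. l $ m < ?T p $ m & ?T p $ m < u $ m)" unfolding ijk(4) ..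
   also have "... \<longleftrightarrow> (l $ i < fst p & fst p < u $ i) & (l $ j < fst (snd p) & fst (snd p) < u $ j)
    & (l $ k < snd (snd p) & snd (snd p) < u $ k)"
    using ijk(1-3) by (auto simp: case_prod_beta axis_def)
   finally show ?thesis .
  qed
  then show ?thesis by (auto simp del: mem_box)
 qed
 then have "emeasure (distr (lborel \<Otimes>\<^sub>M (lborel \<Otimes>\<^sub>M lborel)) borel ?T) (box l u)
  = ennreal (u $ i - l $ i) * (ennreal (u $ j - l $ j) * ennreal (u $ k - l $ k))"
  using le' by (simp add: emeasure_distr space_pair_measure lborel_pair.P.emeasure_pair_measure_Times lborel.emeasure_pair_measure_Times)
 also have "... = (\<Prod>b\<in>Basis. (u - l) \<bullet> b)"
  unfolding B using ijk(1-3) le' by (simp add: axis_eq_axis inner_axis ennreal_mult)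
 finally show "emeasure (distr (lborel \<Otimes>\<^sub>M (lborel \<Otimes>\<^sub>M lborel)) borel ?T) (box l u) = (\<Prod>b\<in>Basis. (u - l) \<bullet> b)" .
qed simp

lemma nn_integral_two:
 fixes i j :: "'n::finite" and f :: "real^'n => ennreal"
 assumes ij: "i ~= j" "(UNIV :: 'n set) = {i, j}" and [measurable]: "f \<in> borel_measurable borel"
 shows "(NN x. f x) = (NN a. NN b. f (a *\<^sub>R axis i 1 + b *\<^sub>R axis j 1))"
 by (subst lborel_two[OF ij], subst nn_integral_distr, measurable, subst lborel.nn_integral_fst[symmetric], measurable)

lemma nn_integral_three:
 fixes i j k :: "'n::finite" and f :: "real^'n => ennreal"
 assumes ijk: "i ~= j" "i ~= k" "j ~= k" "(UNIV :: 'n set) = {i, j, k}" and [measurable]: "f \<in> borel_measurable borel"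
 shows "(NN x. f x) = (NN a. NN b. NN c. f (a *\<^sub>R axis i 1 + b *\<^sub>R axis j 1 + c *\<^sub>R axis k 1))"
proof -
 let ?T = "%(a, b, c). a *\<^sub>R axis i 1 + b *\<^sub>R axis j 1 + c *\<^sub>R axis k 1 :: real^'n"
 have "(NN x. f x) = (\<integral>\<^sup>+p. f (?T p) \<partial>(lborel \<Otimes>\<^sub>M (lborel \<Otimes>\<^sub>M lborel)))"
  by (subst lborel_three[OF ijk]) (rule nn_integral_distr, measurable)
 also have "... = (\<integral>\<^sup>+a. \<integral>\<^sup>+q. f (?T (a, q)) \<partial>(lborel \<Otimes>\<^sub>M lborel) \<partial>lborel)"
  by (rule lborel_pair.P.nn_integral_fst[symmetric]) measurable
 also have "... = (\<integral>\<^sup>+a. \<integral>\<^sup>+q. f (a *\<^sub>R axis i 1 + fst q *\<^sub>R axis j 1 + snd q *\<^sub>R axis k 1) \<partial>(lborel \<Otimes>\<^sub>M lborel) \<partial>lborel)"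
  by (simp add: case_prod_beta)
 also have "... = (NN a. NN b. NN c. f (a *\<^sub>R axis i 1 + fst (b, c) *\<^sub>R axis j 1 + snd (b, c) *\<^sub>R axis k 1))"
  by (intro nn_integral_cong lborel.nn_integral_fst[symmetric]) measurable
 finally show ?thesis by simp
qed

lemma Cc_line_bound:
 fixes g :: "real^'n => real"
 assumes g: "Cc 1 UNIV g"
 shows "ennreal \<bar>g (y + a *\<^sub>R axis i 1)\<bar> <= (NN t. ennreal \<bar>partial i g (y + t *\<^sub>R axis i 1)\<bar>)"
proof -
 obtain K where K: "compact K" "!!x. x \<notin> K ==> g x = 0" using g unfolding Cc_def by blast
 obtain R where R: "!!x. x \<in> K ==> norm x <= R" using compact_imp_bounded[OF K(1)] unfolding bounded_iff by blast
 \<comment> \<open>Left of \<open>a\<close> and so far out that the point on the line has norm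
   greater than \<open>R\<close> and lies outside the support; the fundamental theorem of calculus
   is applied from there.\<close>
 define s where "s = - (\<bar>R\<bar> + \<bar>a\<bar> + norm y + 1)"
 have sa: "s <= a" unfolding s_def by (smt (verit) norm_ge_zero)
 have "norm (y + s *\<^sub>R axis i 1) >= norm (s *\<^sub>R axis i 1 :: real^'n) - norm y"
  using norm_diff_ineq[of "s *\<^sub>R axis i 1" y] by (simp add: add.commute)
 then have "norm (y + s *\<^sub>R axis i 1) > R" unfolding s_def by (simp add: norm_axis_1) 
 then have gs: "g (y + s *\<^sub>R axis i 1) = 0" using K(2) R by force
 have kg: "kcd 1 g" by (rule Cc_kcd[OF g])
 have cont: "continuous_on UNIV (partial i g)" using kcd_continuous[OF kcd_partial'[OF kg, of 0]] by simp
 let ?f = "%t. partial i g (y + t *\<^sub>R axis i 1)"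
 have f: "has_bochner_integral lborel (%t. ?f t * indicator {s..a} t) (g (y + a *\<^sub>R axis i 1) - g (y + s *\<^sub>R axis i 1))"
 proof (rule has_bochner_integral_FTC_Icc_real[OF sa has_derivative_along_axis[OF kg]])
  show "isCont ?f x" for x
   using continuous_on_compose2[OF cont, of UNIV "%t. y + t *\<^sub>R axis i 1"]
   by (auto simp: continuous_on_eq_continuous_at intro!: continuous_intros)
 qed
 have "ennreal \<bar>g (y + a *\<^sub>R axis i 1)\<bar> = ennreal (norm (\<integral>t. ?f t * indicator {s..a} t \<partial>lborel))"
  using has_bochner_integral_integral_eq[OF f] gs by simp
 also have "... <= (NN t. ennreal (norm (?f t * indicator {s..a} t)))"
  by (rule integral_norm_bound_ennreal[OF integrable.intros[OF f]])
 also have "... <= (NN t. ennreal \<bar>?f t\<bar>)"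
  by (intro nn_integral_mono) (auto split: split_indicator)
 finally show ?thesis .
qed

text \<open>One factor g is bounded by a line integral in direction i, which depends on the other
  coordinate only, and the second factor by one in direction j. The integral of the product
  therefore splits into a product of integrals.\<close>

lemma Loomis_Whitney_two:
 fixes g :: "real^'n => real" and i j :: 'n
 assumes g: "Cc 1 UNIV g" and ij: "i ~= j" "(UNIV :: 'n set) = {i, j}"
 shows "(NN x. ennreal ((g x)^2))
  <= (NN x. ennreal \<bar>partial i g x\<bar>) * (NN x. ennreal \<bar>partial j g x\<bar>)"
proof -
 have kg: "kcd 1 g" by (rule Cc_kcd[OF g])
 have [measurable]: "g \<in> borel_measurable borel" "partial m g \<in> borel_measurable borel" for m
  using kcd_continuous[OF kg] kcd_continuous[OF kcd_partial'[OF kg, of 0]] by (auto intro: borel_measurable_continuous_onI)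
 let ?p = "%a b. a *\<^sub>R axis i 1 + b *\<^sub>R axis j 1 :: real^'n"
 let ?A = "%b. NN a. ennreal \<bar>partial i g (?p a b)\<bar>"
 let ?B = "%a. NN b. ennreal \<bar>partial j g (?p a b)\<bar>"
 have pt: "ennreal ((g (?p a b))^2) <= ?A b * ?B a" for a b
 proof -
  have "ennreal ((g (?p a b))^2) = ennreal \<bar>g (?p a b)\<bar> * ennreal \<bar>g (?p a b)\<bar>"
   by (simp add: ennreal_mult'[symmetric] power2_eq_square)
  also have "... <= ?A b * ?B a"
   using Cc_line_bound[OF g, of "b *\<^sub>R axis j 1" a i] Cc_line_bound[OF g, of "a *\<^sub>R axis i 1" b j]
   by (intro mult_mono) (simp_all add: add.commute)
  finally show ?thesis .
 qed
 have "(NN x. ennreal ((g x)^2)) = (NN a. NN b. ennreal ((g (?p a b))^2))"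
  by (rule nn_integral_two[OF ij]) measurable
 also have "... <= (NN a. NN b. ?A b * ?B a)" by (intro nn_integral_mono pt)
 also have "... = (NN b. ?A b) * (NN a. ?B a)"
  by (simp add: nn_integral_multc nn_integral_cmult)
 also have "(NN a. ?B a) = (NN x. ennreal \<bar>partial j g x\<bar>)"
  by (rule nn_integral_two[OF ij, symmetric]) measurable
 also have "(NN b. ?A b) = (NN a. NN b. ennreal \<bar>partial i g (?p a b)\<bar>)"
  by (rule lborel_pair.Fubini') measurable
 also have "... = (NN x. ennreal \<bar>partial i g x\<bar>)"
  by (rule nn_integral_two[OF ij, symmetric]) measurable
 finally show ?thesis .
qed

text \<open>The Loomis-Whitney inequality for three functions, each independent of one variable:
  Cauchy-Schwarz over (a, b) separates \<delta>, and Cauchy-Schwarz over c inside separates \<alpha>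
  from \<beta>.\<close>

lemma nn_integral_three_factors:
 fixes \<alpha> \<beta> \<delta> :: "real => real => ennreal"
 assumes [measurable]: "(%(x, y). \<alpha> x y) \<in> borel_measurable (lborel \<Otimes>\<^sub>M lborel)" "(%(x, y). \<beta> x y) \<in> borel_measurable (lborel \<Otimes>\<^sub>M lborel)"
  "(%(x, y). \<delta> x y) \<in> borel_measurable (lborel \<Otimes>\<^sub>M lborel)"
 shows "(NN a. NN b. NN c. \<alpha> b c * \<beta> a c * \<delta> a b)^2
  <= (NN b. NN c. (\<alpha> b c)^2) * (NN a. NN c. (\<beta> a c)^2) * (NN a. NN b. (\<delta> a b)^2)"
proof -
 have [measurable]: "(%x. \<alpha> (p x) (q x)) \<in> borel_measurable M" "(%x. \<beta> (p x) (q x)) \<in> borel_measurable M" "(%x. \<delta> (p x) (q x)) \<in> borel_measurable M"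
  if [measurable]: "p \<in> borel_measurable M" "q \<in> borel_measurable M" for p q and M :: "'z measure"
  using measurable_compose[OF _ assms(1), of "%x. (p x, q x)" M] measurable_compose[OF _ assms(2), of "%x. (p x, q x)" M]
   measurable_compose[OF _ assms(3), of "%x. (p x, q x)" M] by auto
 define H where "H a b = (NN c. \<alpha> b c * \<beta> a c)" for a b
 have [measurable]: "(%(a, b). H a b) \<in> borel_measurable (lborel \<Otimes>\<^sub>M lborel)" unfolding H_def by measurable
 have "(NN a. NN b. NN c. \<alpha> b c * \<beta> a c * \<delta> a b) = (NN a. NN b. H a b * \<delta> a b)"
  unfolding H_def by (intro nn_integral_cong nn_integral_multc) measurable
 also have "... = (\<integral>\<^sup>+p. (%(a, b). H a b) p * (%(a, b). \<delta> a b) p \<partial>(lborel \<Otimes>\<^sub>M lborel))"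
  by (subst lborel.nn_integral_fst[symmetric]) auto
 finally have "(NN a. NN b. NN c. \<alpha> b c * \<beta> a c * \<delta> a b)^2
  <= (\<integral>\<^sup>+p. ((%(a, b). H a b) p)^2 \<partial>(lborel \<Otimes>\<^sub>M lborel)) * (\<integral>\<^sup>+p. ((%(a, b). \<delta> a b) p)^2 \<partial>(lborel \<Otimes>\<^sub>M lborel))"
  by (simp only:) (rule Cauchy_Schwarz_nn_integral, measurable)
 also have "... = (NN a. NN b. (H a b)^2) * (NN a. NN b. (\<delta> a b)^2)"
  by (subst (1 2) lborel.nn_integral_fst[symmetric]) auto
 also have "(NN a. NN b. (H a b)^2)
  <= (NN a. NN b. (NN c. (\<alpha> b c)^2) * (NN c. (\<beta> a c)^2))"
  unfolding H_def by (intro nn_integral_mono Cauchy_Schwarz_nn_integral) measurable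
 also have "... = (NN b. NN c. (\<alpha> b c)^2) * (NN a. NN c. (\<beta> a c)^2)"
  by (simp add: nn_integral_multc nn_integral_cmult)
 finally show ?thesis by (simp add: mult_right_mono)
qed

text \<open>The three-factor inequality is applied to square roots of line integrals, which are
  extended nonnegative reals.\<close>

definition esqrt :: "ennreal => ennreal" where
 "esqrt x = (if x = top then top else ennreal (sqrt (enn2real x)))"

lemma esqrt_measurable [measurable]: "esqrt \<in> borel_measurable borel"
 unfolding esqrt_def[abs_def] by measurable

lemma esqrt_sq: "(esqrt x)^2 = x"
 by (cases x) (auto simp: esqrt_def ennreal_power top_power_ennreal)

lemma ennreal_sq_le_imp_le:
 fixes x y :: ennreal
 assumes "x^2 <= y^2" shows "x <= y"
 using assms
 by (cases x; cases y) (auto simp: ennreal_power top_power_ennreal ennreal_le_iff top_unique intro: power2_le_imp_le)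

text \<open>For \<open>g = \<phi>\<^sup>4\<close> the left-hand side is the square of the integral of \<open>\<phi>\<^sup>6\<close>.\<close>

lemma Loomis_Whitney_three:
 fixes g h :: "real^'n => real" and i j k :: 'n
 assumes g: "Cc 1 UNIV g" and ijk: "i ~= j" "i ~= k" "j ~= k" "(UNIV :: 'n set) = {i, j, k}"
  and h: "continuous_on UNIV h" "!!x. (h x)^2 = \<bar>g x\<bar> ^ 3" "!!x. h x >= 0"
 shows "(NN x. ennreal (h x))^2
  <= (NN x. ennreal \<bar>partial i g x\<bar>) * (NN x. ennreal \<bar>partial j g x\<bar>) * (NN x. ennreal \<bar>partial k g x\<bar>)"
proof -
 have kg: "kcd 1 g" by (rule Cc_kcd[OF g])
 have [measurable]: "h \<in> borel_measurable borel" "partial m g \<in> borel_measurable borel" for m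
  using h(1) kcd_continuous[OF kcd_partial'[OF kg, of 0]] by (auto intro: borel_measurable_continuous_onI)
 let ?p = "%a b c. a *\<^sub>R axis i 1 + b *\<^sub>R axis j 1 + c *\<^sub>R axis k 1 :: real^'n"
 let ?A = "%b c. NN a. ennreal \<bar>partial i g (?p a b c)\<bar>"
 let ?B = "%a c. NN b. ennreal \<bar>partial j g (?p a b c)\<bar>"
 let ?D = "%a b. NN c. ennreal \<bar>partial k g (?p a b c)\<bar>"
 have pt: "ennreal (h (?p a b c)) <= esqrt (?A b c) * esqrt (?B a c) * esqrt (?D a b)" for a b c
 proof (rule ennreal_sq_le_imp_le)
  have "(ennreal (h (?p a b c)))^2 = ennreal (\<bar>g (?p a b c)\<bar> ^ 3)"
   using h(2,3) by (simp add: ennreal_power)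
  also have "... = ennreal \<bar>g (?p a b c)\<bar> * ennreal \<bar>g (?p a b c)\<bar> * ennreal \<bar>g (?p a b c)\<bar>"
   by (simp add: ennreal_mult'[symmetric] power3_eq_cube)
  also have "... <= ?A b c * ?B a c * ?D a b"
   using Cc_line_bound[OF g, of "b *\<^sub>R axis j 1 + c *\<^sub>R axis k 1" a i] Cc_line_bound[OF g, of "a *\<^sub>R axis i 1 + c *\<^sub>R axis k 1" b j]
     Cc_line_bound[OF g, of "a *\<^sub>R axis i 1 + b *\<^sub>R axis j 1" c k]
   by (intro mult_mono) (simp_all add: add_ac)
  finally show "(ennreal (h (?p a b c)))^2 <= (esqrt (?A b c) * esqrt (?B a c) * esqrt (?D a b))^2"
   by (simp add: power_mult_distrib esqrt_sq)
 qed
 have fub: "(NN x. NN y. f x y) = (NN y. NN x. f x y)"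
  if "case_prod f \<in> borel_measurable (lborel \<Otimes>\<^sub>M lborel)" for f :: "real => real => ennreal"
  by (rule lborel_pair.Fubini'[OF that, symmetric])
 have "(NN x. ennreal (h x)) = (NN a. NN b. NN c. ennreal (h (?p a b c)))"
  by (rule nn_integral_three[OF ijk]) measurable
 also have "... <= (NN a. NN b. NN c. esqrt (?A b c) * esqrt (?B a c) * esqrt (?D a b))"
  by (intro nn_integral_mono pt)
 finally have "(NN x. ennreal (h x))^2 <= ...^2" by (rule power_mono) simp
 also have "... <= (NN b. NN c. (esqrt (?A b c))^2) * (NN a. NN c. (esqrt (?B a c))^2)
   * (NN a. NN b. (esqrt (?D a b))^2)"
  by (rule nn_integral_three_factors) measurable
 also have "... = (NN b. NN c. ?A b c) * (NN a. NN c. ?B a c) * (NN a. NN b. ?D a b)"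
  by (simp only: esqrt_sq)
 also have "(NN a. NN b. ?D a b) = (NN x. ennreal \<bar>partial k g x\<bar>)"
  by (rule nn_integral_three[OF ijk, symmetric]) measurable
 also have "(NN a. NN c. ?B a c) = (NN a. NN b. NN c. ennreal \<bar>partial j g (?p a b c)\<bar>)"
  by (intro nn_integral_cong fub) measurable
 also have "... = (NN x. ennreal \<bar>partial j g x\<bar>)"
  by (rule nn_integral_three[OF ijk, symmetric]) measurable
 also have "(NN b. NN c. ?A b c) = (NN b. NN a. NN c. ennreal \<bar>partial i g (?p a b c)\<bar>)"
  by (intro nn_integral_cong fub) measurable
 also have "... = (NN a. NN b. NN c. ennreal \<bar>partial i g (?p a b c)\<bar>)"
  by (rule fub) measurable
 also have "... = (NN x. ennreal \<bar>partial i g x\<bar>)"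
  by (rule nn_integral_three[OF ijk, symmetric]) measurable
 finally show ?thesis .
qed

section \<open>Poincare and Sobolev inequalities in a bounded domain\<close>

context
 fixes X :: "(real^'n) set"
 assumes op: "open X" and bd: "bounded X"
begin

lemma nn_integral_Cc:
 assumes g: "Cc k X g"
 shows "(NN x. ennreal \<bar>g x\<bar>) = ennreal (LINT x|leb X. \<bar>g x\<bar>)"
proof -
 have "Cc k UNIV g" using Cc_mono[OF g, of k UNIV] by simp
 then have "integrable lborel (%x. \<bar>g x\<bar>)" by (intro integrable_abs Cc_integrable)
 then have "(NN x. ennreal \<bar>g x\<bar>) = ennreal (LINT x|lborel. \<bar>g x\<bar>)"
  by (intro nn_integral_eq_integral) auto
 also have "(LINT x|lborel. \<bar>g x\<bar>) = (LINT x|leb X. \<bar>g x\<bar>)"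
 proof (rule integral_lebesgue_on_support[OF dom_sets[OF op bd], symmetric])
  show "continuous_on UNIV (%x. \<bar>g x\<bar>)" by (intro continuous_intros kcd_continuous[OF Cc_kcd[OF g]])
  show "\<bar>g x\<bar> = 0" if "x \<notin> X" for x using g that unfolding Cc_def by auto
 qed
 finally show ?thesis .
qed

lemma integral_partial_power_le:
 assumes \<phi>: "test_function X \<phi>"
 shows "(LINT x|leb X. \<bar>partial i (%x. \<phi> x ^ Suc n) x\<bar>)
  <= real (Suc n) * (L2norm X (%x. \<phi> x ^ n) * L2norm X (partial i \<phi>))"
proof -
 have k: "kcd m \<phi>" for m by (rule test_function_kcd[OF \<phi>])
 have eq: "\<bar>partial i (%x. \<phi> x ^ Suc n) x\<bar> = real (Suc n) * (\<bar>\<phi> x ^ n\<bar> * \<bar>partial i \<phi> x\<bar>)" for x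
 proof -
  have "partial i (%x. \<phi> x ^ Suc n) x = (real (Suc n) * \<phi> x ^ n) * partial i \<phi> x"
   by (rule partial_compose_real[OF _ k]) (use DERIV_pow[of "Suc n"] in simp)
  then show ?thesis by (simp add: abs_mult mult.assoc)
 qed
 have L: "(%x. \<bar>\<phi> x ^ n\<bar>) \<in> L2 X" "(%x. \<bar>partial i \<phi> x\<bar>) \<in> L2 X"
  using kcd_L2[OF dom_lmeasurable[OF op bd] bd kcd_power[OF k[of 0], of n]]
   kcd_L2[OF dom_lmeasurable[OF op bd] bd kcd_partial[OF k[of "Suc 0"]]]
  by (auto simp: L2_def intro: borel_measurable_abs)
 have "(LINT x|leb X. \<bar>\<phi> x ^ n\<bar> * \<bar>partial i \<phi> x\<bar>) <= L2norm X (%x. \<bar>\<phi> x ^ n\<bar>) * L2norm X (%x. \<bar>partial i \<phi> x\<bar>)"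
  using L2_Cauchy_Schwarz[OF L] by (simp add: L2inner_def)
 also have "... = L2norm X (%x. \<phi> x ^ n) * L2norm X (partial i \<phi>)" by (simp add: L2norm_def)
 finally show ?thesis unfolding eq by (simp add: mult_left_mono)
qed

text \<open>Write the 1 in front of \<phi>^2 as the i-th derivative of the i-th coordinate and
  integrate by parts. The coordinate is bounded by \<open>R\<close> on \<open>X\<close>, and one
  factor of the norm of \<phi> cancels.\<close>

lemma Poincare_test:
 assumes \<phi>: "test_function X \<phi>" and R: "!!x. x \<in> X ==> norm x <= R" "R >= 0"
 shows "L2norm X \<phi> <= 2 * R * L2norm X (partial i \<phi>)"
proof -
 have k: "kcd m \<phi>" for m by (rule test_function_kcd[OF \<phi>])
 have kn: "kcd m (%x :: real^'n. x $ i)" for m by (rule kcd_nth)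
 note lm = dom_lmeasurable[OF op bd]
 have \<phi>L: "\<phi> \<in> L2 X" by (rule kcd_L2[OF lm bd k[of 0]])
 have dL: "partial i \<phi> \<in> L2 X" by (rule kcd_L2[OF lm bd kcd_partial[OF k[of "Suc 0"]]])
 have xL: "(%x. x $ i * \<phi> x) \<in> L2 X" by (rule L2_kcd_mult[OF bd kn[of 0] \<phi>L])
 have Cc: "Cc 1 X (%x. x $ i * (\<phi> x * \<phi> x))" by (intro Cc_mult test_function_Cc \<phi> k kn)
 have pn: "partial i (%x. x $ i) x = 1" for x :: "real^'n"
  by (rule partial_eqI[where D="%h. h $ i", THEN trans]) (auto intro!: bounded_linear_imp_has_derivative bounded_linear_vec_nth)
 have "(LINT x|leb X. x $ i * partial i (%x. \<phi> x * \<phi> x) x) = - (LINT x|leb X. partial i (%x. x $ i) x * (\<phi> x * \<phi> x))"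
  by (rule integral_by_parts_on[OF lm bd kn kcd_mult[OF k k] Cc])
 then have "(L2norm X \<phi>)^2 = - (LINT x|leb X. x $ i * partial i (%x. \<phi> x * \<phi> x) x)"
  by (simp add: pn L2norm_sq power2_eq_square[of "\<phi> _"])
 also have "(LINT x|leb X. x $ i * partial i (%x. \<phi> x * \<phi> x) x) = 2 * L2inner X (%x. x $ i * \<phi> x) (partial i \<phi>)"
  unfolding L2inner_def partial_mult[OF k k] integral_mult_right_zero[symmetric]
  by (rule lint_cong) (simp_all add: algebra_simps)
 also have "- (2 * L2inner X (%x. x $ i * \<phi> x) (partial i \<phi>)) <= 2 * (L2norm X (%x. x $ i * \<phi> x) * L2norm X (partial i \<phi>))"
  using L2_Cauchy_Schwarz[OF xL dL] by linarith
 also have "... <= 2 * ((R * L2norm X \<phi>) * L2norm X (partial i \<phi>))"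
  using L2norm_bounded_mult[OF \<phi>L kcd_measurable[OF kn[of 0]] order.trans[OF component_le_norm_cart R(1)] R(2)]
  by (intro mult_left_mono mult_right_mono) simp_all
 finally have "L2norm X \<phi> * L2norm X \<phi> <= L2norm X \<phi> * (2 * R * L2norm X (partial i \<phi>))"
  by (simp add: power2_eq_square mult_ac)
 then show ?thesis using R(2)
  by (cases "L2norm X \<phi> = 0") (auto simp: mult_le_cancel_left less_le)
qed

text \<open>The planar inequality is applied to \<phi>^3 and then to \<phi>^2, which lowers the
  power by one each time with factors 9 and 4; the first power is handled by Poincare's inequality.
  The constant is sqrt(9 * 4) * 2R = 12 R.\<close>

lemma Sobolev_test_two:
 fixes i j :: 'n
 assumes \<phi>: "test_function X \<phi>" and ij: "i ~= j" "(UNIV :: 'n set) = {i, j}"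
  and R: "!!x. x \<in> X ==> norm x <= R" "R >= 0"
 shows "L2norm X (%x. \<phi> x ^ 3) <= 12 * R * (SUM l. L2norm X (partial l \<phi>)) ^ 3"
proof -
 define d where "d l = L2norm X (partial l \<phi>)" for l
 define c where "c n = L2norm X (%x. \<phi> x ^ n)" for n
 have nn: "d l >= 0" "c n >= 0" for l n by (auto simp: d_def c_def)
 have Cn: "Cc 2 X (%x. \<phi> x ^ Suc n)" for n
  using Cc_mult[OF test_function_Cc[OF \<phi>, of 2] kcd_power[OF test_function_kcd[OF \<phi>], where n=n]] by (simp add: mult.commute)
 have step: "(c (Suc n))^2 <= (real (Suc n) * (c n * d i)) * (real (Suc n) * (c n * d j))" for n
 proof -
  let ?g = "%x. \<phi> x ^ Suc n"
  let ?I = "%l. LINT x|leb X. \<bar>partial l ?g x\<bar>"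
  have I0: "?I l >= 0" for l by (intro lint_nonneg) simp
  have C1: "Cc 1 X (partial l ?g)" for l using Cc_partial[of 1 X ?g l] Cn[of n] by (simp add: numeral_2_eq_2)
  have Cs: "Cc 2 X (%x. ?g x * ?g x)" by (rule Cc_mult[OF Cn Cc_kcd[OF Cn]])
  have "ennreal ((c (Suc n))^2) = (NN x. ennreal ((?g x)^2))"
   using nn_integral_Cc[OF Cs] unfolding c_def L2norm_sq by (simp only: power2_eq_square real_norm_def abs_mult abs_mult_self_eq)
  also have "... <= (NN x. ennreal \<bar>partial i ?g x\<bar>) * (NN x. ennreal \<bar>partial j ?g x\<bar>)"
   by (rule Loomis_Whitney_two[OF Cc_mono[OF Cn] ij]) auto
  also have "... = ennreal (?I i * ?I j)"
   unfolding nn_integral_Cc[OF C1] by (rule ennreal_mult[symmetric, OF I0 I0])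
  finally have "(c (Suc n))^2 <= ?I i * ?I j"
   by (subst (asm) ennreal_le_iff) (rule mult_nonneg_nonneg[OF I0 I0])
  also have "... <= (real (Suc n) * (c n * d i)) * (real (Suc n) * (c n * d j))"
   using nn unfolding c_def d_def by (intro mult_mono integral_partial_power_le \<phi> I0 mult_nonneg_nonneg) auto
  finally show ?thesis .
 qed
 have S: "(SUM l. d l) = d i + d j" unfolding ij(2) using ij(1) by simp
 have suc: "Suc 2 = 3" "Suc 1 = 2" by simp_all
 have "(c 3)^2 <= 9 * (c 2)^2 * (d i * d j)" using step[of 2, unfolded suc] by (simp add: power2_eq_square mult_ac)
 also have "... <= 9 * (4 * (c 1)^2 * (d i * d j)) * (d i * d j)"
  using step[of 1, unfolded suc] nn by (intro mult_right_mono mult_left_mono) (simp_all add: power2_eq_square mult_ac)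
 also have "... = (6 * c 1 * (d i * d j))^2" by (simp add: power2_eq_square)
 finally have "c 3 <= 6 * c 1 * (d i * d j)" by (rule power2_le_imp_le) (simp add: nn)
 also have "... <= 6 * (2 * R * d i) * (d i * d j)"
  using Poincare_test[OF \<phi> R, of i] nn by (intro mult_right_mono mult_left_mono) (auto simp: c_def d_def)
 also have "... = 12 * R * (d i * d i * d j)" by simp
 also have "... <= 12 * R * (d i + d j) ^ 3"
  unfolding power3_eq_cube using nn R(2) by (intro mult_left_mono mult_mono) auto
 finally show ?thesis using S by (simp add: c_def d_def)
qed

text \<open>The spatial inequality for g = \<phi>^4 bounds the fourth power of the norm c of
  \<phi>^3 by 4^3 c^3 times the product of the norms of the three partial derivatives, since each
  derivative of g is 4 \<phi>^3 times one of \<phi>. Cancelling c^3 gives the constant 64.\<close>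

lemma Sobolev_test_three:
 fixes i j k :: 'n
 assumes \<phi>: "test_function X \<phi>" and ijk: "i ~= j" "i ~= k" "j ~= k" "(UNIV :: 'n set) = {i, j, k}"
 shows "L2norm X (%x. \<phi> x ^ 3) <= 64 * (SUM l. L2norm X (partial l \<phi>)) ^ 3"
proof -
 define d where "d l = L2norm X (partial l \<phi>)" for l
 define c where "c = L2norm X (%x. \<phi> x ^ 3)"
 have nn: "d l >= 0" "c >= 0" for l by (auto simp: d_def c_def)
 have Cn: "Cc 2 X (%x. \<phi> x ^ Suc n)" for n
  using Cc_mult[OF test_function_Cc[OF \<phi>, of 2] kcd_power[OF test_function_kcd[OF \<phi>], where n=n]] by (simp add: mult.commute)
 let ?g = "%x. \<phi> x ^ Suc 3"
 let ?I = "%l. LINT x|leb X. \<bar>partial l ?g x\<bar>"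
 have I0: "?I l >= 0" for l by (intro lint_nonneg) simp
 have C1: "Cc 1 X (partial l ?g)" for l using Cc_partial[of 1 X ?g l] Cn[of 3] by (simp add: numeral_2_eq_2)
 have "c^2 = (LINT x|leb X. \<bar>\<phi> x ^ 6\<bar>)"
  unfolding c_def L2norm_sq by (simp add: power_mult[symmetric] power_abs)
 then have "ennreal (c^2) = (NN x. ennreal (\<phi> x ^ 6))"
  using nn_integral_Cc[OF Cn[of 5]] by (simp add: power_abs)
 then have "ennreal ((c^2)^2) = (NN x. ennreal (\<phi> x ^ 6))^2"
  unfolding ennreal_power[OF zero_le_power2, symmetric] by (rule arg_cong)
 also have "... <= (NN x. ennreal \<bar>partial i ?g x\<bar>) * (NN x. ennreal \<bar>partial j ?g x\<bar>) * (NN x. ennreal \<bar>partial k ?g x\<bar>)"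
 proof (rule Loomis_Whitney_three[OF Cc_mono[OF Cn] ijk])
  show "continuous_on UNIV (%x. \<phi> x ^ 6)" by (intro continuous_intros kcd_continuous[OF test_function_kcd[OF \<phi>]])
  show "(\<phi> x ^ 6)^2 = \<bar>\<phi> x ^ Suc 3\<bar> ^ 3" for x by (simp add: power_mult[symmetric] power_abs)
 qed auto
 also have "... = ennreal (?I i * ?I j * ?I k)"
  unfolding nn_integral_Cc[OF C1] using I0 by (simp add: ennreal_mult[symmetric])
 finally have "(c^2)^2 <= ?I i * ?I j * ?I k"
  by (subst (asm) ennreal_le_iff) (auto intro!: mult_nonneg_nonneg I0)
 also have "... <= (4 * (c * d i)) * (4 * (c * d j)) * (4 * (c * d k))"
  using integral_partial_power_le[OF \<phi>, of _ 3] I0 nn unfolding c_def d_def by (intro mult_mono) auto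
 finally have "c ^ 3 * c <= c ^ 3 * (64 * (d i * d j * d k))" by (simp add: power2_eq_square power3_eq_cube mult_ac)
 then have "c <= 64 * (d i * d j * d k)"
  using nn by (cases "c = 0") (auto simp: mult_le_cancel_left less_le)
 also have "... <= 64 * (d i + d j + d k) ^ 3"
  unfolding power3_eq_cube using nn by (intro mult_left_mono mult_mono) (auto intro: add_nonneg_nonneg add_increasing2)
 also have "d i + d j + d k = (SUM l. d l)" unfolding ijk(4) using ijk(1-3) by simp
 finally show ?thesis by (simp add: c_def d_def)
qed

lemma Sobolev_test:
 assumes card: "CARD('n) = 2 \<or> CARD('n) = 3"
 obtains K where "K >= 0" "!!\<phi>. test_function X \<phi> ==> L2norm X (%x. \<phi> x ^ 3) <= K * (SUM l. L2norm X (partial l \<phi>)) ^ 3"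
proof -
 obtain R where R: "!!x. x \<in> X ==> norm x <= R" "R > 0" using bd unfolding bounded_pos by blast
 from card show thesis
 proof
  assume "CARD('n) = 2"
  then obtain i j :: 'n where "UNIV = {i, j}" "i ~= j" unfolding card_2_iff by blast
  then show thesis using that[of "12 * R"] Sobolev_test_two R by simp
 next
  assume "CARD('n) = 3"
  then obtain i j k :: 'n where "UNIV = {i, j, k}" "i ~= j" "j ~= k" "i ~= k" unfolding card_3_iff by blast
  then show thesis using that[of 64] Sobolev_test_three by simp
 qed
qed

text \<open>The cubes of the approximating test functions converge almost everywhere along a
  subsequence but are not known to converge in L2; Fatou's lemma transfers the bound. The Poincare
  inequality is included because lower order terms with u itself occur in the pressure
  estimate.\<close>

lemma Sobolev_H10:
 assumes card: "CARD('n) = 2 \<or> CARD('n) = 3"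
 obtains K where "K >= 0"
  "!!f. f \<in> H10 X ==> (%x. f x ^ 3) \<in> L2 X & L2norm X (%x. f x ^ 3) <= K * (SUM l. L2norm X (wpartial X l f)) ^ 3
    & L2norm X f <= K * (SUM l. L2norm X (wpartial X l f))"
proof (rule Sobolev_test[OF card])
 fix K assume K: "K >= 0" "!!\<phi>. test_function X \<phi> ==> L2norm X (%x. \<phi> x ^ 3) <= K * (SUM l. L2norm X (partial l \<phi>)) ^ 3"
 obtain R where R: "!!x. x \<in> X ==> norm x <= R" "R > 0" using bd unfolding bounded_pos by blast
 have P: "L2norm X \<phi> <= 2 * R * (SUM l. L2norm X (partial l \<phi>))" if "test_function X \<phi>" for \<phi>
 proof -
  fix i :: 'n
  have "L2norm X \<phi> <= 2 * R * L2norm X (partial i \<phi>)" by (rule Poincare_test[OF that R(1)]) (use R(2) in auto)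
  also have "... <= 2 * R * (SUM l. L2norm X (partial l \<phi>))"
   using R(2) by (intro mult_left_mono member_le_sum) auto
  finally show ?thesis .
 qed
 have main: "(%x. f x ^ 3) \<in> L2 X & L2norm X (%x. f x ^ 3) <= K * (SUM l. L2norm X (wpartial X l f)) ^ 3
   & L2norm X f <= 2 * R * (SUM l. L2norm X (wpartial X l f))" if f: "f \<in> H10 X" for f
 proof (rule H10_approx[OF op bd f])
  fix \<Phi> assume \<Phi>: "!!k. test_function X (\<Phi> k)" "(%k. L2norm X (%x. \<Phi> k x - f x)) ----> 0"
   "!!i. (%k. L2norm X (%x. partial i (\<Phi> k) x - wpartial X i f x)) ----> 0"
  have fH: "f \<in> H1 X" using f by (simp add: H10_def)
  note fL = H1_L2(1)[OF op bd fH] and dL = H1_L2(2)[OF op bd fH]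
  have k: "kcd m (\<Phi> n)" for m n by (rule test_function_kcd[OF \<Phi>(1)])
  note lm = dom_lmeasurable[OF op bd]
  have \<Phi>L: "\<Phi> n \<in> L2 X" "partial i (\<Phi> n) \<in> L2 X" "(%x. \<Phi> n x ^ 3) \<in> L2 X" for n i
   by (rule kcd_L2[OF lm bd k[of 0]], rule kcd_L2[OF lm bd kcd_partial[OF k[of "Suc 0"]]], rule kcd_L2[OF lm bd kcd_power[OF k[of 0]]])
  define S where "S n = (SUM l. L2norm X (partial l (\<Phi> n)))" for n
  define s where "s = (SUM l. L2norm X (wpartial X l f))"
  have S: "S ----> s" unfolding S_def[abs_def] s_def
   by (intro tendsto_sum L2_tendsto_norm[OF \<Phi>L(2) dL \<Phi>(3)])
  have n: "(%n. L2norm X (\<Phi> n)) ----> L2norm X f" by (rule L2_tendsto_norm[OF \<Phi>L(1) fL \<Phi>(2)])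
  have 1: "L2norm X f <= 2 * R * s"
   by (rule LIMSEQ_le[OF n tendsto_mult_left[OF S]]) (use P[OF \<Phi>(1)] in \<open>auto simp: S_def\<close>)
  show ?thesis
  proof (rule L2_AE_subseq[OF \<Phi>L(1) fL \<Phi>(2)])
   fix r :: "nat => nat" assume r: "strict_mono r" "AE x in leb X. (%n. \<Phi> (r n) x) ----> f x"
   have lim: "AE x in leb X. (%n. \<Phi> (r n) x ^ 3) ----> f x ^ 3"
    using r(2) by eventually_elim (rule tendsto_power)
   have Kl: "(%n. K * S (r n) ^ 3) ----> K * s ^ 3"
    by (intro tendsto_mult_left tendsto_power LIMSEQ_subseq_LIMSEQ[OF S r(1), unfolded comp_def])
   \<comment> \<open>The bounds along the sequence only converge to K s^3, so Fatou's lemma is used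
     with every strictly larger \<open>B\<close>.\<close>
   have F: "(%x. f x ^ 3) \<in> L2 X" "L2norm X (%x. f x ^ 3) <= B" if B: "B > K * s ^ 3" for B
   proof -
    have "eventually (%n. L2norm X (%x. \<Phi> (r n) x ^ 3) <= B) sequentially"
     using order_tendstoD(2)[OF Kl B]
    proof eventually_elim
     case (elim n)
     then show ?case using K(2)[OF \<Phi>(1), of "r n"] by (simp add: S_def)
    qed
    from L2_Fatou[OF \<Phi>L(3) borel_measurable_power[OF L2D(1)[OF fL]] this lim]
    show "(%x. f x ^ 3) \<in> L2 X" "L2norm X (%x. f x ^ 3) <= B" by blast+
   qed
   have "L2norm X (%x. f x ^ 3) <= K * s ^ 3" by (rule dense_ge) (rule F(2))
   then show ?thesis using F(1)[of "K * s ^ 3 + 1"] 1 by (simp add: s_def)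
  qed
 qed
 show thesis
 proof (rule that[of "max K (2 * R)"])
  show "0 <= max K (2 * R)" using K(1) by simp
  fix f assume f: "f \<in> H10 X"
  let ?s = "SUM l. L2norm X (wpartial X l f)"
  have "?s >= 0" by (intro sum_nonneg) simp
  then have "K * ?s ^ 3 <= max K (2 * R) * ?s ^ 3" "2 * R * ?s <= max K (2 * R) * ?s"
   by (intro mult_right_mono, auto)+
  then show "(%x. f x ^ 3) \<in> L2 X & L2norm X (%x. f x ^ 3) <= max K (2 * R) * ?s ^ 3 & L2norm X f <= max K (2 * R) * ?s"
   using main[OF f] by linarith
 qed
qed

end

section \<open>The convection term\<close>

lemma L2_tendsto_sum:
 assumes "finite I" "!!m n. m \<in> I ==> f m n \<in> L2 X" "!!m. m \<in> I ==> g m \<in> L2 X"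
  "!!m. m \<in> I ==> (%n. L2norm X (%x. f m n x - g m x)) ----> 0"
 shows "(%n::nat. L2norm X (%x. (\<Sum>m\<in>I. f m n x) - (\<Sum>m\<in>I. g m x))) ----> 0"
proof (rule tendsto_sandwich[OF _ _ tendsto_const])
 have "(%n. \<Sum>m\<in>I. L2norm X (%x. f m n x - g m x)) ----> (\<Sum>m\<in>I. 0)" by (intro tendsto_sum assms(4))
 then show "(%n. \<Sum>m\<in>I. L2norm X (%x. f m n x - g m x)) ----> 0" by simp
 show "eventually (%n. L2norm X (%x. (\<Sum>m\<in>I. f m n x) - (\<Sum>m\<in>I. g m x)) <= (\<Sum>m\<in>I. L2norm X (%x. f m n x - g m x))) sequentially"
  unfolding sum_subtractf[symmetric] by (intro always_eventually allI L2norm_sum_le L2_diff assms)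
qed simp

text \<open>The coefficients converge only almost everywhere and the functions only in L2: c f - d g
  = c (f - g) + (c - d) g, where the first term uses the uniform bound and the second dominated
  convergence.\<close>

lemma L2_tendsto_bounded_mult:
 fixes f :: "nat => 'a::euclidean_space => real"
 assumes c: "!!n. c n \<in> meas X" "d \<in> meas X"
  and B: "!!n x. \<bar>c n x\<bar> <= B" "!!x. \<bar>d x\<bar> <= B" "B >= 0" and lim: "AE x in leb X. (%n. c n x) ----> d x"
  and f: "!!n. f n \<in> L2 X" "g \<in> L2 X" "(%n. L2norm X (%x. f n x - g x)) ----> 0"
 shows "!!n. (%x. c n x * f n x) \<in> L2 X" "(%x. d x * g x) \<in> L2 X"
  "(%n. L2norm X (%x. c n x * f n x - d x * g x)) ----> 0"
proof -
 show 1: "(%x. c n x * f n x) \<in> L2 X" for n by (rule L2_bounded_mult_real[OF f(1) c(1) B(1)])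
 show 2: "(%x. d x * g x) \<in> L2 X" by (rule L2_bounded_mult_real[OF f(2) c(2) B(2)])
 have 3: "(%x. c n x * g x) \<in> L2 X" for n by (rule L2_bounded_mult_real[OF f(2) c(1) B(1)])
 have l1: "(%n. L2norm X (%x. c n x * g x - d x * g x)) ----> 0"
 proof (rule L2_dominated_convergence(3)[OF L2D(1)[OF 3] L2D(1)[OF 2] L2_cmult[OF f(2), of B]])
  show "AE x in leb X. norm (c n x * g x) <= norm (B * g x)" for n
   using B(1)[of n] B(3) by (intro AE_I2) (simp add: abs_mult mult_right_mono)
  show "AE x in leb X. (%n. c n x * g x) ----> d x * g x"
   using lim by eventually_elim (rule tendsto_mult_right)
 qed
 have "L2norm X (%x. c n x * f n x - d x * g x) <= B * L2norm X (%x. f n x - g x) + L2norm X (%x. c n x * g x - d x * g x)" for n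
 proof -
  have "L2norm X (%x. c n x * f n x - d x * g x) = L2norm X (%x. c n x *\<^sub>R (f n x - g x) + (c n x * g x - d x * g x))"
   by (simp add: algebra_simps)
  also have "... <= L2norm X (%x. c n x *\<^sub>R (f n x - g x)) + L2norm X (%x. c n x * g x - d x * g x)"
   by (intro L2norm_triangle L2_bounded_mult[OF L2_diff[OF f(1,2)] c(1) AE_I2[OF B(1)]] L2_diff 2 3)
  also have "L2norm X (%x. c n x *\<^sub>R (f n x - g x)) <= B * L2norm X (%x. f n x - g x)"
   by (rule L2norm_bounded_mult[OF L2_diff[OF f(1,2)] c(1) B(1) B(3)])
  finally show ?thesis by simp
 qed
 note le = this
 have "(%n. B * L2norm X (%x. f n x - g x) + L2norm X (%x. c n x * g x - d x * g x)) ----> B * 0 + 0"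
  by (intro tendsto_intros f l1)
 then have "(%n. B * L2norm X (%x. f n x - g x) + L2norm X (%x. c n x * g x - d x * g x)) ----> 0" by simp
 from tendsto_sandwich[OF always_eventually[OF allI[OF L2norm_nonneg]] always_eventually[OF allI[OF le]] tendsto_const this]
 show "(%n. L2norm X (%x. c n x * f n x - d x * g x)) ----> 0" .
qed

lemma L2norm_le_sum_components:
 fixes f :: "'a::euclidean_space => real^'n"
 assumes "f \<in> L2 X"
 shows "L2norm X f <= (SUM i. L2norm X (%x. f x $ i))"
proof -
 have L: "(%x. \<bar>f x $ i\<bar>) \<in> L2 X" for i using L2_component[OF assms, of i] by (auto simp: L2_def intro: borel_measurable_abs)
 have "L2norm X f <= L2norm X (%x. SUM i. \<bar>f x $ i\<bar>)"
  by (rule L2norm_mono[OF L2_sum[OF L] AE_I2 L2D(1)[OF assms]]) (use norm_le_l1_cart in \<open>auto simp: sum_nonneg\<close>)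
 also have "... <= (SUM i. L2norm X (%x. \<bar>f x $ i\<bar>))" by (rule L2norm_sum_le) (auto intro: L)
 finally show ?thesis by (simp add: L2norm_def)
qed

text \<open>
 Tests with \<open>u |u|\<^sup>2\<close> are only admissible after replacing \<open>|u|\<^sup>2\<close> by a bounded function of it with
 bounded \<open>t \<mapsto> t truncate' \<delta> t\<close>.
\<close>

definition truncate :: "real => real => real" where
 "truncate \<delta> t = (1 - exp (- (\<delta> * t))) / \<delta>"

lemma truncate_derivative: "\<delta> > 0 ==> (truncate \<delta> has_real_derivative exp (- (\<delta> * t))) (at t)"
 unfolding truncate_def[abs_def] by (auto intro!: derivative_eq_intros)

lemma kcd_truncate: "\<delta> > 0 ==> kcd 1 (truncate \<delta>)"
proof -
 assume d: "\<delta> > 0"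
 have "kcd 0 (%t. exp (- (\<delta> * t)))" by (auto intro!: continuous_intros)
 from kcd_real_derivative[OF truncate_derivative[OF d] this] show ?thesis by (simp only: One_nat_def)
qed

lemma truncate_bounds:
 assumes "\<delta> > 0" "t >= 0"
 shows "truncate \<delta> t >= 0" "truncate \<delta> t <= t" "truncate \<delta> t <= 1 / \<delta>" "exp (- (\<delta> * t)) * t <= 1 / \<delta>"
proof -
 show "truncate \<delta> t >= 0" "truncate \<delta> t <= 1 / \<delta>" using assms by (auto simp: truncate_def divide_right_mono)
 show "truncate \<delta> t <= t" using assms exp_ge_add_one_self[of "- (\<delta> * t)"] by (simp add: truncate_def field_simps)
 have "\<delta> * t <= exp (\<delta> * t)" using exp_ge_add_one_self[of "\<delta> * t"] by linarith
 then show "exp (- (\<delta> * t)) * t <= 1 / \<delta>" using assms by (simp add: exp_minus field_simps)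
qed

lemma truncate_tendsto: "(%n. truncate (1 / real (Suc n)) t) ----> t"
 unfolding truncate_def by real_asymp

section \<open>Testing the Laplacian with truncated powers of the velocity\<close>

context
 fixes X :: "(real^'n) set"
 assumes op: "open X" and bd: "bounded X"
begin

text \<open>The weak derivative of \<open>h\<close> may be tested only with functions of compact
  support in \<open>X\<close>. The functions approximating \<open>w\<close> are of this kind, so no
  boundary term appears in the limit although \<open>h\<close> itself need not vanish on the
  boundary.\<close>

lemma green_limit:
 assumes \<Psi>: "!!n. Cc 1 X (\<Psi> n)" and w: "w \<in> L2 X" "w' \<in> L2 X"
  and lim: "(%n. L2norm X (%x. \<Psi> n x - w x)) ----> 0" "(%n. L2norm X (%x. partial k (\<Psi> n) x - w' x)) ----> 0"
  and h: "wd X k h h'"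
 shows "(LINT x|leb X. h x * w' x) = - (LINT x|leb X. h' x * w x)"
proof -
 have \<Psi>L: "\<Psi> n \<in> L2 X" "partial k (\<Psi> n) \<in> L2 X" for n
  using wdT_D(1,2)[OF test_wd0[OF op bd \<Psi>]] by blast+
 have "(%n. L2inner X (partial k (\<Psi> n)) h) ----> L2inner X w' h"
  by (rule L2_tendsto_inner[OF \<Psi>L(2) w(2) wdT_D(1)[OF h] lim(2)])
 moreover have "(%n. - L2inner X (\<Psi> n) h') ----> - L2inner X w h'"
  by (rule tendsto_minus[OF L2_tendsto_inner[OF \<Psi>L(1) w(1) wdT_D(2)[OF h] lim(1)]])
 moreover have "L2inner X (partial k (\<Psi> n)) h = - L2inner X (\<Psi> n) h'" for n
  using wdT_D(3)[OF h \<Psi>] by (simp add: L2inner_def mult.commute)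
 ultimately have "L2inner X w' h = - L2inner X w h'" using LIMSEQ_unique by simp
 then show ?thesis by (simp add: L2inner_def mult.commute)
qed

text \<open>Regarding the components as one vector valued sequence yields a single subsequence along
  which all of them converge almost everywhere, as the nonlinear coefficients built from all
  components require.\<close>

lemma vec_H10_approx:
 assumes u: "u \<in> vec_H2_H10 X"
 obtains \<Phi> where "!!i n. test_function X (\<Phi> i n)" "!!i. (%n. L2norm X (%x. \<Phi> i n x - u x $ i)) ----> 0"
  "!!i k. (%n. L2norm X (%x. partial k (\<Phi> i n) x - pd X u k i x)) ----> 0"
  "AE x in leb X. \<forall>i. (%n. \<Phi> i n x) ----> u x $ i"
proof -
 have "\<exists>\<Phi>. (\<forall>n. test_function X (\<Phi> n)) & (%n. L2norm X (%x. \<Phi> n x - u x $ i)) ----> 0 &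
  (\<forall>k. (%n. L2norm X (%x. partial k (\<Phi> n) x - pd X u k i x)) ----> 0)" for i
  using u unfolding vec_H2_H10_def H10_def by blast
 then have "\<exists>\<Phi>. \<forall>i. (\<forall>n. test_function X (\<Phi> i n)) & (%n. L2norm X (%x. \<Phi> i n x - u x $ i)) ----> 0 &
  (\<forall>k. (%n. L2norm X (%x. partial k (\<Phi> i n) x - pd X u k i x)) ----> 0)"
  by (rule choice[OF allI])
 then obtain \<Phi> where \<Phi>: "!!i n. test_function X (\<Phi> i n)" "!!i. (%n. L2norm X (%x. \<Phi> i n x - u x $ i)) ----> 0"
  "!!i k. (%n. L2norm X (%x. partial k (\<Phi> i n) x - pd X u k i x)) ----> 0" by blast
 define V where "V n x = (\<chi> i. \<Phi> i n x)" for n x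
 have Vi: "(%x. V n x $ i) \<in> L2 X" for n i
  unfolding V_def using kcd_L2[OF dom_lmeasurable[OF op bd] bd test_function_kcd[OF \<Phi>(1), of 0]] by simp
 have VL: "V n \<in> L2 X" for n by (rule L2_vecI[OF Vi])
 note uL = vec_H2_H10_L2(1)[OF op bd u]
 have Vu: "(%n. L2norm X (%x. V n x - u x)) ----> 0"
 proof (rule tendsto_sandwich[OF _ _ tendsto_const])
  have "(%n. SUM i. L2norm X (%x. \<Phi> i n x - u x $ i)) ----> (\<Sum>i\<in>(UNIV::'n set). 0)" by (intro tendsto_sum \<Phi>(2))
  then show "(%n. SUM i. L2norm X (%x. \<Phi> i n x - u x $ i)) ----> 0" by simp
  show "eventually (%n. L2norm X (%x. V n x - u x) <= (SUM i. L2norm X (%x. \<Phi> i n x - u x $ i))) sequentially"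
   using L2norm_le_sum_components[OF L2_diff[OF VL uL]] by (intro always_eventually allI) (simp add: V_def)
 qed simp
 show thesis
 proof (rule L2_AE_subseq[OF VL uL Vu])
  fix r :: "nat => nat" assume r: "strict_mono r" and ae: "AE x in leb X. (%n. V (r n) x) ----> u x"
  show thesis
  proof (rule that[of "%i n. \<Phi> i (r n)"])
   show "(%n. L2norm X (%x. \<Phi> i (r n) x - u x $ i)) ----> 0" for i
    using LIMSEQ_subseq_LIMSEQ[OF \<Phi>(2) r] by (simp add: comp_def)
   show "(%n. L2norm X (%x. partial k (\<Phi> i (r n)) x - pd X u k i x)) ----> 0" for i k
    using LIMSEQ_subseq_LIMSEQ[OF \<Phi>(3) r] by (simp add: comp_def)
   show "AE x in leb X. \<forall>i. (%n. \<Phi> i (r n) x) ----> u x $ i"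
    using ae
   proof eventually_elim
    case (elim x)
    from tendsto_vec_nth[OF elim] show ?case by (simp add: V_def)
   qed
  qed (rule \<Phi>(1))
 qed
qed

text \<open>With T for \<open>truncate \<delta>\<close>, the field T(|u|^2) u is paired with the
  Laplacian. Its gradient against that of u gives T(|u|^2) |\<nabla>u|^2 plus 2 T'(|u|^2) times a
  sum over l of the squares of the scalar product of u with its l-th derivative. The latter is
  nonnegative, since T is increasing, and is dropped.\<close>

lemma truncated_advection:
 assumes u: "u \<in> vec_H2_H10 X" and \<delta>: "\<delta> > 0"
 shows "(LINT x|leb X. truncate \<delta> ((norm (u x))^2) * (norm (vgrad X u x))^2)
  <= - L2inner X (%x. truncate \<delta> ((norm (u x))^2) *\<^sub>R u x) (vlaplace X u)"
proof (rule vec_H10_approx[OF u])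
 fix \<Phi> assume \<Phi>: "!!i n. test_function X (\<Phi> i n)" "!!i. (%n. L2norm X (%x. \<Phi> i n x - u x $ i)) ----> 0"
  "!!i k. (%n. L2norm X (%x. partial k (\<Phi> i n) x - pd X u k i x)) ----> 0"
  and ae: "AE x in leb X. \<forall>i. (%n. \<Phi> i n x) ----> u x $ i"
 note w = vec_H2_H10_wd[OF op bd u] and uL = vec_H2_H10_L2[OF op bd u]
 have k: "kcd m (\<Phi> i n)" for m i n by (rule test_function_kcd[OF \<Phi>(1)])
 have \<Phi>L: "\<Phi> i n \<in> L2 X" "partial l (\<Phi> i n) \<in> L2 X" for i l n
  by (rule kcd_L2[OF dom_lmeasurable[OF op bd] bd k[of 0]], rule kcd_L2[OF dom_lmeasurable[OF op bd] bd kcd_partial[OF k[of "Suc 0"]]])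
 have [measurable]: "\<Phi> i n \<in> meas X" "(%x. u x $ i) \<in> meas X" for i n
  by (rule L2D(1)[OF \<Phi>L(1)], rule L2D(1)[OF w(3)])
 have trc: "continuous_on UNIV (truncate \<delta>)" using kcd_continuous[OF kcd_truncate[OF \<delta>]] .
 have [measurable]: "truncate \<delta> \<in> borel_measurable borel" by (rule borel_measurable_continuous_onI[OF trc])
 define s where "s v = (SUM m. (v m)^2)" for v :: "'n => real"
 \<comment> \<open>The derivative with respect to v_m of the map sending v to T(|v|^2) v_i. It is
   bounded because both T and t T'(t) are at most 1/\<delta>; this is what the truncation is made
   for.\<close>
 define c where "c i m v = (if i = m then truncate \<delta> (s v) else 0) + 2 * (exp (- (\<delta> * s v)) * (v i * v m))" for i m and v :: "'n => real"
 have s0: "s v >= 0" for v unfolding s_def by (intro sum_nonneg) simp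
 have vs: "\<bar>v i * v m\<bar> <= s v" for i m and v :: "'n => real"
 proof -
  have "(v i)^2 <= s v" "(v m)^2 <= s v" unfolding s_def by (rule member_le_sum, auto)+
  moreover have "2 * \<bar>v i * v m\<bar> <= (v i)^2 + (v m)^2"
   using sum_squares_bound[of "\<bar>v i\<bar>" "\<bar>v m\<bar>"] by (simp add: abs_mult)
  ultimately show ?thesis by linarith
 qed
 have tb: "\<bar>truncate \<delta> (s v)\<bar> <= 1 / \<delta>" for v using truncate_bounds(1,3)[OF \<delta> s0[of v]] by simp
 have cb: "\<bar>c i m v\<bar> <= 3 / \<delta>" for i m v
 proof -
  have "exp (- (\<delta> * s v)) * \<bar>v i * v m\<bar> <= exp (- (\<delta> * s v)) * s v" by (intro mult_left_mono vs) simp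
  also have "... <= 1 / \<delta>" by (rule truncate_bounds(4)[OF \<delta> s0])
  finally have "\<bar>exp (- (\<delta> * s v)) * (v i * v m)\<bar> <= 1 / \<delta>" by (simp only: abs_mult abs_exp_cancel)
  moreover have "\<bar>(if i = m then a else 0) + 2 * b\<bar> <= \<bar>a\<bar> + 2 * \<bar>b\<bar>" for a b :: real by auto
  ultimately have "\<bar>c i m v\<bar> <= 1 / \<delta> + 2 * (1 / \<delta>)"
   using tb[of v] unfolding c_def by (meson add_mono mult_left_mono order.trans zero_le_numeral)
  then show ?thesis by simp
 qed
 define U where "U x i = u x $ i" for x i
 define F where "F n x i = \<Phi> i n x" for n x i
 have su: "s (U x) = (norm (u x))^2" for x by (simp add: s_def U_def norm_vec_sq)
 have [measurable]: "(%x. s (F n x)) \<in> meas X" "(%x. s (U x)) \<in> meas X" for n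
  unfolding s_def F_def U_def by measurable
 have tm: "(%x. truncate \<delta> (s (F n x))) \<in> meas X" "(%x. truncate \<delta> (s (U x))) \<in> meas X" for n
  by measurable
 have cm: "(%x. c i m (F n x)) \<in> meas X" "(%x. c i m (U x)) \<in> meas X" for i m n
  unfolding c_def F_def[of _ _ i] F_def[of _ _ m] U_def[of _ i] U_def[of _ m] by measurable
 have lims: "AE x in leb X. (%n. s (F n x)) ----> s (U x) & (\<forall>i. (%n. F n x i) ----> U x i)"
  using ae unfolding s_def F_def U_def by eventually_elim (auto intro!: tendsto_intros)
 have limt: "AE x in leb X. (%n. truncate \<delta> (s (F n x))) ----> truncate \<delta> (s (U x))"
  using lims by eventually_elim (intro continuous_on_tendsto_compose[OF trc], auto)
 have limc: "AE x in leb X. (%n. c i m (F n x)) ----> c i m (U x)" for i m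
  using lims limt unfolding c_def by eventually_elim (auto intro!: tendsto_intros)
 define \<Psi> where "\<Psi> i n x = truncate \<delta> (s (F n x)) * \<Phi> i n x" for i n x
 have ks: "kcd 1 (%x. s (F n x))" for n unfolding s_def F_def by (intro kcd_sum kcd_power k)
 have kt: "kcd 1 (%x. truncate \<delta> (s (F n x)))" for n by (rule kcd_compose_real[OF kcd_truncate[OF \<delta>] ks])
 have \<Psi>C: "Cc 1 X (\<Psi> i n)" for i n
  unfolding \<Psi>_def[abs_def] by (rule Cc_mult[OF test_function_Cc[OF \<Phi>(1)] kt])
 have d\<Psi>: "partial l (\<Psi> i n) x = (SUM m. c i m (F n x) * partial l (\<Phi> m n) x)" for l i n x
 proof -
  have "partial l (%x. s (F n x)) x = (SUM m. partial l (%x. (\<Phi> m n x)^2) x)"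
   unfolding s_def F_def by (intro partial_sum kcd_power k)
  also have "... = (SUM m. 2 * \<Phi> m n x * partial l (\<Phi> m n) x)"
   by (intro sum.cong refl partial_compose_real[OF _ k]) (auto intro!: derivative_eq_intros)
  finally have ds: "partial l (%x. s (F n x)) x = ..." .
  have "partial l (\<Psi> i n) x = partial l (%x. truncate \<delta> (s (F n x))) x * \<Phi> i n x + truncate \<delta> (s (F n x)) * partial l (\<Phi> i n) x"
   unfolding \<Psi>_def[abs_def] by (rule partial_mult[OF kt k])
  also have "partial l (%x. truncate \<delta> (s (F n x))) x = exp (- (\<delta> * s (F n x))) * (SUM m. 2 * \<Phi> m n x * partial l (\<Phi> m n) x)"
   unfolding ds[symmetric] by (rule partial_compose_real[OF truncate_derivative[OF \<delta>] ks])
  also have "exp (- (\<delta> * s (F n x))) * (SUM m. 2 * \<Phi> m n x * partial l (\<Phi> m n) x) * \<Phi> i n x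
   = (SUM m. 2 * (exp (- (\<delta> * s (F n x))) * (F n x i * F n x m)) * partial l (\<Phi> m n) x)"
   by (simp add: F_def sum_distrib_left sum_distrib_right mult_ac)
  also have "truncate \<delta> (s (F n x)) * partial l (\<Phi> i n) x = (SUM m. (if i = m then truncate \<delta> (s (F n x)) else 0) * partial l (\<Phi> m n) x)"
   by (simp add: mult_delta_left)
  finally show ?thesis by (simp add: c_def sum.distrib[symmetric] distrib_right add.commute)
 qed
 define w0 where "w0 i x = truncate \<delta> (s (U x)) * u x $ i" for i x
 define w1 where "w1 i l x = (SUM m. c i m (U x) * pd X u l m x)" for i l x
 have W: "(%x. c i m (F n x) * partial l (\<Phi> m n) x) \<in> L2 X" "(%x. c i m (U x) * pd X u l m x) \<in> L2 X"
  "(%n. L2norm X (%x. c i m (F n x) * partial l (\<Phi> m n) x - c i m (U x) * pd X u l m x)) ----> 0" for i m l n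
  using L2_tendsto_bounded_mult[OF cm(1) cm(2) cb cb _ limc \<Phi>L(2) w(4) \<Phi>(3)] \<delta> by auto
 have V: "w0 i \<in> L2 X" "(%n. L2norm X (%x. \<Psi> i n x - w0 i x)) ----> 0" for i
  unfolding w0_def[abs_def] \<Psi>_def using L2_tendsto_bounded_mult[OF tm(1) tm(2) tb tb _ limt \<Phi>L(1) w(3) \<Phi>(2)] \<delta> by auto
 have w1L: "w1 i l \<in> L2 X" for i l unfolding w1_def[abs_def] by (intro L2_sum W(2))
 have gr: "(LINT x|leb X. pd X u l i x * w1 i l x) = - (LINT x|leb X. pdd X u l l i x * w0 i x)" for i l
 proof (rule green_limit[OF \<Psi>C V(1) w1L V(2) _ w(2)])
  show "(%n. L2norm X (%x. partial l (\<Psi> i n) x - w1 i l x)) ----> 0"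
   unfolding d\<Psi> w1_def by (intro L2_tendsto_sum W) simp
 qed
 have i1: "integrable (leb X) (%x. pd X u l i x * w1 i l x)" for i l by (rule L2_mult_integrable[OF w(4) w1L])
 have i2: "integrable (leb X) (%x. pdd X u l l i x * w0 i x)" for i l by (rule L2_mult_integrable[OF w(5) V(1)])
 have ptw: "truncate \<delta> ((norm (u x))^2) * (norm (vgrad X u x))^2 <= (SUM i. SUM l. pd X u l i x * w1 i l x)" for x
 proof -
  let ?p = "%i l. pd X u l i x" and ?e = "exp (- (\<delta> * s (U x)))"
  have "(SUM i. SUM l. ?p i l * w1 i l x)
   = (SUM i. SUM l. truncate \<delta> (s (U x)) * (?p i l)^2 + 2 * ?e * ((?p i l * U x i) * (SUM m. ?p m l * U x m)))"
  proof (intro sum.cong refl)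
   fix i l
   let ?S = "SUM m. ?p m l * U x m"
   have "w1 i l x = truncate \<delta> (s (U x)) * ?p i l + 2 * ?e * U x i * ?S"
    unfolding w1_def c_def distrib_right sum.distrib by (simp add: mult_delta_left mult_delta_right sum_distrib_left mult_ac)
   then show "?p i l * w1 i l x = truncate \<delta> (s (U x)) * (?p i l)^2 + 2 * ?e * ((?p i l * U x i) * ?S)"
    by (simp only: distrib_left power2_eq_square mult_ac)
  qed
  also have "... = truncate \<delta> (s (U x)) * (norm (vgrad X u x))^2 + 2 * ?e * (SUM i. SUM l. (?p i l * U x i) * (SUM m. ?p m l * U x m))"
   unfolding sum.distrib sum_distrib_left[symmetric] norm_mat_sq vgrad_def by simp
  also have "(SUM i. SUM l. (?p i l * U x i) * (SUM m. ?p m l * U x m)) = (SUM l. (SUM i. ?p i l * U x i)^2)"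
   by (subst sum.swap) (simp only: sum_distrib_right[symmetric] power2_eq_square)
  finally show ?thesis unfolding su by (simp add: sum_nonneg)
 qed
 have gi: "integrable (leb X) (%x. (norm (vgrad X u x))^2 * truncate \<delta> (s (U x)))"
  using tb by (intro integrable_bounded_mult[OF L2D(2)[OF uL(2)] tm(2)])
 have "(LINT x|leb X. truncate \<delta> ((norm (u x))^2) * (norm (vgrad X u x))^2)
  <= (LINT x|leb X. (SUM i. SUM l. pd X u l i x * w1 i l x))"
  using gi unfolding su by (intro integral_mono ptw lintegrable_sum i1) (simp add: mult.commute)
 also have "... = (SUM i. SUM l. LINT x|leb X. pd X u l i x * w1 i l x)"
  by (simp add: lint_sum i1 lintegrable_sum)
 also have "... = - (SUM i. SUM l. LINT x|leb X. pdd X u l l i x * w0 i x)"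
  unfolding gr sum_negf ..
 also have "(SUM i. SUM l. LINT x|leb X. pdd X u l l i x * w0 i x)
  = (LINT x|leb X. (SUM i. SUM l. pdd X u l l i x * w0 i x))"
  by (simp add: lint_sum i2 lintegrable_sum)
 also have "... = L2inner X (%x. truncate \<delta> ((norm (u x))^2) *\<^sub>R u x) (vlaplace X u)"
  unfolding L2inner_def inner_vec_def vlaplace_def w0_def su by (simp add: sum_distrib_left mult_ac)
 finally show ?thesis .
qed

end

lemma L2_norm_cube:
 fixes u :: "'a::euclidean_space => real^'n"
 assumes u: "u \<in> meas X" and c: "!!i. (%x. (u x $ i) ^ 3) \<in> L2 X"
 shows "(%x. norm (u x) ^ 3) \<in> L2 X"
  "L2norm X (%x. norm (u x) ^ 3) <= real CARD('n) ^ 3 * (SUM i. L2norm X (%x. (u x $ i) ^ 3))"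
proof -
 let ?N = "real CARD('n)"
 have L: "(%x. \<bar>u x $ i\<bar> ^ 3) \<in> L2 X" for i
  using c[of i] by (auto simp: L2_def power_abs[symmetric] intro: borel_measurable_abs)
 have S: "(%x. SUM i. \<bar>u x $ i\<bar> ^ 3) \<in> L2 X" by (intro L2_sum L)
 have NS: "(%x. ?N ^ 3 * (SUM i. \<bar>u x $ i\<bar> ^ 3)) \<in> L2 X" by (rule L2_cmult[OF S])
 have le: "norm (u x) ^ 3 <= ?N ^ 3 * (SUM i. \<bar>u x $ i\<bar> ^ 3)" for x
 proof -
  define m where "m = Max (range (%i. \<bar>u x $ i\<bar>))"
  have "m \<in> range (%i. \<bar>u x $ i\<bar>)" unfolding m_def by (rule Max_in) auto
  then obtain i where i: "m = \<bar>u x $ i\<bar>" by blast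
  have le: "\<bar>u x $ j\<bar> <= m" for j unfolding m_def by (rule Max_ge) auto
  have "norm (u x) <= (SUM j. \<bar>u x $ j\<bar>)" by (rule norm_le_l1_cart)
  also have "... <= (\<Sum>j\<in>(UNIV :: 'n set). m)" by (intro sum_mono le)
  finally have "norm (u x) ^ 3 <= (?N * m) ^ 3" by (intro power_mono) simp_all
  also have "... = ?N ^ 3 * \<bar>u x $ i\<bar> ^ 3" by (simp add: i power_mult_distrib)
  also have "... <= ?N ^ 3 * (SUM i. \<bar>u x $ i\<bar> ^ 3)"
   by (intro mult_left_mono member_le_sum) auto
  finally show ?thesis .
 qed
 have m: "(%x. norm (u x) ^ 3) \<in> meas X"
  by (intro borel_measurable_power measurable_compose[OF u borel_measurable_norm])
 have ae: "AE x in leb X. norm (norm (u x) ^ 3) <= norm (?N ^ 3 * (SUM i. \<bar>u x $ i\<bar> ^ 3))"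
  by (rule AE_I2) (use le in \<open>simp add: abs_mult sum_nonneg\<close>)
 show "(%x. norm (u x) ^ 3) \<in> L2 X"
 proof (rule L2_dominated[OF m L2D(2)[OF NS]])
  show "AE x in leb X. (norm (norm (u x) ^ 3))^2 <= (norm (?N ^ 3 * (SUM i. \<bar>u x $ i\<bar> ^ 3)))^2"
   using ae by eventually_elim (rule power_mono, auto)
 qed
 have "L2norm X (%x. norm (u x) ^ 3) <= L2norm X (%x. ?N ^ 3 * (SUM i. \<bar>u x $ i\<bar> ^ 3))"
  by (rule L2norm_mono[OF NS ae m])
 also have "... = ?N ^ 3 * L2norm X (%x. SUM i. \<bar>u x $ i\<bar> ^ 3)"
  using L2norm_scaleR[of X "?N ^ 3" "%x. SUM i. \<bar>u x $ i\<bar> ^ 3"] by simp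
 also have "... <= ?N ^ 3 * (SUM i. L2norm X (%x. \<bar>u x $ i\<bar> ^ 3))"
  by (intro mult_left_mono L2norm_sum_le L) auto
 also have "... = ?N ^ 3 * (SUM i. L2norm X (%x. (u x $ i) ^ 3))"
  by (simp add: L2norm_def power_abs)
 finally show "L2norm X (%x. norm (u x) ^ 3) <= ?N ^ 3 * (SUM i. L2norm X (%x. (u x $ i) ^ 3))" .
qed

lemma norm_advect_le: "norm (advect X u u x) <= norm (norm (u x) *\<^sub>R vgrad X u x)"
proof (rule power2_le_imp_le)
 have "(norm (advect X u u x))^2 = (SUM i. (SUM j. u x $ j * vgrad X u x $ i $ j)^2)"
  by (simp add: norm_vec_sq advect_def vgrad_def)
 also have "... <= (SUM i. (SUM j. (u x $ j)^2) * (SUM j. (vgrad X u x $ i $ j)^2))"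
  by (intro sum_mono Cauchy_Schwarz_ineq_sum)
 also have "... = (norm (norm (u x) *\<^sub>R vgrad X u x))^2"
  by (simp add: norm_vec_sq[of "u x"] norm_mat_sq sum_distrib_left power_mult_distrib)
 finally show "(norm (advect X u u x))^2 <= (norm (norm (u x) *\<^sub>R vgrad X u x))^2" .
qed simp

context
 fixes X :: "(real^'n) set"
 assumes op: "open X" and bd: "bounded X"
begin

text \<open>For every truncation level the weighted gradient has norm at most the same
  \<open>B\<close>, because the truncated factor times |u| is at most |u|^3 and Cauchy-Schwarz
  applies to the pairing with the Laplacian. As \<delta> tends to 0, Fatou's lemma yields both
  membership in \<open>L2\<close> and the bound for |u| |\<nabla>u|, which dominates the convection
  term pointwise.\<close>

lemma advect_L2norm_le:
 assumes u: "u \<in> vec_H2_H10 X" and c: "!!i. (%x. (u x $ i) ^ 3) \<in> L2 X"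
 shows "advect X u u \<in> L2 X"
  "(L2norm X (advect X u u))^2 <= L2norm X (%x. norm (u x) ^ 3) * L2norm X (vlaplace X u)"
proof -
 note w = vec_H2_H10_wd[OF op bd u] and uL = vec_H2_H10_L2[OF op bd u]
 note cube = L2_norm_cube[OF L2D(1)[OF uL(1)] c]
 have nm: "(%x. norm (u x)) \<in> meas X"
  by (rule measurable_compose[OF L2D(1)[OF uL(1)] borel_measurable_norm])
 define \<delta> where "\<delta> n = 1 / real (Suc n)" for n
 have \<delta>: "\<delta> n > 0" for n by (simp add: \<delta>_def)
 define B where "B = sqrt (L2norm X (%x. norm (u x) ^ 3) * L2norm X (vlaplace X u))"
 define t where "t n x = truncate (\<delta> n) ((norm (u x))^2)" for n x
 have tb: "0 <= t n x" "t n x <= 1 / \<delta> n" "t n x <= (norm (u x))^2" for n x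
  unfolding t_def using truncate_bounds[OF \<delta>] by auto
 have tr: "truncate (\<delta> n) \<in> borel_measurable borel" for n
  by (rule borel_measurable_continuous_onI[OF kcd_continuous[OF kcd_truncate[OF \<delta>]]])
 have tm: "t n \<in> meas X" for n
  unfolding t_def[abs_def] by (rule measurable_compose[OF borel_measurable_power[OF nm] tr])
 have sm: "(%x. sqrt (t n x)) \<in> meas X" for n
  by (rule measurable_compose[OF tm]) measurable
 have fL: "(%x. sqrt (t n x) *\<^sub>R vgrad X u x) \<in> L2 X" for n
  by (rule L2_bounded_mult[OF uL(2) sm, where B = "sqrt (1 / \<delta> n)"], rule AE_I2)
   (simp only: abs_of_nonneg[OF real_sqrt_ge_zero[OF tb(1)]] real_sqrt_le_iff tb(2))
 have tuL: "(%x. t n x *\<^sub>R u x) \<in> L2 X" for n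
  by (rule L2_bounded_mult[OF uL(1) tm, where B = "1 / \<delta> n"], rule AE_I2) (simp only: abs_of_nonneg[OF tb(1)] tb(2))
 have le: "L2norm X (%x. sqrt (t n x) *\<^sub>R vgrad X u x) <= B" for n
 proof (rule power2_le_imp_le)
  have "(L2norm X (%x. sqrt (t n x) *\<^sub>R vgrad X u x))^2 = (LINT x|leb X. t n x * (norm (vgrad X u x))^2)"
   unfolding L2norm_sq using tb by (simp add: power_mult_distrib)
  also have "... <= - L2inner X (%x. t n x *\<^sub>R u x) (vlaplace X u)"
   using truncated_advection[OF op bd u \<delta>] unfolding t_def .
  also have "... <= L2norm X (%x. t n x *\<^sub>R u x) * L2norm X (vlaplace X u)"
   using L2_Cauchy_Schwarz[OF tuL uL(3), of n] by linarith
  also have "... <= L2norm X (%x. norm (u x) ^ 3) * L2norm X (vlaplace X u)"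
  proof (rule mult_right_mono[OF _ L2norm_nonneg], rule L2norm_mono[OF cube(1) AE_I2 L2D(1)[OF tuL]])
   fix x
   have "norm (t n x *\<^sub>R u x) <= (norm (u x))^2 * norm (u x)" using tb[of n x] by (simp add: mult_right_mono)
   then show "norm (t n x *\<^sub>R u x) <= norm (norm (u x) ^ 3)" by (simp add: power3_eq_cube power2_eq_square)
  qed
  also have "... = B^2" unfolding B_def by (simp add: mult_nonneg_nonneg)
  finally show "(L2norm X (%x. sqrt (t n x) *\<^sub>R vgrad X u x))^2 <= B^2" .
  show "B >= 0" unfolding B_def by simp
 qed
 have gm: "(%x. norm (u x) *\<^sub>R vgrad X u x) \<in> meas X"
  by (rule borel_measurable_scaleR[OF nm L2D(1)[OF uL(2)]])
 have lim: "(%n. sqrt (t n x) *\<^sub>R vgrad X u x) ----> norm (u x) *\<^sub>R vgrad X u x" for x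
 proof -
  have "(%n. sqrt (t n x)) ----> sqrt ((norm (u x))^2)"
   unfolding t_def \<delta>_def by (intro tendsto_real_sqrt truncate_tendsto)
  then show ?thesis by (intro tendsto_scaleR tendsto_const) simp
 qed
 note F = L2_Fatou[OF fL gm always_eventually[OF allI[OF le]] AE_I2[OF lim]]
 have am: "advect X u u \<in> meas X"
 proof -
  have "(%x. advect X u u x $ i) \<in> meas X" for i
   unfolding advect_def vec_lambda_beta by (intro borel_measurable_sum borel_measurable_times L2D(1)[OF w(3)] L2D(1)[OF w(4)])
  then show ?thesis by (subst borel_measurable_euclidean_space) (auto simp: Basis_vec_def inner_axis)
 qed
 have ae: "AE x in leb X. (norm (advect X u u x))^2 <= (norm (norm (u x) *\<^sub>R vgrad X u x))^2"
  by (intro AE_I2 power_mono norm_advect_le) simp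
 show "advect X u u \<in> L2 X" by (rule L2_dominated[OF am L2D(2)[OF F(1)] ae])
 have "L2norm X (advect X u u) <= L2norm X (%x. norm (u x) *\<^sub>R vgrad X u x)"
  by (rule L2norm_mono[OF F(1) AE_I2[OF norm_advect_le] am])
 also have "... <= B" by (rule F(2))
 finally have "(L2norm X (advect X u u))^2 <= B^2" by (intro power_mono) auto
 then show "(L2norm X (advect X u u))^2 <= L2norm X (%x. norm (u x) ^ 3) * L2norm X (vlaplace X u)"
  unfolding B_def by (simp add: mult_nonneg_nonneg)
qed

lemma advect_bound:
 assumes card: "CARD('n) = 2 \<or> CARD('n) = 3"
 obtains K where "K >= 0" "!!u. u \<in> vec_H2_H10 X ==> advect X u u \<in> L2 X &
   (L2norm X (advect X u u))^2 <= K * L2norm X (vgrad X u) ^ 3 * L2norm X (vlaplace X u) &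
   L2norm X u <= K * L2norm X (vgrad X u)"
proof (rule Sobolev_H10[OF op bd card])
 fix K assume K: "K >= 0" "!!f. f \<in> H10 X ==> (%x. f x ^ 3) \<in> L2 X & L2norm X (%x. f x ^ 3) <= K * (SUM l. L2norm X (wpartial X l f)) ^ 3
    & L2norm X f <= K * (SUM l. L2norm X (wpartial X l f))"
 let ?N = "real CARD('n)"
 show thesis
 proof (rule that[of "max (?N ^ 3 * (?N * (K * ?N ^ 3))) (?N * (K * ?N))"])
  show "0 <= max (?N ^ 3 * (?N * (K * ?N ^ 3))) (?N * (K * ?N))" using K(1) by (simp add: le_max_iff_disj)
  fix u assume u: "u \<in> vec_H2_H10 X"
  have H: "(%x. u x $ i) \<in> H10 X" for i using u by (simp add: vec_H2_H10_def)
  note uL = vec_H2_H10_L2[OF op bd u]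
  let ?a = "L2norm X (vgrad X u)" and ?D = "L2norm X (vlaplace X u)"
  have s: "(SUM l. L2norm X (pd X u l i)) <= ?N * ?a" for i
   using sum_mono[of UNIV "%l. L2norm X (pd X u l i)" "%l. ?a"] uL(4) by simp
  have s0: "(SUM l. L2norm X (pd X u l i)) >= 0" for i by (intro sum_nonneg) simp
  note adv = advect_L2norm_le[OF u conjunct1[OF K(2)[OF H]]]
  have c3: "L2norm X (%x. (u x $ i) ^ 3) <= K * (?N * ?a) ^ 3" for i
  proof -
   have "L2norm X (%x. (u x $ i) ^ 3) <= K * (SUM l. L2norm X (pd X u l i)) ^ 3" using K(2)[OF H] by blast
   also have "... <= K * (?N * ?a) ^ 3" by (intro mult_left_mono power_mono s s0 K(1))
   finally show ?thesis .
  qed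
  have "L2norm X (%x. norm (u x) ^ 3) <= ?N ^ 3 * (SUM i. L2norm X (%x. (u x $ i) ^ 3))"
   by (rule L2_norm_cube(2)[OF L2D(1)[OF uL(1)] conjunct1[OF K(2)[OF H]]])
  also have "... <= ?N ^ 3 * (\<Sum>i\<in>(UNIV::'n set). K * (?N * ?a) ^ 3)" by (intro mult_left_mono sum_mono c3) simp
  also have "... = (?N ^ 3 * (?N * (K * ?N ^ 3))) * ?a ^ 3" by (simp add: power_mult_distrib)
  also have "... <= max (?N ^ 3 * (?N * (K * ?N ^ 3))) (?N * (K * ?N)) * ?a ^ 3" by (intro mult_right_mono) auto
  finally have "L2norm X (%x. norm (u x) ^ 3) * ?D <= ... * ?D" by (rule mult_right_mono) simp
  then have 1: "(L2norm X (advect X u u))^2 <= max (?N ^ 3 * (?N * (K * ?N ^ 3))) (?N * (K * ?N)) * ?a ^ 3 * ?D"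
   using adv(2) by linarith
  have "L2norm X u <= (SUM i. L2norm X (%x. u x $ i))" by (rule L2norm_le_sum_components[OF uL(1)])
  also have "... <= (\<Sum>i\<in>(UNIV::'n set). K * (?N * ?a))"
  proof (rule sum_mono)
   fix i
   have "L2norm X (%x. u x $ i) <= K * (SUM l. L2norm X (pd X u l i))" using K(2)[OF H] by blast
   also have "... <= K * (?N * ?a)" by (intro mult_left_mono s K(1))
   finally show "L2norm X (%x. u x $ i) <= K * (?N * ?a)" .
  qed
  also have "... = (?N * (K * ?N)) * ?a" by simp
  also have "... <= max (?N ^ 3 * (?N * (K * ?N ^ 3))) (?N * (K * ?N)) * ?a" by (intro mult_right_mono) auto
  finally show "advect X u u \<in> L2 X &
   (L2norm X (advect X u u))^2 <= max (?N ^ 3 * (?N * (K * ?N ^ 3))) (?N * (K * ?N)) * ?a ^ 3 * ?D &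
   L2norm X u <= max (?N ^ 3 * (?N * (K * ?N ^ 3))) (?N * (K * ?N)) * ?a"
   using 1 adv(1) by blast
 qed
qed

end

section \<open>Time averages of the force\<close>

lemma L2_borel_representative:
 fixes h :: "'a::euclidean_space => real^'n"
 assumes "h \<in> L2 UNIV"
 obtains F where "F \<in> borel_measurable borel" "AE x in lborel. h x = F x" "(NN x. ennreal ((norm (F x))^2)) < top"
proof -
 have "\<exists>g. g \<in> borel_measurable lborel & (AE x in lborel. h x $ i = g x)" for i
  using completion_ex_borel_measurable_real[of "%x. h x $ i" lborel] L2D(1)[OF L2_component[OF assms]] by auto
 then have "\<exists>g. \<forall>i. g i \<in> borel_measurable lborel & (AE x in lborel. h x $ i = g i x)" by (rule choice[OF allI])
 then obtain g where g: "!!i. g i \<in> borel_measurable lborel" "!!i. AE x in lborel. h x $ i = g i x" by blast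
 define F where "F x = (\<chi> i. g i x)" for x
 have F: "F \<in> borel_measurable borel"
  using g(1) unfolding F_def by (subst borel_measurable_euclidean_space) (auto simp: Basis_vec_def inner_axis)
 have "AE x in lborel. \<forall>i\<in>UNIV. h x $ i = g i x" by (rule eventually_ball_finite[OF finite]) (use g(2) in blast)
 then have eq: "AE x in lborel. h x = F x" by eventually_elim (simp add: F_def vec_eq_iff)
 have "(NN x. ennreal ((norm (F x))^2)) = (NN x. ennreal ((norm (h x))^2))"
  by (rule nn_integral_cong_AE) (use eq in eventually_elim, simp)
 also have "... = ennreal ((L2norm UNIV h)^2)" using L2_nn_integral[OF assms] by (simp add: nn_integral_completion lebesgue_on_UNIV_eq)
 also have "... < top" by simp
 finally show thesis by (rule that[OF F eq])
qed

text \<open>The set where \<open>Q\<close> fails need not be measurable for the product, so it is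
  enlarged to a Borel null set before sections are taken in either order.\<close>

lemma AE_lborel_swap:
 fixes Q :: "'a::euclidean_space \<times> 'b::euclidean_space => bool"
 assumes "AE p in lborel. Q p"
 shows "AE t in lborel. AE x in lborel. Q (t, x)" "AE x in lborel. AE t in lborel. Q (t, x)"
proof -
 obtain N where N: "N \<in> null_sets lborel" "{p \<in> space lborel. \<not> Q p} \<subseteq> N" using assms unfolding eventually_ae_filter by blast
 have Nb: "N \<in> sets (lborel \<Otimes>\<^sub>M lborel)" unfolding lborel_prod using N(1) by (auto simp: null_sets_def)
 have "AE p in lborel \<Otimes>\<^sub>M lborel. p \<notin> N" unfolding lborel_prod by (rule AE_not_in[OF N(1)])
 then have 1: "AE t in lborel. AE x in lborel. (t, x) \<notin> N" by (rule lborel_pair.AE_pair)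
 have "{p \<in> space (lborel \<Otimes>\<^sub>M lborel). (fst p, snd p) \<notin> N} \<in> sets (lborel \<Otimes>\<^sub>M lborel)"
  using sets.compl_sets[OF Nb] by (simp add: set_diff_eq)
 from lborel_pair.AE_commute[OF this] 1 have 2: "AE x in lborel. AE t in lborel. (t, x) \<notin> N" by simp
 have Q: "Q p" if "p \<notin> N" for p using N(2) that by auto
 show "AE t in lborel. AE x in lborel. Q (t, x)" using 1 by (auto elim!: eventually_mono intro: Q)
 show "AE x in lborel. AE t in lborel. Q (t, x)" using 2 by (auto elim!: eventually_mono intro: Q)
qed

context
 fixes X :: "(real^'n) set"
 assumes op: "open X" and bd: "bounded X"
begin

lemma nn_integral_lebesgue_on_borel:
 assumes "g \<in> borel_measurable borel" "A \<in> sets borel"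
 shows "(\<integral>\<^sup>+x. g x \<partial>leb A) = (\<integral>\<^sup>+x. indicator A x * g x \<partial>(lborel :: 'a::euclidean_space measure))"
 using assms by (subst nn_integral_restrict_space) (auto simp: nn_integral_completion mult.commute)

text \<open>Jensen's inequality on a time interval, followed by Tonelli and summation over disjoint
  intervals. A single section of \<open>f\<close> in t or in x may be non-measurable, so everything
  is computed with a Borel representative \<open>F\<close>, whose sections agree with those of
  \<open>f\<close> for almost every t and almost every x.\<close>

lemma time_average_bound:
 fixes f :: "real => real^'n => real^'n"
 assumes f: "f \<in> L2_time T X" and dt: "\<Delta>t > 0"
 shows "(real m + 1) * \<Delta>t <= T ==> time_average f \<Delta>t m \<in> L2 X"
  "real n * \<Delta>t <= T ==> (\<Sum>m<n. \<Delta>t * (L2norm X (time_average f \<Delta>t m))^2) <= (LINT t|leb {0..T}. (L2norm X (f t))^2)"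
proof -
 let ?S = "{0<..<T} \<times> X"
 have oS: "open ?S" by (intro open_Times op) simp
 have Ob [measurable]: "X \<in> sets borel" using op by simp
 note ds = dom_sets[OF op bd]
 have fS: "(%(t, x). f t x) \<in> L2 ?S" using f by (simp add: L2_time_def)
 have hL: "(%p. indicator ?S p *\<^sub>R (%(t, x). f t x) p) \<in> L2 UNIV"
  by (rule L2_zero_extension(1)[OF _ fS]) (use oS in \<open>auto intro: borel_open\<close>)
 obtain F where F [measurable]: "F \<in> borel_measurable borel" and eq: "AE p in lborel. indicator ?S p *\<^sub>R (%(t, x). f t x) p = F p"
  and fin: "(NN p. ennreal ((norm (F p))^2)) < top"
  by (rule L2_borel_representative[OF hL])
 have ftx: "AE t in lborel. AE x in lborel. t \<in> {0<..<T} --> x \<in> X --> f t x = F (t, x)"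
  using AE_lborel_swap(1)[OF eq] by (auto elim!: eventually_mono)
 have fxt: "AE x in lborel. AE t in lborel. t \<in> {0<..<T} --> x \<in> X --> f t x = F (t, x)"
  using AE_lborel_swap(2)[OF eq] by (auto elim!: eventually_mono)
 have Fm [measurable]: "F \<in> borel_measurable (lborel \<Otimes>\<^sub>M lborel)" by (simp add: lborel_prod)
 define \<phi> where "\<phi> t = (NN x. indicator X x * ennreal ((norm (F (t, x)))^2))" for t
 have \<phi>m [measurable]: "\<phi> \<in> borel_measurable borel" unfolding \<phi>_def[abs_def] by measurable
 have "(NN t. \<phi> t) <= (NN t. NN x. ennreal ((norm (F (t, x)))^2))"
  unfolding \<phi>_def by (intro nn_integral_mono) (auto split: split_indicator)
 also have "... = (\<integral>\<^sup>+p. ennreal ((norm (F p))^2) \<partial>(lborel \<Otimes>\<^sub>M lborel))"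
  by (rule lborel.nn_integral_fst) measurable
 finally have \<phi>f: "(NN t. \<phi> t) < top" using fin by (simp add: lborel_prod)
 have \<phi>ae: "AE t in lborel. \<phi> t ~= top"
  by (rule nn_integral_PInf_AE[unfolded infinity_ennreal_def]) (use \<phi>f in auto)
 have norm_t: "AE t in lborel. t \<in> {0<..<T} --> (L2norm X (f t))^2 = enn2real (\<phi> t)"
  using ftx
 proof eventually_elim
  case (elim t)
  show ?case
  proof
   assume t: "t \<in> {0<..<T}"
   have Ft [measurable]: "(%x. F (t, x)) \<in> borel_measurable borel" by measurable
   have Fl: "(%x. F (t, x)) \<in> meas X"
    by (rule measurable_restrict_space1, rule measurable_completion) simp
   have "AE x in lebesgue. x \<in> X --> F (t, x) = f t x"
    unfolding AE_completion_iff using elim t by (auto elim!: eventually_mono)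
   then have ae: "AE x in leb X. F (t, x) = f t x" using ds by (simp add: AE_restrict_space_iff)
   have "(L2norm X (f t))^2 = (L2norm X (%x. F (t, x)))^2"
    using L2norm_cong_AE[OF ae Fl lebesgue_on_measurable_AE[OF ds Fl ae]] by simp
   also have "... = enn2real (\<integral>\<^sup>+x. ennreal ((norm (F (t, x)))^2) \<partial>leb X)"
    unfolding L2norm_sq by (rule integral_eq_nn_integral) (use Fl in auto)
   also have "... = enn2real (\<phi> t)"
    unfolding \<phi>_def by (subst nn_integral_lebesgue_on_borel) auto
   finally show "(L2norm X (f t))^2 = enn2real (\<phi> t)" .
  qed
 qed
 define J where "J = (LINT t|leb {0..T}. (L2norm X (f t))^2)"
 \<comment> \<open>The force term of the theorem is an integral over a closed interval of norms of
   sections of \<open>f\<close>. For almost every t these are the norms of sections of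
   \<open>F\<close>; the endpoints, about which nothing is known, form a null set.\<close>
 have Jeq: "J = enn2real (NN t. indicator {0..T} t * \<phi> t)"
 proof -
  have dm: "{0..T} \<in> sets lebesgue" by simp
  have em: "(%t. enn2real (\<phi> t)) \<in> borel_measurable (leb {0..T})"
   by (rule measurable_restrict_space1, rule measurable_completion) measurable
  have "AE t in lborel. t ~= 0" "AE t in lborel. t ~= T" by (rule AE_lborel_singleton)+
  with norm_t have "AE t in lborel. t \<in> {0..T} --> enn2real (\<phi> t) = (L2norm X (f t))^2"
   by eventually_elim auto
  then have ae: "AE t in leb {0..T}. enn2real (\<phi> t) = (L2norm X (f t))^2"
   using dm by (simp add: AE_restrict_space_iff AE_completion_iff)
  have "J = (LINT t|leb {0..T}. enn2real (\<phi> t))"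
   unfolding J_def by (rule integral_cong_AE[OF em lebesgue_on_measurable_AE[OF dm em ae] ae, symmetric])
  also have "... = enn2real (\<integral>\<^sup>+t. ennreal (enn2real (\<phi> t)) \<partial>leb {0..T})"
   by (rule integral_eq_nn_integral[OF em]) simp
  also have "(\<integral>\<^sup>+t. ennreal (enn2real (\<phi> t)) \<partial>leb {0..T}) = (NN t. indicator {0..T} t * ennreal (enn2real (\<phi> t)))"
   by (rule nn_integral_lebesgue_on_borel) auto
  also have "... = (NN t. indicator {0..T} t * \<phi> t)"
   by (rule nn_integral_cong_AE) (use \<phi>ae in eventually_elim, simp add: less_top)
  finally show ?thesis .
 qed
 \<comment> \<open>Open intervals are pairwise disjoint and stay inside (0, T), where
   \<open>F\<close> represents \<open>f\<close>; the averages are defined with closed ones, a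
   difference of measure zero.\<close>
 define I where "I m = {real m * \<Delta>t<..<(real m + 1) * \<Delta>t}" for m
 define A where "A m = (NN t. indicator (I m) t * \<phi> t)" for m
 have Im [measurable]: "I m \<in> sets borel" for m by (simp add: I_def)
 have Af: "A m < top" for m
  using \<phi>f unfolding A_def by (rule le_less_trans[rotated]) (auto intro!: nn_integral_mono split: split_indicator)
 have main: "time_average f \<Delta>t m \<in> L2 X & \<Delta>t * (L2norm X (time_average f \<Delta>t m))^2 <= enn2real (A m)" if mT: "(real m + 1) * \<Delta>t <= T" for m
 proof -
  have "real m * \<Delta>t >= 0" using dt by simp
  then have IT: "I m \<subseteq> {0<..<T}" using mT by (auto simp: I_def)
  define g where "g x = (1 / \<Delta>t) *\<^sub>R (LINT t|lborel. indicator (I m) t *\<^sub>R F (t, x))" for x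
  have gm [measurable]: "g \<in> borel_measurable borel" unfolding g_def[abs_def] by measurable
  have gl: "g \<in> meas X"
   by (rule measurable_restrict_space1, rule measurable_completion) simp
  have "AE x in lborel. x \<in> X --> g x = time_average f \<Delta>t m x"
   using fxt
  proof eventually_elim
   case (elim x)
   show ?case
   proof
    assume x: "x \<in> X"
    let ?I = "{real m * \<Delta>t..(real m + 1) * \<Delta>t}"
    have b: "(%t. indicator (I m) t *\<^sub>R F (t, x)) \<in> borel_measurable borel" by measurable
    have bl: "(%t. indicator (I m) t *\<^sub>R F (t, x)) \<in> borel_measurable lebesgue"
     by (rule measurable_completion) (use b in simp)
    have "AE t in lborel. t ~= real m * \<Delta>t" "AE t in lborel. t ~= (real m + 1) * \<Delta>t" by (rule AE_lborel_singleton)+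
    with elim have "AE t in lborel. indicator (I m) t *\<^sub>R F (t, x) = indicator ?I t *\<^sub>R f t x"
    proof eventually_elim
     case (elim t)
     then show ?case using x IT by (cases "t \<in> I m") (auto simp: I_def)
    qed
    then have ae: "AE t in lebesgue. indicator (I m) t *\<^sub>R F (t, x) = indicator ?I t *\<^sub>R f t x" by (simp add: AE_completion_iff)
    have "(LINT t|leb ?I. f t x) = (LINT t|lebesgue. indicator ?I t *\<^sub>R f t x)"
     by (rule integral_restrict_space) simp
    also have "... = (LINT t|lebesgue. indicator (I m) t *\<^sub>R F (t, x))"
     by (rule integral_cong_AE[OF bl borel_measurable_AE[OF bl ae] ae, symmetric])
    also have "... = (LINT t|lborel. indicator (I m) t *\<^sub>R F (t, x))" by (rule integral_completion) (use b in simp)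
    finally show "g x = time_average f \<Delta>t m x" by (simp add: g_def time_average_def)
   qed
  qed
  then have "AE x in lebesgue. x \<in> X --> g x = time_average f \<Delta>t m x" by (simp add: AE_completion_iff)
  then have ae: "AE x in leb X. g x = time_average f \<Delta>t m x" using ds by (simp add: AE_restrict_space_iff)
  have pt: "ennreal ((norm (g x))^2) <= ennreal (1 / \<Delta>t) * (NN t. indicator (I m) t * ennreal ((norm (F (t, x)))^2))" for x
  proof -
   let ?i = "%t. indicator (I m) t :: ennreal"
   let ?n = "%t. ennreal (norm (F (t, x)))"
   have "ennreal (norm (LINT t|lborel. indicator (I m) t *\<^sub>R F (t, x))) <= (NN t. ?i t * (?i t * ?n t))"
   \<comment> \<open>If a section is not integrable, the integral is 0 by convention and the bound
     is trivial.\<close>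
   proof (cases "integrable lborel (%t. indicator (I m) t *\<^sub>R F (t, x))")
    case True
    then have "ennreal (norm (LINT t|lborel. indicator (I m) t *\<^sub>R F (t, x))) <= (NN t. ennreal (norm (indicator (I m) t *\<^sub>R F (t, x))))"
     by (rule integral_norm_bound_ennreal)
    also have "... = (NN t. ?i t * (?i t * ?n t))" by (intro nn_integral_cong) (auto split: split_indicator)
    finally show ?thesis .
   qed (simp add: not_integrable_integral_eq)
   then have "(ennreal (norm (LINT t|lborel. indicator (I m) t *\<^sub>R F (t, x))))^2 <= (NN t. ?i t * (?i t * ?n t))^2"
    by (rule power_mono) simp
   also have "... <= (NN t. (?i t)^2) * (NN t. (?i t * ?n t)^2)"
    by (rule Cauchy_Schwarz_nn_integral) measurable
   also have "(NN t. (?i t)^2) = (NN t. ?i t)" by (intro nn_integral_cong) (auto split: split_indicator)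
   also have "... = ennreal \<Delta>t" using dt by (simp add: I_def algebra_simps)
   also have "(NN t. (?i t * ?n t)^2) = (NN t. ?i t * ennreal ((norm (F (t, x)))^2))"
    by (intro nn_integral_cong) (auto split: split_indicator simp: ennreal_power)
   finally have bnd: "(ennreal (norm (LINT t|lborel. indicator (I m) t *\<^sub>R F (t, x))))^2 <= ennreal \<Delta>t * (NN t. ?i t * ennreal ((norm (F (t, x)))^2))" .
   have "ennreal ((norm (g x))^2) = ennreal ((1 / \<Delta>t)^2) * (ennreal (norm (LINT t|lborel. indicator (I m) t *\<^sub>R F (t, x))))^2"
    by (simp add: g_def ennreal_power ennreal_mult[symmetric] power_divide)
   also have "... <= ennreal ((1 / \<Delta>t)^2) * (ennreal \<Delta>t * (NN t. ?i t * ennreal ((norm (F (t, x)))^2)))"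
    by (rule mult_left_mono[OF bnd]) simp
   also have "... = ennreal (1 / \<Delta>t) * (NN t. ?i t * ennreal ((norm (F (t, x)))^2))"
    using dt by (simp add: mult.assoc[symmetric] ennreal_mult[symmetric] power2_eq_square)
   finally show ?thesis .
  qed
  have "(\<integral>\<^sup>+x. ennreal ((norm (g x))^2) \<partial>leb X) = (NN x. indicator X x * ennreal ((norm (g x))^2))"
   by (rule nn_integral_lebesgue_on_borel) auto
  also have "... <= (NN x. NN t. ennreal (1 / \<Delta>t) * (indicator X x * (indicator (I m) t * ennreal ((norm (F (t, x)))^2))))"
  proof (rule nn_integral_mono)
   fix x
   have "indicator X x * ennreal ((norm (g x))^2)
    <= indicator X x * (ennreal (1 / \<Delta>t) * (NN t. indicator (I m) t * ennreal ((norm (F (t, x)))^2)))"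
    by (rule mult_left_mono[OF pt]) simp
   also have "... = (NN t. ennreal (1 / \<Delta>t) * (indicator X x * (indicator (I m) t * ennreal ((norm (F (t, x)))^2))))"
    by (simp add: nn_integral_cmult mult.left_commute)
   finally show "indicator X x * ennreal ((norm (g x))^2) <= ..." .
  qed
  also have "... = (NN t. NN x. ennreal (1 / \<Delta>t) * (indicator X x * (indicator (I m) t * ennreal ((norm (F (t, x)))^2))))"
   by (rule lborel_pair.Fubini') measurable
  also have "... = (NN t. ennreal (1 / \<Delta>t) * (indicator (I m) t * \<phi> t))"
   unfolding \<phi>_def by (simp add: nn_integral_cmult[symmetric] mult.left_commute)
  also have "... = ennreal (1 / \<Delta>t) * A m" unfolding A_def by (rule nn_integral_cmult) measurable
  also have "... = ennreal ((sqrt (enn2real (A m) / \<Delta>t))^2)"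
   using Af[of m] dt by (cases "A m") (simp_all add: ennreal_mult'[symmetric])
  finally have le: "(\<integral>\<^sup>+x. ennreal ((norm (g x))^2) \<partial>leb X) <= ennreal ((sqrt (enn2real (A m) / \<Delta>t))^2)" .
  have "sqrt (enn2real (A m) / \<Delta>t) >= 0" using dt by simp
  note G = L2I_nn_integral[OF gl this le]
  have "(L2norm X g)^2 <= (sqrt (enn2real (A m) / \<Delta>t))^2" by (rule power_mono[OF G(2)]) simp
  then have "\<Delta>t * (L2norm X g)^2 <= enn2real (A m)" using dt by (simp add: field_simps)
  then show ?thesis using L2_AE_eq[OF ds G(1) ae] by simp
 qed
 show "(real m + 1) * \<Delta>t <= T ==> time_average f \<Delta>t m \<in> L2 X" using main by blast
 assume nT: "real n * \<Delta>t <= T"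
 have mT: "(real m + 1) * \<Delta>t <= T" if "m < n" for m
 proof -
  have "(real m + 1) * \<Delta>t <= real n * \<Delta>t" using that dt by (intro mult_right_mono) auto
  then show ?thesis using nT by simp
 qed
 have "(\<Sum>m<n. \<Delta>t * (L2norm X (time_average f \<Delta>t m))^2) <= (\<Sum>m<n. enn2real (A m))"
  using main mT by (intro sum_mono) blast
 also have "... = enn2real (\<Sum>m<n. A m)" using Af by (simp add: enn2real_sum)
 also have "... <= enn2real (NN t. indicator {0..T} t * \<phi> t)"
 proof (rule enn2real_mono)
  have "(\<Sum>m<n. A m) = (NN t. (\<Sum>m<n. indicator (I m) t * \<phi> t))"
   unfolding A_def by (rule nn_integral_sum[symmetric]) measurable
  also have "... <= (NN t. indicator {0..T} t * \<phi> t)"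
  proof (rule nn_integral_mono)
   fix t
   have "(\<Sum>m<n. indicator (I m) t :: ennreal) = indicator (\<Union>m<n. I m) t"
   proof (rule indicator_UN_disjoint[symmetric])
    show "disjoint_family_on I {..<n}"
    proof -
     have "I a \<inter> I b = {}" if "a < b" for a b
     proof -
      have "(real a + 1) * \<Delta>t <= real b * \<Delta>t" using that dt by (intro mult_right_mono) auto
      then show ?thesis by (auto simp: I_def)
     qed
     then show ?thesis unfolding disjoint_family_on_def by (metis Int_commute linorder_neqE_nat)
    qed
   qed simp
   also have "... <= indicator {0..T} t"
   proof -
    have "I m \<subseteq> {0..T}" if "m < n" for m
    proof -
     have "real m * \<Delta>t >= 0" using dt by simp
     then show ?thesis using mT[OF that] by (auto simp: I_def)
    qed
    then have "(\<Union>m<n. I m) \<subseteq> {0..T}" by blast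
    then show ?thesis by (auto split: split_indicator)
   qed
   finally show "(\<Sum>m<n. indicator (I m) t * \<phi> t) <= indicator {0..T} t * \<phi> t"
    unfolding sum_distrib_right[symmetric] by (rule mult_right_mono) simp
  qed
  finally show "(\<Sum>m<n. A m) <= (NN t. indicator {0..T} t * \<phi> t)" .
  show "(NN t. indicator {0..T} t * \<phi> t) < top"
   using \<phi>f by (rule le_less_trans[rotated]) (auto intro!: nn_integral_mono split: split_indicator)
 qed
 finally show "(\<Sum>m<n. \<Delta>t * (L2norm X (time_average f \<Delta>t m))^2) <= (LINT t|leb {0..T}. (L2norm X (f t))^2)"
  using Jeq by (simp add: J_def)
qed

end

section \<open>The energy estimate\<close>

lemma Young: "\<epsilon> > 0 ==> 2 * a * b <= \<epsilon> * a^2 + b^2 / (\<epsilon>::real)"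
proof -
 assume e: "\<epsilon> > 0"
 have "0 <= (\<epsilon> * a - b)^2 / \<epsilon>" using e by simp
 also have "... = \<epsilon> * a^2 + b^2 / \<epsilon> - 2 * a * b" using e by (simp add: power2_eq_square field_simps)
 finally show ?thesis by simp
qed

text \<open>Here y and x stand for the norms of the Laplacian at the new and the old step, A for
  that of the gradient, F for the force and N for the convection. Of the dissipation 2 \<nu> y^2 the
  pressure takes \<nu> \<beta> y^2 and the other terms \<gamma>/2 y^2, leaving \<nu> + \<gamma>/2.
  At the old step the pressure gives \<nu> \<beta> and the convection \<gamma>/2, together \<nu> -
  \<gamma>/2. The power A^6 comes from splitting A^3 x, and the three summands of \<open>c\<close>
  from F, A and A^6.\<close>

lemma energy_step_Young:
 fixes A A' x y F N :: real
 assumes h: "A'^2 - A^2 + 2 * \<tau> * \<nu> * y^2 <= 2 * \<tau> * (y * (F + N + \<nu> * (\<beta> * x + C * A)))"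
  and N: "N^2 <= K * A ^ 3 * x" and \<tau>: "\<tau> > 0" and \<nu>: "\<nu> > 0" and \<beta>: "0 <= \<beta>" "\<beta> < 1"
  and \<gamma>: "\<gamma> = \<nu> * (1 - \<beta>)" and c: "c = 6 / \<gamma> + 6 / \<gamma> * \<nu>^2 * C^2 + 18 * K^2 / \<gamma> ^ 3"
 shows "A'^2 + \<tau> * (\<nu> + \<gamma> / 2) * y^2 <= A^2 + \<tau> * (\<nu> - \<gamma> / 2) * x^2 + \<tau> * (c * (F^2 + A^2 + A ^ 6))"
proof -
 have g: "\<gamma> > 0" using \<nu> \<beta> \<gamma> by simp
 have 1: "2 * y * (F + N + \<nu> * C * A) <= \<gamma> / 2 * y^2 + (F + N + \<nu> * C * A)^2 / (\<gamma> / 2)"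
  using g by (intro Young) simp
 have "(F + N + \<nu> * C * A)^2 / (\<gamma> / 2) <= 3 * (F^2 + N^2 + (\<nu> * C * A)^2) / (\<gamma> / 2)"
  using g by (intro divide_right_mono three_squares) simp
 also have "... = 6 / \<gamma> * F^2 + 6 / \<gamma> * N^2 + 6 / \<gamma> * \<nu>^2 * C^2 * A^2"
  using g by (simp add: power_mult_distrib field_simps)
 finally have 2: "(F + N + \<nu> * C * A)^2 / (\<gamma> / 2) <= ..." .
 have "6 / \<gamma> * N^2 <= 6 / \<gamma> * (K * A ^ 3 * x)" using g by (intro mult_left_mono N) simp
 also have "... = 2 * x * (3 * K * A ^ 3 / \<gamma>)" by simp
 also have "... <= \<gamma> / 2 * x^2 + (3 * K * A ^ 3 / \<gamma>)^2 / (\<gamma> / 2)" using g by (intro Young) simp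
 also have "(3 * K * A ^ 3 / \<gamma>)^2 / (\<gamma> / 2) = 18 * K^2 / \<gamma> ^ 3 * A ^ 6"
 proof -
  have "(3 * K * A ^ 3 / \<gamma>)^2 = 9 * K^2 * A ^ 6 / \<gamma>^2" by (simp add: power_mult_distrib power_divide flip: power_mult)
  then show ?thesis using g by (simp add: power2_eq_square[of \<gamma>] power3_eq_cube)
 qed
 finally have 3: "6 / \<gamma> * N^2 <= \<gamma> / 2 * x^2 + 18 * K^2 / \<gamma> ^ 3 * A ^ 6" .
 have "\<nu> * \<beta> * (2 * y * x) <= \<nu> * \<beta> * (y^2 + x^2)"
  using \<nu> \<beta> sum_squares_bound[of y x] by (intro mult_left_mono) auto
 then have 4: "2 * y * (\<nu> * \<beta> * x) <= \<nu> * \<beta> * (y^2 + x^2)" by (simp add: mult_ac)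
 have c0: "6 / \<gamma> >= 0" "6 / \<gamma> * \<nu>^2 * C^2 >= 0" "18 * K^2 / \<gamma> ^ 3 >= 0" using g by auto
 have A6: "A ^ 6 >= 0" by simp
 have 5: "6 / \<gamma> * F^2 + 6 / \<gamma> * \<nu>^2 * C^2 * A^2 + 18 * K^2 / \<gamma> ^ 3 * A ^ 6 <= c * (F^2 + A^2 + A ^ 6)"
 proof -
  have "6 / \<gamma> * F^2 <= c * F^2" "6 / \<gamma> * \<nu>^2 * C^2 * A^2 <= c * A^2" "18 * K^2 / \<gamma> ^ 3 * A ^ 6 <= c * A ^ 6"
   unfolding c using c0 A6 by (intro mult_right_mono; simp)+
  then show ?thesis by (simp add: distrib_left)
 qed
 have "2 * (y * (F + N + \<nu> * (\<beta> * x + C * A))) = 2 * y * (F + N + \<nu> * C * A) + 2 * y * (\<nu> * \<beta> * x)"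
  by (simp add: algebra_simps)
 also have "... <= \<gamma> / 2 * y^2 + (6 / \<gamma> * F^2 + (\<gamma> / 2 * x^2 + 18 * K^2 / \<gamma> ^ 3 * A ^ 6) + 6 / \<gamma> * \<nu>^2 * C^2 * A^2) + \<nu> * \<beta> * (y^2 + x^2)"
  using 1 2 3 4 by linarith
 also have "... <= \<gamma> / 2 * y^2 + \<gamma> / 2 * x^2 + c * (F^2 + A^2 + A ^ 6) + \<nu> * \<beta> * (y^2 + x^2)"
  using 5 by linarith
 also have "... = (2 * \<nu> - (\<nu> + \<gamma> / 2)) * y^2 + (\<nu> - \<gamma> / 2) * x^2 + c * (F^2 + A^2 + A ^ 6)"
  unfolding \<gamma> by (simp add: field_simps)
 finally have "\<tau> * (2 * (y * (F + N + \<nu> * (\<beta> * x + C * A)))) <= \<tau> * ..." using \<tau> by (intro mult_left_mono) auto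
 then show ?thesis using h by (simp add: algebra_simps)
qed

text \<open>A continuation argument: as long as \<open>a\<close> stays below \<open>R\<close>, the
  growth term per step is at most \<tau> c (R + R^3), and the time restriction keeps its total below
  1. Hence R is composed of M for the initial value, c M for the force and 1 for the growth. The
  surplus \<gamma>/2 on each side of a step is what bounds the sum of the
  \<open>x k\<close>.\<close>

lemma discrete_continuation:
 fixes a x F :: "nat => real"
 assumes step: "!!k. k < n ==> a (Suc k) + \<tau> * (\<nu> + \<gamma> / 2) * x (Suc k) <= a k + \<tau> * (\<nu> - \<gamma> / 2) * x k + \<tau> * (c * (F k + a k + a k ^ 3))"
  and nn: "!!k. a k >= 0" "!!k. x k >= 0" and \<tau>: "\<tau> > 0" and \<gamma>: "\<gamma> > 0" "\<gamma> <= \<nu>" and c: "c >= 0"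
  and M: "a 0 + \<nu> * \<tau> * x 0 <= M" "(\<Sum>k<n. \<tau> * F k) <= M" and F: "!!k. F k >= 0"
  and R: "R = (1 + c) * M + 1" and T: "real n * \<tau> * (c * (R + R ^ 3)) <= 1"
 shows "k <= n ==> a k <= R" "(\<Sum>k\<le>n. \<tau> * x k) <= 2 * R / \<gamma>"
proof -
 have M0: "M >= 0" using M(1) nn[of 0] \<tau> \<gamma> by (intro order.trans[OF _ M(1)]) auto
 have R1: "R >= 1" unfolding R using M0 c by simp
 have RM: "M + c * M + 1 = R" unfolding R by (simp add: distrib_right)
 have T': "real n * (\<tau> * (c * (R + R ^ 3))) <= 1" using T by (simp only: mult.assoc)
 \<comment> \<open>The second conjunct is the telescoped inequality, with the dissipation gained
   from the old and from the new side of each step in separate sums. The first conjunct is its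
   consequence, needed to estimate the cubic term in the next step.\<close>
 have E: "a k + \<gamma> / 2 * (\<Sum>j\<le>k. \<tau> * x j) <= R & a k + \<nu> * \<tau> * x k + \<gamma> / 2 * (\<Sum>j<k. \<tau> * x j) + \<gamma> / 2 * (\<Sum>j<k. \<tau> * x (Suc j))
   <= a 0 + \<nu> * \<tau> * x 0 + c * (\<Sum>j<k. \<tau> * F j) + real k * (\<tau> * (c * (R + R ^ 3)))" if "k <= n" for k
  using that
 proof (induction k)
  case 0
  have "\<gamma> / 2 * (\<tau> * x 0) <= \<nu> * (\<tau> * x 0)" using \<gamma> \<tau> nn by (intro mult_right_mono) auto
  moreover have "M <= R" using M0 c unfolding R by (simp add: algebra_simps)
  ultimately show ?case using M(1) by (simp add: mult_ac)
 next
  case (Suc k)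
  then have IH: "a k + \<gamma> / 2 * (\<Sum>j\<le>k. \<tau> * x j) <= R"
   "a k + \<nu> * \<tau> * x k + \<gamma> / 2 * (\<Sum>j<k. \<tau> * x j) + \<gamma> / 2 * (\<Sum>j<k. \<tau> * x (Suc j))
    <= a 0 + \<nu> * \<tau> * x 0 + c * (\<Sum>j<k. \<tau> * F j) + real k * (\<tau> * (c * (R + R ^ 3)))" by auto
  have "0 <= \<gamma> / 2 * (\<Sum>j\<le>k. \<tau> * x j)" using \<gamma> \<tau> nn by (intro mult_nonneg_nonneg sum_nonneg) auto
  then have aR: "a k <= R" using IH(1) by linarith
  have "a k + a k ^ 3 <= R + R ^ 3" using aR nn by (intro add_mono power_mono) auto
  then have "\<tau> * (c * (a k + a k ^ 3)) <= \<tau> * (c * (R + R ^ 3))" using \<tau> c by (intro mult_left_mono) auto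
  then have st: "a (Suc k) + \<nu> * \<tau> * x (Suc k) + \<gamma> / 2 * (\<tau> * x (Suc k)) <= a k + \<nu> * \<tau> * x k - \<gamma> / 2 * (\<tau> * x k) + c * (\<tau> * F k) + \<tau> * (c * (R + R ^ 3))"
   using step[of k] Suc.prems by (simp add: algebra_simps)
  have e2: "a (Suc k) + \<nu> * \<tau> * x (Suc k) + \<gamma> / 2 * (\<Sum>j<Suc k. \<tau> * x j) + \<gamma> / 2 * (\<Sum>j<Suc k. \<tau> * x (Suc j))
    <= a 0 + \<nu> * \<tau> * x 0 + c * (\<Sum>j<Suc k. \<tau> * F j) + real (Suc k) * (\<tau> * (c * (R + R ^ 3)))"
   using st IH(2) by (simp add: distrib_left distrib_right)
  have "real (Suc k) * (\<tau> * (c * (R + R ^ 3))) <= real n * (\<tau> * (c * (R + R ^ 3)))"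
   using Suc.prems \<tau> c R1 by (intro mult_right_mono) auto
  moreover have "(\<Sum>j<Suc k. \<tau> * F j) <= (\<Sum>j<n. \<tau> * F j)"
   using Suc.prems \<tau> F by (intro sum_mono2) auto
  then have "c * (\<Sum>j<Suc k. \<tau> * F j) <= c * M" using M(2) c by (intro mult_left_mono) auto
  ultimately have "a (Suc k) + \<nu> * \<tau> * x (Suc k) + \<gamma> / 2 * (\<Sum>j<Suc k. \<tau> * x j) + \<gamma> / 2 * (\<Sum>j<Suc k. \<tau> * x (Suc j)) <= R"
   using e2 M(1) T' RM by linarith
  moreover have "0 <= \<gamma> / 2 * (\<Sum>j<k. \<tau> * x (Suc j))" using \<gamma> \<tau> nn by (intro mult_nonneg_nonneg sum_nonneg) auto
  moreover have "0 <= \<nu> * \<tau> * x (Suc k)" using \<gamma> \<tau> nn by (intro mult_nonneg_nonneg) auto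
  moreover have "(\<Sum>j\<le>Suc k. \<tau> * x j) = (\<Sum>j<Suc k. \<tau> * x j) + \<tau> * x (Suc k)" by (simp add: lessThan_Suc_atMost)
  moreover have "(\<Sum>j<Suc k. \<tau> * x (Suc j)) = (\<Sum>j<k. \<tau> * x (Suc j)) + \<tau> * x (Suc k)" by simp
  ultimately have "a (Suc k) + \<gamma> / 2 * (\<Sum>j\<le>Suc k. \<tau> * x j) <= R"
   by (simp only: distrib_left)
  then show ?case using e2 by blast
 qed
 have s0: "0 <= \<gamma> / 2 * (\<Sum>j\<le>k. \<tau> * x j)" for k using \<gamma> \<tau> nn by (intro mult_nonneg_nonneg sum_nonneg) auto
 show "a k <= R" if "k <= n" using E[OF that] s0[of k] by linarith
 show "(\<Sum>k\<le>n. \<tau> * x k) <= 2 * R / \<gamma>" using E[of n] nn(1)[of n] \<gamma> by (simp add: field_simps)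
qed

section \<open>The energy inequality of one time step\<close>

context
 fixes X :: "(real^'n) set"
 assumes op: "open X" and bd: "bounded X"
begin

lemma L2inner_mat:
 fixes f g :: "real^'n => real^'n^'n"
 assumes f: "f \<in> L2 X" and g: "g \<in> L2 X"
 shows "L2inner X f g = (SUM i. SUM k. LINT x|leb X. f x $ i $ k * g x $ i $ k)"
proof -
 have c: "(%x. h x $ i $ k) \<in> L2 X" if h: "h \<in> L2 X" for h :: "real^'n => real^'n^'n" and i k
 proof (rule L2_dominated[OF _ L2D(2)[OF h]])
  show "(%x. h x $ i $ k) \<in> meas X"
   by (rule measurable_compose[OF L2D(1)[OF h]]) (intro borel_measurable_continuous_onI continuous_intros)
  have "\<bar>h x $ i $ k\<bar> <= norm (h x)" for x
   using order.trans[OF component_le_norm_cart[of "h x $ i" k] Finite_Cartesian_Product.norm_nth_le] .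
  then show "AE x in leb X. (norm (h x $ i $ k))^2 <= (norm (h x))^2"
   by (intro AE_I2 power_mono) auto
 qed
 have i: "integrable (leb X) (%x. f x $ i $ k * g x $ i $ k)" for i k by (rule L2_mult_integrable[OF c[OF f] c[OF g]])
 have "L2inner X f g = (LINT x|leb X. (SUM i. SUM k. f x $ i $ k * g x $ i $ k))"
  by (simp add: L2inner_def inner_vec_def)
 also have "... = (SUM i. LINT x|leb X. (SUM k. f x $ i $ k * g x $ i $ k))"
  by (intro lint_sum lintegrable_sum i)
 also have "... = (SUM i. SUM k. LINT x|leb X. f x $ i $ k * g x $ i $ k)"
  by (intro sum.cong refl lint_sum i)
 finally show ?thesis .
qed

lemma green_vlaplace:
 assumes v: "v \<in> vec_H2_H10 X" and w: "w \<in> vec_H2_H10 X"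
 shows "L2inner X v (vlaplace X w) = - L2inner X (vgrad X v) (vgrad X w)"
proof (rule vec_H10_approx[OF op bd v])
 fix \<Phi> assume \<Phi>: "!!i n. test_function X (\<Phi> i n)" "!!i. (%n. L2norm X (%x. \<Phi> i n x - v x $ i)) ----> 0"
  "!!i k. (%n. L2norm X (%x. partial k (\<Phi> i n) x - pd X v k i x)) ----> 0"
 note dv = vec_H2_H10_wd[OF op bd v] and dw = vec_H2_H10_wd[OF op bd w]
 note vL = vec_H2_H10_L2[OF op bd v] and wL = vec_H2_H10_L2[OF op bd w]
 have g: "(LINT x|leb X. pd X w k i x * pd X v k i x)
  = - (LINT x|leb X. pdd X w k k i x * v x $ i)" for i k
  by (rule green_limit[OF op bd test_function_Cc[OF \<Phi>(1)] dv(3) dv(4) \<Phi>(2) \<Phi>(3) dw(2)])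
 have i: "integrable (leb X) (%x. pdd X w k k i x * v x $ i)" for i k
  by (rule L2_mult_integrable[OF dw(5) dv(3)])
 have "L2inner X v (vlaplace X w) = (SUM i. LINT x|leb X. (SUM k. pdd X w k k i x * v x $ i))"
  unfolding L2inner_vec[OF op bd vL(1) wL(3)] by (simp add: vlaplace_def sum_distrib_left mult.commute)
 also have "... = (SUM i. SUM k. LINT x|leb X. pdd X w k k i x * v x $ i)"
  by (intro sum.cong refl lint_sum i)
 also have "... = - (SUM i. SUM k. LINT x|leb X. pd X w k i x * pd X v k i x)"
  unfolding g sum_negf by simp
 also have "... = - L2inner X (vgrad X v) (vgrad X w)"
  unfolding L2inner_mat[OF vL(2) wL(2)] by (simp add: vgrad_def mult.commute)
 finally show ?thesis .
qed

text \<open>Subtracting the Euler pressure leaves the Helmholtz projection of force minus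
  convection, a contraction, so this pressure costs nothing. Green's formula for both velocities
  turns the time difference into gradient norms; only the Stokes pressure remains to be
  estimated.\<close>

lemma scheme_step_energy:
 assumes u: "u \<in> vec_H2_H10 X" and s: "scheme_step X \<nu> \<tau> g u u'" and g: "g \<in> L2 X" and a: "advect X u u \<in> L2 X"
  and \<tau>: "\<tau> > 0" and \<nu>: "\<nu> > 0"
 shows "(L2norm X (vgrad X u'))^2 - (L2norm X (vgrad X u))^2 + 2 * \<tau> * \<nu> * (L2norm X (vlaplace X u'))^2
  <= 2 * \<tau> * (L2norm X (vlaplace X u') * (L2norm X g + L2norm X (advect X u u) + \<nu> * L2norm X (grad_pS X u)))"
proof -
 have u': "u' \<in> vec_H2_H10 X" using s by (simp add: scheme_step_def)
 note uL = vec_H2_H10_L2[OF op bd u] and uL' = vec_H2_H10_L2[OF op bd u'] and pL = grad_pS_harmonic(2)[OF op bd u]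
 have hL: "(%x. g x - advect X u u x) \<in> L2 X" by (rule L2_diff[OF g a])
 define P where "P = helmholtz X (%x. g x - advect X u u x)"
 have PL: "P \<in> L2 X" unfolding P_def by (rule helmholtz_L2[OF op bd hL])
 have "L2norm X P <= L2norm X (%x. g x - advect X u u x)" unfolding P_def by (rule helmholtz_norm[OF op bd hL])
 also have "... <= L2norm X g + L2norm X (advect X u u)"
  using L2norm_triangle[OF g L2_uminus[OF a]] by simp
 finally have Pn: "L2norm X P <= L2norm X g + L2norm X (advect X u u)" .
 let ?D = "vlaplace X u'"
 have dL: "(%x. u' x - u x) \<in> L2 X" by (rule L2_diff[OF uL'(1) uL(1)])
 have npL: "(%x. \<nu> *\<^sub>R grad_pS X u x) \<in> L2 X" by (rule L2_scaleR[OF pL])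
 have nDL: "(%x. \<nu> *\<^sub>R ?D x) \<in> L2 X" by (rule L2_scaleR[OF uL'(3)])
 have rL: "(%x. P x - \<nu> *\<^sub>R grad_pS X u x) \<in> L2 X" by (rule L2_diff[OF PL npL])
 have sL: "(%x. (1 / \<tau>) *\<^sub>R (u' x - u x)) \<in> L2 X" by (rule L2_scaleR[OF dL])
 have lL: "(%x. (1 / \<tau>) *\<^sub>R (u' x - u x) - \<nu> *\<^sub>R ?D x) \<in> L2 X" by (rule L2_diff[OF sL nDL])
 have "AE x in leb X. (1 / \<tau>) *\<^sub>R (u' x - u x) - \<nu> *\<^sub>R ?D x = P x - \<nu> *\<^sub>R grad_pS X u x"
  using s unfolding scheme_step_def grad_pE_def P_def by (auto elim!: eventually_mono)
 from L2inner_cong_AE[OF this L2D(1)[OF lL] L2D(1)[OF rL] L2D(1)[OF uL'(3)]]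
 have "(1 / \<tau>) * L2inner X (%x. u' x - u x) ?D - \<nu> * (L2norm X ?D)^2 = L2inner X P ?D - \<nu> * L2inner X (grad_pS X u) ?D"
  by (simp only: L2inner_diff_left[OF sL nDL uL'(3)] L2inner_diff_left[OF PL npL uL'(3)] L2inner_scaleR_left L2inner_self)
 moreover have "- L2inner X P ?D <= L2norm X ?D * (L2norm X g + L2norm X (advect X u u))"
 proof -
  have "- L2inner X P ?D <= L2norm X P * L2norm X ?D" using L2_Cauchy_Schwarz[OF PL uL'(3)] by linarith
  also have "... <= (L2norm X g + L2norm X (advect X u u)) * L2norm X ?D" by (rule mult_right_mono[OF Pn]) simp
  finally show ?thesis by (simp add: mult.commute)
 qed
 moreover have "\<nu> * L2inner X (grad_pS X u) ?D <= \<nu> * (L2norm X (grad_pS X u) * L2norm X ?D)"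
  using L2_Cauchy_Schwarz[OF pL uL'(3)] \<nu> by (intro mult_left_mono) auto
 ultimately have 1: "- (1 / \<tau>) * L2inner X (%x. u' x - u x) ?D + \<nu> * (L2norm X ?D)^2
   <= L2norm X ?D * (L2norm X g + L2norm X (advect X u u) + \<nu> * L2norm X (grad_pS X u))"
  by (simp add: algebra_simps)
 have "L2inner X (%x. u' x - u x) ?D = L2inner X (vgrad X u) (vgrad X u') - (L2norm X (vgrad X u'))^2"
  by (simp add: L2inner_diff_left[OF uL'(1) uL(1) uL'(3)] green_vlaplace[OF u' u'] green_vlaplace[OF u u'] L2inner_self)
 moreover have "2 * L2inner X (vgrad X u) (vgrad X u') <= (L2norm X (vgrad X u))^2 + (L2norm X (vgrad X u'))^2"
  using L2_Cauchy_Schwarz[OF uL(2) uL'(2)] sum_squares_bound[of "L2norm X (vgrad X u)" "L2norm X (vgrad X u')"] by linarith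
 ultimately have 2: "(L2norm X (vgrad X u'))^2 - (L2norm X (vgrad X u))^2 <= - (2 * L2inner X (%x. u' x - u x) ?D)" by linarith
 have "2 * \<tau> * (- (1 / \<tau>) * L2inner X (%x. u' x - u x) ?D + \<nu> * (L2norm X ?D)^2)
   <= 2 * \<tau> * (L2norm X ?D * (L2norm X g + L2norm X (advect X u u) + \<nu> * L2norm X (grad_pS X u)))"
  using \<tau> by (intro mult_left_mono 1) simp
 moreover have "2 * \<tau> * (- (1 / \<tau>) * L2inner X (%x. u' x - u x) ?D + \<nu> * (L2norm X ?D)^2)
  = - (2 * L2inner X (%x. u' x - u x) ?D) + 2 * \<tau> * \<nu> * (L2norm X ?D)^2" using \<tau> by (simp add: field_simps)
 ultimately show ?thesis using 2 by linarith
qed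

end

theorem theorem2:
 fixes \<Omega> :: "(real^'n) set" and \<nu> M0 :: real
 assumes "CARD('n) = 2 \<or> CARD('n) = 3"
  and "bounded_domain \<Omega>"
  and "has_Ck_boundary 3 \<Omega>"
  and "\<nu> > 0"
 shows "\<exists>Tstar > 0. \<exists>C3 > 0.
  \<forall>(T::real) (\<Delta>t::real) (f :: real \<Rightarrow> real^'n \<Rightarrow> real^'n) (u :: nat \<Rightarrow> real^'n \<Rightarrow> real^'n).
   T > 0 \<and> \<Delta>t > 0 \<and> f \<in> L2_time T \<Omega> \<and> u 0 \<in> vec_H2_H10 \<Omega> \<and>
   M0 = (L2norm \<Omega> (vgrad \<Omega> (u 0)))\<^sup>2 + \<nu> * \<Delta>t * (L2norm \<Omega> (vlaplace \<Omega> (u 0)))\<^sup>2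
      + (LINT t|lebesgue_on {0..T}. (L2norm \<Omega> (f t))\<^sup>2) \<and>
   (\<forall>m. (real m + 1) * \<Delta>t \<le> T \<longrightarrow>
      scheme_step \<Omega> \<nu> \<Delta>t (time_average f \<Delta>t m) (u m) (u (Suc m)))
   \<longrightarrow>
   (\<forall>n. real n * \<Delta>t \<le> Tstar \<and> real n * \<Delta>t \<le> T \<longrightarrow>
      (SUP k\<in>{0..n}. (L2norm \<Omega> (vgrad \<Omega> (u k)))\<^sup>2)
      + (\<Sum>k=0..n. (L2norm \<Omega> (vlaplace \<Omega> (u k)))\<^sup>2 * \<Delta>t) \<le> C3)"
proof -
 have op: "open \<Omega>" and bd: "bounded \<Omega>" using assms(2) by (auto simp: bounded_domain_def)
 obtain C where C: "C >= 0" "!!u. u \<in> vec_H2_H10 \<Omega> ==>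
  L2norm \<Omega> (grad_pS \<Omega> u) <= sqrt (3 / 4) * L2norm \<Omega> (vlaplace \<Omega> u) + C * (L2norm \<Omega> u + L2norm \<Omega> (vgrad \<Omega> u))"
  using grad_pS_bound[OF op bd assms(2,3)] by blast
 obtain K where K: "K >= 0" "!!u. u \<in> vec_H2_H10 \<Omega> ==> advect \<Omega> u u \<in> L2 \<Omega> &
   (L2norm \<Omega> (advect \<Omega> u u))^2 <= K * L2norm \<Omega> (vgrad \<Omega> u) ^ 3 * L2norm \<Omega> (vlaplace \<Omega> u) &
   L2norm \<Omega> u <= K * L2norm \<Omega> (vgrad \<Omega> u)"
  using advect_bound[OF op bd assms(1)] by blast
 define \<beta> where "\<beta> = sqrt (3 / 4)"
 have \<beta>: "0 <= \<beta>" "\<beta> < 1" unfolding \<beta>_def by simp_all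
 define \<gamma> where "\<gamma> = \<nu> * (1 - \<beta>)"
 have \<gamma>: "\<gamma> > 0" "\<gamma> <= \<nu>" using \<beta> assms(4) by (auto simp: \<gamma>_def mult_le_cancel_left1)
 \<comment> \<open>The norm of u in the pressure estimate is absorbed into that of its gradient by
   Poincare's inequality.\<close>
 define C' where "C' = C * (K + 1)"
 define c where "c = 6 / \<gamma> + 6 / \<gamma> * \<nu>^2 * C'^2 + 18 * K^2 / \<gamma> ^ 3"
 have c: "c > 0" unfolding c_def using \<gamma>(1) by (intro add_pos_nonneg) auto
 \<comment> \<open>\<open>M0\<close> is an arbitrary real until the data are introduced, while
   \<open>R\<close> has to be fixed before them; the absolute value ensures R \<ge> 1.\<close>
 define R where "R = (1 + c) * \<bar>M0\<bar> + 1"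
 have R: "R >= 1" unfolding R_def using c by simp
 \<comment> \<open>Over this time the growth permitted while the squared gradient norm is at most R
   adds up to at most 1, the reserve built into R.\<close>
 define Tstar where "Tstar = 1 / (c * (R + R ^ 3))"
 have "c * (R + R ^ 3) > 0" using c R by (intro mult_pos_pos add_pos_pos) auto
 then have Ts: "Tstar > 0" "Tstar * (c * (R + R ^ 3)) = 1" unfolding Tstar_def by auto
 have C3: "R + 2 * R / \<gamma> > 0" using R \<gamma> by (intro add_pos_pos) auto
 show ?thesis
 proof (rule exI[of _ Tstar], rule conjI[OF Ts(1)], rule exI[of _ "R + 2 * R / \<gamma>"], rule conjI[OF C3], intro allI impI)
  fix T \<tau> :: real and f :: "real => real^'n => real^'n" and u :: "nat => real^'n => real^'n" and n :: nat
  let ?A = "%k. L2norm \<Omega> (vgrad \<Omega> (u k))" and ?x = "%k. L2norm \<Omega> (vlaplace \<Omega> (u k))"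
  let ?J = "LINT t|lebesgue_on {0..T}. (L2norm \<Omega> (f t))^2"
  assume "T > 0 & \<tau> > 0 & f \<in> L2_time T \<Omega> & u 0 \<in> vec_H2_H10 \<Omega> & M0 = (?A 0)^2 + \<nu> * \<tau> * (?x 0)^2 + ?J &
   (\<forall>m. (real m + 1) * \<tau> <= T --> scheme_step \<Omega> \<nu> \<tau> (time_average f \<tau> m) (u m) (u (Suc m)))"
  then have \<tau>: "\<tau> > 0" and f: "f \<in> L2_time T \<Omega>" and u0: "u 0 \<in> vec_H2_H10 \<Omega>" and M0: "M0 = (?A 0)^2 + \<nu> * \<tau> * (?x 0)^2 + ?J"
   and step: "!!m. (real m + 1) * \<tau> <= T ==> scheme_step \<Omega> \<nu> \<tau> (time_average f \<tau> m) (u m) (u (Suc m))" by blast+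
  assume "real n * \<tau> <= Tstar & real n * \<tau> <= T"
  then have n: "real n * \<tau> <= Tstar" "real n * \<tau> <= T" by blast+
  let ?F = "%m. L2norm \<Omega> (time_average f \<tau> m)"
  have kT: "(real k + 1) * \<tau> <= T" if "k < n" for k
  proof -
   have "(real k + 1) * \<tau> <= real n * \<tau>" using that \<tau> by (intro mult_right_mono) auto
   then show ?thesis using n(2) by simp
  qed
  have uH: "u k \<in> vec_H2_H10 \<Omega>" if "k <= n" for k
  proof (cases k)
   case (Suc m)
   then show ?thesis using step[OF kT[of m]] that by (simp add: scheme_step_def)
  qed (simp add: u0)
  have J0: "?J >= 0" by (intro lint_nonneg) simp
  have x0: "0 <= \<nu> * \<tau> * (?x 0)^2" using assms(4) \<tau> by simp
  have es: "(?A (Suc k))^2 + \<tau> * (\<nu> + \<gamma> / 2) * (?x (Suc k))^2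
   <= (?A k)^2 + \<tau> * (\<nu> - \<gamma> / 2) * (?x k)^2 + \<tau> * (c * ((?F k)^2 + (?A k)^2 + ((?A k)^2) ^ 3))" if k: "k < n" for k
  proof -
   have uk: "u k \<in> vec_H2_H10 \<Omega>" by (rule uH) (use k in simp)
   note Kk = K(2)[OF uk]
   have "L2norm \<Omega> (grad_pS \<Omega> (u k)) <= \<beta> * ?x k + C * (L2norm \<Omega> (u k) + ?A k)" unfolding \<beta>_def by (rule C(2)[OF uk])
   also have "... <= \<beta> * ?x k + C * (K * ?A k + ?A k)" using Kk C(1) by (intro add_left_mono mult_left_mono add_right_mono) auto
   finally have pS: "L2norm \<Omega> (grad_pS \<Omega> (u k)) <= \<beta> * ?x k + C' * ?A k" by (simp add: C'_def algebra_simps)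
   have "(?A (Suc k))^2 - (?A k)^2 + 2 * \<tau> * \<nu> * (?x (Suc k))^2
    <= 2 * \<tau> * (?x (Suc k) * (?F k + L2norm \<Omega> (advect \<Omega> (u k) (u k)) + \<nu> * L2norm \<Omega> (grad_pS \<Omega> (u k))))"
    by (rule scheme_step_energy[OF op bd uk step[OF kT[OF k]] time_average_bound(1)[OF op bd f \<tau> kT[OF k]] conjunct1[OF Kk] \<tau> assms(4)])
   also have "... <= 2 * \<tau> * (?x (Suc k) * (?F k + L2norm \<Omega> (advect \<Omega> (u k) (u k)) + \<nu> * (\<beta> * ?x k + C' * ?A k)))"
    using \<tau> assms(4) pS by (intro mult_left_mono add_left_mono) auto
   finally have "(?A (Suc k))^2 + \<tau> * (\<nu> + \<gamma> / 2) * (?x (Suc k))^2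
    <= (?A k)^2 + \<tau> * (\<nu> - \<gamma> / 2) * (?x k)^2 + \<tau> * (c * ((?F k)^2 + (?A k)^2 + ?A k ^ 6))"
    by (rule energy_step_Young[OF _ conjunct1[OF conjunct2[OF Kk]] \<tau> assms(4) \<beta> \<gamma>_def c_def])
   \<comment> \<open>The sixth power of the gradient norm is the cube of its square, the quantity
     that is iterated; this is the cubic growth.\<close>
   then show ?thesis by (simp add: power_mult[symmetric])
  qed
  have T1: "real n * \<tau> * (c * (R + R ^ 3)) <= 1"
   using mult_right_mono[OF n(1), of "c * (R + R ^ 3)"] Ts c R by simp
  have m1: "(?A 0)^2 + \<nu> * \<tau> * (?x 0)^2 <= \<bar>M0\<bar>" using J0 M0 by linarith
  have m2: "(\<Sum>k<n. \<tau> * (?F k)^2) <= \<bar>M0\<bar>"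
   using time_average_bound(2)[OF op bd f \<tau> n(2)] M0 x0 zero_le_power2[of "?A 0"] by linarith
  note D = discrete_continuation[of n "%k. (?A k)^2" \<tau> \<nu> \<gamma> "%k. (?x k)^2" c "%k. (?F k)^2", OF es _ _ \<tau> \<gamma> _ m1 m2 _ R_def T1]
  have "(SUP k\<in>{0..n}. (?A k)^2) <= R" by (rule cSUP_least) (use D(1) c in auto)
  moreover have "(\<Sum>k=0..n. (?x k)^2 * \<tau>) <= 2 * R / \<gamma>"
   using D(2) c by (simp add: atMost_atLeast0 mult.commute)
  ultimately show "(SUP k\<in>{0..n}. (?A k)^2) + (\<Sum>k=0..n. (?x k)^2 * \<tau>) <= R + 2 * R / \<gamma>" by simp
 qed
qed

end
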